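(* Let $A$ be an associative unital algebra over a field $\mathbf{k}$, let $(P,\mu_P)$ be an $A^e$-projective resolution of $A$ and let $\Delta_P:P\to P\otimes_A P$ be a diagonal $2$-approximation of $P$. Let $f:P\to A[-n]$ and $g:P\to A[-m]$ be cocycles (i.e. $fd_P=0$, $gd_P=0$). Suppose that $\phi_f:P\to P[1-n]$ and $\phi_g:P\to P[1-m]$ are homotopy liftings for $(f,\Delta_P)$ and $(g,\Delta_P)$ respectively. Then the Gerstenhaber bracket of the classes of $f$ and $g$ in $\mathrm{HH}^*(A)$ is represented by the class of $$[f,g]_{\phi,\Delta}=(-1)^m f\phi_g+(-1)^{m(n-1)}g\phi_f .$$
   Context: Complexes. $A^e=A\otimes_{\mathbf{k}}A^{op}$. An $A^e$-complex is a $\mathbb{Z}$-graded $A$-bimodule $P=\bigoplus_n P_n$ with a bimodule differential $d_P$ of degree $-1$. $P[t]$ is the complex with $P[t]_n=P_{t+n}$ and $d_{P[t]}=(-1)^td_P$. A map of complexes $f:P\to Q$ is a degree-preserving bimodule homomorphism (not necessarily commuting with differentials); it is also regarded as a map $P[t]\to Q[t]$. Put $\mathbf{d}f=fd_P-d_Qf:P\to Q[-1]$ (so for $f:P\to Q[m]$, $\mathbf{d}f=fd_P-(-1)^md_Qf$); $f$ is a chain map if $\mathbf{d}f=0$. Write $f\sim g$ if $f-g=\mathbf{d}s$ for some $s:P\to Q[1]$. A bimodule is viewed as a complex concentrated in degree $0$. $P\otimes_AQ$ has differential $d(x\otimes y)=d_P(x)\otimes y+(-1)^ix\otimes d_Q(y)$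 for $x\in P_i$. For $f:P\to P'[n]$, $g:Q\to Q'[m]$, the map $f\otimes g:P\otimes_AQ\to (P'\otimes_AQ')[n+m]$ is $(f\otimes g)(x\otimes y)=(-1)^{im}f(x)\otimes g(y)$ for $x\in P_i$. $P\otimes_AA$ and $A\otimes_AP$ are identified with $P$. Resolutions. An $A^e$-projective resolution $(P,\mu_P)$ of $A$ is an $A^e$-complex $P$ of projective bimodules with $P_n=0$ for $n<0$, $H_n(P)=0$ for $n>0$, and a bimodule map $\mu_P:P_0\to A$ inducing $H_0(P)\cong A$ ($\mu_P$ is extended by zero to $P\to A$). A diagonal $2$-approximation is a chain map $\Delta_P:P\to P\otimes_AP$ with $(\mu_P\otimes\mu_P)\Delta_P=\mu_P$. Homotopy lifting. For $f:P\to A[-n]$ with $fd_P=0$, a homotopy lifting of $(f,\Delta_P)$ is a map $\phi_f:P\to P[1-n]$ such that $\mathbf{d}\phi_f=(f\otimes1_P-1_P\otimes f)\Delta_P$ and $\mu_P\phi_f+f\phi\sim0$ for some $\phi:P\to P[1]$ with $\mathbf{d}\phi=(\mu_P\otimes1_P-1_P\otimes\mu_P)\Delta_P$. Hochschild cohomology. $\mathrm{HH}^n(A)$ is the space of maps $f:P\to A[-n]$ (i.e. bimodule maps $P_n\to A$) with $fd_P=0$ modulo those of the form $hd_P$; different resolutions are identified via comparison chain maps over $A$. For the bar resolution ($\mathrm{Bar}_n(A)=A^{\otimes(n+2)}$, $d(a_0\otimes\cdots\otimes a_{n+1})=\sum_{i=0}^n(-1)^ia_0\otimes\cdots\otimes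 a_ia_{i+1}\otimes\cdots\otimes a_{n+1}$, $\mu$ the multiplication), cochains are $C^n(A)=\mathrm{Hom}_{\mathbf{k}}(A^{\otimes n},A)$, and the Gerstenhaber bracket of $\alpha\in C^n(A)$, $\beta\in C^m(A)$ is $[\alpha,\beta]=\alpha\circ\beta-(-1)^{(n-1)(m-1)}\beta\circ\alpha$ with $\alpha\circ\beta=\sum_{i=1}^n(-1)^{(m-1)(i-1)}\alpha\circ_i\beta$, where $(\alpha\circ_i\beta)(a_1\otimes\cdots\otimes a_{n+m-1})=\alpha(a_1\otimes\cdots\otimes a_{i-1}\otimes\beta(a_i\otimes\cdots\otimes a_{i+m-1})\otimes a_{i+m}\otimes\cdots\otimes a_{n+m-1})$ (for $m=0$ the element $\beta\in A$ is inserted in position $i$; for $n=0$, $\alpha\circ\beta=0$). *)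

theory Defs
  imports
    "HOL.Vector_Spaces"
    "HOL-Algebra.Module"
    "HOL-Library.Poly_Mapping"
    "HOL-Library.Set_Algebras"
    "HOL-Computational_Algebra.Group_Closure"
begin

section \<open>Algebras and bimodules\<close>

text \<open>
  The sort \<open>{ring, monoid_mult}\<close> is that of unital associative rings; unlike \<open>ring_1\<close> it does
  not exclude the zero ring.
\<close>

locale k_algebra = vector_space scale
  for scale :: "'k::field \<Rightarrow> 'a::{ring,monoid_mult} \<Rightarrow> 'a" +
  assumes scale_mult_left: "scale c (x * y) = scale c x * y"
    and scale_mult_right: "scale c (x * y) = x * scale c y"

text \<open>
  Bimodules carry the additive structure of a \<^type>\<open>ring\<close> record; its multiplicative fields
  play no role (as for the library's \<^type>\<open>module\<close>).
\<close>

record ('a, 'm) bimodule = "('a, 'm) module" +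
  rsmult :: "'m \<Rightarrow> 'a \<Rightarrow> 'm" (infixl \<open>\<bullet>\<index>\<close> 70)

text \<open>
  Modules over \<open>A \<otimes>\<^sub>k A\<^sup>o\<^sup>p\<close> are bimodules on which the two actions of \<open>k\<close> agree; this is the
  assumption \<open>central\<close>.
\<close>

locale bimodule = k_algebra scale + M?: abelian_group M
  for scale :: "'k::field \<Rightarrow> 'a::{ring,monoid_mult} \<Rightarrow> 'a"
    and M :: "('a, 'm) bimodule" (structure) +
  assumes lsmult_closed: "x \<in> carrier M \<Longrightarrow> a \<odot> x \<in> carrier M"
    and rsmult_closed: "x \<in> carrier M \<Longrightarrow> x \<bullet> a \<in> carrier M"
    and lsmult_distrib_left: "x \<in> carrier M \<Longrightarrow> (a + b) \<odot> x = a \<odot> x \<oplus> b \<odot> x"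
    and lsmult_distrib_right:
      "x \<in> carrier M \<Longrightarrow> y \<in> carrier M \<Longrightarrow> a \<odot> (x \<oplus> y) = a \<odot> x \<oplus> a \<odot> y"
    and rsmult_distrib_right: "x \<in> carrier M \<Longrightarrow> x \<bullet> (a + b) = x \<bullet> a \<oplus> x \<bullet> b"
    and rsmult_distrib_left:
      "x \<in> carrier M \<Longrightarrow> y \<in> carrier M \<Longrightarrow> (x \<oplus> y) \<bullet> a = x \<bullet> a \<oplus> y \<bullet> a"
    and lsmult_assoc: "x \<in> carrier M \<Longrightarrow> (a * b) \<odot> x = a \<odot> (b \<odot> x)"
    and rsmult_assoc: "x \<in> carrier M \<Longrightarrow> x \<bullet> (a * b) = (x \<bullet> a) \<bullet> b"
    and lsmult_one: "x \<in> carrier M \<Longrightarrow> 1 \<odot> x = x"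
    and rsmult_one: "x \<in> carrier M \<Longrightarrow> x \<bullet> 1 = x"
    and lsmult_rsmult: "x \<in> carrier M \<Longrightarrow> (a \<odot> x) \<bullet> b = a \<odot> (x \<bullet> b)"
    and central: "x \<in> carrier M \<Longrightarrow> scale c 1 \<odot> x = x \<bullet> scale c 1"

definition bimod_hom :: "('a, 'm) bimodule \<Rightarrow> ('a, 'n) bimodule \<Rightarrow> ('m \<Rightarrow> 'n) set" where
  "bimod_hom M N = {f \<in> carrier M \<rightarrow> carrier N.
     (\<forall>x\<in>carrier M. \<forall>y\<in>carrier M. f (x \<oplus>\<^bsub>M\<^esub> y) = f x \<oplus>\<^bsub>N\<^esub> f y) \<and>
     (\<forall>a. \<forall>x\<in>carrier M. f (a \<odot>\<^bsub>M\<^esub> x) = a \<odot>\<^bsub>N\<^esub> f x \<and> f (x \<bullet>\<^bsub>M\<^esub> a) = f x \<bullet>\<^bsub>N\<^esub> a)}"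

text \<open>Multiplication by \<open>(-1)\<^sup>k\<close> for an integer exponent.\<close>

definition signed :: "int \<Rightarrow> 'a::uminus \<Rightarrow> 'a" where
  "signed k x = (if even k then x else - x)"

definition msigned :: "('a, 'm) bimodule \<Rightarrow> int \<Rightarrow> 'm \<Rightarrow> 'm" where
  "msigned M k x = (if even k then x else \<ominus>\<^bsub>M\<^esub> x)"

section \<open>Bimodules given by generators and relations\<close>

text \<open>
  \<open>pres_class R u\<close> is the class of the formal integral combination \<open>u\<close> of generators modulo the
  subgroup generated by \<open>R\<close>. \<open>pres_bimod S R l r\<close> is the abelian group with generators \<open>S\<close> and
  relators \<open>R\<close>, with actions induced by the actions \<open>l\<close>, \<open>r\<close> on the generators.
\<close>

definition pres_class :: "('g \<Rightarrow>\<^sub>0 int) set \<Rightarrow> ('g \<Rightarrow>\<^sub>0 int) \<Rightarrow> ('g \<Rightarrow>\<^sub>0 int) set" where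
  "pres_class R u = u +o group_closure R"

definition pres_bimod ::
  "'g set \<Rightarrow> ('g \<Rightarrow>\<^sub>0 int) set \<Rightarrow> ('a \<Rightarrow> 'g \<Rightarrow> 'g) \<Rightarrow> ('g \<Rightarrow> 'a \<Rightarrow> 'g)
    \<Rightarrow> ('a, ('g \<Rightarrow>\<^sub>0 int) set) bimodule" where
  "pres_bimod S R l r =
    \<lparr>carrier = {pres_class R u |u. Poly_Mapping.keys u \<subseteq> S},
     mult = undefined, one = undefined,
     zero = pres_class R 0, add = (\<lambda>X Y. X + Y),
     smult = (\<lambda>a X. \<Union>u\<in>X. pres_class R (frag_extend (\<lambda>g. frag_of (l a g)) u)),
     rsmult = (\<lambda>X a. \<Union>u\<in>X. pres_class R (frag_extend (\<lambda>g. frag_of (r g a)) u))\<rparr>"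

text \<open>
  \<open>pres_lift M h\<close> is the homomorphism from a group given by generators and relations to \<open>M\<close> with
  values \<open>h\<close> on the generators (meaningful when \<open>h\<close> respects the relators).
\<close>

definition pres_lift :: "('a, 'm) bimodule \<Rightarrow> ('g \<Rightarrow> 'm) \<Rightarrow> ('g \<Rightarrow>\<^sub>0 int) set \<Rightarrow> 'm" where
  "pres_lift M h X =
    the_elem ((\<lambda>u. \<Oplus>\<^bsub>M\<^esub>g\<in>Poly_Mapping.keys u. [Poly_Mapping.lookup u g] \<cdot>\<^bsub>M\<^esub> h g) ` X)"

section \<open>Projective bimodules\<close>

text \<open>
  The free bimodule on \<open>X\<close>, that is \<open>\<Oplus>\<^bsub>x\<in>X\<^esub> A \<otimes>\<^sub>k A\<close>; the generator \<open>(a, x, b)\<close> stands for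
  \<open>a \<otimes> b\<close> in the summand of \<open>x\<close>.
\<close>

definition free_rel :: "('k \<Rightarrow> 'a::{ring,monoid_mult} \<Rightarrow> 'a) \<Rightarrow> 'x set \<Rightarrow> ('a \<times> 'x \<times> 'a \<Rightarrow>\<^sub>0 int) set" where
  "free_rel scale X =
     {frag_of (a + a', x, b) - frag_of (a, x, b) - frag_of (a', x, b) |a a' x b. x \<in> X} \<union>
     {frag_of (a, x, b + b') - frag_of (a, x, b) - frag_of (a, x, b') |a x b b'. x \<in> X} \<union>
     {frag_of (scale c a, x, b) - frag_of (a, x, scale c b) |c a x b. x \<in> X}"

definition free_bimod ::
  "('k \<Rightarrow> 'a::{ring,monoid_mult} \<Rightarrow> 'a) \<Rightarrow> 'x set \<Rightarrow> ('a, ('a \<times> 'x \<times> 'a \<Rightarrow>\<^sub>0 int) set) bimodule" where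
  "free_bimod scale X = pres_bimod {(a, x, b). x \<in> X} (free_rel scale X)
     (\<lambda>c (a, x, b). (c * a, x, b)) (\<lambda>(a, x, b) c. (a, x, b * c))"

text \<open>
  Projective: a direct summand of a free bimodule. Index sets in the type of the elements suffice:
  a projective \<open>M\<close> is a direct summand of the free bimodule on its own carrier.
\<close>

definition projective_bimod ::
  "('k::field \<Rightarrow> 'a::{ring,monoid_mult} \<Rightarrow> 'a) \<Rightarrow> ('a, 'm) bimodule \<Rightarrow> bool" where
  "projective_bimod scale M \<longleftrightarrow> bimodule scale M \<and>
     (\<exists>(X :: 'm set) s p. s \<in> bimod_hom M (free_bimod scale X) \<and> p \<in> bimod_hom (free_bimod scale X) M \<and>
        (\<forall>x\<in>carrier M. p (s x) = x))"

section \<open>Complexes\<close>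

record ('a, 'm) bimod_complex =
  cmod :: "int \<Rightarrow> ('a, 'm) bimodule"
  cdiff :: "int \<Rightarrow> 'm \<Rightarrow> 'm"

definition is_complex ::
  "('k::field \<Rightarrow> 'a::{ring,monoid_mult} \<Rightarrow> 'a) \<Rightarrow> ('a, 'm) bimod_complex \<Rightarrow> bool" where
  "is_complex scale P \<longleftrightarrow>
     (\<forall>n. bimodule scale (cmod P n) \<and> cdiff P n \<in> bimod_hom (cmod P n) (cmod P (n - 1)) \<and>
        (\<forall>x\<in>carrier (cmod P n). cdiff P (n - 1) (cdiff P n x) = \<zero>\<^bsub>cmod P (n - 2)\<^esub>))"

text \<open>
  \<open>maps P Q t\<close> consists of the maps \<open>P \<rightarrow> Q[t]\<close>, not necessarily commuting with the differentials;
  they are families \<open>P\<^sub>i \<rightarrow> Q\<^sub>i\<^sub>+\<^sub>t\<close>, whose values outside the carriers are irrelevant.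
  For such an \<open>f\<close>, \<open>dmap P Q t f\<close> is \<open>f d\<^sub>P - (-1)\<^sup>t d\<^sub>Q f\<close>, a map \<open>P \<rightarrow> Q[t - 1]\<close>.
\<close>

definition maps ::
  "('a, 'p) bimod_complex \<Rightarrow> ('a, 'q) bimod_complex \<Rightarrow> int \<Rightarrow> (int \<Rightarrow> 'p \<Rightarrow> 'q) set" where
  "maps P Q t = {f. \<forall>i. f i \<in> bimod_hom (cmod P i) (cmod Q (i + t))}"

definition dmap ::
  "('a, 'p) bimod_complex \<Rightarrow> ('a, 'q) bimod_complex \<Rightarrow> int
    \<Rightarrow> (int \<Rightarrow> 'p \<Rightarrow> 'q) \<Rightarrow> int \<Rightarrow> 'p \<Rightarrow> 'q" where
  "dmap P Q t f = (\<lambda>i x. f (i - 1) (cdiff P i x)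
     \<ominus>\<^bsub>cmod Q (i + t - 1)\<^esub> msigned (cmod Q (i + t - 1)) t (cdiff Q (i + t) (f i x)))"

definition chain_map ::
  "('a, 'p) bimod_complex \<Rightarrow> ('a, 'q) bimod_complex \<Rightarrow> (int \<Rightarrow> 'p \<Rightarrow> 'q) \<Rightarrow> bool" where
  "chain_map P Q f \<longleftrightarrow> f \<in> maps P Q 0 \<and>
     (\<forall>i. \<forall>x\<in>carrier (cmod P i). dmap P Q 0 f i x = \<zero>\<^bsub>cmod Q (i - 1)\<^esub>)"

text \<open>\<open>f \<sim> g\<close> for \<open>f, g : P \<rightarrow> Q[t]\<close>\<close>

definition homotopic ::
  "('a, 'p) bimod_complex \<Rightarrow> ('a, 'q) bimod_complex \<Rightarrow> int
    \<Rightarrow> (int \<Rightarrow> 'p \<Rightarrow> 'q) \<Rightarrow> (int \<Rightarrow> 'p \<Rightarrow> 'q) \<Rightarrow> bool" where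
  "homotopic P Q t f g \<longleftrightarrow> (\<exists>s \<in> maps P Q (t + 1).
     \<forall>i. \<forall>x\<in>carrier (cmod P i). f i x \<ominus>\<^bsub>cmod Q (i + t)\<^esub> g i x = dmap P Q (t + 1) s i x)"

definition alg_complex :: "('a::{ring,monoid_mult}, 'a) bimod_complex" where
  "alg_complex =
    \<lparr>cmod = (\<lambda>i. \<lparr>carrier = (if i = 0 then UNIV else {0}), mult = (*), one = 1,
        zero = 0, add = (+), smult = (*), rsmult = (*)\<rparr>),
     cdiff = (\<lambda>_ _. 0)\<rparr>"

section \<open>Tensor products over the algebra\<close>

text \<open>
  \<open>tensor_mod P Q n\<close> is the degree \<open>n\<close> part \<open>\<Oplus>\<^sub>i P\<^sub>i \<otimes>\<^sub>A Q\<^sub>n\<^sub>-\<^sub>i\<close> of \<open>P \<otimes>\<^sub>A Q\<close>; the generator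
  \<open>(i, x, y)\<close> stands for \<open>x \<otimes> y\<close> with \<open>x \<in> P\<^sub>i\<close> and \<open>y \<in> Q\<^sub>n\<^sub>-\<^sub>i\<close>.
\<close>

definition tensor_rel ::
  "('a, 'p) bimod_complex \<Rightarrow> ('a, 'q) bimod_complex \<Rightarrow> int \<Rightarrow> (int \<times> 'p \<times> 'q \<Rightarrow>\<^sub>0 int) set" where
  "tensor_rel P Q n =
     {frag_of (i, x \<oplus>\<^bsub>cmod P i\<^esub> x', y) - frag_of (i, x, y) - frag_of (i, x', y) |i x x' y.
        x \<in> carrier (cmod P i) \<and> x' \<in> carrier (cmod P i) \<and> y \<in> carrier (cmod Q (n - i))} \<union>
     {frag_of (i, x, y \<oplus>\<^bsub>cmod Q (n - i)\<^esub> y') - frag_of (i, x, y) - frag_of (i, x, y') |i x y y'.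
        x \<in> carrier (cmod P i) \<and> y \<in> carrier (cmod Q (n - i)) \<and> y' \<in> carrier (cmod Q (n - i))} \<union>
     {frag_of (i, x \<bullet>\<^bsub>cmod P i\<^esub> a, y) - frag_of (i, x, a \<odot>\<^bsub>cmod Q (n - i)\<^esub> y) |i x a y.
        x \<in> carrier (cmod P i) \<and> y \<in> carrier (cmod Q (n - i))}"

definition tensor_mod ::
  "('a, 'p) bimod_complex \<Rightarrow> ('a, 'q) bimod_complex \<Rightarrow> int
    \<Rightarrow> ('a, (int \<times> 'p \<times> 'q \<Rightarrow>\<^sub>0 int) set) bimodule" where
  "tensor_mod P Q n = pres_bimod
     {(i, x, y). x \<in> carrier (cmod P i) \<and> y \<in> carrier (cmod Q (n - i))} (tensor_rel P Q n)
     (\<lambda>a (i, x, y). (i, a \<odot>\<^bsub>cmod P i\<^esub> x, y)) (\<lambda>(i, x, y) a. (i, x, y \<bullet>\<^bsub>cmod Q (n - i)\<^esub> a))"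

definition tensor_complex ::
  "('a, 'p) bimod_complex \<Rightarrow> ('a, 'q) bimod_complex
    \<Rightarrow> ('a, (int \<times> 'p \<times> 'q \<Rightarrow>\<^sub>0 int) set) bimod_complex" where
  "tensor_complex P Q =
    \<lparr>cmod = tensor_mod P Q,
     cdiff = (\<lambda>n. pres_lift (tensor_mod P Q (n - 1)) (\<lambda>(i, x, y).
        pres_class (tensor_rel P Q (n - 1))
          (frag_of (i - 1, cdiff P i x, y) + signed i (frag_of (i, x, cdiff Q (n - i) y)))))\<rparr>"

text \<open>\<open>tensor_map P' Q' s t f g\<close> is \<open>f \<otimes> g\<close> for \<open>f : P \<rightarrow> P'[s]\<close> and \<open>g : Q \<rightarrow> Q'[t]\<close>.\<close>

definition tensor_map ::
  "('a, 'p2) bimod_complex \<Rightarrow> ('a, 'q2) bimod_complex \<Rightarrow> int \<Rightarrow> int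
    \<Rightarrow> (int \<Rightarrow> 'p \<Rightarrow> 'p2) \<Rightarrow> (int \<Rightarrow> 'q \<Rightarrow> 'q2)
    \<Rightarrow> int \<Rightarrow> (int \<times> 'p \<times> 'q \<Rightarrow>\<^sub>0 int) set \<Rightarrow> (int \<times> 'p2 \<times> 'q2 \<Rightarrow>\<^sub>0 int) set" where
  "tensor_map P' Q' s t f g = (\<lambda>n. pres_lift (tensor_mod P' Q' (n + s + t)) (\<lambda>(i, x, y).
     pres_class (tensor_rel P' Q' (n + s + t))
       (signed (i * t) (frag_of (i + s, f i x, g (n - i) y)))))"

text \<open>
  The identifications of \<open>A \<otimes>\<^sub>A P\<close> and \<open>P \<otimes>\<^sub>A A\<close> with \<open>P\<close>. Generators involving a component of
  the algebra of nonzero degree (which is zero) are sent to zero.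
\<close>

definition left_unit ::
  "('a::{ring,monoid_mult}, 'p) bimod_complex \<Rightarrow> int \<Rightarrow> (int \<times> 'a \<times> 'p \<Rightarrow>\<^sub>0 int) set \<Rightarrow> 'p" where
  "left_unit P n = pres_lift (cmod P n)
     (\<lambda>(i, a, x). if i = 0 then a \<odot>\<^bsub>cmod P n\<^esub> x else \<zero>\<^bsub>cmod P n\<^esub>)"

definition right_unit ::
  "('a::{ring,monoid_mult}, 'p) bimod_complex \<Rightarrow> int \<Rightarrow> (int \<times> 'p \<times> 'a \<Rightarrow>\<^sub>0 int) set \<Rightarrow> 'p" where
  "right_unit P n = pres_lift (cmod P n)
     (\<lambda>(i, x, a). if i = n then x \<bullet>\<^bsub>cmod P n\<^esub> a else \<zero>\<^bsub>cmod P n\<^esub>)"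

section \<open>Resolutions and diagonal approximations\<close>

definition projective_resolution ::
  "('k::field \<Rightarrow> 'a::{ring,monoid_mult} \<Rightarrow> 'a) \<Rightarrow> ('a, 'p) bimod_complex \<Rightarrow> ('p \<Rightarrow> 'a) \<Rightarrow> bool" where
  "projective_resolution scale P \<mu> \<longleftrightarrow>
     is_complex scale P \<and>
     (\<forall>n. projective_bimod scale (cmod P n)) \<and>
     (\<forall>n<0. carrier (cmod P n) = {\<zero>\<^bsub>cmod P n\<^esub>}) \<and>
     (\<forall>n>0. {x \<in> carrier (cmod P n). cdiff P n x = \<zero>\<^bsub>cmod P (n - 1)\<^esub>}
        = cdiff P (n + 1) ` carrier (cmod P (n + 1))) \<and>
     \<mu> \<in> bimod_hom (cmod P 0) (cmod alg_complex 0) \<and>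
     \<mu> ` carrier (cmod P 0) = UNIV \<and>
     {x \<in> carrier (cmod P 0). \<mu> x = 0} = cdiff P 1 ` carrier (cmod P 1)"

text \<open>The extension of an augmentation by zero to a map \<open>P \<rightarrow> A\<close> of complexes.\<close>

definition aug :: "('p \<Rightarrow> 'a::zero) \<Rightarrow> int \<Rightarrow> 'p \<Rightarrow> 'a" where
  "aug \<mu> = (\<lambda>i x. if i = 0 then \<mu> x else 0)"

definition diagonal_approximation ::
  "('a::{ring,monoid_mult}, 'p) bimod_complex \<Rightarrow> ('p \<Rightarrow> 'a)
    \<Rightarrow> (int \<Rightarrow> 'p \<Rightarrow> (int \<times> 'p \<times> 'p \<Rightarrow>\<^sub>0 int) set) \<Rightarrow> bool" where
  "diagonal_approximation P \<mu> \<Delta> \<longleftrightarrow>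
     chain_map P (tensor_complex P P) \<Delta> \<and>
     (\<forall>i. \<forall>x\<in>carrier (cmod P i).
        left_unit alg_complex i (tensor_map alg_complex alg_complex 0 0 (aug \<mu>) (aug \<mu>) i (\<Delta> i x))
          = aug \<mu> i x)"

section \<open>Homotopy liftings\<close>

text \<open>\<open>(f \<otimes> 1 - 1 \<otimes> f) \<Delta>\<close> as a map \<open>P \<rightarrow> P[-n]\<close>, for \<open>f : P \<rightarrow> A[-n]\<close>\<close>

definition diag_commutator ::
  "('a::{ring,monoid_mult}, 'p) bimod_complex \<Rightarrow> (int \<Rightarrow> 'p \<Rightarrow> (int \<times> 'p \<times> 'p \<Rightarrow>\<^sub>0 int) set)
    \<Rightarrow> int \<Rightarrow> (int \<Rightarrow> 'p \<Rightarrow> 'a) \<Rightarrow> int \<Rightarrow> 'p \<Rightarrow> 'p" where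
  "diag_commutator P \<Delta> n f = (\<lambda>i x.
     left_unit P (i - n) (tensor_map alg_complex P (- n) 0 f (\<lambda>_ y. y) i (\<Delta> i x))
     \<ominus>\<^bsub>cmod P (i - n)\<^esub>
     right_unit P (i - n) (tensor_map P alg_complex 0 (- n) (\<lambda>_ y. y) f i (\<Delta> i x)))"

definition homotopy_lifting ::
  "('a::{ring,monoid_mult}, 'p) bimod_complex \<Rightarrow> ('p \<Rightarrow> 'a)
    \<Rightarrow> (int \<Rightarrow> 'p \<Rightarrow> (int \<times> 'p \<times> 'p \<Rightarrow>\<^sub>0 int) set)
    \<Rightarrow> int \<Rightarrow> (int \<Rightarrow> 'p \<Rightarrow> 'a) \<Rightarrow> (int \<Rightarrow> 'p \<Rightarrow> 'p) \<Rightarrow> bool" where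
  "homotopy_lifting P \<mu> \<Delta> n f \<phi> \<longleftrightarrow>
     \<phi> \<in> maps P P (1 - n) \<and>
     (\<forall>i. \<forall>x\<in>carrier (cmod P i). dmap P P (1 - n) \<phi> i x = diag_commutator P \<Delta> n f i x) \<and>
     (\<exists>\<psi> \<in> maps P P 1.
        (\<forall>i. \<forall>x\<in>carrier (cmod P i). dmap P P 1 \<psi> i x = diag_commutator P \<Delta> 0 (aug \<mu>) i x) \<and>
        homotopic P alg_complex (1 - n)
          (\<lambda>i x. aug \<mu> (i + (1 - n)) (\<phi> i x) + f (i + 1) (\<psi> i x)) (\<lambda>_ _. 0))"

section \<open>Hochschild cohomology\<close>

definition cocycle ::
  "('a::{ring,monoid_mult}, 'p) bimod_complex \<Rightarrow> int \<Rightarrow> (int \<Rightarrow> 'p \<Rightarrow> 'a) \<Rightarrow> bool" where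
  "cocycle P n f \<longleftrightarrow> f \<in> maps P alg_complex (- n) \<and>
     (\<forall>i. \<forall>x\<in>carrier (cmod P i). f (i - 1) (cdiff P i x) = 0)"

text \<open>The class of \<open>f\<close> in the cohomology computed by \<open>P\<close>, as the set of cocycles representing it.\<close>

definition hh_class ::
  "('a::{ring,monoid_mult}, 'p) bimod_complex \<Rightarrow> int \<Rightarrow> (int \<Rightarrow> 'p \<Rightarrow> 'a) \<Rightarrow> (int \<Rightarrow> 'p \<Rightarrow> 'a) set" where
  "hh_class P n f = {f'. cocycle P n f' \<and> (\<exists>h \<in> maps P alg_complex (1 - n).
     \<forall>i. \<forall>x\<in>carrier (cmod P i). f' i x - f i x = h (i - 1) (cdiff P i x))}"

definition comparison_map ::
  "('a, 'p) bimod_complex \<Rightarrow> ('p \<Rightarrow> 'a) \<Rightarrow> ('a, 'q) bimod_complex \<Rightarrow> ('q \<Rightarrow> 'a)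
    \<Rightarrow> (int \<Rightarrow> 'p \<Rightarrow> 'q) \<Rightarrow> bool" where
  "comparison_map P \<mu> Q \<nu> \<iota> \<longleftrightarrow>
     chain_map P Q \<iota> \<and> (\<forall>x\<in>carrier (cmod P 0). \<nu> (\<iota> 0 x) = \<mu> x)"

text \<open>
  The map from degree \<open>n\<close> classes on \<open>Q\<close> to degree \<open>n\<close> classes on \<open>P\<close> induced by \<open>\<iota> : P \<rightarrow> Q\<close>.
\<close>

definition hh_pullback ::
  "('a::{ring,monoid_mult}, 'p) bimod_complex \<Rightarrow> int \<Rightarrow> (int \<Rightarrow> 'p \<Rightarrow> 'q)
    \<Rightarrow> (int \<Rightarrow> 'q \<Rightarrow> 'a) set \<Rightarrow> (int \<Rightarrow> 'p \<Rightarrow> 'a) set" where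
  "hh_pullback P n \<iota> F = (\<Union>f\<in>F. hh_class P n (\<lambda>i x. f i (\<iota> i x)))"

section \<open>The bar resolution and the Gerstenhaber bracket\<close>

text \<open>
  \<open>bar_mod scale n\<close> is the tensor power of \<open>A\<close> over \<open>k\<close> with \<open>n + 2\<close> factors for \<open>n \<ge> 0\<close>, and the
  zero bimodule (no generators) for \<open>n < 0\<close>; the list \<open>[a\<^sub>0, \<dots>, a\<^sub>n\<^sub>+\<^sub>1]\<close> stands for
  \<open>a\<^sub>0 \<otimes> \<dots> \<otimes> a\<^sub>n\<^sub>+\<^sub>1\<close>.
\<close>

definition bar_rel :: "('k \<Rightarrow> 'a::{ring,monoid_mult} \<Rightarrow> 'a) \<Rightarrow> int \<Rightarrow> ('a list \<Rightarrow>\<^sub>0 int) set" where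
  "bar_rel scale n =
     {frag_of (xs @ (a + b) # ys) - frag_of (xs @ a # ys) - frag_of (xs @ b # ys) |xs a b ys.
        0 \<le> n \<and> int (length xs + length ys) = n + 1} \<union>
     {frag_of (xs @ scale c a # ys @ b # zs) - frag_of (xs @ a # ys @ scale c b # zs) |xs c a ys b zs.
        0 \<le> n \<and> int (length xs + length ys + length zs) = n}"

definition bar_mod ::
  "('k \<Rightarrow> 'a::{ring,monoid_mult} \<Rightarrow> 'a) \<Rightarrow> int \<Rightarrow> ('a, ('a list \<Rightarrow>\<^sub>0 int) set) bimodule" where
  "bar_mod scale n = pres_bimod {as. 0 \<le> n \<and> int (length as) = n + 2} (bar_rel scale n)
     (\<lambda>a as. (a * hd as) # tl as) (\<lambda>as a. butlast as @ [last as * a])"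

definition bar_complex ::
  "('k \<Rightarrow> 'a::{ring,monoid_mult} \<Rightarrow> 'a) \<Rightarrow> ('a, ('a list \<Rightarrow>\<^sub>0 int) set) bimod_complex" where
  "bar_complex scale =
    \<lparr>cmod = bar_mod scale,
     cdiff = (\<lambda>n. pres_lift (bar_mod scale (n - 1)) (\<lambda>as.
        pres_class (bar_rel scale (n - 1)) (if n \<le> 0 then 0 else
          \<Sum>i\<le>nat n. signed (int i)
            (frag_of (take i as @ (as ! i * as ! Suc i) # drop (i + 2) as)))))\<rparr>"

definition bar_aug :: "('a list \<Rightarrow>\<^sub>0 int) set \<Rightarrow> 'a::{ring,monoid_mult}" where
  "bar_aug = pres_lift (cmod alg_complex 0) (\<lambda>as. as ! 0 * as ! 1)"

text \<open>
  A cochain in \<open>C\<^sup>n(A) = Hom\<^sub>k(A\<^sup>\<otimes>\<^sup>n, A)\<close> is given by its values on pure tensors, that is on lists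
  of length \<open>n\<close>. It corresponds to a bimodule map on the bar resolution by
  \<open>a\<^sub>0 \<otimes> \<dots> \<otimes> a\<^sub>n\<^sub>+\<^sub>1 \<mapsto> a\<^sub>0 \<alpha>(a\<^sub>1 \<otimes> \<dots> \<otimes> a\<^sub>n) a\<^sub>n\<^sub>+\<^sub>1\<close>.
\<close>

definition cochain_of ::
  "('k \<Rightarrow> 'a::{ring,monoid_mult} \<Rightarrow> 'a) \<Rightarrow> nat \<Rightarrow> (int \<Rightarrow> ('a list \<Rightarrow>\<^sub>0 int) set \<Rightarrow> 'a)
    \<Rightarrow> 'a list \<Rightarrow> 'a" where
  "cochain_of scale n F = (\<lambda>as. F (int n) (pres_class (bar_rel scale (int n)) (frag_of (1 # as @ [1]))))"

definition bar_map_of ::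
  "int \<Rightarrow> ('a list \<Rightarrow> 'a) \<Rightarrow> int \<Rightarrow> ('a list \<Rightarrow>\<^sub>0 int) set \<Rightarrow> 'a::{ring,monoid_mult}" where
  "bar_map_of n \<alpha> = (\<lambda>i X. if i = n
     then pres_lift (cmod alg_complex 0) (\<lambda>as. hd as * \<alpha> (butlast (tl as)) * last as) X else 0)"

definition circ_i ::
  "nat \<Rightarrow> nat \<Rightarrow> ('a list \<Rightarrow> 'a) \<Rightarrow> ('a list \<Rightarrow> 'a) \<Rightarrow> 'a list \<Rightarrow> 'a" where
  "circ_i m i \<alpha> \<beta> = (\<lambda>as. \<alpha> (take (i - 1) as @ \<beta> (take m (drop (i - 1) as)) # drop (i - 1 + m) as))"

definition circ ::
  "nat \<Rightarrow> nat \<Rightarrow> ('a::{ring,monoid_mult} list \<Rightarrow> 'a) \<Rightarrow> ('a list \<Rightarrow> 'a) \<Rightarrow> 'a list \<Rightarrow> 'a" where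
  "circ n m \<alpha> \<beta> = (\<lambda>as. \<Sum>i=1..n. signed ((int m - 1) * (int i - 1)) (circ_i m i \<alpha> \<beta> as))"

definition gerstenhaber ::
  "nat \<Rightarrow> nat \<Rightarrow> ('a::{ring,monoid_mult} list \<Rightarrow> 'a) \<Rightarrow> ('a list \<Rightarrow> 'a) \<Rightarrow> 'a list \<Rightarrow> 'a" where
  "gerstenhaber n m \<alpha> \<beta> = (\<lambda>as.
     circ n m \<alpha> \<beta> as - signed ((int n - 1) * (int m - 1)) (circ m n \<beta> \<alpha> as))"

text \<open>
  The bracket of cohomology classes on the bar resolution. The degree \<open>n + m - 1\<close> is an integer,
  so for \<open>n = m = 0\<close> the bracket lies in degree \<open>-1\<close>, where the cohomology vanishes.
\<close>

definition hh_bracket ::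
  "('k \<Rightarrow> 'a::{ring,monoid_mult} \<Rightarrow> 'a) \<Rightarrow> nat \<Rightarrow> nat
    \<Rightarrow> (int \<Rightarrow> ('a list \<Rightarrow>\<^sub>0 int) set \<Rightarrow> 'a) set \<Rightarrow> (int \<Rightarrow> ('a list \<Rightarrow>\<^sub>0 int) set \<Rightarrow> 'a) set
    \<Rightarrow> (int \<Rightarrow> ('a list \<Rightarrow>\<^sub>0 int) set \<Rightarrow> 'a) set" where
  "hh_bracket scale n m F G = (\<Union>\<alpha>\<in>F. \<Union>\<beta>\<in>G.
     hh_class (bar_complex scale) (int n + int m - 1) (bar_map_of (int n + int m - 1)
       (gerstenhaber n m (cochain_of scale n \<alpha>) (cochain_of scale m \<beta>))))"

text \<open>\<open>[f,g]\<^bsub>\<phi>,\<Delta>\<^esub> = (-1)\<^sup>m f \<phi>\<^sub>g + (-1)\<^bsup>m(n-1)\<^esup> g \<phi>\<^sub>f\<close>\<close>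

definition lifting_bracket ::
  "nat \<Rightarrow> nat \<Rightarrow> (int \<Rightarrow> 'p \<Rightarrow> 'a::{ring,monoid_mult}) \<Rightarrow> (int \<Rightarrow> 'p \<Rightarrow> 'a)
    \<Rightarrow> (int \<Rightarrow> 'p \<Rightarrow> 'p) \<Rightarrow> (int \<Rightarrow> 'p \<Rightarrow> 'p) \<Rightarrow> int \<Rightarrow> 'p \<Rightarrow> 'a" where
  "lifting_bracket n m f g \<phi>\<^sub>f \<phi>\<^sub>g = (\<lambda>i x.
     signed (int m) (f (i + (1 - int m)) (\<phi>\<^sub>g i x))
     + signed (int m * (int n - 1)) (g (i + (1 - int n)) (\<phi>\<^sub>f i x)))"

end

theory Submission
  imports Defs
begin

text \<open>
  A comparison map \<open>\<iota>\<close> from the bar resolution is determined by the elements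
  \<open>I(a\<^sub>1, \<dots>, a\<^sub>n) = \<iota>(1 \<otimes> a\<^sub>1 \<otimes> \<dots> \<otimes> a\<^sub>n \<otimes> 1)\<close> of \<open>P\<^sub>n\<close>, a multilinear cochain whose Hochschild
  coboundary is \<open>d I\<close>. Since \<open>P \<otimes>\<^sub>A P\<close> is exact, \<open>\<Delta> I\<close> differs from the cup product \<open>T = I \<smile> I\<close>
  only by the total coboundary of a cochain \<open>H\<close>. Inserting the cochain \<open>f\<iota>\<close> into \<open>I\<close> is, up to
  sign, a homotopy for \<open>(f \<otimes> 1 - 1 \<otimes> f) T\<close>; as \<open>\<phi>\<^sub>f I\<close> is a homotopy for \<open>(f \<otimes> 1 - 1 \<otimes> f) \<Delta> I\<close>, the two
  differ by \<open>(f \<otimes> 1 - 1 \<otimes> f) H\<close> and a chain map into \<open>P\<close>, and the condition on \<open>\<mu>\<phi>\<^sub>f\<close> makes this chain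
  map null-homotopic. Applying \<open>g\<close> shows that \<open>g\<phi>\<^sub>f\<iota>\<close> is cohomologous to \<open>(-1)\<^sup>n g\<iota> \<circ> f\<iota>\<close> plus
  \<open>g (f \<otimes> 1 - 1 \<otimes> f) H\<close>, and the terms with \<open>H\<close> cancel in \<open>[f, g]\<^bsub>\<phi>,\<Delta>\<^esub>\<close>.
\<close>

text \<open>The obstacle to the final null-homotopy sits in one degree: P is exact apart from its
  augmentation, so the lifting argument needs the component with values in degree 0 to lie in the
  kernel of \<mu>. For the chain map X built from \<open>\<phi>\<^sub>f\<close> this fails in
  general, but \<mu>X is a coboundary. On the one hand \<open>\<mu>\<phi>\<^sub>f + f\<psi>\<close>
  equals s d for some s. On the other hand \<psi>I - (\<mu> \<otimes> 1 - 1 \<otimes> \<mu>)H is a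
  chain map with values in positive degrees, hence null-homotopic through some Y. The terms with H
  match because \<mu>(f \<otimes> 1 - 1 \<otimes> f) = -f(\<mu> \<otimes> 1 - 1 \<otimes> \<mu>) in
  degree n. So \<mu>X is the coboundary of sI + fY, and this cochain, multiplied by an element p
  with \<mu> p = 1, gives the correction of X. All cochains are constructed by choosing values on
  lists of basis vectors of the algebra, which is where the ground field enters. Exactness of the
  tensor square rests on a contraction of P by right linear maps, obtained from
  projectivity.\<close>

lemma signed_add: "signed k (x + y) = signed k x + signed k (y::'v::ab_group_add)"
  and signed_diff: "signed k (x - y) = signed k x - signed k (y::'v::ab_group_add)"
  and signed_0 [simp]: "signed k (0::'v::ab_group_add) = 0"
  and signed_signed: "signed k (signed j x) = signed (k + j) (x::'v::ab_group_add)"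
  by (auto simp: signed_def)

lemma signed_zero [simp]: "signed 0 x = x"
  by (simp add: signed_def)

lemma additive_signed: "additive h \<Longrightarrow> h (signed k x) = signed k (h x)"
  by (simp add: signed_def additive.minus)

section \<open>Hochschild cochains with coefficients in a bimodule\<close>

text \<open>A bimodule structure on a whole type. The ground field does not occur: the two actions
  of k are known to agree on homogeneous elements of the complexes at hand, not on the whole type,
  so this agreement is supplied separately where scalars matter.\<close>

locale bimod_act =
  fixes l :: "'a::{ring,monoid_mult} \<Rightarrow> 'v::ab_group_add \<Rightarrow> 'v" and r :: "'v \<Rightarrow> 'a \<Rightarrow> 'v"
  assumes l_add: "l a (x + y) = l a x + l a y"
    and l_add_left: "l (a + b) x = l a x + l b x"
    and l_assoc: "l (a * b) x = l a (l b x)"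
    and l_one: "l 1 x = x"
    and r_add: "r (x + y) a = r x a + r y a"
    and r_add_right: "r x (a + b) = r x a + r x b"
    and r_assoc: "r x (a * b) = r (r x a) b"
    and r_one: "r x 1 = x"
    and l_r: "r (l a x) b = l a (r x b)"
begin

lemma additive_l: "additive (l a)" by (simp add: additive_def l_add)
lemma additive_r: "additive (\<lambda>x. r x a)" by (simp add: additive_def r_add)
lemma additive_l_left: "additive (\<lambda>a. l a x)" by (simp add: additive_def l_add_left)
lemma additive_r_right: "additive (r x)" by (simp add: additive_def r_add_right)

lemmas l_0 [simp] = additive.zero [OF additive_l]
lemmas r_0 [simp] = additive.zero [OF additive_r]
lemmas l_0_left [simp] = additive.zero [OF additive_l_left]
lemmas r_0_right [simp] = additive.zero [OF additive_r_right]
lemmas l_diff = additive.diff [OF additive_l]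
lemmas r_diff = additive.diff [OF additive_r]
lemmas l_sum = additive.sum [OF additive_l]
lemmas r_sum = additive.sum [OF additive_r]
lemmas l_signed = additive_signed [OF additive_l]
lemmas r_signed = additive_signed [OF additive_r]

end

lemma bimod_act_mult: "bimod_act (*) ((*) :: 'a::{ring,monoid_mult} \<Rightarrow> _)"
  by unfold_locales (simp_all add: algebra_simps)

text \<open>
  \<open>merge r F\<close> is the alternating sum of the values of \<open>F\<close> on the lists with two neighbours
  multiplied, the last entry being multiplied into the value by \<open>r\<close>. Up to sign these are all
  terms of the Hochschild coboundary \<open>hb l r F\<close> but the first.
\<close>

fun merge :: "('v::ab_group_add \<Rightarrow> 'a::times \<Rightarrow> 'v) \<Rightarrow> ('a list \<Rightarrow> 'v) \<Rightarrow> 'a list \<Rightarrow> 'v" where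
  "merge r F [] = 0"
| "merge r F [a] = r (F []) a"
| "merge r F (a # c # cs) = F ((a * c) # cs) - merge r (\<lambda>ys. F (a # ys)) (c # cs)"

text \<open>The part of \<open>merge\<close> in which the head meets its successor, or acts from the
  right at the end of the list. It gives \<open>merge\<close> the uniform recursion
  \<open>merge_Cons\<close>, without cases on the tail.\<close>

definition merge1 :: "('v \<Rightarrow> 'a::times \<Rightarrow> 'v) \<Rightarrow> ('a list \<Rightarrow> 'v) \<Rightarrow> 'a \<Rightarrow> 'a list \<Rightarrow> 'v" where
  "merge1 r F a ys = (case ys of [] \<Rightarrow> r (F []) a | c # cs \<Rightarrow> F ((a * c) # cs))"

lemma merge1_simps [simp]: "merge1 r F a [] = r (F []) a" "merge1 r F a (c # cs) = F ((a * c) # cs)"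
  by (simp_all add: merge1_def)

lemma merge_Cons: "merge r F (a # as) = merge1 r F a as - merge r (\<lambda>ys. F (a # ys)) as"
  by (cases as) simp_all

definition hb :: "('a \<Rightarrow> 'v \<Rightarrow> 'v) \<Rightarrow> ('v::ab_group_add \<Rightarrow> 'a::times \<Rightarrow> 'v) \<Rightarrow> ('a list \<Rightarrow> 'v) \<Rightarrow> 'a list \<Rightarrow> 'v" where
  "hb l r F xs = (case xs of [] \<Rightarrow> 0 | a # as \<Rightarrow> l a (F as) - merge r F xs)"

lemma hb_Nil [simp]: "hb l r F [] = 0"
  and hb_Cons: "hb l r F (a # as) = l a (F as) - merge r F (a # as)"
  by (simp_all add: hb_def)

lemma merge_cong: "(\<And>ys. Suc (length ys) = length xs \<Longrightarrow> F ys = G ys) \<Longrightarrow> merge r F xs = merge r G xs"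
  by (induction r F xs arbitrary: G rule: merge.induct) auto

lemma hb_cong: "(\<And>ys. Suc (length ys) = length xs \<Longrightarrow> F ys = G ys) \<Longrightarrow> hb l r F xs = hb l r G xs"
  by (cases xs) (auto simp: hb_Cons intro: merge_cong)

lemma merge_hom:
  assumes "additive h" "\<And>ys a. h (r (F ys) a) = r' (h (F ys)) a"
  shows "h (merge r F xs) = merge r' (\<lambda>ys. h (F ys)) xs"
  using assms(2)
  by (induction r F xs rule: merge.induct) (auto simp: additive.zero [OF assms(1)] additive.diff [OF assms(1)])

lemma hb_hom:
  assumes "additive h" "\<And>ys a. h (r (F ys) a) = r' (h (F ys)) a" "\<And>ys a. h (l a (F ys)) = l' a (h (F ys))"
  shows "h (hb l r F xs) = hb l' r' (\<lambda>ys. h (F ys)) xs"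
  using assms by (cases xs) (auto simp: hb_Cons additive.zero additive.diff merge_hom)

lemma merge_closed:
  assumes "0 \<in> V" "\<And>x y. x \<in> V \<Longrightarrow> y \<in> V \<Longrightarrow> x - y \<in> V" "\<And>x a. x \<in> V \<Longrightarrow> r x a \<in> V"
    and "\<And>ys. Suc (length ys) = length xs \<Longrightarrow> F ys \<in> V"
  shows "merge r F xs \<in> V"
  using assms(4)
  by (induction xs arbitrary: F rule: induct_list012) (auto simp: assms(1-3))

lemma hb_closed:
  assumes "0 \<in> V" "\<And>x y. x \<in> V \<Longrightarrow> y \<in> V \<Longrightarrow> x - y \<in> V" "\<And>x a. x \<in> V \<Longrightarrow> r x a \<in> V"
    and "\<And>x a. x \<in> V \<Longrightarrow> l a x \<in> V"
    and "\<And>ys. Suc (length ys) = length xs \<Longrightarrow> F ys \<in> V"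
  shows "hb l r F xs \<in> V"
  using assms by (cases xs) (auto simp: hb_Cons intro!: assms(2) merge_closed)

context bimod_act
begin

lemma merge_add: "merge r (\<lambda>xs. F xs + G xs) xs = merge r F xs + merge r G xs"
  by (induction xs arbitrary: F G rule: induct_list012) (simp_all add: r_add)

lemma merge_diff: "merge r (\<lambda>xs. F xs - G xs) xs = merge r F xs - merge r G xs"
  by (induction xs arbitrary: F G rule: induct_list012) (simp_all add: r_diff)

lemma merge_l: "merge r (\<lambda>xs. l a (F xs)) xs = l a (merge r F xs)"
  using merge_hom [of "l a" r F r xs] by (simp add: additive_l l_r)

lemma merge_signed: "merge r (\<lambda>xs. signed k (F xs)) xs = signed k (merge r F xs)"
  using merge_hom [of "signed k" r F r xs] by (simp add: r_signed signed_add additive_def)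

lemma merge_0 [simp]: "merge r (\<lambda>xs. 0) xs = 0"
  using merge_diff [of "\<lambda>_. 0" "\<lambda>_. 0" xs] by simp

lemma hb_add: "hb l r (\<lambda>xs. F xs + G xs) xs = hb l r F xs + hb l r G xs"
  by (cases xs) (simp_all add: hb_Cons merge_add l_add)

lemma hb_diff: "hb l r (\<lambda>xs. F xs - G xs) xs = hb l r F xs - hb l r G xs"
  by (cases xs) (simp_all add: hb_Cons merge_diff l_diff)

lemma hb_signed: "hb l r (\<lambda>xs. signed k (F xs)) xs = signed k (hb l r F xs)"
  by (cases xs) (simp_all add: hb_Cons merge_signed l_signed signed_diff)

lemma hb_0 [simp]: "hb l r (\<lambda>xs. 0) xs = 0"
  using hb_diff [of "\<lambda>_. 0" "\<lambda>_. 0" xs] by simp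

text \<open>The simplicial identities. Products touching \<open>a\<close> cancel in pairs, by
  associativity where they overlap; what is left is the same double sum for
  \<open>\<lambda>ys. F (a # ys)\<close> on the tail, so induction applies.\<close>

lemma merge_merge: "merge r (merge r F) (a # c # cs) = 0"
proof (induction cs arbitrary: F a c)
  case Nil
  then show ?case by (simp add: r_assoc)
next
  case (Cons e es)
  have "merge r (merge r F) (a # c # e # es) = merge r (merge r (\<lambda>ys. F (a # ys))) (c # e # es)"
    by (simp add: merge_Cons [of r "\<lambda>ys. merge r F (a # ys)"] merge_Cons [of r "\<lambda>ys. merge r F (a # c # ys)"]
        merge_diff algebra_simps)
  then show ?case by (simp only: Cons.IH)
qed

text \<open>With the left action split off, the mixed terms cancel because left and right actions
  commute (\<open>merge_l\<close>), \<open>l_assoc\<close> settles the two leading entries, and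
  \<open>merge_merge\<close> disposes of the rest.\<close>

lemma hb_hb: "hb l r (hb l r F) xs = 0"
proof -
  have 1: "hb l r (hb l r F) [a] = 0" for a by (simp add: hb_Cons)
  have "hb l r (hb l r F) (a # c # cs) = 0" for a c cs
  proof -
    have "merge r (hb l r F) (a # c # cs) =
        l (a * c) (F cs) - merge r F ((a * c) # cs) - merge r (\<lambda>ys. l a (F ys) - merge r F (a # ys)) (c # cs)"
      by (simp add: hb_Cons)
    also have "\<dots> = l (a * c) (F cs) - l a (merge r F (c # cs)) - merge r (merge r F) (a # c # cs)"
      by (simp add: merge_diff merge_l)
    finally show ?thesis
      using merge_merge [of F a c cs] by (simp add: hb_Cons l_diff l_assoc algebra_simps)
  qed
  with 1 show ?thesis by (metis hb_Nil list.exhaust)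
qed

end

section \<open>Insertion of one cochain into another\<close>

definition insert1 :: "nat \<Rightarrow> ('a list \<Rightarrow> 'a) \<Rightarrow> ('a list \<Rightarrow> 'v::zero) \<Rightarrow> 'a list \<Rightarrow> 'v" where
  "insert1 n \<alpha> F xs = (if n \<le> length xs then F (\<alpha> (take n xs) # drop n xs) else 0)"

text \<open>Gerstenhaber's circle product of \<open>F\<close> with \<alpha>, for any coefficients
  and on lists of every length: passing an entry costs the sign (-1)^(n-1). Recursion on the list
  replaces the sum over positions, so that the homotopy formula can be proved by induction. For n =
  0 the empty list still admits one insertion.\<close>

primrec insertion :: "nat \<Rightarrow> ('a list \<Rightarrow> 'a) \<Rightarrow> ('a list \<Rightarrow> 'v::ab_group_add) \<Rightarrow> 'a list \<Rightarrow> 'v" where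
  "insertion n \<alpha> F [] = insert1 n \<alpha> F []"
| "insertion n \<alpha> F (a # as) =
     insert1 n \<alpha> F (a # as) + signed (int n - 1) (insertion n \<alpha> (\<lambda>ys. F (a # ys)) as)"

text \<open>The additive half of multilinearity. It lets \<open>F\<close> be expanded when a slot is
  filled with an alternating sum, such as a merged value or a coboundary.\<close>

definition slotwise_add :: "('a::plus list \<Rightarrow> 'v::plus) \<Rightarrow> bool" where
  "slotwise_add F \<longleftrightarrow> (\<forall>xs a b ys. F (xs @ (a + b) # ys) = F (xs @ a # ys) + F (xs @ b # ys))"

lemma slotwise_add_Cons: "slotwise_add F \<Longrightarrow> slotwise_add (\<lambda>ys. F (a # ys))"
  by (metis append_Cons slotwise_add_def)

lemma slotwise_add_first: "slotwise_add F \<Longrightarrow> F ((a + b) # ys) = F (a # ys) + F (b # ys)"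
  by (metis append_Nil slotwise_add_def)

lemma slotwise_add_first_diff:
  fixes F :: "'a::ab_group_add list \<Rightarrow> 'v::ab_group_add"
  shows "slotwise_add F \<Longrightarrow> F ((a - b) # ys) = F (a # ys) - F (b # ys)"
  using slotwise_add_first [of F "a - b" b ys] by (simp add: algebra_simps)

lemma insertion_short: "length xs < n \<Longrightarrow> insertion n \<alpha> F xs = 0"
  by (induction xs arbitrary: F) (simp_all add: insert1_def)

lemma insertion_hom:
  assumes "additive h"
  shows "h (insertion n \<alpha> F xs) = insertion n \<alpha> (\<lambda>ys. h (F ys)) xs"
  by (induction xs arbitrary: F)
    (simp_all add: insert1_def additive.zero [OF assms] additive.add [OF assms] additive_signed [OF assms])

lemma insertion_add: "insertion n \<alpha> (\<lambda>ys. F ys + G ys) xs = insertion n \<alpha> F xs + insertion n \<alpha> G xs"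
  by (induction xs arbitrary: F G) (simp_all add: insert1_def signed_add)

lemma insertion_diff: "insertion n \<alpha> (\<lambda>ys. F ys - G ys) xs = insertion n \<alpha> F xs - insertion n \<alpha> G xs"
  by (induction xs arbitrary: F G) (simp_all add: insert1_def signed_diff)

lemma insertion_cong:
  assumes "\<And>ys. length ys + n = Suc (length xs) \<Longrightarrow> F ys = G ys" "\<And>ys. length ys = n \<Longrightarrow> \<alpha> ys = \<beta> ys"
  shows "insertion n \<alpha> F xs = insertion n \<beta> G xs"
  using assms(1)
proof (induction xs arbitrary: F G)
  case Nil
  then show ?case by (auto simp: insert1_def assms(2))
next
  case (Cons a as)
  have "insertion n \<alpha> (\<lambda>ys. F (a # ys)) as = insertion n \<beta> (\<lambda>ys. G (a # ys)) as"
    by (rule Cons.IH) (simp add: Cons.prems)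
  moreover have "insert1 n \<alpha> F (a # as) = insert1 n \<beta> G (a # as)"
    by (auto simp: insert1_def assms(2) intro!: Cons.prems)
  ultimately show ?case by simp
qed

lemma insertion_add_inner:
  assumes "slotwise_add F"
  shows "insertion n (\<lambda>ys. \<alpha> ys + \<beta> ys) F xs = insertion n \<alpha> F xs + insertion n \<beta> F xs"
  using assms
proof (induction xs arbitrary: F)
  case Nil
  then show ?case by (simp add: insert1_def slotwise_add_first)
next
  case (Cons a as)
  then show ?case
    by (simp add: insert1_def slotwise_add_first slotwise_add_Cons signed_add)
qed

context bimod_act
begin

text \<open>Products inside the block are faces of \<gamma>, products after it are faces of
  \<open>F\<close>. Both terms on the right contain in addition the product of the value of \<gamma>
  with the entry following the block, as last face of \<gamma> and as first face of
  \<open>F\<close>, and these cancel.\<close>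

lemma merge_insert1:
  assumes "slotwise_add F" "length xs = n + Suc k"
  shows "merge r (insert1 n \<gamma> F) xs = F (merge (*) \<gamma> (take (Suc n) xs) # drop (Suc n) xs)
           - signed (int n) (merge r F (\<gamma> (take n xs) # drop n xs))"
  using assms
proof (induction n arbitrary: \<gamma> xs)
  case 0
  then obtain c cs where xs: "xs = c # cs" by (cases xs) auto
  have "insert1 0 \<gamma> F = (\<lambda>ys. F (\<gamma> [] # ys))" by (simp add: insert1_def fun_eq_iff)
  then show ?case by (simp add: xs)
next
  case (Suc n)
  then obtain a c cs where xs: "xs = a # c # cs"
    by (metis Suc_length_conv add_Suc_right add_Suc)
  have len: "length (c # cs) = n + Suc k" using Suc.prems xs by simp
  have tail: "(\<lambda>ys. insert1 (Suc n) \<gamma> F (a # ys)) = insert1 n (\<lambda>ys. \<gamma> (a # ys)) F"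
    by (simp add: insert1_def fun_eq_iff)
  have "merge r (insert1 (Suc n) \<gamma> F) xs = insert1 (Suc n) \<gamma> F ((a * c) # cs)
      - merge r (insert1 n (\<lambda>ys. \<gamma> (a # ys)) F) (c # cs)"
    by (simp add: xs tail)
  also have "insert1 (Suc n) \<gamma> F ((a * c) # cs) = F (\<gamma> ((a * c) # take n cs) # drop n cs)"
    using len by (simp add: insert1_def)
  also have "merge r (insert1 n (\<lambda>ys. \<gamma> (a # ys)) F) (c # cs) =
      F (merge (*) (\<lambda>ys. \<gamma> (a # ys)) (take (Suc n) (c # cs)) # drop (Suc n) (c # cs))
      - signed (int n) (merge r F (\<gamma> (a # take n (c # cs)) # drop n (c # cs)))"
    by (rule Suc.IH [OF Suc.prems(1) len])
  finally show ?case
    using slotwise_add_first_diff [OF Suc.prems(1)] by (simp add: xs signed_def)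
qed

text \<open>The homotopy formula without left actions. The last summand arises when the block stands
  at the end of the list and the value of \<alpha> is multiplied into \<open>F\<close> from the
  right. The induction freezes the head \<open>a\<close> and passes to
  \<open>\<lambda>ys. F (a # ys)\<close>.\<close>

lemma insertion_merge:
  assumes "slotwise_add F" "n \<le> length xs"
  shows "insertion n \<alpha> (merge r F) xs =
    signed (int n - 1) (merge r (insertion n \<alpha> F) xs)
    + signed (int n - 1) (insertion (Suc n) (hb (*) (*) \<alpha>) F xs)
    + signed (int (length xs - n) * int n)
        (r (F (take (length xs - n) xs)) (\<alpha> (drop (length xs - n) xs)))"
  using assms
proof (induction xs arbitrary: F)
  case Nil
  then show ?case by (simp add: insert1_def)
next
  case (Cons a as)
  let ?s = "signed (int n - 1)" and ?Fa = "\<lambda>ys. F (a # ys)"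
  note Fa = slotwise_add_Cons [OF Cons.prems(1), of a]
  show ?case
  proof (cases "n = Suc (length as)")
    \<comment> \<open>The block fills the list: only \<open>merge r F [\<alpha> (a # as)]\<close>
      survives, and this is the last summand.\<close>
    case True
    have m: "merge r (insertion n \<alpha> F) (a # as) = 0"
      using merge_cong [of "a # as" "insertion n \<alpha> F" "\<lambda>_. 0"] True by (auto simp: insertion_short)
    have "insertion (Suc n) (hb (*) (*) \<alpha>) F (a # as) = 0"
      by (rule insertion_short) (simp add: True)
    with m True show ?thesis
      by (simp add: insertion_short insert1_def)
  next
    case False
    then have n: "n \<le> length as" using Cons.prems by simp
    obtain k where k: "length (a # as) = n + Suc k" using n by (metis add_Suc_right le_Suc_ex length_Cons)
    let ?cup = "signed (int (length as - n) * int n)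
        (r (?Fa (take (length as - n) as)) (\<alpha> (drop (length as - n) as)))"
    have IH: "insertion n \<alpha> (merge r ?Fa) as = ?s (merge r (insertion n \<alpha> ?Fa) as)
        + ?s (insertion (Suc n) (hb (*) (*) \<alpha>) ?Fa as) + ?cup"
      by (rule Cons.IH [OF Fa n])
    have mF: "(\<lambda>ys. merge r F (a # ys)) = (\<lambda>ys. merge1 r F a ys - merge r ?Fa ys)"
      by (simp add: fun_eq_iff merge_Cons)
    have L: "insertion n \<alpha> (merge r F) (a # as) = merge r F (\<alpha> (take n (a # as)) # drop n (a # as))
        + ?s (insertion n \<alpha> (merge1 r F a) as) - ?s (insertion n \<alpha> (merge r ?Fa) as)"
      using Cons.prems by (simp add: mF insertion_diff signed_diff insert1_def)
    have iF: "(\<lambda>ys. insertion n \<alpha> F (a # ys)) = (\<lambda>ys. insert1 n \<alpha> F (a # ys) + ?s (insertion n \<alpha> ?Fa ys))"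
      by (simp add: fun_eq_iff)
    have R: "merge r (insertion n \<alpha> F) (a # as) = merge1 r (insertion n \<alpha> F) a as
        - merge r (\<lambda>ys. insert1 n \<alpha> F (a # ys)) as - ?s (merge r (insertion n \<alpha> ?Fa) as)"
      by (subst merge_Cons) (simp add: iF merge_add merge_signed)
    \<comment> \<open>Multiplying \<open>a\<close> into the next entry commutes with insertion at
      every position but the front one. There \<open>a\<close> is absorbed either by the entry after
      it, before \<alpha> is inserted, or by the value of \<alpha>.\<close>
    have J: "merge1 r (insertion n \<alpha> F) a as - insertion n \<alpha> (merge1 r F a) as
        = merge1 r (insert1 n \<alpha> F) a as - F ((a * \<alpha> (take n as)) # drop n as)"
      using n by (cases as) (simp_all add: insert1_def)
    have K: "merge r (insert1 n \<alpha> F) (a # as) = merge1 r (insert1 n \<alpha> F) a as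
        - merge r (\<lambda>ys. insert1 n \<alpha> F (a # ys)) as"
      by (rule merge_Cons)
    have M: "merge r (insert1 n \<alpha> F) (a # as) = F (merge (*) \<alpha> (take (Suc n) (a # as)) # drop (Suc n) (a # as))
        - signed (int n) (merge r F (\<alpha> (take n (a # as)) # drop n (a # as)))"
      by (rule merge_insert1 [OF Cons.prems(1) k])
    have B: "insert1 (Suc n) (hb (*) (*) \<alpha>) F (a # as) = F ((a * \<alpha> (take n as)) # drop n as)
        - F (merge (*) \<alpha> (take (Suc n) (a # as)) # drop (Suc n) (a # as))"
      using n by (simp add: insert1_def hb_Cons slotwise_add_first_diff [OF Cons.prems(1)])
    \<comment> \<open>The head adds one entry in front of the final block, hence the factor
      (-1)^n.\<close>
    have C: "signed (int (length (a # as) - n) * int n)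
        (r (F (take (length (a # as) - n) (a # as))) (\<alpha> (drop (length (a # as) - n) (a # as))))
      = signed (int n) ?cup"
    proof -
      have 1: "length (a # as) - n = Suc (length as - n)" using n by simp
      have "int (Suc (length as - n)) * int n = int n + int (length as - n) * int n"
        by (simp add: algebra_simps)
      then show ?thesis unfolding 1 by (simp add: signed_signed)
    qed
    have B': "insertion (Suc n) (hb (*) (*) \<alpha>) F (a # as) = insert1 (Suc n) (hb (*) (*) \<alpha>) F (a # as)
        + signed (int n) (insertion (Suc n) (hb (*) (*) \<alpha>) ?Fa as)" by simp
    from J have J': "insertion n \<alpha> (merge1 r F a) as = merge1 r (insertion n \<alpha> F) a as
        - merge1 r (insert1 n \<alpha> F) a as + F ((a * \<alpha> (take n as)) # drop n as)"
      by (simp add: algebra_simps)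
    show ?thesis
      unfolding L C R J' IH B' B
      using M K by (cases "even n") (auto simp: signed_def algebra_simps)
  qed
qed

text \<open>Of the left actions, the one with the block at the front gives the new term with
  \<open>l\<close>; those at the other positions assemble to the left action in the coboundary of
  the insertion. For a cocycle \<alpha> the formula says that insertion of \<alpha> is, up to sign,
  a homotopy between the left and the right cup product with \<alpha>.\<close>

lemma insertion_hb:
  assumes F: "slotwise_add F" and n: "n \<le> length xs"
  shows "signed (int n) (hb l r (insertion n \<alpha> F) xs) + insertion n \<alpha> (hb l r F) xs =
    l (\<alpha> (take n xs)) (F (drop n xs))
    - signed (int (length xs - n) * int n)
        (r (F (take (length xs - n) xs)) (\<alpha> (drop (length xs - n) xs)))
    + signed (int n) (insertion (Suc n) (hb (*) (*) \<alpha>) F xs)"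
proof -
  let ?L = "\<lambda>xs. case xs of [] \<Rightarrow> 0 | a # as \<Rightarrow> l a (F as)"
  have "hb l r F = (\<lambda>xs. ?L xs - merge r F xs)"
    by (auto simp: fun_eq_iff hb_def split: list.split)
  then have "insertion n \<alpha> (hb l r F) xs = insertion n \<alpha> ?L xs - insertion n \<alpha> (merge r F) xs"
    by (simp add: insertion_diff)
  moreover have "insertion n \<alpha> ?L xs = l (\<alpha> (take n xs)) (F (drop n xs))
      + signed (int n - 1) (case xs of [] \<Rightarrow> 0 | a # as \<Rightarrow> l a (insertion n \<alpha> F as))"
    using n by (cases xs) (simp_all add: insert1_def insertion_hom [OF additive_l])
  moreover have "hb l r (insertion n \<alpha> F) xs = (case xs of [] \<Rightarrow> 0 | a # as \<Rightarrow> l a (insertion n \<alpha> F as))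
      - merge r (insertion n \<alpha> F) xs"
    by (simp add: hb_def split: list.split)
  ultimately show ?thesis
    unfolding insertion_merge [OF F n] by (cases "even n") (auto simp: signed_def)
qed

end

lemma insertion_sum:
  fixes F :: "'a list \<Rightarrow> 'v::ab_group_add"
  shows "insertion m \<beta> F as = (\<Sum>i<Suc (length as) - m.
     signed ((int m - 1) * int i) (F (take i as @ \<beta> (take m (drop i as)) # drop (i + m) as)))"
proof (induction as arbitrary: F)
  case Nil
  show ?case
  proof (cases "m = 0")
    case False
    then show ?thesis by (cases m) (simp_all add: insert1_def)
  qed (simp add: insert1_def)
next
  case (Cons a as)
  show ?case
  proof (cases "m \<le> Suc (length as)")
    case True
    have 1: "Suc (length (a # as)) - m = Suc (Suc (length as) - m)" using True by simp
    have 2: "signed (int m - 1) (insertion m \<beta> (\<lambda>ys. F (a # ys)) as) =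
      (\<Sum>i<Suc (length as) - m. signed ((int m - 1) * int (Suc i))
        (F (take (Suc i) (a # as) @ \<beta> (take m (drop (Suc i) (a # as))) # drop (Suc i + m) (a # as))))"
    proof -
      have add: "additive (signed (int m - 1) :: 'v \<Rightarrow> 'v)" by (simp add: additive_def signed_add)
      have "(int m - 1) + (int m - 1) * int i = (int m - 1) * int (Suc i)" for i
        by (simp add: algebra_simps)
      then show ?thesis by (simp add: Cons.IH additive.sum [OF add] signed_signed)
    qed
    show ?thesis unfolding 1 sum.lessThan_Suc_shift insertion.simps 2
      using True by (simp add: insert1_def)
  next
    case False
    then have "Suc (length (a # as)) - m = 0" by simp
    then show ?thesis using False by (simp only: lessThan_0 sum.empty) (simp add: insertion_short insert1_def)
  qed
qed

text \<open>The length condition makes the number of available positions equal to \<open>n\<close>,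
  the range of the sum in \<open>circ\<close>.\<close>

lemma circ_eq_insertion:
  assumes "length as + 1 = n + m"
  shows "circ n m \<alpha> \<beta> as = insertion m \<beta> \<alpha> as"
proof -
  have "Suc (length as) - m = n" using assms by simp
  then show ?thesis
    using sum.atLeast1_atMost_eq [of "\<lambda>i. signed ((int m - 1) * (int i - 1)) (circ_i m i \<alpha> \<beta> as)" n]
    unfolding insertion_sum circ_def by (simp add: circ_i_def)
qed

section \<open>Products of cochains\<close>

text \<open>The sum over all splittings of the list into a prefix for \<open>F\<close> and a suffix
  for \<open>G\<close>. The index handed to \<open>t\<close> grows with the prefix because a tensor
  generator records the degree of its left factor.\<close>

primrec cup :: "(int \<Rightarrow> 'u \<Rightarrow> 'v \<Rightarrow> 'w::ab_group_add) \<Rightarrow> int \<Rightarrow> ('a list \<Rightarrow> 'u) \<Rightarrow> ('a list \<Rightarrow> 'v) \<Rightarrow> 'a list \<Rightarrow> 'w" where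
  "cup t i F G [] = t i (F []) (G [])"
| "cup t i F G (a # as) = t i (F []) (G (a # as)) + cup t (i + 1) (\<lambda>ys. F (a # ys)) G as"

locale bimod_tensor = U: bimod_act lU rU + V: bimod_act lV rV + W: bimod_act lW rW
  for lU :: "'a::{ring,monoid_mult} \<Rightarrow> 'u::ab_group_add \<Rightarrow> 'u" and rU
    and lV :: "'a \<Rightarrow> 'v::ab_group_add \<Rightarrow> 'v" and rV
    and lW :: "'a \<Rightarrow> 'w::ab_group_add \<Rightarrow> 'w" and rW +
  fixes t :: "int \<Rightarrow> 'u \<Rightarrow> 'v \<Rightarrow> 'w"
  assumes t_add_left: "t i (x + x') y = t i x y + t i x' y"
    and t_add_right: "t i x (y + y') = t i x y + t i x y'"
    and t_balanced: "t i (rU x a) y = t i x (lV a y)"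
    and t_l: "t i (lU a x) y = lW a (t i x y)"
    and t_r: "t i x (rV y a) = rW (t i x y) a"
begin

lemma additive_t_left: "additive (\<lambda>x. t i x y)" by (simp add: additive_def t_add_left)
lemma additive_t_right: "additive (t i x)" by (simp add: additive_def t_add_right)
lemmas t_minus_left = additive.minus [OF additive_t_left]
  and t_diff_left = additive.diff [OF additive_t_left]
  and t_diff_right = additive.diff [OF additive_t_right]
  and t_0_left [simp] = additive.zero [OF additive_t_left]
  and t_0_right [simp] = additive.zero [OF additive_t_right]

lemma cup_diff_left: "cup t i (\<lambda>ys. F ys - F' ys) G as = cup t i F G as - cup t i F' G as"
  by (induction as arbitrary: i F F') (simp_all add: t_diff_left)

lemma cup_minus_left: "cup t i (\<lambda>ys. - F ys) G as = - cup t i F G as"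
  by (induction as arbitrary: i F) (simp_all add: t_minus_left)

lemma cup_l: "cup t i (\<lambda>ys. lU a (F ys)) G as = lW a (cup t i F G as)"
  by (induction as arbitrary: i F) (simp_all add: t_l W.l_add)

text \<open>A product of two neighbours lies within the prefix or within the suffix. For each
  splitting the right side contains in addition an entry acting on \<open>F\<close> from the right
  and the same entry acting on \<open>G\<close> from the left; these agree by
  \<open>t_balanced\<close> and have opposite signs. Therefore \<open>merge\<close> for
  \<open>F\<close> is accompanied by the full \<open>hb\<close> for \<open>G\<close>. The index
  \<open>i - 1\<close> accounts for the entry that a face of the prefix removes.\<close>

lemma merge_cup:
  "merge rW (cup t i F G) xs = cup t (i - 1) (merge rU F) G xs
     - cup t i (\<lambda>ys. signed (int (length ys)) (F ys)) (hb lV rV G) xs"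
proof (induction xs arbitrary: i F)
  case Nil
  then show ?case by simp
next
  case (Cons a as)
  let ?Fa = "\<lambda>ys. F (a # ys)" and ?sg = "\<lambda>F ys. signed (int (length ys)) (F ys)"
  have 1: "cup t i F G (a # ys) = t i (F []) (G (a # ys)) + cup t (i + 1) ?Fa G ys" for ys
    by simp
  have 2: "merge rW (\<lambda>ys. t i (F []) (G (a # ys))) as = t i (F []) (merge rV (\<lambda>ys. G (a # ys)) as)"
    using merge_hom [OF additive_t_right, of i "F []" rV "\<lambda>ys. G (a # ys)" rW as] by (simp add: t_r)
  have L: "merge rW (cup t i F G) (a # as) = merge1 rW (cup t i F G) a as
      - t i (F []) (merge rV (\<lambda>ys. G (a # ys)) as) - cup t i (merge rU ?Fa) G as
      + cup t (i + 1) (?sg ?Fa) (hb lV rV G) as"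
    by (subst merge_Cons) (simp add: W.merge_add 2 Cons.IH)
  have 3: "(\<lambda>ys. merge rU F (a # ys)) = (\<lambda>ys. merge1 rU F a ys - merge rU ?Fa ys)"
    by (simp add: fun_eq_iff merge_Cons)
  have R1: "cup t (i - 1) (merge rU F) G (a # as) = cup t i (merge1 rU F a) G as - cup t i (merge rU ?Fa) G as"
    by (simp add: 3 cup_diff_left)
  have 4: "(\<lambda>ys. ?sg F (a # ys)) = (\<lambda>ys. - ?sg ?Fa ys)"
    by (simp add: fun_eq_iff signed_def)
  have R2: "cup t i (?sg F) (hb lV rV G) (a # as) =
      t i (F []) (hb lV rV G (a # as)) - cup t (i + 1) (?sg ?Fa) (hb lV rV G) as"
    unfolding cup.simps 4 by (simp add: cup_minus_left)
  have H: "hb lV rV G (a # as) = lV a (G as) - merge1 rV G a as + merge rV (\<lambda>ys. G (a # ys)) as"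
    by (simp add: hb_Cons merge_Cons)
  have J: "merge1 rW (cup t i F G) a as = cup t i (merge1 rU F a) G as - t i (F []) (lV a (G as))
      + t i (F []) (merge1 rV G a as)"
    by (cases as) (simp_all add: t_balanced t_r)
  show ?case unfolding L R1 R2 H J by (simp add: t_diff_right t_add_right algebra_simps)
qed

lemma hb_cup:
  "hb lW rW (cup t i F G) xs = cup t (i - 1) (hb lU rU F) G xs
     + cup t i (\<lambda>ys. signed (int (length ys)) (F ys)) (hb lV rV G) xs"
proof (cases xs)
  case (Cons a as)
  have 1: "(\<lambda>ys. hb lU rU F (a # ys)) = (\<lambda>ys. lU a (F ys) - merge rU F (a # ys))"
    by (simp add: fun_eq_iff hb_Cons)
  have "cup t (i - 1) (hb lU rU F) G xs = lW a (cup t i F G as) - cup t (i - 1) (merge rU F) G xs"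
    by (simp add: Cons 1 cup_diff_left cup_l)
  then show ?thesis using merge_cup [of i F G xs] by (simp add: Cons hb_Cons)
qed simp

end

text \<open>For \<open>i = 0\<close> this has the shape of \<open>hb_cup\<close>, with
  \<open>d\<close> in place of the coboundaries. Hence the cup product of two solutions of d F = hb
  F is again a solution.\<close>

lemma cup_hom:
  fixes F :: "'a list \<Rightarrow> 'u::ab_group_add"
  assumes "additive h"
    and "\<And>i x y. h (t i x y) = t' (i - 1) (d x) y + signed i (t' i x (d y))"
    and "\<And>i x y k. t' i (signed k x) y = signed k (t' i x y)"
  shows "h (cup t i F G as) = cup t' (i - 1) (\<lambda>ys. d (F ys)) G as
     + signed i (cup t' i (\<lambda>ys. signed (int (length ys)) (F ys)) (\<lambda>ys. d (G ys)) as)"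
proof (induction as arbitrary: i F)
  case Nil
  show ?case by (simp add: assms(2))
next
  case (Cons a as)
  have 0: "cup t' i (\<lambda>ys. signed k (H ys)) K as = signed k (cup t' i H K as)" for i k H K and as :: "'a list"
    by (induction as arbitrary: i H) (simp_all add: assms(3) signed_add)
  have "(\<lambda>ys. signed (1 + int (length ys)) (F (a # ys)))
      = (\<lambda>ys. signed 1 (signed (int (length ys)) (F (a # ys))))"
    by (simp add: signed_signed)
  then have 1: "cup t' i (\<lambda>ys. signed (1 + int (length ys)) (F (a # ys))) K as
    = signed 1 (cup t' i (\<lambda>ys. signed (int (length ys)) (F (a # ys))) K as)" for i K
    by (simp only: 0)
  then show ?case
    by (simp add: additive.add [OF assms(1)] assms(2) Cons.IH 1 signed_add signed_signed)
qed

text \<open>Made for f \<otimes> 1 and 1 \<otimes> f, which see one tensor degree only, so that a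
  single splitting survives.\<close>

lemma cup_eval:
  assumes "additive h" "\<And>j x y. h (t j x y) = (if j = c then k x y else 0)"
  shows "h (cup t i F G as) = (if i \<le> c \<and> c \<le> i + int (length as)
    then k (F (take (nat (c - i)) as)) (G (drop (nat (c - i)) as)) else 0)"
proof (induction as arbitrary: i F)
  case (Cons a as)
  consider "c < i" | "c = i" | "i < c" by linarith
  then show ?case
  proof cases
    case 3
    then have "nat (c - i) = Suc (nat (c - (i + 1)))" by simp
    then show ?thesis using 3 by (auto simp: additive.add [OF assms(1)] assms(2) Cons.IH)
  qed (auto simp: additive.add [OF assms(1)] assms(2) Cons.IH)
qed (auto simp: assms(2))

section \<open>Multilinear cochains\<close>

definition linear1 :: "('k \<Rightarrow> 'a \<Rightarrow> 'a) \<Rightarrow> ('k \<Rightarrow> 'v \<Rightarrow> 'v) \<Rightarrow> ('a::plus list \<Rightarrow> 'v::plus) \<Rightarrow> bool" where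
  "linear1 scale sc F \<longleftrightarrow> (\<forall>a b ys. F ((a + b) # ys) = F (a # ys) + F (b # ys)) \<and>
     (\<forall>c a ys. F (scale c a # ys) = sc c (F (a # ys)))"

text \<open>Every slot is reached as the first one after a prefix, so proofs can go by recursion on
  the prefix. The length is not fixed: one function stands for cochains of all degrees at
  once.\<close>

definition multilinear :: "('k \<Rightarrow> 'a \<Rightarrow> 'a) \<Rightarrow> ('k \<Rightarrow> 'v \<Rightarrow> 'v) \<Rightarrow> ('a::plus list \<Rightarrow> 'v::plus) \<Rightarrow> bool" where
  "multilinear scale sc F \<longleftrightarrow> (\<forall>xs. linear1 scale sc (\<lambda>ys. F (xs @ ys)))"

lemma multilinear_linear1: "multilinear scale sc F \<Longrightarrow> linear1 scale sc F"
  unfolding multilinear_def by (drule spec [of _ "[]"]) simp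

lemma multilinear_Cons: "multilinear scale sc F \<Longrightarrow> multilinear scale sc (\<lambda>ys. F (a # ys))"
  unfolding multilinear_def by (rule allI, drule_tac x = "a # xs" in spec) simp

lemma multilinearI:
  "linear1 scale sc F \<Longrightarrow> (\<And>a. multilinear scale sc (\<lambda>ys. F (a # ys))) \<Longrightarrow> multilinear scale sc F"
  unfolding multilinear_def by (rule allI, case_tac xs) simp_all

lemma multilinear_slotwise: "multilinear scale sc F \<Longrightarrow> slotwise_add F"
  by (auto simp: multilinear_def linear1_def slotwise_add_def)

lemma multilinear_iff: "multilinear scale sc F \<longleftrightarrow> slotwise_add F \<and>
    (\<forall>xs c a ys. F (xs @ scale c a # ys) = sc c (F (xs @ a # ys)))"
  by (auto simp: multilinear_def linear1_def slotwise_add_def)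

lemma multilinear_hom:
  assumes "multilinear scale sc F" "additive h" "\<And>c xs. h (sc c (F xs)) = sc' c (h (F xs))"
  shows "multilinear scale sc' (\<lambda>xs. h (F xs))"
  using assms by (auto simp: multilinear_iff slotwise_add_def additive.add)

lemma multilinear_add:
  fixes F :: "_ \<Rightarrow> 'v::ab_group_add"
  assumes "multilinear scale sc F" "multilinear scale sc G" "\<And>c. additive (sc c)"
  shows "multilinear scale sc (\<lambda>xs. F xs + G xs)"
  using assms by (auto simp: multilinear_iff slotwise_add_def additive.add)

lemma multilinear_diff:
  fixes F :: "_ \<Rightarrow> 'v::ab_group_add"
  assumes "multilinear scale sc F" "multilinear scale sc G" "\<And>c. additive (sc c)"
  shows "multilinear scale sc (\<lambda>xs. F xs - G xs)"
  using assms by (auto simp: multilinear_iff slotwise_add_def additive.diff)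

lemma multilinear_by_length:
  assumes "\<And>n. multilinear scale sc (Y n)"
  shows "multilinear scale sc (\<lambda>xs. Y (length xs) xs)"
  using assms by (simp add: multilinear_iff slotwise_add_def)

lemma multilinear_restrict:
  fixes F :: "_ \<Rightarrow> 'v::ab_group_add"
  assumes "multilinear scale sc F" "\<And>c. additive (sc c)"
  shows "multilinear scale sc (\<lambda>xs. if length xs = n then F xs else 0)"
  using assms by (auto simp: multilinear_iff slotwise_add_def additive.zero)

text \<open>The last entry leaves the list through the right action, so its scalar has to be
  recognised as \<open>sc c\<close>. The condition \<open>rF\<close> asks this at values of
  \<open>F\<close>, which in the applications are homogeneous and thus central over k.\<close>

lemma multilinear_merge:
  fixes F :: "'a::{ring,monoid_mult} list \<Rightarrow> 'v::ab_group_add"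
  assumes "multilinear scale sc F"
    and alg: "\<And>c a b. scale c (a * b) = scale c a * b" "\<And>c a b. scale c (a * b) = a * scale c b"
    and sc: "\<And>c. additive (sc c)"
    and r: "\<And>a. additive (\<lambda>x. r x a)" "\<And>x. additive (r x)" "\<And>c x a. r (sc c x) a = sc c (r x a)"
    and rF: "\<And>c ys a. r (F ys) (scale c a) = sc c (r (F ys) a)"
  shows "multilinear scale sc (merge r F)"
proof -
  have add: "merge r (\<lambda>ys. G ys + H ys) ys = merge r G ys + merge r H ys" for G H :: "'a list \<Rightarrow> 'v" and ys
    by (induction ys arbitrary: G H rule: induct_list012) (simp_all add: additive.add [OF r(1)])
  have hom: "merge r (\<lambda>ys. sc c (G ys)) ys = sc c (merge r G ys)" for G c ys
    using merge_hom [OF sc, where F=G and r=r and r'=r] r(3) by simp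
  have lin: "linear1 scale sc (merge r F)" if F: "multilinear scale sc F"
     "\<And>c ys a. r (F ys) (scale c a) = sc c (r (F ys) a)" for F
  proof -
    have m: "F (scale c a # ys) = sc c (F (a # ys))" "F ((a + b) # ys) = F (a # ys) + F (b # ys)" for a b c ys
      using multilinear_linear1 [OF F(1)] by (simp_all add: linear1_def)
    have "merge r F ((a + b) # ys) = merge r F (a # ys) + merge r F (b # ys)" for a b ys
      by (cases ys) (simp_all add: m add distrib_right additive.add [OF r(2)])
    moreover have "merge r F (scale c a # ys) = sc c (merge r F (a # ys))" for c a ys
      by (cases ys) (simp_all add: m hom F(2) additive.diff [OF sc] flip: alg(1))
    ultimately show ?thesis by (simp add: linear1_def)
  qed
  have "linear1 scale sc (\<lambda>ys. merge r F (xs @ ys))" if F: "multilinear scale sc F"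
     "\<And>c ys a. r (F ys) (scale c a) = sc c (r (F ys) a)" for xs F
    using F
  proof (induction xs arbitrary: F)
    case Nil
    then show ?case using lin by simp
  next
    case (Cons a as)
    have IH: "linear1 scale sc (\<lambda>ys. merge r (\<lambda>zs. F (a # zs)) (as @ ys))"
      by (rule Cons.IH [OF multilinear_Cons [OF Cons.prems(1)]]) (rule Cons.prems(2))
    have "linear1 scale sc (\<lambda>ys. merge1 r F a (as @ ys))"
    proof (cases as)
      case Nil
      then show ?thesis using multilinear_linear1 [OF Cons.prems(1)]
        by (simp add: linear1_def distrib_left flip: alg(2))
    next
      case (Cons c cs)
      have "linear1 scale sc (\<lambda>ys. F (((a * c) # cs) @ ys))"
        using \<open>multilinear scale sc F\<close> unfolding multilinear_def by blast
      then show ?thesis by (simp add: Cons)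
    qed
    with IH show ?case by (simp add: merge_Cons linear1_def additive.diff [OF sc])
  qed
  with assms(1) rF show ?thesis by (simp add: multilinear_def)
qed

lemma multilinear_hb:
  fixes F :: "'a::{ring,monoid_mult} list \<Rightarrow> 'v::ab_group_add"
  assumes "multilinear scale sc F"
    and alg: "\<And>c a b. scale c (a * b) = scale c a * b" "\<And>c a b. scale c (a * b) = a * scale c b"
    and sc: "\<And>c. additive (sc c)"
    and r: "\<And>a. additive (\<lambda>x. r x a)" "\<And>x. additive (r x)" "\<And>c x a. r (sc c x) a = sc c (r x a)"
    and rF: "\<And>c ys a. r (F ys) (scale c a) = sc c (r (F ys) a)"
    and l: "\<And>a. additive (l a)" "\<And>x. additive (\<lambda>a. l a x)" "\<And>c x a. l a (sc c x) = sc c (l a x)"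
      "\<And>c x a. l (scale c a) x = sc c (l a x)"
  shows "multilinear scale sc (hb l r F)"
proof -
  let ?L = "\<lambda>xs. case xs of [] \<Rightarrow> 0 | a # as \<Rightarrow> l a (F as)"
  have "multilinear scale sc ?L"
  proof (rule multilinearI)
    show "linear1 scale sc ?L" by (simp add: linear1_def additive.add [OF l(2)] l(4))
    show "multilinear scale sc (\<lambda>ys. ?L (a # ys))" for a
      using multilinear_hom [OF assms(1) l(1), of a sc] by (simp add: l(3))
  qed
  moreover have "hb l r F = (\<lambda>xs. ?L xs - merge r F xs)"
    by (auto simp: fun_eq_iff hb_def split: list.split)
  moreover have "multilinear scale sc (merge r F)"
    by (rule multilinear_merge [OF assms(1) alg sc r rF])
  ultimately show ?thesis
    using multilinear_diff [of scale sc ?L "merge r F"] sc by simp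
qed

lemma (in k_algebra) scale_one_left: "scale c 1 * a = scale c a"
  and scale_one_right: "a * scale c 1 = scale c a"
  using scale_mult_left [of c 1 a] scale_mult_right [of c a 1] by simp_all

lemma additive_sgn: "additive (signed k :: 'v::ab_group_add \<Rightarrow> 'v)"
  by (simp add: additive_def signed_add)

lemma multilinear_insert1:
  assumes F: "multilinear scale sc F" and \<alpha>: "multilinear scale scale \<alpha>" and 0: "\<And>c. sc c 0 = (0::'v::ab_group_add)"
  shows "multilinear scale sc (insert1 n \<alpha> F)"
proof -
  have "linear1 scale sc (\<lambda>ys. insert1 n \<alpha> F (xs @ ys))" for xs
  proof (cases "length xs < n")
    case True
    have "insert1 n \<alpha> F (xs @ (a + b) # ys) = insert1 n \<alpha> F (xs @ a # ys) + insert1 n \<alpha> F (xs @ b # ys)" for a b ys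
      using multilinear_slotwise [OF \<alpha>] multilinear_slotwise [OF F] True
      by (simp add: insert1_def slotwise_add_def slotwise_add_first take_Cons' drop_Cons' multilinear_slotwise)
    moreover have "insert1 n \<alpha> F (xs @ scale c a # ys) = sc c (insert1 n \<alpha> F (xs @ a # ys))" for c a ys
      using \<alpha> multilinear_linear1 [OF F] True
      by (simp add: insert1_def take_Cons' drop_Cons' multilinear_iff linear1_def 0)
    ultimately show ?thesis by (simp add: linear1_def)
  next
    case False
    then have 1: "insert1 n \<alpha> F (xs @ ys) = F ((\<alpha> (take n xs) # drop n xs) @ ys)" for ys
      by (simp add: insert1_def)
    show ?thesis unfolding 1 using F unfolding multilinear_def by blast
  qed
  then show ?thesis by (simp add: multilinear_def)
qed

lemma multilinear_insertion:
  assumes "multilinear scale sc F" and \<alpha>: "multilinear scale scale \<alpha>"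
    and sc: "\<And>c. additive (sc c :: 'v::ab_group_add \<Rightarrow> 'v)"
  shows "multilinear scale sc (insertion n \<alpha> F)"
proof -
  have lin: "linear1 scale sc (insertion n \<alpha> F)" if F: "multilinear scale sc F" for F
  proof -
    note i = multilinear_linear1 [OF multilinear_insert1 [OF F \<alpha> additive.zero [OF sc], where n = n], unfolded linear1_def]
    have 1: "(\<lambda>ys. F ((a + b) # ys)) = (\<lambda>ys. F (a # ys) + F (b # ys))"
      "(\<lambda>ys. F (scale c a # ys)) = (\<lambda>ys. sc c (F (a # ys)))" for a b c
      using multilinear_linear1 [OF F] by (simp_all add: linear1_def)
    show ?thesis
      by (simp add: linear1_def i 1 insertion_add signed_add additive.add [OF sc] additive_signed [OF sc]
          flip: insertion_hom [OF sc])
  qed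
  have "linear1 scale sc (\<lambda>ys. insertion n \<alpha> F (xs @ ys))" if "multilinear scale sc F" for xs F
    using that
  proof (induction xs arbitrary: F)
    case Nil
    then show ?case using lin by simp
  next
    case (Cons a as)
    have "linear1 scale sc (\<lambda>ys. insert1 n \<alpha> F ((a # as) @ ys))"
      using multilinear_insert1 [OF Cons.prems \<alpha> additive.zero [OF sc]] unfolding multilinear_def by blast
    with Cons.IH [OF multilinear_Cons [OF Cons.prems], of a] show ?case
      by (simp add: linear1_def signed_add additive.add [OF sc] additive_signed [OF sc])
  qed
  with assms(1) show ?thesis by (simp add: multilinear_def)
qed

lemma multilinear_cup:
  fixes F :: "'a::plus list \<Rightarrow> 'u::ab_group_add" and G :: "'a list \<Rightarrow> 'v::ab_group_add"
  assumes "multilinear scale scU F" "multilinear scale scV G"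
    and t: "\<And>i y. additive (\<lambda>x. t i x y)" "\<And>i x. additive (t i x)"
    and sc: "\<And>c. additive (sc c :: 'w::ab_group_add \<Rightarrow> 'w)" "\<And>c i x y. t i (scU c x) y = sc c (t i x y)"
    and sG: "\<And>c i xs y. t i (F xs) (scV c y) = sc c (t i (F xs) y)"
  shows "multilinear scale sc (cup t i F G)"
proof -
  have add: "cup t i (\<lambda>ys. F ys + F' ys) G as = cup t i F G as + cup t i F' G as" for i F F' as
    by (induction as arbitrary: i F F') (simp_all add: additive.add [OF t(1)])
  have hom: "cup t i (\<lambda>ys. scU c (F ys)) G as = sc c (cup t i F G as)" for i F c as
    by (induction as arbitrary: i F) (simp_all add: sc(2) additive.add [OF sc(1)])
  have "linear1 scale sc (\<lambda>ys. cup t i F G (xs @ ys))"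
    if "multilinear scale scU F" "\<And>c i xs y. t i (F xs) (scV c y) = sc c (t i (F xs) y)" for xs i F
    using that
  proof (induction xs arbitrary: i F)
    case Nil
    have 1: "(\<lambda>ys. F ((a + b) # ys)) = (\<lambda>ys. F (a # ys) + F (b # ys))"
      "(\<lambda>ys. F (scale c a # ys)) = (\<lambda>ys. scU c (F (a # ys)))" for a b c
      using multilinear_linear1 [OF Nil(1)] by (simp_all add: linear1_def)
    have 2: "G ((a + b) # ys) = G (a # ys) + G (b # ys)" "G (scale c a # ys) = scV c (G (a # ys))" for a b c ys
      using multilinear_linear1 [OF assms(2)] by (simp_all add: linear1_def)
    show ?case by (simp add: linear1_def 1 2 add hom additive.add [OF t(2)] Nil(2) additive.add [OF sc(1)])
  next
    case (Cons a as)
    have "linear1 scale sc (\<lambda>ys. cup t (i + 1) (\<lambda>ys. F (a # ys)) G (as @ ys))"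
      by (rule Cons.IH [OF multilinear_Cons [OF Cons.prems(1)]]) (rule Cons.prems(2))
    moreover have "linear1 scale scV (\<lambda>ys. G ((a # as) @ ys))"
      using assms(2) unfolding multilinear_def by blast
    ultimately show ?case
      by (simp add: linear1_def additive.add [OF t(2)] Cons.prems(2) additive.add [OF sc(1)])
  qed
  with assms(1) sG show ?thesis by (simp add: multilinear_def)
qed

lemma insertion_zero_inner:
  fixes F :: "'a::monoid_add list \<Rightarrow> 'v::ab_group_add"
  assumes "slotwise_add F" "\<And>ys. length ys = n \<Longrightarrow> \<alpha> ys = 0"
  shows "insertion n \<alpha> F xs = 0"
proof -
  have 0: "slotwise_add F \<Longrightarrow> F (0 # ys) = 0" for F :: "'a list \<Rightarrow> 'v" and ys
    using slotwise_add_first [of F 0 0 ys] by simp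
  have "insertion n (\<lambda>_. 0) F xs = 0"
    using assms(1) by (induction xs arbitrary: F) (simp_all add: insert1_def 0 slotwise_add_Cons)
  moreover have "insertion n \<alpha> F xs = insertion n (\<lambda>_. 0) F xs"
    by (rule insertion_cong) (simp_all add: assms(2))
  ultimately show ?thesis by simp
qed

section \<open>The bracket of a coboundary and a cocycle\<close>

lemma gerstenhaber_eq_insertion:
  assumes "length xs + 1 = n + m"
  shows "gerstenhaber n m \<alpha> \<beta> xs = insertion m \<beta> \<alpha> xs
     - signed ((int n - 1) * (int m - 1)) (insertion n \<alpha> \<beta> xs)"
  using assms by (simp add: gerstenhaber_def circ_eq_insertion add.commute)

context k_algebra
begin

lemma additive_scale: "additive (scale c)" by (simp add: additive_def scale_right_distrib)

lemma multilinear_insertion_alg: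
  "multilinear scale scale F \<Longrightarrow> multilinear scale scale \<alpha> \<Longrightarrow> multilinear scale scale (insertion n \<alpha> F)"
  by (rule multilinear_insertion) (auto simp: additive_scale)

lemma multilinear_signed: "multilinear scale scale F \<Longrightarrow> multilinear scale scale (\<lambda>xs. signed k (F xs))"
  by (rule multilinear_hom [where h = "signed k"]) (simp_all add: additive_sgn additive_signed [OF additive_scale])

lemma multilinear_gerstenhaber:
  assumes "multilinear scale scale \<alpha>" "multilinear scale scale \<beta>"
  shows "multilinear scale scale (\<lambda>xs. insertion m \<beta> \<alpha> xs - signed ((int n - 1) * (int m - 1)) (insertion n \<alpha> \<beta> xs))"
  using assms by (auto intro!: multilinear_diff multilinear_signed multilinear_insertion_alg additive_scale)

text \<open>Two instances of \<open>insertion_hb\<close>, one with \<beta> inserted into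
  \<open>h\<close> and one with \<open>h\<close> inserted into \<beta>. The cocycle condition
  removes the terms with the coboundary of \<beta>, and the cup products of both instances
  cancel.\<close>

lemma bracket_coboundary_left:
  assumes h: "multilinear scale scale h" and \<beta>: "multilinear scale scale \<beta>"
    and cocycle: "\<And>xs. length xs = Suc m \<Longrightarrow> hb (*) (*) \<beta> xs = 0"
  obtains \<eta> where "multilinear scale scale \<eta>"
    "\<And>xs. length xs = k + m \<Longrightarrow> gerstenhaber (Suc k) m (hb (*) (*) h) \<beta> xs = hb (*) (*) \<eta> xs"
proof
  interpret A: bimod_act "(*)" "(*) :: 'a \<Rightarrow> 'a \<Rightarrow> 'a" by (rule bimod_act_mult)
  \<comment> \<open>Up to the sign (-1)^(m-1) this is the bracket of \<open>h\<close>, in degree k,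
    with \<beta>: the coboundary is a derivation of the bracket and kills \<beta>.\<close>
  let ?\<eta> = "\<lambda>xs. signed (int m - 1) (insertion m \<beta> h xs) - signed (int k * (int m - 1)) (insertion k h \<beta> xs)"
  show "multilinear scale scale ?\<eta>"
    using assms by (auto intro!: multilinear_diff multilinear_signed multilinear_insertion_alg additive_scale)
  fix xs :: "'a list" assume len: "length xs = k + m"
  have 1: "insertion (Suc m) (hb (*) (*) \<beta>) h xs = 0"
    by (rule insertion_zero_inner [OF multilinear_slotwise [OF h] cocycle])
  have "insertion k h (hb (*) (*) \<beta>) xs = insertion k h (\<lambda>_. 0) xs"
    using len by (intro insertion_cong) (auto intro: cocycle)
  also have "\<dots> = 0" using insertion_diff [of k h "\<lambda>_. 0" "\<lambda>_. 0" xs] by simp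
  finally have 2: "insertion k h (hb (*) (*) \<beta>) xs = 0" .
  have e: "int (k + m - m) * int m = int k * int m" "int (k + m - k) * int k = int k * int m" by simp_all
  note A1 = A.insertion_hb [OF multilinear_slotwise [OF h], of m xs \<beta>, unfolded len 1 e]
  note A2 = A.insertion_hb [OF multilinear_slotwise [OF \<beta>], of k xs h, unfolded len 2 e]
  have B1: "insertion m \<beta> (hb (*) (*) h) xs = \<beta> (take m xs) * h (drop m xs)
      - signed (int k * int m) (h (take k xs) * \<beta> (drop k xs)) - signed (int m) (hb (*) (*) (insertion m \<beta> h) xs)"
    using A1 by (simp add: eq_diff_eq add.commute)
  have "signed (int k) (insertion (Suc k) (hb (*) (*) h) \<beta> xs) = signed (int k) (hb (*) (*) (insertion k h \<beta>) xs)
      - h (take k xs) * \<beta> (drop k xs) + signed (int k * int m) (\<beta> (take m xs) * h (drop m xs))"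
    using A2 by (simp add: algebra_simps)
  then have "signed (int k) (signed (int k) (insertion (Suc k) (hb (*) (*) h) \<beta> xs)) = signed (int k) (signed (int k) (hb (*) (*) (insertion k h \<beta>) xs)
      - h (take k xs) * \<beta> (drop k xs) + signed (int k * int m) (\<beta> (take m xs) * h (drop m xs)))"
    by simp
  then have B2: "insertion (Suc k) (hb (*) (*) h) \<beta> xs = hb (*) (*) (insertion k h \<beta>) xs
      - signed (int k) (h (take k xs) * \<beta> (drop k xs))
      + signed (int k + int k * int m) (\<beta> (take m xs) * h (drop m xs))"
    by (simp add: signed_add signed_diff signed_signed) (simp add: signed_def)
  show "gerstenhaber (Suc k) m (hb (*) (*) h) \<beta> xs = hb (*) (*) ?\<eta> xs"
    using B1 B2 len unfolding A.hb_diff A.hb_signed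
    by (cases "even k"; cases "even m") (simp_all add: gerstenhaber_eq_insertion signed_def)
qed

lemma gerstenhaber_swap:
  assumes "length xs + 1 = n + m"
  shows "gerstenhaber n m \<alpha> \<beta> xs = - signed ((int n - 1) * (int m - 1)) (gerstenhaber m n \<beta> \<alpha> xs)"
  using assms by (simp add: gerstenhaber_eq_insertion add.commute signed_def)

lemma bracket_coboundary_right:
  assumes h: "multilinear scale scale h" and \<alpha>: "multilinear scale scale \<alpha>"
    and cocycle: "\<And>xs. length xs = Suc n \<Longrightarrow> hb (*) (*) \<alpha> xs = 0"
  obtains \<eta> where "multilinear scale scale \<eta>"
    "\<And>xs. length xs = n + k \<Longrightarrow> gerstenhaber n (Suc k) \<alpha> (hb (*) (*) h) xs = hb (*) (*) \<eta> xs"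
proof -
  interpret A: bimod_act "(*)" "(*) :: 'a \<Rightarrow> 'a \<Rightarrow> 'a" by (rule bimod_act_mult)
  obtain \<eta> where \<eta>: "multilinear scale scale \<eta>"
    "\<And>xs. length xs = k + n \<Longrightarrow> gerstenhaber (Suc k) n (hb (*) (*) h) \<alpha> xs = hb (*) (*) \<eta> xs"
    using bracket_coboundary_left [OF h \<alpha> cocycle] by metis
  let ?\<eta> = "\<lambda>xs. signed (1 + (int n - 1) * int k) (\<eta> xs)"
  have "gerstenhaber n (Suc k) \<alpha> (hb (*) (*) h) xs = hb (*) (*) ?\<eta> xs" if "length xs = n + k" for xs
    using that unfolding A.hb_signed by (simp add: gerstenhaber_swap [of xs n "Suc k"] \<eta>(2)) (simp add: signed_def)
  with multilinear_signed [OF \<eta>(1)] that show ?thesis by blast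
qed

end

section \<open>Lifting multilinear cochains along exact complexes\<close>

locale k_bimod_act = k_algebra scale + bimod_act l r
  for scale :: "'k::field \<Rightarrow> 'a::{ring,monoid_mult} \<Rightarrow> 'a" and l :: "'a \<Rightarrow> 'v::ab_group_add \<Rightarrow> 'v" and r
begin

text \<open>Linear extension in one slot from a k-basis of the algebra, obtained by extending the
  empty independent set. Scalars act from the left through \<open>scale c 1\<close>.\<close>

abbreviation lin_sum :: "'a \<Rightarrow> ('a \<Rightarrow> 'v) \<Rightarrow> 'v" where
  "lin_sum a h \<equiv> (\<Sum>b | representation (extend_basis {}) a b \<noteq> 0. l (scale (representation (extend_basis {}) a b) 1) (h b))"

lemma basis_span: "a \<in> span (extend_basis {})"
  using span_extend_basis [OF independent_empty] by simp

lemma basis_independent: "independent (extend_basis {})"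
  using independent_extend_basis [OF independent_empty] .

lemma lin_sum_superset:
  assumes "finite S" "{b. representation (extend_basis {}) a b \<noteq> 0} \<subseteq> S"
  shows "lin_sum a h = (\<Sum>b\<in>S. l (scale (representation (extend_basis {}) a b) 1) (h b))"
  using assms by (intro sum.mono_neutral_left) auto

lemma lin_sum_add: "lin_sum (a + a') h = lin_sum a h + lin_sum a' h"
proof -
  let ?S = "\<lambda>a. {b. representation (extend_basis {}) a b \<noteq> 0}"
  have f: "finite (?S a \<union> ?S a')" by (simp add: finite_representation)
  have "?S (a + a') \<subseteq> ?S a \<union> ?S a'"
    by (auto simp: representation_add [OF basis_independent basis_span basis_span])
  then show ?thesis
    using lin_sum_superset [OF f, of "a + a'"] lin_sum_superset [OF f, of a] lin_sum_superset [OF f, of a']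
    by (simp add: representation_add [OF basis_independent basis_span basis_span] scale_left_distrib
        l_add_left sum.distrib)
qed

lemma lin_sum_scale: "lin_sum (scale c a) h = l (scale c 1) (lin_sum a h)"
proof -
  let ?S = "\<lambda>a. {b. representation (extend_basis {}) a b \<noteq> 0}"
  have f: "finite (?S a)" by (simp add: finite_representation)
  have "?S (scale c a) \<subseteq> ?S a"
    by (auto simp: representation_scale [OF basis_independent basis_span])
  then show ?thesis
    using lin_sum_superset [OF f, of "scale c a"]
    by (simp add: representation_scale [OF basis_independent basis_span] l_sum scale_one_left
        flip: l_assoc)
qed

lemma lin_sum_linear:
  assumes "additive q" "\<And>c a. q (scale c a) = l (scale c 1) (q a)"
  shows "q a = lin_sum a q"
proof -
  have "a = (\<Sum>b | representation (extend_basis {}) a b \<noteq> 0. scale (representation (extend_basis {}) a b) b)"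
    using sum_nonzero_representation_eq [OF basis_independent basis_span] by simp
  then have "q a = q (\<Sum>b | representation (extend_basis {}) a b \<noteq> 0. scale (representation (extend_basis {}) a b) b)"
    by simp
  also have "\<dots> = lin_sum a q" by (simp only: additive.sum [OF assms(1)] assms(2))
  finally show ?thesis .
qed

text \<open>\<open>v\<close> prescribes the values on lists of basis vectors.\<close>

primrec mext :: "('a list \<Rightarrow> 'v) \<Rightarrow> 'a list \<Rightarrow> 'v" where
  mext_Nil: "mext v [] = v []"
| mext_Cons: "mext v (a # as) = lin_sum a (\<lambda>b. mext (\<lambda>ys. v (b # ys)) as)"

lemma multilinear_mext: "multilinear scale (\<lambda>c. l (scale c 1)) (mext v)"
proof -
  have "linear1 scale (\<lambda>c. l (scale c 1)) (\<lambda>ys. mext v (xs @ ys))" for xs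
  proof (induction xs arbitrary: v)
    case Nil
    show ?case by (simp add: linear1_def lin_sum_add lin_sum_scale)
  next
    case (Cons a as)
    have "l (scale k 1) (l (scale c 1) x) = l (scale c 1) (l (scale k 1) x)" for k c x
      by (simp add: scale_one_left mult.commute flip: l_assoc)
    with Cons show ?case by (simp add: linear1_def l_add sum.distrib l_sum)
  qed
  then show ?thesis by (simp add: multilinear_def)
qed

lemma mext_eq:
  assumes "multilinear scale (\<lambda>c. l (scale c 1)) F"
  shows "mext F xs = F xs"
  using assms
proof (induction xs arbitrary: F)
  case Nil
  then show ?case by simp
next
  case (Cons a as)
  have "F (a # as) = lin_sum a (\<lambda>b. F (b # as))"
    using multilinear_linear1 [OF Cons.prems] by (intro lin_sum_linear) (auto simp: additive_def linear1_def)
  then show ?case by (simp add: Cons.IH [OF multilinear_Cons [OF Cons.prems]])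
qed

lemma mext_hom:
  assumes "additive e" "\<And>a x. e (l a x) = l a (e x)"
  shows "e (mext v xs) = mext (\<lambda>ys. e (v ys)) xs"
  by (induction xs arbitrary: v) (simp_all add: additive.sum [OF assms(1)] assms(2))

lemma mext_closed:
  assumes "0 \<in> V" "\<And>x y. x \<in> V \<Longrightarrow> y \<in> V \<Longrightarrow> x + y \<in> V" "\<And>x a. x \<in> V \<Longrightarrow> l a x \<in> V"
    and "\<And>ys. length ys = length xs \<Longrightarrow> v ys \<in> V"
  shows "mext v xs \<in> V"
  using assms(4)
proof (induction xs arbitrary: v)
  case (Cons a as)
  have "sum h S \<in> V" if "\<And>b. b \<in> S \<Longrightarrow> h b \<in> V" for h :: "'a \<Rightarrow> 'v" and S
    using that by (induction S rule: infinite_finite_induct) (auto simp: assms(1,2))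
  with Cons show ?case by (simp add: assms(3))
qed simp

text \<open>The primitives are chosen on lists of basis vectors, by recursion on the length.\<close>

lemma cochain_lift:
  fixes V :: "int \<Rightarrow> 'v set" and t s :: int
  assumes V: "\<And>i. 0 \<in> V i" "\<And>i x y. x \<in> V i \<Longrightarrow> y \<in> V i \<Longrightarrow> x - y \<in> V i"
      "\<And>i x a. x \<in> V i \<Longrightarrow> l a x \<in> V i" "\<And>i x a. x \<in> V i \<Longrightarrow> r x a \<in> V i"
    and central: "\<And>i x c. x \<in> V i \<Longrightarrow> l (scale c 1) x = r x (scale c 1)"
    and e: "additive e" "\<And>a x. e (l a x) = l a (e x)" "\<And>a x. e (r x a) = r (e x) a"
    and exact: "\<And>i x. x \<in> V i \<Longrightarrow> e x = 0 \<Longrightarrow> \<exists>y\<in>V (i + 1). e y = x"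
    and Z: "multilinear scale (\<lambda>c. l (scale c 1)) Z" "\<And>xs. Z xs \<in> V (int (length xs) + t)"
      "\<And>xs. e (Z xs) = signed s (hb l r Z xs)"
  obtains Y where "multilinear scale (\<lambda>c. l (scale c 1)) Y" "\<And>xs. Y xs \<in> V (int (length xs) + t + 1)"
    "\<And>xs. Z xs = e (Y xs) + signed s (hb l r Y xs)"
proof -
  let ?ml = "multilinear scale (\<lambda>c. l (scale c 1))"
  have sum: "x \<in> V i \<Longrightarrow> y \<in> V i \<Longrightarrow> x + y \<in> V i" for i x y
    using V(2) [of x i "0 - y"] V(2) [OF V(1), of y i] by simp
  have sgn: "x \<in> V i \<Longrightarrow> signed s x \<in> V i" for i x
    using V(2) [OF V(1), of x i] by (simp add: signed_def)
  have signed_ml: "?ml F \<Longrightarrow> ?ml (\<lambda>xs. signed s (F xs))" for F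
    by (rule multilinear_hom [where h = "signed s"]) (auto simp: additive_def signed_add l_signed)
  \<comment> \<open>Degrees matter here: the last entry acts from the right, and its scalar is
    brought to the left by \<open>central\<close>, which speaks about elements of
    \<open>V\<close>.\<close>
  have hb_ml: "?ml (hb l r F)" if "?ml F" "\<And>xs. F xs \<in> V (int (length xs) + t + 1)" for F
    using that(1)
  proof (rule multilinear_hb)
    show "r (F ys) (scale c a) = l (scale c 1) (r (F ys) a)" for c ys a
      using central [OF that(2), of c ys]
      by (metis l_r r_assoc scale_one_left)
    show "r (l (scale c 1) x) a = l (scale c 1) (r x a)" for c x a by (simp add: l_r)
    show "l a (l (scale c 1) x) = l (scale c 1) (l a x)" "l (scale c a) x = l (scale c 1) (l a x)" for c x a
      by (simp_all add: scale_one_left scale_one_right flip: l_assoc)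
  qed (simp_all add: scale_mult_left scale_mult_right additive_l additive_r additive_l_left additive_r_right
      flip: scale_mult_left scale_mult_right)
  \<comment> \<open>Stage N chooses primitives on lists of length N, of which \<open>mext\<close>
    reads those consisting of basis vectors. \<open>F\<close> is the cochain of the previous stage,
    needed on lists that are one entry shorter.\<close>
  define step where "step N F xs = mext (\<lambda>bs. if length bs = N
      then SOME y. y \<in> V (int N + t + 1) \<and> e y = Z bs - signed s (hb l r F bs) else 0) xs" for N F xs
  define Ys where "Ys = rec_nat (step 0 (\<lambda>_. 0)) (\<lambda>N. step (Suc N))"
  have Ys_simps: "Ys 0 = step 0 (\<lambda>_. 0)" "Ys (Suc N) = step (Suc N) (Ys N)" for N
    by (simp_all add: Ys_def)
  define Y where "Y xs = Ys (length xs) xs" for xs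
  have hbY: "hb l r (Ys N) bs = hb l r Y bs" if "length bs = Suc N" for N bs
    using that by (intro hb_cong) (simp add: Y_def)
  have step_eq: "Ys N xs = mext (\<lambda>bs. if length bs = N
      then SOME y. y \<in> V (int N + t + 1) \<and> e y = Z bs - signed s (hb l r Y bs) else 0) xs" for N xs
  proof (cases N)
    case 0
    then show ?thesis by (simp add: Ys_simps step_def cong: if_cong)
  next
    case (Suc M)
    show ?thesis unfolding Suc Ys_simps step_def
      by (intro arg_cong [where f = "\<lambda>v. mext v xs"] ext if_cong refl) (simp add: hbY)
  qed
  have Y_ml: "?ml Y"
  proof -
    have "?ml (Ys N)" for N
    proof -
      have "Ys N = mext (\<lambda>bs. if length bs = N
        then SOME y. y \<in> V (int N + t + 1) \<and> e y = Z bs - signed s (hb l r Y bs) else 0)"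
        by (rule ext) (rule step_eq)
      then show ?thesis by (simp only: multilinear_mext)
    qed
    moreover have "Y = (\<lambda>xs. Ys (length xs) xs)" by (simp add: fun_eq_iff Y_def)
    ultimately show ?thesis by (simp only: multilinear_by_length)
  qed
  have main: "Y xs \<in> V (int (length xs) + t + 1) \<and> Z xs = e (Y xs) + signed s (hb l r Y xs)" for xs
  proof (induction "length xs" arbitrary: xs rule: less_induct)
    case less
    let ?N = "length xs"
    have ZV: "Z bs - signed s (hb l r Y bs) \<in> V (int ?N + t)" if "length bs = ?N" for bs
    proof (rule V(2))
      show "Z bs \<in> V (int ?N + t)" using Z(2) [of bs] that by simp
      have "Y ys \<in> V (int ?N + t)" if "Suc (length ys) = length bs" for ys
      proof -
        have "Y ys \<in> V (int (length ys) + t + 1)" and "int (length ys) + t + 1 = int ?N + t"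
          using less [of ys] that \<open>length bs = ?N\<close> by simp_all
        then show ?thesis by simp
      qed
      then show "signed s (hb l r Y bs) \<in> V (int ?N + t)"
        by (intro sgn hb_closed) (auto simp: V)
    qed
    \<comment> \<open>Applying \<open>e\<close> gives the coboundary of \<open>Z\<close> twice with
      opposite signs: on shorter lists \<open>e (Y ys)\<close> is \<open>Z ys\<close> minus a
      coboundary by induction, and that coboundary is removed by \<open>hb_hb\<close>.\<close>
    have Zker: "e (Z bs - signed s (hb l r Y bs)) = 0" if "length bs = ?N" for bs
    proof -
      have "e (hb l r Y bs) = hb l r (\<lambda>ys. e (Y ys)) bs"
        by (rule hb_hom) (simp_all add: e)
      also have "\<dots> = hb l r (\<lambda>ys. Z ys - signed s (hb l r Y ys)) bs"
        using less that by (intro hb_cong) (simp add: algebra_simps)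
      also have "\<dots> = hb l r Z bs" by (simp add: hb_diff hb_signed hb_hb)
      finally show ?thesis by (simp add: additive.diff [OF e(1)] additive_signed [OF e(1)] Z(3))
    qed
    let ?P = "\<lambda>bs y. y \<in> V (int ?N + t + 1) \<and> e y = Z bs - signed s (hb l r Y bs)"
    let ?v = "\<lambda>bs. if length bs = ?N then SOME y. ?P bs y else 0"
    have v: "?P bs (?v bs)" if "length bs = ?N" for bs
      using exact [OF ZV [OF that] Zker [OF that]] that someI_ex [of "?P bs"] by auto
    have Yv: "Y xs = mext ?v xs" by (simp add: Y_def step_eq)
    have "Y xs \<in> V (int ?N + t + 1)"
      unfolding Yv using v by (intro mext_closed) (auto simp: V sum)
    moreover have "e (Y xs) = Z xs - signed s (hb l r Y xs)"
    proof -
      let ?Zr = "\<lambda>bs. if length bs = ?N then Z bs - signed s (hb l r (Ys (?N - 1)) bs) else 0"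
      have "e (Y xs) = mext (\<lambda>bs. e (?v bs)) xs" unfolding Yv by (rule mext_hom [OF e(1,2)])
      also have "(\<lambda>bs. e (?v bs)) = (\<lambda>bs. if length bs = ?N then Z bs - signed s (hb l r Y bs) else 0)"
        using v by (auto simp: fun_eq_iff additive.zero [OF e(1)])
      also have "mext \<dots> xs = Z xs - signed s (hb l r Y xs)"
      proof -
        \<comment> \<open>The values on basis lists determine \<open>Z - hb Y\<close> only once this
          is known to be multilinear, and \<open>hb_ml\<close> needs values in \<open>V\<close>,
          available so far only on lists shorter than \<open>xs\<close>. So \<open>Y\<close> is cut
          down to the one length that enters.\<close>
        define Y' where "Y' ys = (if Suc (length ys) = ?N then Y ys else 0)" for ys
        have "hb l r Y' bs = hb l r Y bs" if "length bs = ?N" for bs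
          using that by (intro hb_cong) (simp add: Y'_def)
        then have eq: "(\<lambda>bs. if length bs = ?N then Z bs - signed s (hb l r Y bs) else 0)
            = (\<lambda>bs. if length bs = ?N then Z bs - signed s (hb l r Y' bs) else 0)"
          by (auto simp: fun_eq_iff)
        have "?ml Y'"
        proof (cases ?N)
          case 0
          then have "Y' = (\<lambda>ys. Y ys - Y ys)" by (simp add: Y'_def fun_eq_iff)
          then show ?thesis by (simp only: multilinear_diff [OF Y_ml Y_ml additive_l])
        next
          case (Suc M)
          then have "Y' = (\<lambda>ys. if length ys = M then Y ys else 0)" by (simp add: Y'_def fun_eq_iff)
          then show ?thesis by (simp only: multilinear_restrict [OF Y_ml additive_l])
        qed
        moreover have "Y' ys \<in> V (int (length ys) + t + 1)" for ys
          using less [of ys] by (auto simp: Y'_def V)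
        ultimately have "?ml (\<lambda>bs. if length bs = ?N then Z bs - signed s (hb l r Y' bs) else 0)"
          by (intro multilinear_restrict multilinear_diff Z(1) signed_ml hb_ml additive_l)
        from mext_eq [OF this, of xs] show ?thesis unfolding eq
          using \<open>\<And>bs. length bs = ?N \<Longrightarrow> hb l r Y' bs = hb l r Y bs\<close> by simp
      qed
      finally show ?thesis .
    qed
    ultimately show ?case by simp
  qed
  show thesis using that [OF Y_ml] main by blast
qed

end

section \<open>All bimodules inside one type\<close>

text \<open>The bimodule axioms without reference to the ground field, so that the type
  \<open>total\<close> does not depend on \<open>scale\<close>.\<close>

definition ring_bimod :: "('a::{ring,monoid_mult}, 'm) bimodule \<Rightarrow> bool" where
  "ring_bimod M \<longleftrightarrow> abelian_group M \<and>
    (\<forall>x\<in>carrier M. \<forall>a b. a \<odot>\<^bsub>M\<^esub> x \<in> carrier M \<and> x \<bullet>\<^bsub>M\<^esub> a \<in> carrier M \<and>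
      (a + b) \<odot>\<^bsub>M\<^esub> x = a \<odot>\<^bsub>M\<^esub> x \<oplus>\<^bsub>M\<^esub> b \<odot>\<^bsub>M\<^esub> x \<and> x \<bullet>\<^bsub>M\<^esub> (a + b) = x \<bullet>\<^bsub>M\<^esub> a \<oplus>\<^bsub>M\<^esub> x \<bullet>\<^bsub>M\<^esub> b \<and>
      (a * b) \<odot>\<^bsub>M\<^esub> x = a \<odot>\<^bsub>M\<^esub> (b \<odot>\<^bsub>M\<^esub> x) \<and> x \<bullet>\<^bsub>M\<^esub> (a * b) = (x \<bullet>\<^bsub>M\<^esub> a) \<bullet>\<^bsub>M\<^esub> b \<and>
      (a \<odot>\<^bsub>M\<^esub> x) \<bullet>\<^bsub>M\<^esub> b = a \<odot>\<^bsub>M\<^esub> (x \<bullet>\<^bsub>M\<^esub> b) \<and> 1 \<odot>\<^bsub>M\<^esub> x = x \<and> x \<bullet>\<^bsub>M\<^esub> 1 = x) \<and>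
    (\<forall>x\<in>carrier M. \<forall>y\<in>carrier M. \<forall>a. a \<odot>\<^bsub>M\<^esub> (x \<oplus>\<^bsub>M\<^esub> y) = a \<odot>\<^bsub>M\<^esub> x \<oplus>\<^bsub>M\<^esub> a \<odot>\<^bsub>M\<^esub> y \<and>
      (x \<oplus>\<^bsub>M\<^esub> y) \<bullet>\<^bsub>M\<^esub> a = x \<bullet>\<^bsub>M\<^esub> a \<oplus>\<^bsub>M\<^esub> y \<bullet>\<^bsub>M\<^esub> a)"

lemma bimodule_ring_bimod: "bimodule scale M \<Longrightarrow> ring_bimod M"
  unfolding ring_bimod_def
  by (simp add: bimodule.axioms bimodule.lsmult_closed bimodule.rsmult_closed bimodule.lsmult_distrib_left
      bimodule.lsmult_distrib_right bimodule.rsmult_distrib_left bimodule.rsmult_distrib_right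
      bimodule.lsmult_assoc bimodule.rsmult_assoc bimodule.lsmult_rsmult bimodule.lsmult_one bimodule.rsmult_one)

lemma ring_bimod_group: "ring_bimod M \<Longrightarrow> abelian_group M"
  and ring_bimod_monoid: "ring_bimod M \<Longrightarrow> abelian_monoid M"
  by (simp_all add: ring_bimod_def abelian_group.axioms)

lemma ring_bimod_zero: "ring_bimod M \<Longrightarrow> \<zero>\<^bsub>M\<^esub> \<in> carrier M"
  and ring_bimod_add: "ring_bimod M \<Longrightarrow> x \<in> carrier M \<Longrightarrow> y \<in> carrier M \<Longrightarrow> x \<oplus>\<^bsub>M\<^esub> y \<in> carrier M"
  and ring_bimod_minus: "ring_bimod M \<Longrightarrow> x \<in> carrier M \<Longrightarrow> \<ominus>\<^bsub>M\<^esub> x \<in> carrier M"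
  using abelian_monoid.zero_closed [OF ring_bimod_monoid] abelian_monoid.a_closed [OF ring_bimod_monoid]
    abelian_group.a_inv_closed [OF ring_bimod_group] by auto

text \<open>
  The product of all bimodules with elements in \<open>'m\<close>, over all degrees. Homogeneous elements of a
  complex embed into it, and maps of complexes become everywhere defined additive functions, so that
  no carriers are left in the calculations.
\<close>

definition total_family :: "(int \<times> ('a::{ring,monoid_mult}, 'm) bimodule \<Rightarrow> 'm) \<Rightarrow> bool" where
  "total_family F \<longleftrightarrow> (\<forall>i M. if ring_bimod M then F (i, M) \<in> carrier M else F (i, M) = undefined)"

typedef (overloaded) ('a, 'm) total = "{F :: int \<times> ('a::{ring,monoid_mult}, 'm) bimodule \<Rightarrow> 'm. total_family F}"
  morphisms component Abs_total
proof
  show "(\<lambda>(i, M). if ring_bimod M then \<zero>\<^bsub>M\<^esub> else undefined) \<in> {F :: int \<times> ('a, 'm) bimodule \<Rightarrow> 'm. total_family F}"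
    by (simp add: total_family_def ring_bimod_zero)
qed

setup_lifting type_definition_total

lemma component_closed: "ring_bimod M \<Longrightarrow> component u (i, M) \<in> carrier M"
  using component [of u] by (simp add: total_family_def)

lemma total_eqI:
  fixes u v :: "('a::{ring,monoid_mult}, 'm) total"
  shows "(\<And>i M. ring_bimod M \<Longrightarrow> component u (i, M) = component v (i, M)) \<Longrightarrow> u = v"
proof (subst component_inject [symmetric], rule ext)
  fix j :: "int \<times> ('a, 'm) bimodule" assume *: "\<And>i M. ring_bimod M \<Longrightarrow> component u (i, M) = component v (i, M)"
  obtain i M where j: "j = (i, M)" by (cases j)
  show "component u j = component v j"
  proof (cases "ring_bimod M")
    case False
    then have "component w j = undefined" for w :: "('a, 'm) total"
      using component [of w] by (simp add: total_family_def j)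
    then show ?thesis by simp
  qed (simp add: j *)
qed

instantiation total :: ("{ring,monoid_mult}", type) ab_group_add
begin

lift_definition zero_total :: "('a, 'm) total" is "\<lambda>(i, M). if ring_bimod M then \<zero>\<^bsub>M\<^esub> else undefined"
  by (simp add: total_family_def ring_bimod_zero)

lift_definition plus_total :: "('a, 'm) total \<Rightarrow> ('a, 'm) total \<Rightarrow> ('a, 'm) total"
  is "\<lambda>F G (i, M). if ring_bimod M then F (i, M) \<oplus>\<^bsub>M\<^esub> G (i, M) else undefined"
  unfolding total_family_def by (simp add: ring_bimod_add)

lift_definition uminus_total :: "('a, 'm) total \<Rightarrow> ('a, 'm) total"
  is "\<lambda>F (i, M). if ring_bimod M then \<ominus>\<^bsub>M\<^esub> F (i, M) else undefined"
  unfolding total_family_def by (simp add: ring_bimod_minus)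

definition minus_total :: "('a, 'm) total \<Rightarrow> ('a, 'm) total \<Rightarrow> ('a, 'm) total"
  where "minus_total F G = F + (- G)"

instance
proof
  fix a b c :: "('a, 'm) total"
  note c = zero_total.rep_eq plus_total.rep_eq uminus_total.rep_eq component_closed
  show "a + b + c = a + (b + c)"
    by (rule total_eqI) (simp add: c abelian_monoid.a_assoc ring_bimod_monoid)
  show "a + b = b + a" by (rule total_eqI) (simp add: c abelian_monoid.a_comm ring_bimod_monoid)
  show "0 + a = a" by (rule total_eqI) (simp add: c abelian_monoid.l_zero ring_bimod_monoid)
  show "- a + a = 0" by (rule total_eqI) (simp add: c abelian_group.l_neg ring_bimod_group)
  show "a - b = a + - b" by (rule minus_total_def)
qed

end

lemma ring_bimod_l: "ring_bimod M \<Longrightarrow> x \<in> carrier M \<Longrightarrow> a \<odot>\<^bsub>M\<^esub> x \<in> carrier M"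
  and ring_bimod_r: "ring_bimod M \<Longrightarrow> x \<in> carrier M \<Longrightarrow> x \<bullet>\<^bsub>M\<^esub> a \<in> carrier M"
  by (simp_all add: ring_bimod_def)

lift_definition tl_act :: "'a::{ring,monoid_mult} \<Rightarrow> ('a, 'm) total \<Rightarrow> ('a, 'm) total"
  is "\<lambda>a F (i, M). if ring_bimod M then a \<odot>\<^bsub>M\<^esub> F (i, M) else undefined"
  unfolding total_family_def by (simp add: ring_bimod_l)

lift_definition tr_act :: "('a::{ring,monoid_mult}, 'm) total \<Rightarrow> 'a \<Rightarrow> ('a, 'm) total"
  is "\<lambda>F a (i, M). if ring_bimod M then F (i, M) \<bullet>\<^bsub>M\<^esub> a else undefined"
  unfolding total_family_def by (simp add: ring_bimod_r)

lemma component_zero: "ring_bimod M \<Longrightarrow> component 0 (i, M) = \<zero>\<^bsub>M\<^esub>"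
  by (simp add: zero_total.rep_eq)

lemma component_add: "ring_bimod M \<Longrightarrow> component (u + v) (i, M) = component u (i, M) \<oplus>\<^bsub>M\<^esub> component v (i, M)"
  by (simp add: plus_total.rep_eq)

lemma component_minus: "ring_bimod M \<Longrightarrow> component (- u) (i, M) = \<ominus>\<^bsub>M\<^esub> component u (i, M)"
  by (simp add: uminus_total.rep_eq)

lemma component_l: "ring_bimod M \<Longrightarrow> component (tl_act a u) (i, M) = a \<odot>\<^bsub>M\<^esub> component u (i, M)"
  by (simp add: tl_act.rep_eq)

lemma component_r: "ring_bimod M \<Longrightarrow> component (tr_act u a) (i, M) = component u (i, M) \<bullet>\<^bsub>M\<^esub> a"
  by (simp add: tr_act.rep_eq)

lemma component_diff: "ring_bimod M \<Longrightarrow> component (u - v) (i, M) = component u (i, M) \<ominus>\<^bsub>M\<^esub> component v (i, M)"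
  by (simp add: diff_conv_add_uminus component_add component_minus a_minus_def del: add_uminus_conv_diff)

lemma component_signed: "ring_bimod M \<Longrightarrow> component (signed k u) (i, M) = msigned M k (component u (i, M))"
  by (simp add: signed_def msigned_def component_minus)

lemma bimod_act_total: "bimod_act tl_act (tr_act :: ('a::{ring,monoid_mult}, 'm) total \<Rightarrow> _)"
proof
  fix x y :: "('a, 'm) total" and a b
  have rb: "x \<in> carrier M \<Longrightarrow> y \<in> carrier M \<Longrightarrow> a \<odot>\<^bsub>M\<^esub> (x \<oplus>\<^bsub>M\<^esub> y) = a \<odot>\<^bsub>M\<^esub> x \<oplus>\<^bsub>M\<^esub> a \<odot>\<^bsub>M\<^esub> y \<and>
      (x \<oplus>\<^bsub>M\<^esub> y) \<bullet>\<^bsub>M\<^esub> a = x \<bullet>\<^bsub>M\<^esub> a \<oplus>\<^bsub>M\<^esub> y \<bullet>\<^bsub>M\<^esub> a"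
    "x \<in> carrier M \<Longrightarrow> (a + b) \<odot>\<^bsub>M\<^esub> x = a \<odot>\<^bsub>M\<^esub> x \<oplus>\<^bsub>M\<^esub> b \<odot>\<^bsub>M\<^esub> x \<and> x \<bullet>\<^bsub>M\<^esub> (a + b) = x \<bullet>\<^bsub>M\<^esub> a \<oplus>\<^bsub>M\<^esub> x \<bullet>\<^bsub>M\<^esub> b \<and>
      (a * b) \<odot>\<^bsub>M\<^esub> x = a \<odot>\<^bsub>M\<^esub> (b \<odot>\<^bsub>M\<^esub> x) \<and> x \<bullet>\<^bsub>M\<^esub> (a * b) = (x \<bullet>\<^bsub>M\<^esub> a) \<bullet>\<^bsub>M\<^esub> b \<and>
      (a \<odot>\<^bsub>M\<^esub> x) \<bullet>\<^bsub>M\<^esub> b = a \<odot>\<^bsub>M\<^esub> (x \<bullet>\<^bsub>M\<^esub> b) \<and> 1 \<odot>\<^bsub>M\<^esub> x = x \<and> x \<bullet>\<^bsub>M\<^esub> 1 = x"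
    if "ring_bimod M" for M :: "('a, 'm) bimodule" and x y a b
    using that by (simp_all add: ring_bimod_def)
  note c = component_closed component_zero component_add component_l component_r rb
  show "tl_act a (x + y) = tl_act a x + tl_act a y"
    by (rule total_eqI) (simp add: c)
  show "tl_act (a + b) x = tl_act a x + tl_act b x"
    by (rule total_eqI) (simp add: c)
  show "tl_act (a * b) x = tl_act a (tl_act b x)"
    by (rule total_eqI) (simp add: c)
  show "tl_act 1 x = x"
    by (rule total_eqI) (simp add: c)
  show "tr_act (x + y) a = tr_act x a + tr_act y a"
    by (rule total_eqI) (simp add: c)
  show "tr_act x (a + b) = tr_act x a + tr_act x b"
    by (rule total_eqI) (simp add: c)
  show "tr_act x (a * b) = tr_act (tr_act x a) b"
    by (rule total_eqI) (simp add: c)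
  show "tr_act x 1 = x"
    by (rule total_eqI) (simp add: c)
  show "tr_act (tl_act a x) b = tl_act a (tr_act x b)"
    by (rule total_eqI) (simp add: c)
qed

global_interpretation T: bimod_act tl_act tr_act
  by (rule bimod_act_total)

text \<open>The key contains the degree besides the bimodule, which keeps equal bimodules in
  different degrees of a complex apart. Arguments outside the carrier go to zero.\<close>

lift_definition embed :: "int \<times> ('a::{ring,monoid_mult}, 'm) bimodule \<Rightarrow> 'm \<Rightarrow> ('a, 'm) total"
  is "\<lambda>k x (i, M). if ring_bimod M then if k = (i, M) \<and> x \<in> carrier M then x else \<zero>\<^bsub>M\<^esub> else undefined"
  by (simp add: total_family_def ring_bimod_zero)

lemma component_embed: "ring_bimod M \<Longrightarrow> component (embed k x) (i, M) =
    (if k = (i, M) \<and> x \<in> carrier M then x else \<zero>\<^bsub>M\<^esub>)"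
  by (simp add: embed.rep_eq)

lemma embed_zero: "ring_bimod M \<Longrightarrow> embed (i, M) \<zero>\<^bsub>M\<^esub> = 0"
  by (rule total_eqI) (simp add: component_embed component_zero)

lemma embed_add: "ring_bimod M \<Longrightarrow> x \<in> carrier M \<Longrightarrow> y \<in> carrier M \<Longrightarrow>
    embed (i, M) (x \<oplus>\<^bsub>M\<^esub> y) = embed (i, M) x + embed (i, M) y"
  by (rule total_eqI) (auto simp: component_embed component_add ring_bimod_add
      abelian_monoid.l_zero [OF ring_bimod_monoid] ring_bimod_zero)

lemma ring_bimod_act_zero:
  assumes "ring_bimod M"
  shows "a \<odot>\<^bsub>M\<^esub> \<zero>\<^bsub>M\<^esub> = \<zero>\<^bsub>M\<^esub>" "\<zero>\<^bsub>M\<^esub> \<bullet>\<^bsub>M\<^esub> a = \<zero>\<^bsub>M\<^esub>"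
  using component_l [OF assms, of a 0 0] component_r [OF assms, of 0 a 0] by (simp_all add: component_zero assms)

lemma embed_l: "ring_bimod M \<Longrightarrow> x \<in> carrier M \<Longrightarrow> embed (i, M) (a \<odot>\<^bsub>M\<^esub> x) = tl_act a (embed (i, M) x)"
  by (rule total_eqI) (auto simp: component_embed component_l ring_bimod_act_zero, simp add: ring_bimod_def)

lemma embed_r: "ring_bimod M \<Longrightarrow> x \<in> carrier M \<Longrightarrow> embed (i, M) (x \<bullet>\<^bsub>M\<^esub> a) = tr_act (embed (i, M) x) a"
  by (rule total_eqI) (auto simp: component_embed component_r ring_bimod_act_zero, simp add: ring_bimod_def)

lemma embed_inject: "ring_bimod M \<Longrightarrow> x \<in> carrier M \<Longrightarrow> y \<in> carrier M \<Longrightarrow>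
    embed (i, M) x = embed (i, M) y \<longleftrightarrow> x = y"
  by (metis component_embed)

section \<open>Graded bimodules and their maps\<close>

definition graded_bimod :: "('a::{ring,monoid_mult}, 'p) bimod_complex \<Rightarrow> bool" where
  "graded_bimod P \<longleftrightarrow> (\<forall>i. ring_bimod (cmod P i))"

definition inc :: "('a::{ring,monoid_mult}, 'p) bimod_complex \<Rightarrow> int \<Rightarrow> 'p \<Rightarrow> ('a, 'p) total" where
  "inc P i = embed (i, cmod P i)"

definition prj :: "('a::{ring,monoid_mult}, 'p) bimod_complex \<Rightarrow> int \<Rightarrow> ('a, 'p) total \<Rightarrow> 'p" where
  "prj P i u = component u (i, cmod P i)"

definition homog :: "('a::{ring,monoid_mult}, 'p) bimod_complex \<Rightarrow> int \<Rightarrow> ('a, 'p) total set" where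
  "homog P i = inc P i ` carrier (cmod P i)"

text \<open>Acts in all degrees at once: the component of the value in degree j comes from the
  component of the argument in degree j - t. Projecting first makes the result additive and linear
  for both actions on the whole type, although \<phi> is meaningful on carriers only.\<close>

definition gmap :: "('a::{ring,monoid_mult}, 'p) bimod_complex \<Rightarrow> ('a, 'q) bimod_complex \<Rightarrow> int
    \<Rightarrow> (int \<Rightarrow> 'p \<Rightarrow> 'q) \<Rightarrow> ('a, 'p) total \<Rightarrow> ('a, 'q) total" where
  "gmap P Q t \<phi> u = Abs_total (\<lambda>(j, M). if ring_bimod M then
     if M = cmod Q j then \<phi> (j - t) (prj P (j - t) u) else \<zero>\<^bsub>M\<^esub> else undefined)"

context
  fixes P :: "('a::{ring,monoid_mult}, 'p) bimod_complex"
  assumes P: "graded_bimod P"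
begin

lemma graded_ring_bimod: "ring_bimod (cmod P i)" using P by (simp add: graded_bimod_def)

lemma prj_closed: "prj P i u \<in> carrier (cmod P i)"
  by (simp add: prj_def component_closed graded_ring_bimod)

lemma prj_inc: "x \<in> carrier (cmod P i) \<Longrightarrow> prj P j (inc P i x) = (if i = j then x else \<zero>\<^bsub>cmod P j\<^esub>)"
  by (auto simp: prj_def inc_def component_embed graded_ring_bimod)

lemma prj_simps: "prj P i 0 = \<zero>\<^bsub>cmod P i\<^esub>" "prj P i (u + v) = prj P i u \<oplus>\<^bsub>cmod P i\<^esub> prj P i v"
  "prj P i (u - v) = prj P i u \<ominus>\<^bsub>cmod P i\<^esub> prj P i v"
  "prj P i (tl_act a u) = a \<odot>\<^bsub>cmod P i\<^esub> prj P i u" "prj P i (tr_act u a) = prj P i u \<bullet>\<^bsub>cmod P i\<^esub> a"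
  "prj P i (signed k u) = msigned (cmod P i) k (prj P i u)"
  by (simp_all add: prj_def component_zero component_add component_diff component_l component_r component_signed
      graded_ring_bimod)

lemma inc_zero: "inc P i \<zero>\<^bsub>cmod P i\<^esub> = 0"
  by (simp add: inc_def embed_zero graded_ring_bimod)

lemma inc_add: "x \<in> carrier (cmod P i) \<Longrightarrow> y \<in> carrier (cmod P i) \<Longrightarrow>
    inc P i (x \<oplus>\<^bsub>cmod P i\<^esub> y) = inc P i x + inc P i y"
  by (simp add: inc_def embed_add graded_ring_bimod)

lemma inc_l: "x \<in> carrier (cmod P i) \<Longrightarrow> inc P i (a \<odot>\<^bsub>cmod P i\<^esub> x) = tl_act a (inc P i x)"
  and inc_r: "x \<in> carrier (cmod P i) \<Longrightarrow> inc P i (x \<bullet>\<^bsub>cmod P i\<^esub> a) = tr_act (inc P i x) a"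
  by (simp_all add: inc_def embed_l embed_r graded_ring_bimod)

lemma inc_inject: "x \<in> carrier (cmod P i) \<Longrightarrow> y \<in> carrier (cmod P i) \<Longrightarrow> inc P i x = inc P i y \<longleftrightarrow> x = y"
  by (simp add: inc_def embed_inject graded_ring_bimod)

lemma inc_minus: "x \<in> carrier (cmod P i) \<Longrightarrow> inc P i (\<ominus>\<^bsub>cmod P i\<^esub> x) = - inc P i x"
  using inc_add [of x i "\<ominus>\<^bsub>cmod P i\<^esub> x"]
  by (simp add: ring_bimod_minus [OF graded_ring_bimod] abelian_group.r_neg [OF ring_bimod_group [OF graded_ring_bimod]]
      inc_zero eq_neg_iff_add_eq_0 add.commute)

lemma inc_signed: "x \<in> carrier (cmod P i) \<Longrightarrow> inc P i (msigned (cmod P i) k x) = signed k (inc P i x)"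
  by (simp add: msigned_def signed_def inc_minus)

lemma inc_diff: "x \<in> carrier (cmod P i) \<Longrightarrow> y \<in> carrier (cmod P i) \<Longrightarrow>
    inc P i (x \<ominus>\<^bsub>cmod P i\<^esub> y) = inc P i x - inc P i y"
  by (simp add: a_minus_def inc_add inc_minus ring_bimod_minus [OF graded_ring_bimod])

lemma homog_0: "0 \<in> homog P i"
  unfolding homog_def using inc_zero by (metis image_eqI ring_bimod_zero [OF graded_ring_bimod])

lemma homog_add: "u \<in> homog P i \<Longrightarrow> v \<in> homog P i \<Longrightarrow> u + v \<in> homog P i"
  by (auto simp: homog_def simp flip: inc_add intro!: imageI ring_bimod_add [OF graded_ring_bimod])

lemma homog_diff: "u \<in> homog P i \<Longrightarrow> v \<in> homog P i \<Longrightarrow> u - v \<in> homog P i"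
  by (auto simp: homog_def a_minus_def simp flip: inc_diff
      intro!: imageI ring_bimod_add [OF graded_ring_bimod] ring_bimod_minus [OF graded_ring_bimod])

lemma homog_signed: "u \<in> homog P i \<Longrightarrow> signed k u \<in> homog P i"
  using homog_diff [OF homog_0, of u i] by (simp add: signed_def)

lemma homog_l: "u \<in> homog P i \<Longrightarrow> tl_act a u \<in> homog P i"
  and homog_r: "u \<in> homog P i \<Longrightarrow> tr_act u a \<in> homog P i"
  using graded_ring_bimod [of i] by (auto simp: homog_def ring_bimod_def simp flip: inc_l inc_r)

lemma inc_homog: "x \<in> carrier (cmod P i) \<Longrightarrow> inc P i x \<in> homog P i"
  by (simp add: homog_def)

lemma inc_prj: "u \<in> homog P i \<Longrightarrow> inc P i (prj P i u) = u"
  by (auto simp: homog_def prj_inc)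

lemma prj_homog_other: "u \<in> homog P i \<Longrightarrow> j \<noteq> i \<Longrightarrow> prj P j u = \<zero>\<^bsub>cmod P j\<^esub>"
  by (auto simp: homog_def prj_inc)

end

lemma bimod_hom_closed: "f \<in> bimod_hom M N \<Longrightarrow> x \<in> carrier M \<Longrightarrow> f x \<in> carrier N"
  and bimod_hom_add: "f \<in> bimod_hom M N \<Longrightarrow> x \<in> carrier M \<Longrightarrow> y \<in> carrier M \<Longrightarrow> f (x \<oplus>\<^bsub>M\<^esub> y) = f x \<oplus>\<^bsub>N\<^esub> f y"
  and bimod_hom_l: "f \<in> bimod_hom M N \<Longrightarrow> x \<in> carrier M \<Longrightarrow> f (a \<odot>\<^bsub>M\<^esub> x) = a \<odot>\<^bsub>N\<^esub> f x"
  and bimod_hom_r: "f \<in> bimod_hom M N \<Longrightarrow> x \<in> carrier M \<Longrightarrow> f (x \<bullet>\<^bsub>M\<^esub> a) = f x \<bullet>\<^bsub>N\<^esub> a"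
  by (auto simp: bimod_hom_def)

lemma bimod_hom_zero:
  assumes "f \<in> bimod_hom M N" "ring_bimod M" "ring_bimod N"
  shows "f \<zero>\<^bsub>M\<^esub> = \<zero>\<^bsub>N\<^esub>"
proof -
  interpret N: abelian_group N using assms by (simp add: ring_bimod_group)
  have "f \<zero>\<^bsub>M\<^esub> \<in> carrier N" using assms by (simp add: bimod_hom_closed ring_bimod_zero)
  moreover have "f \<zero>\<^bsub>M\<^esub> \<oplus>\<^bsub>N\<^esub> f \<zero>\<^bsub>M\<^esub> = f \<zero>\<^bsub>M\<^esub>"
    using bimod_hom_add [OF assms(1), of "\<zero>\<^bsub>M\<^esub>" "\<zero>\<^bsub>M\<^esub>"] assms
    by (simp add: ring_bimod_zero abelian_monoid.l_zero [OF ring_bimod_monoid])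
  ultimately show ?thesis by (simp add: N.add.r_cancel_one)
qed

lemma mapsD: "f \<in> maps P Q t \<Longrightarrow> f i \<in> bimod_hom (cmod P i) (cmod Q (i + t))"
  by (simp add: maps_def)

context
  fixes P :: "('a::{ring,monoid_mult}, 'p) bimod_complex" and Q :: "('a, 'q) bimod_complex" and t \<phi>
  assumes P: "graded_bimod P" and Q: "graded_bimod Q" and \<phi>: "\<phi> \<in> maps P Q t"
begin

lemma maps_closed: "x \<in> carrier (cmod P (i - t)) \<Longrightarrow> \<phi> (i - t) x \<in> carrier (cmod Q i)"
  using bimod_hom_closed [OF mapsD [OF \<phi>], of x "i - t"] by simp

lemma component_gmap: "ring_bimod M \<Longrightarrow> component (gmap P Q t \<phi> u) (i, M) =
    (if M = cmod Q i then \<phi> (i - t) (prj P (i - t) u) else \<zero>\<^bsub>M\<^esub>)"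
  unfolding gmap_def
  by (subst Abs_total_inverse) (auto simp: total_family_def ring_bimod_zero maps_closed prj_closed [OF P])

lemma prj_gmap: "prj Q i (gmap P Q t \<phi> u) = \<phi> (i - t) (prj P (i - t) u)"
  by (simp add: prj_def [of Q] component_gmap graded_ring_bimod [OF Q])

lemma additive_gmap: "additive (gmap P Q t \<phi>)"
proof (rule additive.intro, rule total_eqI)
  fix u v i and M :: "('a, 'q) bimodule" assume M: "ring_bimod M"
  show "component (gmap P Q t \<phi> (u + v)) (i, M) = component (gmap P Q t \<phi> u + gmap P Q t \<phi> v) (i, M)"
    using bimod_hom_add [OF mapsD [OF \<phi>], of _ "i - t"]
    by (simp add: component_gmap component_add M prj_simps [OF P] prj_closed [OF P] ring_bimod_zero
      abelian_monoid.l_zero [OF ring_bimod_monoid])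
qed

lemma gmap_l: "gmap P Q t \<phi> (tl_act a u) = tl_act a (gmap P Q t \<phi> u)"
  and gmap_r: "gmap P Q t \<phi> (tr_act u a) = tr_act (gmap P Q t \<phi> u) a"
  using bimod_hom_l [OF mapsD [OF \<phi>], of _ "i - t" for i] bimod_hom_r [OF mapsD [OF \<phi>], of _ "i - t" for i]
  by (auto intro!: total_eqI simp: component_gmap component_l component_r prj_simps [OF P] prj_closed [OF P]
      ring_bimod_act_zero)

lemma gmap_inc: "x \<in> carrier (cmod P i) \<Longrightarrow> gmap P Q t \<phi> (inc P i x) = inc Q (i + t) (\<phi> i x)"
proof (rule total_eqI)
  fix j and M :: "('a, 'q) bimodule" assume x: "x \<in> carrier (cmod P i)" and M: "ring_bimod M"
  have "\<phi> i x \<in> carrier (cmod Q (i + t))" using maps_closed [of x "i + t"] x by simp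
  moreover have "\<phi> k \<zero>\<^bsub>cmod P k\<^esub> = \<zero>\<^bsub>cmod Q (k + t)\<^esub>" for k
    by (rule bimod_hom_zero [OF mapsD [OF \<phi>]]) (simp_all add: graded_ring_bimod P Q)
  from this [of "j - t"] have "\<phi> (j - t) \<zero>\<^bsub>cmod P (j - t)\<^esub> = \<zero>\<^bsub>cmod Q j\<^esub>" by simp
  ultimately show "component (gmap P Q t \<phi> (inc P i x)) (j, M) = component (inc Q (i + t) (\<phi> i x)) (j, M)"
    by (auto simp: component_gmap M prj_inc [OF P] x inc_def [of Q] component_embed)
qed

lemma gmap_homog: "u \<in> homog P i \<Longrightarrow> gmap P Q t \<phi> u \<in> homog Q (i + t)"
  using bimod_hom_closed [OF mapsD [OF \<phi>]] by (auto simp: homog_def [of P] gmap_inc inc_homog [OF Q])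

end

section \<open>Bimodules given by generators and relations\<close>

lemma frag_extend_closure:
  assumes "\<And>v. v \<in> R \<Longrightarrow> frag_extend f v \<in> group_closure R'" "v \<in> group_closure R"
  shows "frag_extend f v \<in> group_closure R'"
  using assms(2)
  by (induction rule: group_closure.induct) (auto simp: frag_extend_diff assms(1) intro: group_closure.diff)

lemma pres_class_eq_iff: "pres_class R u = pres_class R v \<longleftrightarrow> u - v \<in> group_closure R"
proof
  assume "pres_class R u = pres_class R v"
  then have "u \<in> pres_class R v" by (metis (no_types, lifting) add.right_neutral pres_class_def set_plus_intro2 elt_set_plus_def zero_in_group_closure)
  then show "u - v \<in> group_closure R" by (auto simp: pres_class_def elt_set_plus_def)
next
  assume uv: "u - v \<in> group_closure R"
  have "u + w \<in> pres_class R v" if "w \<in> group_closure R" for w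
    using group_closure_add [OF uv that] by (auto simp: pres_class_def elt_set_plus_def intro!: exI bexI)
  moreover have "v + w \<in> pres_class R u" if "w \<in> group_closure R" for w
    using group_closure.diff [OF that uv] by (auto simp: pres_class_def elt_set_plus_def intro!: bexI [rotated])
  ultimately show "pres_class R u = pres_class R v"
    by (auto simp: pres_class_def elt_set_plus_def)
qed

lemma in_pres_class_iff: "v \<in> pres_class R u \<longleftrightarrow> v - u \<in> group_closure R"
  by (auto simp: pres_class_def elt_set_plus_def intro!: bexI [of _ "v - u"])

lemma pres_class_add: "pres_class R u + pres_class R v = pres_class R (u + v)"
proof (intro Set.set_eqI iffI)
  fix w assume "w \<in> pres_class R u + pres_class R v"
  then obtain x y where "w = x + y" "x - u \<in> group_closure R" "y - v \<in> group_closure R"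
    by (auto simp: set_plus_def in_pres_class_iff)
  then show "w \<in> pres_class R (u + v)"
    using group_closure_add [of "x - u" R "y - v"] by (simp add: in_pres_class_iff algebra_simps)
next
  fix w assume "w \<in> pres_class R (u + v)"
  then have "w - v \<in> pres_class R u" "v \<in> pres_class R v" by (auto simp: in_pres_class_iff algebra_simps)
  then show "w \<in> pres_class R u + pres_class R v" by (metis diff_add_cancel set_plus_intro)
qed

lemma pres_class_UN:
  assumes "\<And>v. v \<in> R \<Longrightarrow> frag_extend f v \<in> group_closure R"
  shows "(\<Union>v\<in>pres_class R u. pres_class R (frag_extend f v)) = pres_class R (frag_extend f u)"
proof -
  have "pres_class R (frag_extend f v) = pres_class R (frag_extend f u)" if "v \<in> pres_class R u" for v
    using frag_extend_closure [where v = "v - u", OF assms] that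
    by (simp add: pres_class_eq_iff in_pres_class_iff frag_extend_diff)
  moreover have "u \<in> pres_class R u" by (simp add: in_pres_class_iff)
  ultimately show ?thesis by blast
qed

definition frag_eval :: "('a, 'm) bimodule \<Rightarrow> ('g \<Rightarrow> 'm) \<Rightarrow> ('g \<Rightarrow>\<^sub>0 int) \<Rightarrow> 'm" where
  "frag_eval M h u = (\<Oplus>\<^bsub>M\<^esub>g\<in>Poly_Mapping.keys u. [Poly_Mapping.lookup u g] \<cdot>\<^bsub>M\<^esub> h g)"

context
  fixes N :: "('a, 'm) bimodule" and S :: "'g set" and h :: "'g \<Rightarrow> 'm"
  assumes N: "abelian_group N" and h: "\<And>g. g \<in> S \<Longrightarrow> h g \<in> carrier N"
begin

interpretation N: abelian_group N by (rule N)

lemma frag_pow: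
  fixes k j :: int
  shows "x \<in> carrier N \<Longrightarrow> add_pow N k x \<in> carrier N"
    and "x \<in> carrier N \<Longrightarrow> add_pow N (k + j) x = add_pow N k x \<oplus>\<^bsub>N\<^esub> add_pow N j x"
    and "add_pow N (0::int) x = \<zero>\<^bsub>N\<^esub>" and "x \<in> carrier N \<Longrightarrow> add_pow N (1::int) x = x"
  using group.int_pow_closed [OF N.a_group, of x k] group.int_pow_mult [OF N.a_group, of x k j]
    group.int_pow_1 [OF N.a_group, of x]
  by (simp_all add: add_pow_def int_pow_def)

lemma frag_eval_closed: "Poly_Mapping.keys u \<subseteq> S \<Longrightarrow> frag_eval N h u \<in> carrier N"
  unfolding frag_eval_def by (intro N.finsum_closed) (auto intro!: frag_pow(1) h)

lemma frag_eval_superset: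
  assumes "finite K" "Poly_Mapping.keys u \<subseteq> K" "K \<subseteq> S"
  shows "frag_eval N h u = (\<Oplus>\<^bsub>N\<^esub>g\<in>K. [Poly_Mapping.lookup u g] \<cdot>\<^bsub>N\<^esub> h g)"
  unfolding frag_eval_def
  using assms by (intro N.add.finprod_mono_neutral_cong_left)
    (auto simp: in_keys_iff frag_pow(3) intro!: frag_pow(1) h)

lemma frag_eval_add:
  assumes "Poly_Mapping.keys u \<subseteq> S" "Poly_Mapping.keys v \<subseteq> S"
  shows "frag_eval N h (u + v) = frag_eval N h u \<oplus>\<^bsub>N\<^esub> frag_eval N h v"
proof -
  let ?K = "Poly_Mapping.keys u \<union> Poly_Mapping.keys v"
  have K: "finite ?K" "?K \<subseteq> S" using assms by auto
  have "frag_eval N h (u + v) = (\<Oplus>\<^bsub>N\<^esub>g\<in>?K. [Poly_Mapping.lookup (u + v) g] \<cdot>\<^bsub>N\<^esub> h g)"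
    by (rule frag_eval_superset [OF K(1) Poly_Mapping.keys_add K(2)])
  also have "\<dots> = (\<Oplus>\<^bsub>N\<^esub>g\<in>?K. [Poly_Mapping.lookup u g] \<cdot>\<^bsub>N\<^esub> h g \<oplus>\<^bsub>N\<^esub> [Poly_Mapping.lookup v g] \<cdot>\<^bsub>N\<^esub> h g)"
    using K(2) by (intro N.finsum_cong') (auto simp: lookup_add frag_pow(2) h intro!: N.a_closed frag_pow(1) h)
  also have "\<dots> = frag_eval N h u \<oplus>\<^bsub>N\<^esub> frag_eval N h v"
    using K(2) by (subst N.finsum_addf)
      (auto simp: frag_eval_superset [OF K(1) _ K(2)] intro!: frag_pow(1) h)
  finally show ?thesis .
qed

lemma frag_eval_0: "frag_eval N h 0 = \<zero>\<^bsub>N\<^esub>"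
  by (simp add: frag_eval_def)

lemma frag_eval_diff:
  assumes "Poly_Mapping.keys u \<subseteq> S" "Poly_Mapping.keys v \<subseteq> S"
  shows "frag_eval N h (u - v) = frag_eval N h u \<ominus>\<^bsub>N\<^esub> frag_eval N h v"
proof -
  have k: "Poly_Mapping.keys (u - v) \<subseteq> S" using keys_diff [of u v] assms by auto
  have "frag_eval N h (u - v) \<oplus>\<^bsub>N\<^esub> frag_eval N h v = frag_eval N h u"
    using frag_eval_add [OF k assms(2)] by simp
  then show ?thesis
    using frag_eval_closed k assms by (metis a_minus_def N.add.inv_closed N.add.m_assoc N.add.r_inv N.add.r_one)
qed

lemma frag_eval_of: "g \<in> S \<Longrightarrow> frag_eval N h (frag_of g) = h g"
  by (simp add: frag_eval_def frag_pow(4) h)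

lemma frag_eval_closure:
  assumes "\<And>v. v \<in> R \<Longrightarrow> Poly_Mapping.keys v \<subseteq> S" "\<And>v. v \<in> R \<Longrightarrow> frag_eval N h v = \<zero>\<^bsub>N\<^esub>" "v \<in> group_closure R"
  shows "frag_eval N h v = \<zero>\<^bsub>N\<^esub> \<and> Poly_Mapping.keys v \<subseteq> S"
  using assms(3)
proof (induction rule: group_closure.induct)
  case (base s)
  then show ?case using assms frag_eval_0 by auto
next
  case (diff s t)
  then show ?case using frag_eval_diff [of s t] keys_diff [of s t] by (auto simp: N.r_neg a_minus_def)
qed

end

text \<open>Evaluation vanishes on the subgroup generated by the relators, hence is constant on a
  class. This makes \<open>the_elem\<close> in \<open>pres_lift\<close> meaningful.\<close>

lemma pres_lift_class:
  fixes N :: "('a, 'm) bimodule"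
  assumes N: "abelian_group N" and h: "\<And>g. g \<in> S \<Longrightarrow> h g \<in> carrier N"
    and R: "\<And>v. v \<in> R \<Longrightarrow> Poly_Mapping.keys v \<subseteq> S" "\<And>v. v \<in> R \<Longrightarrow> frag_eval N h v = \<zero>\<^bsub>N\<^esub>"
    and u: "Poly_Mapping.keys u \<subseteq> S"
  shows "pres_lift N h (pres_class R u) = frag_eval N h u"
proof -
  interpret N: abelian_group N by (rule N)
  have "frag_eval N h v = frag_eval N h u" if "v \<in> pres_class R u" for v
  proof -
    have 1: "frag_eval N h (v - u) = \<zero>\<^bsub>N\<^esub>" "Poly_Mapping.keys (v - u) \<subseteq> S"
      using frag_eval_closure [of N S h R "v - u", OF N h R] that by (auto simp: in_pres_class_iff)
    have "frag_eval N h ((v - u) + u) = \<zero>\<^bsub>N\<^esub> \<oplus>\<^bsub>N\<^esub> frag_eval N h u"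
      using frag_eval_add [of N S h, OF N h 1(2) u] 1(1) by simp
    then show ?thesis using frag_eval_closed [of N S h, OF N h u] by simp
  qed
  then have "frag_eval N h ` pres_class R u = (\<lambda>_. frag_eval N h u) ` pres_class R u"
    by (rule image_cong [OF refl])
  also have "\<dots> = {frag_eval N h u}"
    by (rule image_constant [of u]) (simp add: in_pres_class_iff)
  finally have "frag_eval N h ` pres_class R u = {frag_eval N h u}" .
  then show ?thesis unfolding pres_lift_def by (simp add: frag_eval_def [abs_def])
qed

lemma ring_bimod_act_diff:
  fixes M :: "('a::{ring,monoid_mult}, 'm) bimodule"
  assumes M: "ring_bimod M" and xy: "x \<in> carrier M" "y \<in> carrier M"
  shows "a \<odot>\<^bsub>M\<^esub> (x \<ominus>\<^bsub>M\<^esub> y) = a \<odot>\<^bsub>M\<^esub> x \<ominus>\<^bsub>M\<^esub> a \<odot>\<^bsub>M\<^esub> y"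
    and "(x \<ominus>\<^bsub>M\<^esub> y) \<bullet>\<^bsub>M\<^esub> a = x \<bullet>\<^bsub>M\<^esub> a \<ominus>\<^bsub>M\<^esub> y \<bullet>\<^bsub>M\<^esub> a"
proof -
  have c: "component (embed (0, M) x) (0, M) = x" "component (embed (0, M) y) (0, M) = y"
    using M xy by (simp_all add: component_embed)
  show "a \<odot>\<^bsub>M\<^esub> (x \<ominus>\<^bsub>M\<^esub> y) = a \<odot>\<^bsub>M\<^esub> x \<ominus>\<^bsub>M\<^esub> a \<odot>\<^bsub>M\<^esub> y"
    using arg_cong [OF T.l_diff [of a "embed (0, M) x" "embed (0, M) y"], of "\<lambda>u. component u (0, M)"]
    by (simp add: component_l component_diff M c)
  show "(x \<ominus>\<^bsub>M\<^esub> y) \<bullet>\<^bsub>M\<^esub> a = x \<bullet>\<^bsub>M\<^esub> a \<ominus>\<^bsub>M\<^esub> y \<bullet>\<^bsub>M\<^esub> a"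
    using arg_cong [OF T.r_diff [of "embed (0, M) x" "embed (0, M) y" a], of "\<lambda>u. component u (0, M)"]
    by (simp add: component_r component_diff M c)
qed

text \<open>What generators and relators have to satisfy for \<open>pres_bimod\<close> to be a
  bimodule. Unit and associativity laws hold for the generators themselves, additivity in the
  algebra element only modulo relators.\<close>

locale presentation =
  fixes S :: "'g set" and R :: "('g \<Rightarrow>\<^sub>0 int) set"
    and l :: "'a::{ring,monoid_mult} \<Rightarrow> 'g \<Rightarrow> 'g" and r :: "'g \<Rightarrow> 'a \<Rightarrow> 'g"
  assumes R_S: "v \<in> R \<Longrightarrow> Poly_Mapping.keys v \<subseteq> S"
    and l_S: "g \<in> S \<Longrightarrow> l a g \<in> S" and r_S: "g \<in> S \<Longrightarrow> r g a \<in> S"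
    and l_R: "v \<in> R \<Longrightarrow> frag_extend (\<lambda>g. frag_of (l a g)) v \<in> group_closure R"
    and r_R: "v \<in> R \<Longrightarrow> frag_extend (\<lambda>g. frag_of (r g a)) v \<in> group_closure R"
    and l_sum: "g \<in> S \<Longrightarrow> frag_of (l (a + b) g) - frag_of (l a g) - frag_of (l b g) \<in> group_closure R"
    and r_sum: "g \<in> S \<Longrightarrow> frag_of (r g (a + b)) - frag_of (r g a) - frag_of (r g b) \<in> group_closure R"
    and l_mult: "g \<in> S \<Longrightarrow> l (a * b) g = l a (l b g)" and r_mult: "g \<in> S \<Longrightarrow> r g (a * b) = r (r g a) b"
    and l_1: "g \<in> S \<Longrightarrow> l 1 g = g" and r_1: "g \<in> S \<Longrightarrow> r g 1 = g"
    and l_r_comm: "g \<in> S \<Longrightarrow> r (l a g) b = l a (r g b)"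
begin

abbreviation M :: "('a, ('g \<Rightarrow>\<^sub>0 int) set) bimodule" where "M \<equiv> pres_bimod S R l r"
abbreviation gen :: "'g \<Rightarrow> ('g \<Rightarrow>\<^sub>0 int) set" where "gen g \<equiv> pres_class R (frag_of g)"

lemma M_simps: "carrier M = {pres_class R u |u. Poly_Mapping.keys u \<subseteq> S}" "\<zero>\<^bsub>M\<^esub> = pres_class R 0"
  "pres_class R u \<oplus>\<^bsub>M\<^esub> pres_class R v = pres_class R (u + v)"
  "a \<odot>\<^bsub>M\<^esub> pres_class R u = pres_class R (frag_extend (\<lambda>g. frag_of (l a g)) u)"
  "pres_class R u \<bullet>\<^bsub>M\<^esub> a = pres_class R (frag_extend (\<lambda>g. frag_of (r g a)) u)"
  by (simp_all add: pres_bimod_def pres_class_add pres_class_UN l_R r_R)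

lemma group: "abelian_group M"
proof (rule abelian_groupI)
  fix x y z assume x: "x \<in> carrier M" and y: "y \<in> carrier M"
  then show "x \<oplus>\<^bsub>M\<^esub> y \<in> carrier M"
    using Poly_Mapping.keys_add by (fastforce simp: M_simps(1,3))
  show "x \<oplus>\<^bsub>M\<^esub> y = y \<oplus>\<^bsub>M\<^esub> x" using x y by (auto simp: M_simps(1,3) add.commute)
  show "\<zero>\<^bsub>M\<^esub> \<oplus>\<^bsub>M\<^esub> x = x" using x by (auto simp: M_simps(1-3))
  obtain u where u: "x = pres_class R u" "Poly_Mapping.keys u \<subseteq> S" using x by (auto simp: M_simps(1))
  have "Poly_Mapping.keys (- u) \<subseteq> S" using u(2) by simp
  then have "pres_class R (- u) \<in> carrier M" unfolding M_simps(1) by blast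
  then show "\<exists>y\<in>carrier M. y \<oplus>\<^bsub>M\<^esub> x = \<zero>\<^bsub>M\<^esub>"
    by (rule rev_bexI) (simp add: u(1) M_simps(2,3))
  assume "z \<in> carrier M"
  then show "x \<oplus>\<^bsub>M\<^esub> y \<oplus>\<^bsub>M\<^esub> z = x \<oplus>\<^bsub>M\<^esub> (y \<oplus>\<^bsub>M\<^esub> z)"
    using x y by (auto simp: M_simps(1,3) add.assoc)
next
  show "\<zero>\<^bsub>M\<^esub> \<in> carrier M" by (force simp: M_simps(1,2))
qed

lemma class_diff:
  assumes "Poly_Mapping.keys u \<subseteq> S" "Poly_Mapping.keys v \<subseteq> S"
  shows "pres_class R u \<ominus>\<^bsub>M\<^esub> pres_class R v = pres_class R (u - v)"
proof -
  interpret M: abelian_group M by (rule group)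
  have k: "Poly_Mapping.keys (u - v) \<subseteq> S" using keys_diff [of u v] assms by auto
  have c: "pres_class R (u - v) \<in> carrier M" "pres_class R v \<in> carrier M" using assms k by (auto simp: M_simps(1))
  have "pres_class R (u - v) \<oplus>\<^bsub>M\<^esub> pres_class R v = pres_class R u" by (simp add: M_simps(3))
  with c show ?thesis
    by (metis a_minus_def M.add.inv_closed M.add.m_assoc M.add.r_inv M.add.r_one)
qed

lemma gen_closed: "g \<in> S \<Longrightarrow> gen g \<in> carrier M"
  by (force simp: M_simps(1))

lemma gen_l: "a \<odot>\<^bsub>M\<^esub> gen g = gen (l a g)" and gen_r: "gen g \<bullet>\<^bsub>M\<^esub> a = gen (r g a)"
  by (simp_all add: M_simps)

lemma gen_eq: "frag_of g - frag_of g' \<in> R \<Longrightarrow> gen g = gen g'"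
  by (simp add: pres_class_eq_iff group_closure.base)

lemma gen_add: "frag_of g - frag_of g1 - frag_of g2 \<in> R \<Longrightarrow> gen g = gen g1 \<oplus>\<^bsub>M\<^esub> gen g2"
  by (simp add: M_simps(3) pres_class_eq_iff group_closure.base diff_diff_eq)

lemma carrier_induct [consumes 1, case_names zero gen diff]:
  assumes "x \<in> carrier M" "Q \<zero>\<^bsub>M\<^esub>" "\<And>g. g \<in> S \<Longrightarrow> Q (gen g)"
    "\<And>x y. x \<in> carrier M \<Longrightarrow> y \<in> carrier M \<Longrightarrow> Q x \<Longrightarrow> Q y \<Longrightarrow> Q (x \<ominus>\<^bsub>M\<^esub> y)"
  shows "Q x"
proof -
  obtain u where u: "x = pres_class R u" "Poly_Mapping.keys u \<subseteq> S" using assms(1) by (auto simp: M_simps(1))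
  have "Poly_Mapping.keys u \<subseteq> S \<and> Q (pres_class R u)"
    using u(2)
  proof (induction u rule: frag_induction)
    case zero
    then show ?case using assms(2) by (simp add: M_simps(2))
  next
    case (one x)
    then show ?case using assms(3) by simp
  next
    case (diff a b)
    then have k: "Poly_Mapping.keys a \<subseteq> S" "Poly_Mapping.keys b \<subseteq> S" by auto
    then have "Poly_Mapping.keys (a - b) \<subseteq> S" using keys_diff [of a b] by auto
    moreover have "pres_class R a \<in> carrier M" "pres_class R b \<in> carrier M" using k by (auto simp: M_simps(1))
    ultimately show ?case using assms(4) [of "pres_class R a" "pres_class R b"] diff k by (simp add: class_diff)
  qed
  then show ?thesis using u by simp
qed

lemma ring_bimod: "ring_bimod M"
proof -
  have ext: "frag_extend f u - frag_extend f1 u - frag_extend f2 u \<in> group_closure R"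
    if "\<And>g. g \<in> S \<Longrightarrow> f g - f1 g - f2 g \<in> group_closure R" "Poly_Mapping.keys u \<subseteq> S"
    for f f1 f2 :: "'g \<Rightarrow> 'g \<Rightarrow>\<^sub>0 int" and u
    using that(2)
  proof (induction u rule: frag_induction)
    case (one x)
    then show ?case by (simp add: that(1))
  next
    case (diff a b)
    from group_closure.diff [OF diff.IH] show ?case by (simp add: frag_extend_diff algebra_simps)
  qed simp
  have eq: "frag_extend f u = frag_extend f' u" if "\<And>g. g \<in> S \<Longrightarrow> f g = f' g" "Poly_Mapping.keys u \<subseteq> S"
    for f f' :: "'g \<Rightarrow> 'g \<Rightarrow>\<^sub>0 int" and u
    using that by (intro frag_extend_eq) auto
  have comp: "frag_extend f (frag_extend (\<lambda>g. frag_of (k g)) u) = frag_extend (\<lambda>g. f (k g)) u"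
    for f :: "'g \<Rightarrow> 'g \<Rightarrow>\<^sub>0 int" and k u
    using frag_extend_compose [of f k u] by (simp add: o_def)
  have keys: "Poly_Mapping.keys (frag_extend (\<lambda>g. frag_of (k g)) u) \<subseteq> S"
    if "\<And>g. g \<in> S \<Longrightarrow> k g \<in> S" "Poly_Mapping.keys u \<subseteq> S" for k u
    using keys_frag_extend [of "\<lambda>g. frag_of (k g)" u] that by auto
  have 1: "a \<odot>\<^bsub>M\<^esub> x \<in> carrier M \<and> x \<bullet>\<^bsub>M\<^esub> a \<in> carrier M \<and>
      (a + b) \<odot>\<^bsub>M\<^esub> x = a \<odot>\<^bsub>M\<^esub> x \<oplus>\<^bsub>M\<^esub> b \<odot>\<^bsub>M\<^esub> x \<and> x \<bullet>\<^bsub>M\<^esub> (a + b) = x \<bullet>\<^bsub>M\<^esub> a \<oplus>\<^bsub>M\<^esub> x \<bullet>\<^bsub>M\<^esub> b \<and>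
      (a * b) \<odot>\<^bsub>M\<^esub> x = a \<odot>\<^bsub>M\<^esub> (b \<odot>\<^bsub>M\<^esub> x) \<and> x \<bullet>\<^bsub>M\<^esub> (a * b) = (x \<bullet>\<^bsub>M\<^esub> a) \<bullet>\<^bsub>M\<^esub> b \<and>
      (a \<odot>\<^bsub>M\<^esub> x) \<bullet>\<^bsub>M\<^esub> b = a \<odot>\<^bsub>M\<^esub> (x \<bullet>\<^bsub>M\<^esub> b) \<and> 1 \<odot>\<^bsub>M\<^esub> x = x \<and> x \<bullet>\<^bsub>M\<^esub> 1 = x" if xM: "x \<in> carrier M" for x a b
  proof -
    obtain u where x: "x = pres_class R u" and u: "Poly_Mapping.keys u \<subseteq> S" using xM by (auto simp: M_simps(1))
    have "a \<odot>\<^bsub>M\<^esub> x \<in> carrier M" and "x \<bullet>\<^bsub>M\<^esub> a \<in> carrier M"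
      unfolding x M_simps using keys [of "l a" u] keys [of "\<lambda>g. r g a" u] u by (auto simp: l_S r_S)
    moreover have e: "frag_extend (\<lambda>g. frag_of (l (a + b) g)) u - frag_extend (\<lambda>g. frag_of (l a g)) u
         - frag_extend (\<lambda>g. frag_of (l b g)) u \<in> group_closure R"
      "frag_extend (\<lambda>g. frag_of (r g (a + b))) u - frag_extend (\<lambda>g. frag_of (r g a)) u
         - frag_extend (\<lambda>g. frag_of (r g b)) u \<in> group_closure R"
      by (rule ext [OF l_sum u], assumption) (rule ext [OF r_sum u], assumption)
    moreover have "frag_extend (\<lambda>g. frag_of (l 1 g)) u = u" "frag_extend (\<lambda>g. frag_of (r g 1)) u = u"
      using eq [of "\<lambda>g. frag_of (l 1 g)" frag_of u] eq [of "\<lambda>g. frag_of (r g 1)" frag_of u] u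
      by (simp_all add: l_1 r_1 flip: frag_expansion)
    moreover have "frag_extend (\<lambda>g. frag_of (l (a * b) g)) u = frag_extend (\<lambda>g. frag_of (l a (l b g))) u"
       "frag_extend (\<lambda>g. frag_of (r g (a * b))) u = frag_extend (\<lambda>g. frag_of (r (r g a) b)) u"
       "frag_extend (\<lambda>g. frag_of (r (l a g) b)) u = frag_extend (\<lambda>g. frag_of (l a (r g b))) u"
      using u by (auto intro!: eq simp: l_mult r_mult l_r_comm)
    ultimately show ?thesis
      by (simp add: x M_simps(2-) comp pres_class_eq_iff diff_diff_eq)
  qed
  have 2: "a \<odot>\<^bsub>M\<^esub> (x \<oplus>\<^bsub>M\<^esub> y) = a \<odot>\<^bsub>M\<^esub> x \<oplus>\<^bsub>M\<^esub> a \<odot>\<^bsub>M\<^esub> y \<and> (x \<oplus>\<^bsub>M\<^esub> y) \<bullet>\<^bsub>M\<^esub> a = x \<bullet>\<^bsub>M\<^esub> a \<oplus>\<^bsub>M\<^esub> y \<bullet>\<^bsub>M\<^esub> a"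
    if "x \<in> carrier M" "y \<in> carrier M" for x y a
    using that by (auto simp: M_simps(1)) (simp_all add: M_simps(3-) frag_extend_add)
  show ?thesis unfolding ring_bimod_def by (intro conjI group ballI allI) (simp_all only: 1 2)
qed

context
  fixes N :: "('b, 'm) bimodule" and h :: "'g \<Rightarrow> 'm"
  assumes N: "abelian_group N" and h: "\<And>g. g \<in> S \<Longrightarrow> h g \<in> carrier N"
    and kills: "\<And>v. v \<in> R \<Longrightarrow> frag_eval N h v = \<zero>\<^bsub>N\<^esub>"
begin

lemma lift_class: "Poly_Mapping.keys u \<subseteq> S \<Longrightarrow> pres_lift N h (pres_class R u) = frag_eval N h u"
  by (rule pres_lift_class [OF N h R_S kills])

lemma lift_gen: "g \<in> S \<Longrightarrow> pres_lift N h (gen g) = h g"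
  using lift_class [of "frag_of g"] frag_eval_of [of N S h, OF N h] by simp

lemma lift_closed: "x \<in> carrier M \<Longrightarrow> pres_lift N h x \<in> carrier N"
  using frag_eval_closed [of N S h, OF N h] by (auto simp: M_simps(1) lift_class)

lemma lift_add: "x \<in> carrier M \<Longrightarrow> y \<in> carrier M \<Longrightarrow> pres_lift N h (x \<oplus>\<^bsub>M\<^esub> y) = pres_lift N h x \<oplus>\<^bsub>N\<^esub> pres_lift N h y"
proof -
  assume "x \<in> carrier M" "y \<in> carrier M"
  then obtain u v where *: "x = pres_class R u" "y = pres_class R v" "Poly_Mapping.keys u \<subseteq> S" "Poly_Mapping.keys v \<subseteq> S"
    by (auto simp: M_simps(1))
  then have "Poly_Mapping.keys (u + v) \<subseteq> S" using Poly_Mapping.keys_add [of u v] by auto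
  with * show ?thesis using frag_eval_add [of N S h, OF N h] by (simp add: M_simps(3) lift_class)
qed

lemma lift_zero: "pres_lift N h \<zero>\<^bsub>M\<^esub> = \<zero>\<^bsub>N\<^esub>"
  using frag_eval_0 [of N S h, OF N h] by (simp add: M_simps(2) lift_class)

lemma lift_diff: "x \<in> carrier M \<Longrightarrow> y \<in> carrier M \<Longrightarrow> pres_lift N h (x \<ominus>\<^bsub>M\<^esub> y) = pres_lift N h x \<ominus>\<^bsub>N\<^esub> pres_lift N h y"
proof -
  assume "x \<in> carrier M" "y \<in> carrier M"
  then obtain u v where *: "x = pres_class R u" "y = pres_class R v" "Poly_Mapping.keys u \<subseteq> S" "Poly_Mapping.keys v \<subseteq> S"
    by (auto simp: M_simps(1))
  then have "Poly_Mapping.keys (u - v) \<subseteq> S" using keys_diff [of u v] by auto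
  with * show ?thesis using frag_eval_diff [of N S h, OF N h] by (simp add: class_diff lift_class)
qed

end

lemma lift_hom:
  assumes N: "ring_bimod N" and h: "\<And>g. g \<in> S \<Longrightarrow> h g \<in> carrier N"
    and kills: "\<And>v. v \<in> R \<Longrightarrow> frag_eval N h v = \<zero>\<^bsub>N\<^esub>"
    and eq: "\<And>g a. g \<in> S \<Longrightarrow> h (l a g) = a \<odot>\<^bsub>N\<^esub> h g" "\<And>g a. g \<in> S \<Longrightarrow> h (r g a) = h g \<bullet>\<^bsub>N\<^esub> a"
  shows "pres_lift N h \<in> bimod_hom M N"
proof -
  note L = ring_bimod_group [OF N] h kills
  have "pres_lift N h (a \<odot>\<^bsub>M\<^esub> x) = a \<odot>\<^bsub>N\<^esub> pres_lift N h x \<and> pres_lift N h (x \<bullet>\<^bsub>M\<^esub> a) = pres_lift N h x \<bullet>\<^bsub>N\<^esub> a"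
    if "x \<in> carrier M" for x a
    using that
  proof (induction rule: carrier_induct)
    case zero
    show ?case by (simp add: ring_bimod_act_zero [OF ring_bimod] ring_bimod_act_zero [OF N] lift_zero [OF L])
  next
    case (gen g)
    then show ?case by (simp add: gen_l gen_r lift_gen [OF L] l_S r_S eq)
  next
    case (diff x y)
    then show ?case
      by (simp add: diff ring_bimod_act_diff [OF ring_bimod] ring_bimod_act_diff [OF N] lift_diff [OF L] lift_closed [OF L]
          ring_bimod_l [OF ring_bimod] ring_bimod_r [OF ring_bimod])
  qed
  then show ?thesis by (simp add: bimod_hom_def lift_add [OF L] lift_closed [OF L])
qed

end

lemma ring_bimod_minus_zero: "ring_bimod M \<Longrightarrow> \<ominus>\<^bsub>M\<^esub> \<zero>\<^bsub>M\<^esub> = \<zero>\<^bsub>M\<^esub>"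
  using component_minus [of M 0 0] component_zero [of M 0] by simp

lemma msigned_closed: "ring_bimod M \<Longrightarrow> x \<in> carrier M \<Longrightarrow> msigned M k x \<in> carrier M"
  by (simp add: msigned_def ring_bimod_minus)

text \<open>All relators of tensor products, free bimodules and the bar resolution have one of two
  shapes, balancing (two generators) or additivity (three generators).\<close>

lemma frag_eval_relator:
  assumes N: "abelian_group N" and h: "\<And>g. g \<in> S \<Longrightarrow> h g \<in> carrier N" and S: "g1 \<in> S" "g2 \<in> S"
  shows "h g1 = h g2 \<Longrightarrow> frag_eval N h (frag_of g1 - frag_of g2) = \<zero>\<^bsub>N\<^esub>"
    and "g3 \<in> S \<Longrightarrow> h g1 = h g2 \<oplus>\<^bsub>N\<^esub> h g3 \<Longrightarrow> frag_eval N h (frag_of g1 - frag_of g2 - frag_of g3) = \<zero>\<^bsub>N\<^esub>"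
proof -
  interpret N: abelian_group N by (rule N)
  have k: "Poly_Mapping.keys (frag_of g) \<subseteq> S" if "g \<in> S" for g using that by simp
  have k2: "Poly_Mapping.keys (frag_of g1 - frag_of g2) \<subseteq> S"
    using keys_diff [of "frag_of g1" "frag_of g2"] S by auto
  note d = frag_eval_diff [of N S h, OF N h] and o = frag_eval_of [of N S h, OF N h]
  show "h g1 = h g2 \<Longrightarrow> frag_eval N h (frag_of g1 - frag_of g2) = \<zero>\<^bsub>N\<^esub>"
    using S by (simp add: d [OF _ k k] o h a_minus_def N.r_neg)
  assume "g3 \<in> S" "h g1 = h g2 \<oplus>\<^bsub>N\<^esub> h g3"
  then show "frag_eval N h (frag_of g1 - frag_of g2 - frag_of g3) = \<zero>\<^bsub>N\<^esub>"
    using S by (simp add: d [OF _ k2 k] d [OF _ k k] o h a_minus_def)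
      (metis N.a_assoc N.a_comm N.add.inv_closed N.r_neg N.r_zero h)
qed

lemma keys_relator:
  "g1 \<in> S \<Longrightarrow> g2 \<in> S \<Longrightarrow> Poly_Mapping.keys (frag_of g1 - frag_of g2) \<subseteq> S"
  "g1 \<in> S \<Longrightarrow> g2 \<in> S \<Longrightarrow> g3 \<in> S \<Longrightarrow> Poly_Mapping.keys (frag_of g1 - frag_of g2 - frag_of g3) \<subseteq> S"
  using keys_diff [of "frag_of g1" "frag_of g2"] keys_diff [of "frag_of g1 - frag_of g2" "frag_of g3"]
  by auto

section \<open>Tensor products\<close>

lemma ring_bimod_distrib:
  assumes "ring_bimod M" "x \<in> carrier M"
  shows "y \<in> carrier M \<Longrightarrow> a \<odot>\<^bsub>M\<^esub> (x \<oplus>\<^bsub>M\<^esub> y) = a \<odot>\<^bsub>M\<^esub> x \<oplus>\<^bsub>M\<^esub> a \<odot>\<^bsub>M\<^esub> y"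
    "y \<in> carrier M \<Longrightarrow> (x \<oplus>\<^bsub>M\<^esub> y) \<bullet>\<^bsub>M\<^esub> a = x \<bullet>\<^bsub>M\<^esub> a \<oplus>\<^bsub>M\<^esub> y \<bullet>\<^bsub>M\<^esub> a"
    "(a + b) \<odot>\<^bsub>M\<^esub> x = a \<odot>\<^bsub>M\<^esub> x \<oplus>\<^bsub>M\<^esub> b \<odot>\<^bsub>M\<^esub> x" "x \<bullet>\<^bsub>M\<^esub> (a + b) = x \<bullet>\<^bsub>M\<^esub> a \<oplus>\<^bsub>M\<^esub> x \<bullet>\<^bsub>M\<^esub> b"
    "(a * b) \<odot>\<^bsub>M\<^esub> x = a \<odot>\<^bsub>M\<^esub> (b \<odot>\<^bsub>M\<^esub> x)" "x \<bullet>\<^bsub>M\<^esub> (a * b) = (x \<bullet>\<^bsub>M\<^esub> a) \<bullet>\<^bsub>M\<^esub> b"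
    "(a \<odot>\<^bsub>M\<^esub> x) \<bullet>\<^bsub>M\<^esub> b = a \<odot>\<^bsub>M\<^esub> (x \<bullet>\<^bsub>M\<^esub> b)" "1 \<odot>\<^bsub>M\<^esub> x = x" "x \<bullet>\<^bsub>M\<^esub> 1 = x"
  using assms by (simp_all add: ring_bimod_def)

abbreviation tensor_gens where
  "tensor_gens P Q n \<equiv> {(i, x, y). x \<in> carrier (cmod P i) \<and> y \<in> carrier (cmod Q (n - i))}"

context
  fixes P :: "('a::{ring,monoid_mult}, 'p) bimod_complex" and Q :: "('a, 'q) bimod_complex"
  assumes P: "graded_bimod P" and Q: "graded_bimod Q"
begin

lemma rbP: "ring_bimod (cmod P i)" and rbQ: "ring_bimod (cmod Q i)"
  using P Q by (simp_all add: graded_ring_bimod)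

lemma tensor_relE:
  assumes "v \<in> tensor_rel P Q n"
  obtains (left) i x x' y where "v = frag_of (i, x \<oplus>\<^bsub>cmod P i\<^esub> x', y) - frag_of (i, x, y) - frag_of (i, x', y)"
      "x \<in> carrier (cmod P i)" "x' \<in> carrier (cmod P i)" "y \<in> carrier (cmod Q (n - i))"
    | (right) i x y y' where "v = frag_of (i, x, y \<oplus>\<^bsub>cmod Q (n - i)\<^esub> y') - frag_of (i, x, y) - frag_of (i, x, y')"
      "x \<in> carrier (cmod P i)" "y \<in> carrier (cmod Q (n - i))" "y' \<in> carrier (cmod Q (n - i))"
    | (mid) i x a y where "v = frag_of (i, x \<bullet>\<^bsub>cmod P i\<^esub> a, y) - frag_of (i, x, a \<odot>\<^bsub>cmod Q (n - i)\<^esub> y)"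
      "x \<in> carrier (cmod P i)" "y \<in> carrier (cmod Q (n - i))"
  using assms unfolding tensor_rel_def by blast

lemma tensor_relI:
  "x \<in> carrier (cmod P i) \<Longrightarrow> x' \<in> carrier (cmod P i) \<Longrightarrow> y \<in> carrier (cmod Q (n - i)) \<Longrightarrow>
    frag_of (i, x \<oplus>\<^bsub>cmod P i\<^esub> x', y) - frag_of (i, x, y) - frag_of (i, x', y) \<in> tensor_rel P Q n"
  "x \<in> carrier (cmod P i) \<Longrightarrow> y \<in> carrier (cmod Q (n - i)) \<Longrightarrow> y' \<in> carrier (cmod Q (n - i)) \<Longrightarrow>
    frag_of (i, x, y \<oplus>\<^bsub>cmod Q (n - i)\<^esub> y') - frag_of (i, x, y) - frag_of (i, x, y') \<in> tensor_rel P Q n"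
  "x \<in> carrier (cmod P i) \<Longrightarrow> y \<in> carrier (cmod Q (n - i)) \<Longrightarrow>
    frag_of (i, x \<bullet>\<^bsub>cmod P i\<^esub> a, y) - frag_of (i, x, a \<odot>\<^bsub>cmod Q (n - i)\<^esub> y) \<in> tensor_rel P Q n"
  unfolding tensor_rel_def by blast+

lemma tensor_presentation: "presentation (tensor_gens P Q n) (tensor_rel P Q n)
    (\<lambda>a (i, x, y). (i, a \<odot>\<^bsub>cmod P i\<^esub> x, y)) (\<lambda>(i, x, y) a. (i, x, y \<bullet>\<^bsub>cmod Q (n - i)\<^esub> a))"
proof
  fix v assume v: "v \<in> tensor_rel P Q n"
  then show "Poly_Mapping.keys v \<subseteq> tensor_gens P Q n"
    by (cases rule: tensor_relE; simp only:; intro keys_relator)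
      (auto simp: rbP rbQ ring_bimod_add ring_bimod_l ring_bimod_r)
  fix a
  note c = rbP rbQ ring_bimod_l ring_bimod_r
  show "frag_extend (\<lambda>g. frag_of ((\<lambda>(i, x, y). (i, a \<odot>\<^bsub>cmod P i\<^esub> x, y)) g)) v \<in> group_closure (tensor_rel P Q n)"
    using v
  proof (cases rule: tensor_relE)
    case (left i x x' y)
    then show ?thesis
      using tensor_relI(1) [of "a \<odot>\<^bsub>cmod P i\<^esub> x" i "a \<odot>\<^bsub>cmod P i\<^esub> x'" y]
      by (simp add: frag_extend_diff c ring_bimod_distrib group_closure.base)
  next
    case (right i x y y')
    then show ?thesis
      using tensor_relI(2) [of "a \<odot>\<^bsub>cmod P i\<^esub> x" i y n y'] by (simp add: frag_extend_diff c group_closure.base)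
  next
    case (mid i x b y)
    then show ?thesis
      using tensor_relI(3) [of "a \<odot>\<^bsub>cmod P i\<^esub> x" i y n b]
      by (simp add: frag_extend_diff c ring_bimod_distrib(7) group_closure.base)
  qed
  show "frag_extend (\<lambda>g. frag_of ((\<lambda>(i, x, y) a. (i, x, y \<bullet>\<^bsub>cmod Q (n - i)\<^esub> a)) g a)) v \<in> group_closure (tensor_rel P Q n)"
    using v
  proof (cases rule: tensor_relE)
    case (left i x x' y)
    then show ?thesis
      using tensor_relI(1) [of x i x' "y \<bullet>\<^bsub>cmod Q (n - i)\<^esub> a"] by (simp add: frag_extend_diff c group_closure.base)
  next
    case (right i x y y')
    then show ?thesis
      using tensor_relI(2) [of x i "y \<bullet>\<^bsub>cmod Q (n - i)\<^esub> a" n "y' \<bullet>\<^bsub>cmod Q (n - i)\<^esub> a"]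
      by (simp add: frag_extend_diff c ring_bimod_distrib group_closure.base)
  next
    case (mid i x b y)
    then show ?thesis
      using tensor_relI(3) [of x i "y \<bullet>\<^bsub>cmod Q (n - i)\<^esub> a" n b]
      by (simp add: frag_extend_diff c ring_bimod_distrib(7) group_closure.base)
  qed
next
  fix g :: "int \<times> 'p \<times> 'q" and a b
  assume g: "g \<in> tensor_gens P Q n"
  then obtain i x y where gi: "g = (i, x, y)" "x \<in> carrier (cmod P i)" "y \<in> carrier (cmod Q (n - i))" by auto
  show "frag_of ((\<lambda>(i, x, y). (i, (a + b) \<odot>\<^bsub>cmod P i\<^esub> x, y)) g) - frag_of ((\<lambda>(i, x, y). (i, a \<odot>\<^bsub>cmod P i\<^esub> x, y)) g)
      - frag_of ((\<lambda>(i, x, y). (i, b \<odot>\<^bsub>cmod P i\<^esub> x, y)) g) \<in> group_closure (tensor_rel P Q n)"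
    using tensor_relI(1) [of "a \<odot>\<^bsub>cmod P i\<^esub> x" i "b \<odot>\<^bsub>cmod P i\<^esub> x" y] gi
    by (simp add: rbP ring_bimod_l ring_bimod_distrib group_closure.base)
  show "frag_of ((\<lambda>(i, x, y) a. (i, x, y \<bullet>\<^bsub>cmod Q (n - i)\<^esub> a)) g (a + b)) - frag_of ((\<lambda>(i, x, y) a. (i, x, y \<bullet>\<^bsub>cmod Q (n - i)\<^esub> a)) g a)
      - frag_of ((\<lambda>(i, x, y) a. (i, x, y \<bullet>\<^bsub>cmod Q (n - i)\<^esub> a)) g b) \<in> group_closure (tensor_rel P Q n)"
    using tensor_relI(2) [of x i "y \<bullet>\<^bsub>cmod Q (n - i)\<^esub> a" n "y \<bullet>\<^bsub>cmod Q (n - i)\<^esub> b"] gi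
    by (simp add: rbQ ring_bimod_r ring_bimod_distrib group_closure.base)
qed (auto simp: rbP rbQ ring_bimod_l ring_bimod_r ring_bimod_distrib)

lemmas tensor_ring_bimod = presentation.ring_bimod [OF tensor_presentation, folded tensor_mod_def]

lemma tensor_kills:
  fixes N :: "('b, 'm) bimodule"
  assumes N: "abelian_group N"
    and c: "\<And>i x y. x \<in> carrier (cmod P i) \<Longrightarrow> y \<in> carrier (cmod Q (n - i)) \<Longrightarrow> h i x y \<in> carrier N"
    and l: "\<And>i x x' y. x \<in> carrier (cmod P i) \<Longrightarrow> x' \<in> carrier (cmod P i) \<Longrightarrow> y \<in> carrier (cmod Q (n - i)) \<Longrightarrow>
      h i (x \<oplus>\<^bsub>cmod P i\<^esub> x') y = h i x y \<oplus>\<^bsub>N\<^esub> h i x' y"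
    and r: "\<And>i x y y'. x \<in> carrier (cmod P i) \<Longrightarrow> y \<in> carrier (cmod Q (n - i)) \<Longrightarrow> y' \<in> carrier (cmod Q (n - i)) \<Longrightarrow>
      h i x (y \<oplus>\<^bsub>cmod Q (n - i)\<^esub> y') = h i x y \<oplus>\<^bsub>N\<^esub> h i x y'"
    and b: "\<And>i x a y. x \<in> carrier (cmod P i) \<Longrightarrow> y \<in> carrier (cmod Q (n - i)) \<Longrightarrow>
      h i (x \<bullet>\<^bsub>cmod P i\<^esub> a) y = h i x (a \<odot>\<^bsub>cmod Q (n - i)\<^esub> y)"
    and v: "v \<in> tensor_rel P Q n"
  shows "frag_eval N (\<lambda>(i, x, y). h i x y) v = \<zero>\<^bsub>N\<^esub>"
proof -
  have c': "(\<lambda>(i, x, y). h i x y) g \<in> carrier N" if "g \<in> tensor_gens P Q n" for g using that c by auto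
  from v show ?thesis
    by (cases rule: tensor_relE)
      (auto intro!: frag_eval_relator [where S = "tensor_gens P Q n", OF N c'] simp: l r b
         rbP rbQ ring_bimod_add ring_bimod_l ring_bimod_r)
qed

end

text \<open>Makes the additive group of a type a target of \<open>pres_lift\<close>, for maps that
  are additive without being bimodule maps, such as contractions.\<close>

definition type_group :: "('a, 'z::ab_group_add) bimodule" where
  "type_group = \<lparr>carrier = UNIV, mult = undefined, one = undefined, zero = 0, add = (+),
     smult = undefined, rsmult = undefined\<rparr>"

lemma type_group_simps: "carrier type_group = UNIV" "\<zero>\<^bsub>type_group\<^esub> = 0" "x \<oplus>\<^bsub>type_group\<^esub> y = x + y"
  by (simp_all add: type_group_def)

lemma group_type_group: "abelian_group type_group"
  by (rule abelian_groupI) (auto simp: type_group_simps add.assoc add.commute intro: exI [of _ "- x" for x])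

abbreviation bimod_pairing :: "(int \<Rightarrow> ('a::{ring,monoid_mult}, 'p) total \<Rightarrow> ('a, 'q) total \<Rightarrow> ('a, 'm) total) \<Rightarrow> bool" where
  "bimod_pairing H \<equiv> bimod_tensor tl_act tr_act tl_act tr_act tl_act tr_act H"

lemma bimod_pairingI:
  assumes "\<And>i x x' y. H i (x + x') y = H i x y + H i x' y" "\<And>i x y y'. H i x (y + y') = H i x y + H i x y'"
    "\<And>i x a y. H i (tr_act x a) y = H i x (tl_act a y)"
    "\<And>i x a y. H i (tl_act a x) y = tl_act a (H i x y)" "\<And>i x a y. H i x (tr_act y a) = tr_act (H i x y) a"
  shows "bimod_pairing H"
  by (intro bimod_tensor.intro bimod_act_total bimod_tensor_axioms.intro assms)

text \<open>The class of u \<otimes> v after projection of u to degree i and of v to degree n - i.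
  Thanks to the projections it is a balanced pairing on the whole types.\<close>

definition tgen :: "('a::{ring,monoid_mult}, 'p) bimod_complex \<Rightarrow> ('a, 'q) bimod_complex \<Rightarrow> int \<Rightarrow> int
    \<Rightarrow> ('a, 'p) total \<Rightarrow> ('a, 'q) total \<Rightarrow> ('a, (int \<times> 'p \<times> 'q \<Rightarrow>\<^sub>0 int) set) total" where
  "tgen P Q n i u v = inc (tensor_complex P Q) n
     (pres_class (tensor_rel P Q n) (frag_of (i, prj P i u, prj Q (n - i) v)))"

lemma cmod_tensor [simp]: "cmod (tensor_complex P Q) n = tensor_mod P Q n"
  by (simp add: tensor_complex_def)

lemma graded_tensor: "graded_bimod P \<Longrightarrow> graded_bimod Q \<Longrightarrow> graded_bimod (tensor_complex P Q)"
  by (simp add: graded_bimod_def tensor_ring_bimod)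

context
  fixes P :: "('a::{ring,monoid_mult}, 'p) bimod_complex" and Q :: "('a, 'q) bimod_complex"
  assumes P: "graded_bimod P" and Q: "graded_bimod Q"
begin

lemma tensor_cls_closed: "x \<in> carrier (cmod P i) \<Longrightarrow> y \<in> carrier (cmod Q (n - i)) \<Longrightarrow>
    pres_class (tensor_rel P Q n) (frag_of (i, x, y)) \<in> carrier (tensor_mod P Q n)"
  unfolding tensor_mod_def
  by (rule presentation.gen_closed [OF tensor_presentation [OF P Q]]) simp

lemma tgen_inc: "x \<in> carrier (cmod P i) \<Longrightarrow> y \<in> carrier (cmod Q (n - i)) \<Longrightarrow>
    tgen P Q n i (inc P i x) (inc Q (n - i) y) = inc (tensor_complex P Q) n (pres_class (tensor_rel P Q n) (frag_of (i, x, y)))"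
  by (simp add: tgen_def prj_inc P Q)

lemma tgen_homog: "tgen P Q n i u v \<in> homog (tensor_complex P Q) n"
  unfolding tgen_def
  by (rule inc_homog [OF graded_tensor [OF P Q]]) (simp add: tensor_cls_closed prj_closed P Q)

lemma tgen_prj: "tgen P Q n i (inc P i (prj P i u)) v = tgen P Q n i u v"
  "tgen P Q n i u (inc Q (n - i) (prj Q (n - i) v)) = tgen P Q n i u v"
  by (simp_all add: tgen_def prj_inc P Q prj_closed)

lemma pairing_tgen: "bimod_pairing (tgen P Q n)"
proof (rule bimod_pairingI)
  note W = graded_tensor [OF P Q]
  note gen_add = presentation.gen_add [OF tensor_presentation [OF P Q], folded tensor_mod_def]
    and gen_eq = presentation.gen_eq [OF tensor_presentation [OF P Q], folded tensor_mod_def]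
  note c = tensor_cls_closed prj_closed P Q
  fix i x x' y y' and a :: 'a
  let ?cl = "\<lambda>x y. pres_class (tensor_rel P Q n) (frag_of (i, x, y))"
  show "tgen P Q n i (x + x') y = tgen P Q n i x y + tgen P Q n i x' y"
    unfolding tgen_def using inc_add [OF W, of "?cl (prj P i x) (prj Q (n - i) y)" n "?cl (prj P i x') (prj Q (n - i) y)"]
    by (simp add: prj_simps [OF P] gen_add [OF tensor_relI(1)] c)
  show "tgen P Q n i x (y + y') = tgen P Q n i x y + tgen P Q n i x y'"
    unfolding tgen_def using inc_add [OF W, of "?cl (prj P i x) (prj Q (n - i) y)" n "?cl (prj P i x) (prj Q (n - i) y')"]
    by (simp add: prj_simps [OF Q] gen_add [OF tensor_relI(2)] c)
  show "tgen P Q n i (tr_act x a) y = tgen P Q n i x (tl_act a y)"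
    unfolding tgen_def by (simp add: prj_simps [OF P] prj_simps [OF Q] gen_eq [OF tensor_relI(3)] c)
  show "tgen P Q n i (tl_act a x) y = tl_act a (tgen P Q n i x y)"
    unfolding tgen_def using inc_l [OF W, of "?cl (prj P i x) (prj Q (n - i) y)" n a]
    by (simp add: prj_simps [OF P] c presentation.gen_l [OF tensor_presentation [OF P Q], folded tensor_mod_def])
  show "tgen P Q n i x (tr_act y a) = tr_act (tgen P Q n i x y) a"
    unfolding tgen_def using inc_r [OF W, of "?cl (prj P i x) (prj Q (n - i) y)" n a]
    by (simp add: prj_simps [OF Q] c presentation.gen_r [OF tensor_presentation [OF P Q], folded tensor_mod_def])
qed

lemma tensor_induct [consumes 1, case_names zero tgen diff]:
  assumes "w \<in> homog (tensor_complex P Q) n" "R 0" "\<And>i u v. R (tgen P Q n i u v)"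
    "\<And>w w'. w \<in> homog (tensor_complex P Q) n \<Longrightarrow> w' \<in> homog (tensor_complex P Q) n \<Longrightarrow> R w \<Longrightarrow> R w' \<Longrightarrow> R (w - w')"
  shows "R w"
proof -
  note W = graded_tensor [OF P Q]
  obtain x where x: "w = inc (tensor_complex P Q) n x" "x \<in> carrier (tensor_mod P Q n)"
    using assms(1) by (auto simp: homog_def)
  from x(2) have "R (inc (tensor_complex P Q) n x)"
  proof (induction rule: presentation.carrier_induct [OF tensor_presentation [OF P Q], folded tensor_mod_def, consumes 1, case_names zero gen diff])
    case zero
    show ?case using inc_zero [OF W, of n] assms(2) by simp
  next
    case (gen g)
    then obtain i x y where "g = (i, x, y)" "x \<in> carrier (cmod P i)" "y \<in> carrier (cmod Q (n - i))" by auto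
    then show ?case using assms(3) [of i "inc P i x" "inc Q (n - i) y"] by (simp add: tgen_inc)
  next
    case (diff x y)
    then show ?case using inc_diff [OF W, of x n y] assms(4) inc_homog [OF W] by simp
  qed
  then show ?thesis using x by simp
qed

text \<open>Well-definedness and linearity are checked inside \<open>total\<close>, where
  \<open>embed\<close> is injective on the carrier; of \<open>h\<close> it is asked that it agrees
  with a pairing \<open>H\<close>.\<close>

lemma tensor_lift:
  fixes N :: "('a, 'm) bimodule"
  assumes N: "ring_bimod N" and H: "bimod_pairing H"
    and h: "\<And>i x y. x \<in> carrier (cmod P i) \<Longrightarrow> y \<in> carrier (cmod Q (n - i)) \<Longrightarrow>
      h i x y \<in> carrier N \<and> embed (k, N) (h i x y) = H i (inc P i x) (inc Q (n - i) y)"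
  shows "pres_lift N (\<lambda>(i, x, y). h i x y) \<in> bimod_hom (tensor_mod P Q n) N"
    and "x \<in> carrier (cmod P i) \<Longrightarrow> y \<in> carrier (cmod Q (n - i)) \<Longrightarrow>
      pres_lift N (\<lambda>(i, x, y). h i x y) (pres_class (tensor_rel P Q n) (frag_of (i, x, y))) = h i x y"
proof -
  interpret H: bimod_tensor tl_act tr_act tl_act tr_act tl_act tr_act H by (rule H)
  note c = graded_ring_bimod [OF P] graded_ring_bimod [OF Q] ring_bimod_add ring_bimod_l ring_bimod_r N h
  have eqI: "x = y" if "x \<in> carrier N" "y \<in> carrier N" "embed (k, N) x = embed (k, N) y" for x y
    using that embed_inject [OF N] by blast
  have kills: "frag_eval N (\<lambda>(i, x, y). h i x y) v = \<zero>\<^bsub>N\<^esub>" if "v \<in> tensor_rel P Q n" for v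
    by (rule tensor_kills [OF P Q ring_bimod_group [OF N] _ _ _ _ that])
      (auto intro!: eqI simp: c embed_add inc_add [OF P] inc_add [OF Q] inc_l [OF Q] inc_r [OF P]
        H.t_add_left H.t_add_right H.t_balanced)
  have hc: "(\<lambda>(i, x, y). h i x y) g \<in> carrier N" if "g \<in> tensor_gens P Q n" for g using that h by auto
  show "x \<in> carrier (cmod P i) \<Longrightarrow> y \<in> carrier (cmod Q (n - i)) \<Longrightarrow>
      pres_lift N (\<lambda>(i, x, y). h i x y) (pres_class (tensor_rel P Q n) (frag_of (i, x, y))) = h i x y"
    using presentation.lift_gen [OF tensor_presentation [OF P Q] ring_bimod_group [OF N] hc kills, where g = "(i, x, y)"] by simp
  show "pres_lift N (\<lambda>(i, x, y). h i x y) \<in> bimod_hom (tensor_mod P Q n) N"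
    unfolding tensor_mod_def
    by (rule presentation.lift_hom [OF tensor_presentation [OF P Q] N hc kills])
      (auto intro!: eqI simp: c embed_l embed_r inc_l [OF P] inc_r [OF Q] H.t_l H.t_r)
qed

text \<open>The common source of f \<otimes> g, of the differential of a tensor product and of the
  unit isomorphisms: each is a \<open>pres_lift\<close> whose values are described by a
  pairing.\<close>

lemma tensor_lift_gmap:
  fixes Q' :: "('a, 'm) bimod_complex"
  assumes Q': "graded_bimod Q'" and H: "\<And>n. bimod_pairing (H n)"
    and h: "\<And>n i x y. x \<in> carrier (cmod P i) \<Longrightarrow> y \<in> carrier (cmod Q (n - i)) \<Longrightarrow>
      h n i x y \<in> carrier (cmod Q' (n + t)) \<and> inc Q' (n + t) (h n i x y) = H n i (inc P i x) (inc Q (n - i) y)"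
    and L: "\<And>n. L n = pres_lift (cmod Q' (n + t)) (\<lambda>(i, x, y). h n i x y)"
  shows "L \<in> maps (tensor_complex P Q) Q' t"
    and "gmap (tensor_complex P Q) Q' t L (tgen P Q n i u v) = H n i (inc P i (prj P i u)) (inc Q (n - i) (prj Q (n - i) v))"
proof -
  note lift = tensor_lift [where N = "cmod Q' (n + t)" and H = "H n" and n = n and h = "h n" and k = "n + t" for n,
      OF graded_ring_bimod [OF Q'] H h [unfolded inc_def [of Q']], folded L]
  show L: "L \<in> maps (tensor_complex P Q) Q' t"
    using lift(1) by (simp add: maps_def)
  show "gmap (tensor_complex P Q) Q' t L (tgen P Q n i u v) = H n i (inc P i (prj P i u)) (inc Q (n - i) (prj Q (n - i) v))"
    unfolding tgen_def
    by (subst gmap_inc [OF graded_tensor [OF P Q] Q' L])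
      (simp_all add: tensor_cls_closed prj_closed P Q lift(2) h)
qed

text \<open>For functions that respect nothing but addition and balancing. S \<otimes> 1 is of this
  kind for a right linear S: it is compatible with the tensor relation but is no bimodule
  map.\<close>

lemma tensor_universal:
  fixes H :: "int \<Rightarrow> ('a, 'p) total \<Rightarrow> ('a, 'q) total \<Rightarrow> 'z::ab_group_add"
  assumes "\<And>i x x' y. H i (x + x') y = H i x y + H i x' y" "\<And>i x y y'. H i x (y + y') = H i x y + H i x y'"
    "\<And>i x a y. H i (tr_act x a) y = H i x (tl_act a y)"
  obtains E where "additive E"
    "\<And>i u v. E (tgen P Q n i u v) = H i (inc P i (prj P i u)) (inc Q (n - i) (prj Q (n - i) v))"
proof
  let ?G = "type_group :: ('a, 'z) bimodule"
  note W = graded_tensor [OF P Q]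
  let ?h = "\<lambda>i x y. H i (inc P i x) (inc Q (n - i) y)"
  define L where "L = pres_lift ?G (\<lambda>(i, x, y). ?h i x y)"
  have kills: "frag_eval ?G (\<lambda>(i, x, y). ?h i x y) v = \<zero>\<^bsub>?G\<^esub>" if "v \<in> tensor_rel P Q n" for v
    by (rule tensor_kills [OF P Q group_type_group _ _ _ _ that])
      (simp_all add: type_group_simps inc_add [OF P] inc_add [OF Q] inc_l [OF Q] inc_r [OF P] assms)
  have hc: "(\<lambda>(i, x, y). ?h i x y) g \<in> carrier ?G" for g by (simp add: type_group_simps split: prod.split)
  note lift = presentation.lift_add [OF tensor_presentation [OF P Q] group_type_group hc kills, folded tensor_mod_def L_def]
    presentation.lift_gen [OF tensor_presentation [OF P Q] group_type_group hc kills, folded tensor_mod_def L_def]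
  let ?E = "\<lambda>w. L (prj (tensor_complex P Q) n w)"
  show "additive ?E"
    using lift(1) prj_closed [OF W, of n] by (simp add: additive_def prj_simps [OF W] type_group_simps)
  show "?E (tgen P Q n i u v) = H i (inc P i (prj P i u)) (inc Q (n - i) (prj Q (n - i) v))" for i u v
    unfolding tgen_def
    by (simp add: prj_inc [OF W] tensor_cls_closed prj_closed P Q lift(2))
qed

end

lemma graded_alg: "graded_bimod (alg_complex :: ('a::{ring,monoid_mult}, 'a) bimod_complex)"
proof -
  have "abelian_group (cmod (alg_complex :: ('a, 'a) bimod_complex) i)" for i
    by (rule abelian_groupI) (auto simp: alg_complex_def add.assoc add.commute intro: exI [of _ "- x" for x])
  then show ?thesis
    by (simp add: graded_bimod_def ring_bimod_def) (simp add: alg_complex_def algebra_simps)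
qed

lemma alg_simps: "carrier (cmod alg_complex 0) = UNIV" "i \<noteq> 0 \<Longrightarrow> carrier (cmod alg_complex i) = {0}"
  "\<zero>\<^bsub>cmod alg_complex i\<^esub> = 0" "x \<oplus>\<^bsub>cmod alg_complex i\<^esub> y = x + y"
  "a \<odot>\<^bsub>cmod alg_complex i\<^esub> x = a * x" "x \<bullet>\<^bsub>cmod alg_complex i\<^esub> a = x * a"
  by (simp_all add: alg_complex_def)

lemma tensor_cls_signed:
  fixes P :: "('a::{ring,monoid_mult}, 'p) bimod_complex" and Q :: "('a, 'q) bimod_complex"
  assumes P: "graded_bimod P" and Q: "graded_bimod Q"
    and w: "Poly_Mapping.keys w \<subseteq> tensor_gens P Q k"
  shows "pres_class (tensor_rel P Q k) w \<in> carrier (tensor_mod P Q k)"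
    and "pres_class (tensor_rel P Q k) (signed j w) = msigned (tensor_mod P Q k) j (pres_class (tensor_rel P Q k) w)"
proof -
  interpret M: abelian_group "tensor_mod P Q k" by (rule ring_bimod_group [OF tensor_ring_bimod [OF P Q]])
  note p = tensor_presentation [OF P Q, of k]
  have "pres_class (tensor_rel P Q k) 0 \<ominus>\<^bsub>tensor_mod P Q k\<^esub> pres_class (tensor_rel P Q k) w = pres_class (tensor_rel P Q k) (- w)"
    using presentation.class_diff [OF p, of 0 w] w by (simp add: tensor_mod_def)
  moreover have "pres_class (tensor_rel P Q k) 0 = \<zero>\<^bsub>tensor_mod P Q k\<^esub>"
    using presentation.M_simps(2) [OF p] by (simp add: tensor_mod_def)
  moreover show "pres_class (tensor_rel P Q k) w \<in> carrier (tensor_mod P Q k)"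
    using w presentation.M_simps(1) [OF p] by (auto simp: tensor_mod_def)
  ultimately show "pres_class (tensor_rel P Q k) (signed j w) = msigned (tensor_mod P Q k) j (pres_class (tensor_rel P Q k) w)"
    by (simp add: a_minus_def signed_def msigned_def)
qed

lemma tensor_cls_add:
  "pres_class (tensor_rel P Q k) (u + v) = pres_class (tensor_rel P Q k) u \<oplus>\<^bsub>tensor_mod P Q k\<^esub> pres_class (tensor_rel P Q k) v"
  by (simp add: tensor_mod_def pres_bimod_def pres_class_add)

lemma tensor_map_gmap:
  fixes P :: "('a::{ring,monoid_mult}, 'p) bimod_complex" and Q :: "('a, 'q) bimod_complex"
  assumes P: "graded_bimod P" and Q: "graded_bimod Q" and P': "graded_bimod P'" and Q': "graded_bimod Q'"
    and f: "f \<in> maps P P' s" and g: "g \<in> maps Q Q' t"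
  shows "tensor_map P' Q' s t f g \<in> maps (tensor_complex P Q) (tensor_complex P' Q') (s + t)"
    and "gmap (tensor_complex P Q) (tensor_complex P' Q') (s + t) (tensor_map P' Q' s t f g) (tgen P Q n i u v)
      = signed (i * t) (tgen P' Q' (n + s + t) (i + s) (gmap P P' s f u) (gmap Q Q' t g v))"
proof -
  interpret G: bimod_tensor tl_act tr_act tl_act tr_act tl_act tr_act "tgen P' Q' k" for k by (rule pairing_tgen [OF P' Q'])
  let ?H = "\<lambda>n i u v. signed (i * t) (tgen P' Q' (n + (s + t)) (i + s) (gmap P P' s f u) (gmap Q Q' t g v))"
  let ?h = "\<lambda>n (i :: int) x y. pres_class (tensor_rel P' Q' (n + (s + t)))
       (signed (i * t) (frag_of (i + s, f i x, g (n - i) y)))"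
  note af = additive.add [OF additive_gmap [OF P P' f]] gmap_l [OF P P' f] gmap_r [OF P P' f]
    and ag = additive.add [OF additive_gmap [OF Q Q' g]] gmap_l [OF Q Q' g] gmap_r [OF Q Q' g]
  have H: "bimod_pairing (?H n)" for n
    by (rule bimod_pairingI) (simp_all add: af ag G.t_add_left G.t_add_right G.t_balanced G.t_l G.t_r signed_add
        T.l_signed T.r_signed)
  have h: "?h n i x y \<in> carrier (cmod (tensor_complex P' Q') (n + (s + t))) \<and>
      inc (tensor_complex P' Q') (n + (s + t)) (?h n i x y) = ?H n i (inc P i x) (inc Q (n - i) y)"
    if x: "x \<in> carrier (cmod P i)" and y: "y \<in> carrier (cmod Q (n - i))" for n i x y
  proof -
    have fx: "f i x \<in> carrier (cmod P' (i + s))" using bimod_hom_closed [OF mapsD [OF f] x] .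
    have e: "n + (s + t) - (i + s) = n - i + t" by simp
    have gy: "g (n - i) y \<in> carrier (cmod Q' (n + (s + t) - (i + s)))"
      unfolding e using bimod_hom_closed [OF mapsD [OF g] y] .
    have k: "Poly_Mapping.keys (frag_of (i + s, f i x, g (n - i) y)) \<subseteq> tensor_gens P' Q' (n + (s + t))"
      using fx gy by simp
    show ?thesis
      using tgen_inc [OF P' Q' fx gy] gmap_inc [OF P P' f x] gmap_inc [OF Q Q' g y]
        inc_signed [OF graded_tensor [OF P' Q'], of _ "n + (s + t)" "i * t"] tensor_cls_signed [OF P' Q' k]
      by (simp add: msigned_closed tensor_ring_bimod P' Q' e)
  qed
  have L: "tensor_map P' Q' s t f g n = pres_lift (cmod (tensor_complex P' Q') (n + (s + t))) (\<lambda>(i, x, y). ?h n i x y)" for n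
    by (simp add: tensor_map_def add.assoc)
  show "tensor_map P' Q' s t f g \<in> maps (tensor_complex P Q) (tensor_complex P' Q') (s + t)"
    by (rule tensor_lift_gmap(1) [OF P Q graded_tensor [OF P' Q'] H h L])
  show "gmap (tensor_complex P Q) (tensor_complex P' Q') (s + t) (tensor_map P' Q' s t f g) (tgen P Q n i u v)
      = signed (i * t) (tgen P' Q' (n + s + t) (i + s) (gmap P P' s f u) (gmap Q Q' t g v))"
    using tensor_lift_gmap(2) [OF P Q graded_tensor [OF P' Q'] H h L, of n i u v]
    by (simp add: tgen_def prj_gmap [OF P P' f] prj_gmap [OF Q Q' g] prj_inc [OF P] prj_inc [OF Q] prj_closed P Q
        add.assoc)
qed

lemma tensor_cdiff_gmap:
  fixes P :: "('a::{ring,monoid_mult}, 'p) bimod_complex" and Q :: "('a, 'q) bimod_complex"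
  assumes P: "graded_bimod P" and Q: "graded_bimod Q"
    and dP: "cdiff P \<in> maps P P (- 1)" and dQ: "cdiff Q \<in> maps Q Q (- 1)"
  defines "W \<equiv> tensor_complex P Q"
  shows "cdiff W \<in> maps W W (- 1)"
    and "gmap W W (- 1) (cdiff W) (tgen P Q n i u v) =
      tgen P Q (n - 1) (i - 1) (gmap P P (- 1) (cdiff P) u) v
      + signed i (tgen P Q (n - 1) i u (gmap Q Q (- 1) (cdiff Q) v))"
proof -
  interpret G: bimod_tensor tl_act tr_act tl_act tr_act tl_act tr_act "tgen P Q k" for k by (rule pairing_tgen [OF P Q])
  let ?H = "\<lambda>n i u v. tgen P Q (n - 1) (i - 1) (gmap P P (- 1) (cdiff P) u) v
      + signed i (tgen P Q (n - 1) i u (gmap Q Q (- 1) (cdiff Q) v))"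
  let ?h = "\<lambda>n (i :: int) x y. pres_class (tensor_rel P Q (n - 1))
          (frag_of (i - 1, cdiff P i x, y) + signed i (frag_of (i, x, cdiff Q (n - i) y)))"
  note W = graded_tensor [OF P Q]
  note af = additive.add [OF additive_gmap [OF P P dP]] gmap_l [OF P P dP] gmap_r [OF P P dP]
    and ag = additive.add [OF additive_gmap [OF Q Q dQ]] gmap_l [OF Q Q dQ] gmap_r [OF Q Q dQ]
  have H: "bimod_pairing (?H n)" for n
    by (rule bimod_pairingI) (simp_all add: af ag G.t_add_left G.t_add_right G.t_balanced G.t_l G.t_r signed_add
        T.l_signed T.r_signed T.l_add T.r_add)
  have h: "?h n i x y \<in> carrier (cmod W (n + - 1)) \<and>
      inc W (n + - 1) (?h n i x y) = ?H n i (inc P i x) (inc Q (n - i) y)"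
    if x: "x \<in> carrier (cmod P i)" and y: "y \<in> carrier (cmod Q (n - i))" for n i x y
  proof -
    have fx: "cdiff P i x \<in> carrier (cmod P (i - 1))" and y': "y \<in> carrier (cmod Q (n - 1 - (i - 1)))"
      using bimod_hom_closed [OF mapsD [OF dP] x] y by simp_all
    have gy: "cdiff Q (n - i) y \<in> carrier (cmod Q (n - 1 - i))"
      using bimod_hom_closed [OF mapsD [OF dQ] y] by (simp add: algebra_simps)
    have k: "Poly_Mapping.keys (frag_of (i - 1, cdiff P i x, y)) \<subseteq> tensor_gens P Q (n - 1)"
        "Poly_Mapping.keys (frag_of (i, x, cdiff Q (n - i) y)) \<subseteq> tensor_gens P Q (n - 1)"
      using fx gy x y' by simp_all
    note c1 = tensor_cls_signed [OF P Q k(1)] and c2 = tensor_cls_signed [OF P Q k(2)]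
    have g1: "gmap P P (- 1) (cdiff P) (inc P i x) = inc P (i - 1) (cdiff P i x)"
      using gmap_inc [OF P P dP x] by simp
    have g2: "gmap Q Q (- 1) (cdiff Q) (inc Q (n - i) y) = inc Q (n - 1 - i) (cdiff Q (n - i) y)"
      using gmap_inc [OF Q Q dQ y] by (simp add: algebra_simps)
    have e: "inc Q (n - i) y = inc Q (n - 1 - (i - 1)) y" by simp
    have rb: "ring_bimod (tensor_mod P Q (n - 1))" by (rule tensor_ring_bimod [OF P Q])
    note inc' = inc_add [OF W, of _ "n - 1", simplified] inc_signed [OF W, of _ "n - 1", simplified]
    show ?thesis
      unfolding g1 g2 unfolding e tgen_inc [OF P Q fx y'] tgen_inc [OF P Q x gy]
      using c1(1) c2(1)
      by (simp add: W_def tensor_cls_add c2(2) ring_bimod_add [OF rb] msigned_closed [OF rb] inc')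
  qed
  have L: "cdiff W n = pres_lift (cmod W (n + - 1)) (\<lambda>(i, x, y). ?h n i x y)" for n
    by (simp add: W_def tensor_complex_def)
  note lift = tensor_lift_gmap [OF P Q graded_tensor [OF P Q, folded W_def] H h L]
  show "cdiff W \<in> maps W W (- 1)" using lift(1) by (simp add: W_def)
  show "gmap W W (- 1) (cdiff W) (tgen P Q n i u v) =
      tgen P Q (n - 1) (i - 1) (gmap P P (- 1) (cdiff P) u) v
      + signed i (tgen P Q (n - 1) i u (gmap Q Q (- 1) (cdiff Q) v))"
    using lift(2) [of n i u v]
    by (simp add: W_def tgen_def prj_gmap [OF P P dP] prj_gmap [OF Q Q dQ] prj_inc [OF P] prj_inc [OF Q] prj_closed P Q)
qed

abbreviation alg_val :: "('a::{ring,monoid_mult}, 'a) total \<Rightarrow> 'a" where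
  "alg_val \<equiv> prj alg_complex 0"

lemma alg_val_simps: "alg_val (u + v) = alg_val u + alg_val v" "alg_val (tl_act a u) = a * alg_val u"
  "alg_val (tr_act u a) = alg_val u * a"
  by (simp_all add: prj_simps [OF graded_alg] alg_simps)

lemma left_unit_gmap:
  fixes P :: "('a::{ring,monoid_mult}, 'p) bimod_complex"
  assumes P: "graded_bimod P"
  shows "left_unit P \<in> maps (tensor_complex alg_complex P) P 0"
    and "gmap (tensor_complex alg_complex P) P 0 (left_unit P) (tgen alg_complex P n i u v) =
      (if i = 0 then tl_act (alg_val u) (inc P n (prj P n v)) else 0)"
proof -
  let ?H = "\<lambda>n i u v. if i = (0 :: int) then tl_act (alg_val u) v else 0"
  let ?h = "\<lambda>n (i :: int) a x. if i = 0 then a \<odot>\<^bsub>cmod P n\<^esub> x else \<zero>\<^bsub>cmod P n\<^esub>"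
  have H: "bimod_pairing (?H n)" for n :: int
    by (rule bimod_pairingI) (simp_all add: alg_val_simps T.l_add T.l_add_left T.l_assoc T.l_r)
  have h: "?h n i a x \<in> carrier (cmod P (n + 0)) \<and>
      inc P (n + 0) (?h n i a x) = ?H n i (inc alg_complex i a) (inc P (n - i) x)"
    if "a \<in> carrier (cmod alg_complex i)" "x \<in> carrier (cmod P (n - i))" for n i a x
    using that by (auto simp: graded_ring_bimod P ring_bimod_l ring_bimod_zero inc_zero [OF P] inc_l [OF P] prj_inc [OF graded_alg])
  have L: "left_unit P n = pres_lift (cmod P (n + 0)) (\<lambda>(i, a, x). ?h n i a x)" for n
    by (simp add: left_unit_def)
  note lift = tensor_lift_gmap [OF graded_alg P P H h L]
  show "left_unit P \<in> maps (tensor_complex alg_complex P) P 0" by (rule lift(1))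
  show "gmap (tensor_complex alg_complex P) P 0 (left_unit P) (tgen alg_complex P n i u v) =
      (if i = 0 then tl_act (alg_val u) (inc P n (prj P n v)) else 0)"
    using lift(2) [of n i u v] by (simp add: prj_inc [OF graded_alg] prj_closed [OF graded_alg])
qed

lemma right_unit_gmap:
  fixes P :: "('a::{ring,monoid_mult}, 'p) bimod_complex"
  assumes P: "graded_bimod P"
  shows "right_unit P \<in> maps (tensor_complex P alg_complex) P 0"
    and "gmap (tensor_complex P alg_complex) P 0 (right_unit P) (tgen P alg_complex n i u v) =
      (if i = n then tr_act (inc P n (prj P n u)) (alg_val v) else 0)"
proof -
  let ?H = "\<lambda>n i u v. if i = (n :: int) then tr_act u (alg_val v) else 0"
  let ?h = "\<lambda>n (i :: int) x a. if i = n then x \<bullet>\<^bsub>cmod P n\<^esub> a else \<zero>\<^bsub>cmod P n\<^esub>"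
  have H: "bimod_pairing (?H n)" for n :: int
    by (rule bimod_pairingI) (simp_all add: alg_val_simps T.r_add T.r_add_right T.r_assoc T.l_r)
  have h: "?h n i x a \<in> carrier (cmod P (n + 0)) \<and>
      inc P (n + 0) (?h n i x a) = ?H n i (inc P i x) (inc alg_complex (n - i) a)"
    if "x \<in> carrier (cmod P i)" "a \<in> carrier (cmod alg_complex (n - i))" for n i x a
    using that by (auto simp: graded_ring_bimod P ring_bimod_r ring_bimod_zero inc_zero [OF P] inc_r [OF P] prj_inc [OF graded_alg])
  have L: "right_unit P n = pres_lift (cmod P (n + 0)) (\<lambda>(i, x, a). ?h n i x a)" for n
    by (simp add: right_unit_def)
  note lift = tensor_lift_gmap [OF P graded_alg P H h L]
  show "right_unit P \<in> maps (tensor_complex P alg_complex) P 0" by (rule lift(1))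
  show "gmap (tensor_complex P alg_complex) P 0 (right_unit P) (tgen P alg_complex n i u v) =
      (if i = n then tr_act (inc P n (prj P n u)) (alg_val v) else 0)"
    using lift(2) [of n i u v] by (simp add: prj_inc [OF graded_alg] prj_closed [OF graded_alg])
qed

section \<open>Free bimodules are projective as right modules\<close>

lemma free_relE:
  assumes "v \<in> free_rel scale X"
  obtains (left) a a' x b where "v = frag_of (a + a', x, b) - frag_of (a, x, b) - frag_of (a', x, b)" "x \<in> X"
    | (right) a x b b' where "v = frag_of (a, x, b + b') - frag_of (a, x, b) - frag_of (a, x, b')" "x \<in> X"
    | (mid) c a x b where "v = frag_of (scale c a, x, b) - frag_of (a, x, scale c b)" "x \<in> X"
  using assms unfolding free_rel_def by blast

lemma free_relI:
  "x \<in> X \<Longrightarrow> frag_of (a + a', x, b) - frag_of (a, x, b) - frag_of (a', x, b) \<in> free_rel scale X"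
  "x \<in> X \<Longrightarrow> frag_of (a, x, b + b') - frag_of (a, x, b) - frag_of (a, x, b') \<in> free_rel scale X"
  "x \<in> X \<Longrightarrow> frag_of (scale c a, x, b) - frag_of (a, x, scale c b) \<in> free_rel scale X"
  unfolding free_rel_def by blast+

context k_algebra
begin

lemma free_presentation: "presentation {(a, x, b). x \<in> X} (free_rel scale X)
    (\<lambda>c (a, x, b). (c * a, x, b)) (\<lambda>(a, x, b) c. (a, x, b * c))"
proof
  fix v assume v: "v \<in> free_rel scale X"
  then show "Poly_Mapping.keys v \<subseteq> {(a, x, b). x \<in> X}"
    by (cases rule: free_relE; simp only:; intro keys_relator) auto
  fix a
  show "frag_extend (\<lambda>g. frag_of ((\<lambda>(a', x, b). (a * a', x, b)) g)) v \<in> group_closure (free_rel scale X)"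
    using v
    by (cases rule: free_relE)
      (simp_all add: frag_extend_diff distrib_left free_relI group_closure.base flip: scale_mult_right)
  show "frag_extend (\<lambda>g. frag_of ((\<lambda>(a, x, b) c. (a, x, b * c)) g a)) v \<in> group_closure (free_rel scale X)"
    using v
    by (cases rule: free_relE)
      (simp_all add: frag_extend_diff distrib_right free_relI group_closure.base flip: scale_mult_left)
qed (auto simp: distrib_left distrib_right free_relI group_closure.base mult.assoc)

end

lemma bimod_hom_diff:
  assumes f: "f \<in> bimod_hom M N" and M: "ring_bimod M" and N: "ring_bimod N"
    and xy: "x \<in> carrier M" "y \<in> carrier M"
  shows "f (x \<ominus>\<^bsub>M\<^esub> y) = f x \<ominus>\<^bsub>N\<^esub> f y"
proof -
  interpret M: abelian_group M by (rule ring_bimod_group [OF M])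
  interpret N: abelian_group N by (rule ring_bimod_group [OF N])
  have "f (x \<ominus>\<^bsub>M\<^esub> y) \<oplus>\<^bsub>N\<^esub> f y = f ((x \<ominus>\<^bsub>M\<^esub> y) \<oplus>\<^bsub>M\<^esub> y)"
    using bimod_hom_add [OF f] xy by simp
  also have "(x \<ominus>\<^bsub>M\<^esub> y) \<oplus>\<^bsub>M\<^esub> y = x"
    using xy by (simp add: a_minus_def M.a_assoc M.l_neg)
  finally show ?thesis
    using bimod_hom_closed [OF f] xy
    by (metis M.minus_closed N.add.inv_closed N.add.m_assoc N.add.r_inv N.add.r_one a_minus_def)
qed

section \<open>Projective resolutions\<close>

locale resolution = k_algebra scale
  for scale :: "'k::field \<Rightarrow> 'a::{ring,monoid_mult} \<Rightarrow> 'a"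
    and P :: "('a, 'p) bimod_complex" and \<mu> :: "'p \<Rightarrow> 'a" +
  assumes res: "projective_resolution scale P \<mu>"
begin

sublocale K: k_bimod_act scale tl_act "tr_act :: ('a, 'p) total \<Rightarrow> _" ..

definition d :: "('a, 'p) total \<Rightarrow> ('a, 'p) total" where "d = gmap P P (- 1) (cdiff P)"

definition mu :: "('a, 'p) total \<Rightarrow> 'a" where "mu u = \<mu> (prj P 0 u)"

lemma bimodule_P: "bimodule scale (cmod P i)"
  using res by (simp add: projective_resolution_def is_complex_def)

lemma graded_P: "graded_bimod P"
  by (simp add: graded_bimod_def bimodule_ring_bimod [OF bimodule_P])

lemma cdiff_maps: "cdiff P \<in> maps P P (- 1)"
  using res by (simp add: projective_resolution_def is_complex_def maps_def)

lemma additive_d: "additive d" and d_l: "d (tl_act a u) = tl_act a (d u)" and d_r: "d (tr_act u a) = tr_act (d u) a"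
  unfolding d_def by (simp_all add: additive_gmap gmap_l gmap_r graded_P cdiff_maps)

lemmas d_0 [simp] = additive.zero [OF additive_d] and d_add = additive.add [OF additive_d]
  and d_diff = additive.diff [OF additive_d] and d_signed = additive_signed [OF additive_d]
  and d_minus = additive.minus [OF additive_d]

lemma d_homog: "u \<in> homog P i \<Longrightarrow> d u \<in> homog P (i - 1)"
  unfolding d_def using gmap_homog [OF graded_P graded_P cdiff_maps] by fastforce

lemma prj_d: "prj P i (d u) = cdiff P (i + 1) (prj P (i + 1) u)"
  by (simp add: d_def prj_gmap graded_P cdiff_maps)

lemma cdiff_cdiff: "x \<in> carrier (cmod P i) \<Longrightarrow> cdiff P (i - 1) (cdiff P i x) = \<zero>\<^bsub>cmod P (i - 2)\<^esub>"
  using res by (simp add: projective_resolution_def is_complex_def)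

lemma d_inc: "x \<in> carrier (cmod P i) \<Longrightarrow> d (inc P i x) = inc P (i - 1) (cdiff P i x)"
  by (simp add: d_def gmap_inc graded_P cdiff_maps)

lemma cdiff_closed: "x \<in> carrier (cmod P i) \<Longrightarrow> cdiff P i x \<in> carrier (cmod P (i - 1))"
  using bimod_hom_closed [OF mapsD [OF cdiff_maps], of x i] by simp

lemma d_d: "u \<in> homog P i \<Longrightarrow> d (d u) = 0"
  by (auto simp: homog_def d_inc cdiff_closed cdiff_cdiff inc_zero [OF graded_P])

lemma homog_neg: "u \<in> homog P i \<Longrightarrow> i < 0 \<Longrightarrow> u = 0"
  using res by (auto simp: projective_resolution_def homog_def inc_zero [OF graded_P])

lemma mu_hom: "\<mu> \<in> bimod_hom (cmod P 0) (cmod alg_complex 0)"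
  using res by (simp add: projective_resolution_def)

lemma additive_mu: "additive mu" and mu_l: "mu (tl_act a u) = a * mu u" and mu_r: "mu (tr_act u a) = mu u * a"
  using bimod_hom_add [OF mu_hom] bimod_hom_l [OF mu_hom] bimod_hom_r [OF mu_hom]
  by (simp_all add: additive_def mu_def prj_simps [OF graded_P] prj_closed [OF graded_P] alg_simps)

lemmas mu_0 [simp] = additive.zero [OF additive_mu] and mu_add = additive.add [OF additive_mu]
  and mu_diff = additive.diff [OF additive_mu]

lemma mu_ker: "{x \<in> carrier (cmod P 0). \<mu> x = 0} = cdiff P 1 ` carrier (cmod P 1)"
  using res by (simp add: projective_resolution_def)

lemma mu_d: "mu (d u) = 0"
proof -
  have "cdiff P 1 (prj P 1 u) \<in> {x \<in> carrier (cmod P 0). \<mu> x = 0}"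
    unfolding mu_ker using prj_closed [OF graded_P] by blast
  then show ?thesis by (simp add: mu_def prj_d)
qed

lemma exact_mu: "u \<in> homog P 0 \<Longrightarrow> mu u = 0 \<Longrightarrow> \<exists>v\<in>homog P 1. d v = u"
proof -
  assume "u \<in> homog P 0" "mu u = 0"
  then obtain x where x: "u = inc P 0 x" "x \<in> carrier (cmod P 0)" "\<mu> x = 0"
    by (auto simp: homog_def mu_def prj_inc [OF graded_P])
  then have "x \<in> cdiff P 1 ` carrier (cmod P 1)" using mu_ker by blast
  then obtain y where "y \<in> carrier (cmod P 1)" "x = cdiff P 1 y" by blast
  then show ?thesis using x d_inc [of y 1] by (auto simp: homog_def)
qed

lemma exact_pos: "0 < i \<Longrightarrow> u \<in> homog P i \<Longrightarrow> d u = 0 \<Longrightarrow> \<exists>v\<in>homog P (i + 1). d v = u"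
proof -
  assume i: "0 < i" and "u \<in> homog P i" "d u = 0"
  then obtain x where x: "u = inc P i x" "x \<in> carrier (cmod P i)" "inc P (i - 1) (cdiff P i x) = 0"
    by (auto simp: homog_def d_inc)
  then have "cdiff P i x = \<zero>\<^bsub>cmod P (i - 1)\<^esub>"
    using inc_inject [OF graded_P, of "cdiff P i x" "i - 1" "\<zero>\<^bsub>cmod P (i - 1)\<^esub>"] cdiff_closed [of x i]
      graded_ring_bimod [OF graded_P]
    by (simp add: inc_zero [OF graded_P] ring_bimod_zero)
  then have "x \<in> cdiff P (i + 1) ` carrier (cmod P (i + 1))"
    using res i x unfolding projective_resolution_def by blast
  then obtain y where "y \<in> carrier (cmod P (i + 1))" "x = cdiff P (i + 1) y" by blast
  then show ?thesis using x d_inc [of y "i + 1"] by (auto simp: homog_def)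
qed

lemma central_P: "u \<in> homog P i \<Longrightarrow> tl_act (scale c 1) u = tr_act u (scale c 1)"
  using bimodule.central [OF bimodule_P]
  by (auto simp: homog_def simp flip: inc_l [OF graded_P] inc_r [OF graded_P])

lemma obtain_unit: obtains p where "p \<in> homog P 0" "mu p = 1"
proof -
  have "\<mu> ` carrier (cmod P 0) = UNIV" using res by (simp add: projective_resolution_def)
  then obtain x where "x \<in> carrier (cmod P 0)" "\<mu> x = 1" by (metis imageE UNIV_I)
  then show ?thesis using that [of "inc P 0 x"] by (simp add: homog_def mu_def prj_inc [OF graded_P])
qed

text \<open>A free bimodule is free as a right module, on the pairs of a basis vector e of the
  algebra and a generator x. So a right linear map is lifted by choosing preimages of its values at
  \<open>(e, x, 1)\<close>, and a direct summand inherits this. Lifting of bimodule maps would not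
  suffice, as the maps to be lifted for the contraction are right linear only.\<close>

lemma right_lift:
  assumes q: "additive q" "\<And>u a. q (tr_act u a) = tr_act (q u) a" "\<And>u. u \<in> homog P i \<Longrightarrow> q u \<in> homog P j"
    and lift: "\<And>u. u \<in> homog P i \<Longrightarrow> \<exists>w\<in>homog P (j + 1). d w = q u"
  obtains s where "additive s" "\<And>u a. s (tr_act u a) = tr_act (s u) a"
    "\<And>u. u \<in> homog P i \<Longrightarrow> s u \<in> homog P (j + 1)" "\<And>u. u \<in> homog P i \<Longrightarrow> d (s u) = q u"
proof -
  have "projective_bimod scale (cmod P i)" using res by (simp add: projective_resolution_def)
  then obtain X :: "'p set" and sc pr where sc: "sc \<in> bimod_hom (cmod P i) (free_bimod scale X)"
    and pr: "pr \<in> bimod_hom (free_bimod scale X) (cmod P i)" and split: "\<And>x. x \<in> carrier (cmod P i) \<Longrightarrow> pr (sc x) = x"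
    unfolding projective_bimod_def by blast
  note pres = free_presentation [of X]
  interpret F: presentation "{(a, x, b). x \<in> X}" "free_rel scale X"
    "\<lambda>c (a, x, b). (c * a, x, b)" "\<lambda>(a, x, b) c. (a, x, b * c)" by (rule pres)
  let ?F = "free_bimod scale X"
  define \<Phi> where "\<Phi> a x b = q (inc P i (pr (F.gen (a, x, b))))" for a x b
  have F_def: "F.M = ?F" by (simp only: free_bimod_def)
  note F = F.gen_closed [unfolded F_def] F.gen_add [unfolded F_def] F.gen_r [unfolded F_def]
  have gen: "F.gen (a, x, b) \<in> carrier ?F" if "x \<in> X" for a x b
    using F(1) [of "(a, x, b)"] that by simp
  have prg: "pr (F.gen (a, x, b)) \<in> carrier (cmod P i)" if "x \<in> X" for a x b
    using bimod_hom_closed [OF pr gen [OF that]] .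
  have \<Phi>j: "\<Phi> a x b \<in> homog P j" if "x \<in> X" for a x b
    unfolding \<Phi>_def by (rule q(3)) (simp add: inc_homog [OF graded_P] prg that)
  have \<Phi>_r: "\<Phi> a x (b * c) = tr_act (\<Phi> a x b) c" if "x \<in> X" for a x b c
    using F(3) [of "(a, x, b)" c] bimod_hom_r [OF pr gen [OF that], of a b c] inc_r [OF graded_P prg [OF that], of a b c]
    by (simp add: \<Phi>_def q(2))
  have \<Phi>_add: "\<Phi> (a + a') x b = \<Phi> a x b + \<Phi> a' x b" if "x \<in> X" for a a' x b
    using F(2) [OF free_relI(1) [OF that]] gen [OF that] prg [OF that]
    by (simp add: \<Phi>_def bimod_hom_add [OF pr] inc_add [OF graded_P] additive.add [OF q(1)])
  have \<Phi>_scale: "\<Phi> (scale c a) x b = tl_act (scale c 1) (\<Phi> a x b)" if "x \<in> X" for c a x b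
  proof -
    have "\<Phi> (scale c a) x b = \<Phi> a x (scale c b)"
      using F.gen_eq [OF free_relI(3) [OF that]] by (simp add: \<Phi>_def)
    also have "\<dots> = \<Phi> a x (b * scale c 1)" by (simp add: scale_one_right)
    also have "\<dots> = tl_act (scale c 1) (\<Phi> a x b)" by (simp add: \<Phi>_r that central_P [OF \<Phi>j])
    finally show ?thesis .
  qed
  \<comment> \<open>Preimages for the generators \<open>(e, x, 1)\<close>. Below, \<open>h\<close>
    reads them at basis vectors e and extends linearly in the first entry and right linearly in the
    last.\<close>
  define m where "m e x = (SOME w. w \<in> homog P (j + 1) \<and> d w = \<Phi> e x 1)" for e x
  have m: "m e x \<in> homog P (j + 1) \<and> d (m e x) = \<Phi> e x 1" if "x \<in> X" for e x
  proof -
    have "\<exists>w. w \<in> homog P (j + 1) \<and> d w = \<Phi> e x 1"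
      using lift [OF inc_homog [OF graded_P prg [OF that, of e 1]]] unfolding \<Phi>_def by blast
    then show ?thesis unfolding m_def by (rule someI_ex)
  qed
  define h where "h = (\<lambda>(a, x, b). K.lin_sum a (\<lambda>e. tr_act (m e x) b))"
  have h_r: "h (a, x, b * c) = tr_act (h (a, x, b)) c" for a x b c
    by (simp add: h_def T.r_assoc T.r_sum T.l_r)
  have h_add: "h (a + a', x, b) = h (a, x, b) + h (a', x, b)" for a a' x b
    by (simp add: h_def K.lin_sum_add)
  have h_add2: "h (a, x, b + b') = h (a, x, b) + h (a, x, b')" for a x b b'
    by (simp add: h_def T.r_add_right T.l_add sum.distrib)
  \<comment> \<open>The relator that moves a scalar from the left to the right factor is respected
    because the preimages are homogeneous elements of P, on which both actions of k agree.\<close>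
  have h_scale: "h (scale c a, x, b) = h (a, x, scale c b)" if "x \<in> X" for c a x b
  proof -
    have "tr_act (m e x) (scale c b) = tl_act (scale c 1) (tr_act (m e x) b)" for e
      using central_P [of "m e x" "j + 1" c] m [OF that, of e]
      by (simp add: scale_one_left flip: T.l_r T.r_assoc)
    moreover have "tl_act (scale k 1) (tl_act (scale c 1) x) = tl_act (scale c 1) (tl_act (scale k 1) x)"
      for k and x :: "('a, 'p) total"
      by (simp add: scale_one_left mult.commute flip: T.l_assoc)
    ultimately show ?thesis by (simp add: h_def K.lin_sum_scale T.l_sum)
  qed
  have h_homog: "h (a, x, b) \<in> homog P (j + 1)" if "x \<in> X" for a x b
  proof -
    have "sum f S \<in> homog P (j + 1)" if "\<And>e. f e \<in> homog P (j + 1)" for f :: "'a \<Rightarrow> _" and S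
      by (induction S rule: infinite_finite_induct) (auto simp: homog_0 homog_add graded_P that)
    then show ?thesis using m [OF that] by (simp add: h_def homog_l homog_r graded_P)
  qed
  have h_d: "d (h (a, x, b)) = \<Phi> a x b" if "x \<in> X" for a x b
  proof -
    have "d (h (a, x, b)) = K.lin_sum a (\<lambda>e. tr_act (d (m e x)) b)"
      by (simp add: h_def additive.sum [OF additive_d] d_l d_r)
    also have "\<dots> = K.lin_sum a (\<lambda>e. \<Phi> e x b)"
      using m [OF that] \<Phi>_r [OF that, of _ 1 b] by simp
    also have "\<dots> = \<Phi> a x b"
      by (rule K.lin_sum_linear [symmetric]) (simp_all add: additive_def \<Phi>_add \<Phi>_scale that)
    finally show ?thesis .
  qed
  let ?G = "type_group :: ('a, ('a, 'p) total) bimodule"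
  have hc: "h g \<in> carrier ?G" for g by (simp add: type_group_simps)
  have kills: "frag_eval ?G h v = \<zero>\<^bsub>?G\<^esub>" if "v \<in> free_rel scale X" for v
    using that
    by (cases rule: free_relE; simp only:)
      (rule frag_eval_relator [where S = UNIV, OF group_type_group hc];
        simp add: type_group_simps h_add h_add2 h_scale)+
  define E where "E = pres_lift ?G h"
  note G = group_type_group hc kills
  have a_minus: "x \<ominus>\<^bsub>?G\<^esub> y = x - y" for x y
    using abelian_group.minus_eq [OF group_type_group, of x y]
      abelian_group.r_neg [OF group_type_group, of y]
    by (simp add: a_minus_def type_group_simps add_eq_0_iff)
  have E_add: "E (x \<oplus>\<^bsub>?F\<^esub> y) = E x + E y" if "x \<in> carrier ?F" "y \<in> carrier ?F" for x y
    using F.lift_add [OF G, folded E_def, unfolded F_def] that by (simp add: type_group_simps)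
  have E_diff: "E (x \<ominus>\<^bsub>?F\<^esub> y) = E x - E y" if "x \<in> carrier ?F" "y \<in> carrier ?F" for x y
    using F.lift_diff [OF G, folded E_def, unfolded F_def] that by (simp add: type_group_simps a_minus)
  have E_gen: "E (F.gen (a, x, b)) = h (a, x, b)" if "x \<in> X" for a x b
    using F.lift_gen [OF G, of "(a, x, b)", folded E_def] that by simp
  have E_0: "E \<zero>\<^bsub>?F\<^esub> = 0"
    using F.lift_zero [OF G, folded E_def, unfolded F_def] by (simp add: type_group_simps)
  have rbF: "ring_bimod ?F" using F.ring_bimod [unfolded F_def] .
  have E_props: "E (x \<bullet>\<^bsub>?F\<^esub> c) = tr_act (E x) c \<and> E x \<in> homog P (j + 1) \<and> d (E x) = q (inc P i (pr x))"
    if "x \<in> carrier ?F" for x c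
    using that
  proof (induction rule: F.carrier_induct [unfolded F_def, consumes 1, case_names zero gen diff])
    case zero
    show ?case
      using bimod_hom_zero [OF pr rbF graded_ring_bimod [OF graded_P]]
      by (simp add: E_0 ring_bimod_act_zero [OF rbF] homog_0 graded_P inc_zero additive.zero [OF q(1)])
  next
    case (gen g)
    then obtain a x b where g: "g = (a, x, b)" "x \<in> X" by auto
    have "E (F.gen (a, x, b) \<bullet>\<^bsub>?F\<^esub> c) = tr_act (h (a, x, b)) c"
      using E_gen [OF g(2), of a "b * c"] by (simp add: F(3) h_r)
    then show ?case by (simp add: g E_gen h_homog h_d) (simp add: \<Phi>_def)
  next
    case (diff x y)
    note xy = diff(1,2)
    have "pr (x \<ominus>\<^bsub>?F\<^esub> y) = pr x \<ominus>\<^bsub>cmod P i\<^esub> pr y"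
      by (rule bimod_hom_diff [OF pr rbF graded_ring_bimod [OF graded_P] xy])
    with diff show ?case
      by (simp add: ring_bimod_act_diff [OF rbF] E_diff ring_bimod_r [OF rbF] T.r_diff homog_diff graded_P
        d_diff inc_diff bimod_hom_closed [OF pr] additive.diff [OF q(1)])
  qed
  define s where "s u = E (sc (prj P i u))" for u
  note scc = bimod_hom_closed [OF sc prj_closed [OF graded_P]]
  show thesis
  proof
    show "additive s"
      by (simp add: additive_def s_def prj_simps [OF graded_P] bimod_hom_add [OF sc] prj_closed [OF graded_P] E_add scc)
    show "s (tr_act u a) = tr_act (s u) a" for u a
      using E_props [OF scc] by (simp add: s_def prj_simps [OF graded_P] bimod_hom_r [OF sc] prj_closed [OF graded_P])
    show "s u \<in> homog P (j + 1)" for u using E_props [OF scc] by (simp add: s_def)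
    show "d (s u) = q u" if "u \<in> homog P i" for u
      using E_props [OF scc, of u 1] by (simp add: s_def split prj_closed [OF graded_P] inc_prj [OF graded_P that])
  qed
qed

end

section \<open>A right linear contraction of the resolution\<close>

context resolution
begin

text \<open>The augmented complex is exact and consists of projective right modules, and \<mu> is
  split by the right linear map a \<mapsto> p a. Hence the identity minus this splitting after \<mu>
  is null-homotopic by right linear maps, built degree by degree with
  \<open>right_lift\<close>.\<close>

lemma contraction:
  obtains p S where "p \<in> homog P 0" "mu p = 1"
    "\<And>i :: int. additive (S i)" "\<And>i u a. S i (tr_act u a) = tr_act (S i u) a"
    "\<And>i u. u \<in> homog P i \<Longrightarrow> S i u \<in> homog P (i + 1)"
    "\<And>i u. u \<in> homog P i \<Longrightarrow> d (S i u) + S (i - 1) (d u) = u - (if i = 0 then tr_act p (mu u) else 0)"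
proof -
  obtain p where p: "p \<in> homog P 0" "mu p = 1" by (rule obtain_unit)
  \<comment> \<open>\<open>right_lift\<close> asks for additive, right linear maps on the whole
    type; \<open>pi i\<close> is the identity of degree i in this form.\<close>
  define pi where "pi i u = inc P i (prj P i u)" for i u
  have pi: "additive (pi i)" "pi i (tr_act u a) = tr_act (pi i u) a" "pi i u \<in> homog P i" for i u a
    by (simp_all add: pi_def additive_def prj_simps inc_add inc_r graded_P prj_closed inc_homog)
  have pi_id: "u \<in> homog P i \<Longrightarrow> pi i u = u" for i u by (simp add: pi_def inc_prj graded_P)
  \<comment> \<open>The clause d s d = d is the invariant of the recursion: it makes u - s (d u) a
    cycle in the next degree, which can then be lifted by exactness.\<close>
  let ?ok = "\<lambda>n s. additive s \<and> (\<forall>u a. s (tr_act u a) = tr_act (s u) a) \<and>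
     (\<forall>u\<in>homog P (int n). s u \<in> homog P (int n + 1)) \<and> (\<forall>u\<in>homog P (int n + 1). d (s (d u)) = d u) \<and>
     (n = 0 \<longrightarrow> (\<forall>u\<in>homog P 0. d (s u) = u - tr_act p (mu u)))"
  have "\<exists>f. \<forall>n. ?ok n (f n) \<and> (\<forall>u\<in>homog P (int n + 1). d (f (Suc n) u) = u - f n (d u))"
  proof (rule dependent_nat_choice)
    let ?q = "\<lambda>u. pi 0 u - tr_act p (mu u)"
    have "additive ?q" by (simp add: additive_def additive.add [OF pi(1)] mu_add T.r_add_right)
    moreover have "?q (tr_act u a) = tr_act (?q u) a" for u a by (simp add: pi mu_r T.r_diff T.r_assoc)
    moreover have qh: "?q u \<in> homog P 0" for u by (intro homog_diff homog_r pi graded_P p)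
    moreover have "\<exists>w\<in>homog P (0 + 1). d w = ?q u" if "u \<in> homog P 0" for u
      using exact_mu [OF qh, of u] by (simp add: mu_diff mu_r p pi_id that)
    ultimately obtain s where s: "additive s" "\<And>u a. s (tr_act u a) = tr_act (s u) a"
      "\<And>u. u \<in> homog P 0 \<Longrightarrow> s u \<in> homog P (0 + 1)" "\<And>u. u \<in> homog P 0 \<Longrightarrow> d (s u) = ?q u"
      using right_lift [of ?q 0 0] by blast
    have "d (s (d u)) = d u" if "u \<in> homog P 1" for u
      using s(4) [of "d u"] d_homog [OF that] by (simp add: mu_d pi_id)
    then show "\<exists>s. ?ok 0 s" using s by (intro exI [of _ s]) (simp add: pi_id)
  next
    fix s n assume s: "?ok n s"
    let ?q = "\<lambda>u. pi (int n + 1) u - s (d u)"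
    have ds: "d u \<in> homog P (int n)" if "u \<in> homog P (int n + 1)" for u using d_homog [OF that] by simp
    have "additive ?q" using s by (simp add: additive_def additive.add [OF pi(1)] d_add)
    moreover have "?q (tr_act u a) = tr_act (?q u) a" for u a using s by (simp add: pi d_r T.r_diff)
    moreover have qh: "?q u \<in> homog P (int n + 1)" if "u \<in> homog P (int n + 1)" for u
      using s ds [OF that] by (intro homog_diff pi graded_P) auto
    moreover have "\<exists>w\<in>homog P (int n + 1 + 1). d w = ?q u" if "u \<in> homog P (int n + 1)" for u
      using exact_pos [OF _ qh [OF that]] s that by (simp add: d_diff pi_id)
    ultimately obtain s' where s': "additive s'" "\<And>u a. s' (tr_act u a) = tr_act (s' u) a"
      "\<And>u. u \<in> homog P (int n + 1) \<Longrightarrow> s' u \<in> homog P (int n + 1 + 1)"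
      "\<And>u. u \<in> homog P (int n + 1) \<Longrightarrow> d (s' u) = ?q u"
      using right_lift [of ?q "int n + 1" "int n + 1"] by blast
    have "d (s' (d u)) = d u" if u: "u \<in> homog P (int n + 1 + 1)" for u
    proof -
      have "int n + 1 + 1 - 1 = int n + 1" by simp
      then have du: "d u \<in> homog P (int n + 1)" using d_homog [OF u] by (simp only:)
      have "s 0 = 0" using s additive.zero by blast
      then show ?thesis using s'(4) [OF du] d_d [OF u] by (simp add: pi_id du)
    qed
    then show "\<exists>s'. ?ok (Suc n) s' \<and> (\<forall>u\<in>homog P (int n + 1). d (s' u) = u - s (d u))"
      using s' by (intro exI [of _ s']) (simp add: pi_id add.commute)
  qed
  then obtain f where ff: "\<forall>n. ?ok n (f n) \<and> (\<forall>u\<in>homog P (int n + 1). d (f (Suc n) u) = u - f n (d u))"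
    by (rule exE)
  have f: "?ok n (f n)" for n using spec [OF ff, of n] by (rule conjunct1)
  have f2: "d (f (Suc n) u) = u - f n (d u)" if "u \<in> homog P (int n + 1)" for n u
    using conjunct2 [OF spec [OF ff, of n]] that by (rule bspec)
  \<comment> \<open>Zero in negative degrees, where P vanishes; the recursion ran over natural
    numbers.\<close>
  define S where "S i = (if i < 0 then (\<lambda>_. 0) else f (nat i))" for i :: int
  show thesis
  proof
    show "p \<in> homog P 0" "mu p = 1" by (fact p)+
    show "additive (S i)" "S i (tr_act u a) = tr_act (S i u) a" for i u a
      using f [of "nat i"] by (auto simp: S_def additive_def)
    show "S i u \<in> homog P (i + 1)" if "u \<in> homog P i" for i u
      using f [of "nat i"] that by (auto simp: S_def homog_0 graded_P)
    show "d (S i u) + S (i - 1) (d u) = u - (if i = 0 then tr_act p (mu u) else 0)" if u: "u \<in> homog P i" for i u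
    proof -
      consider "i < 0" | "i = 0" | "0 < i" by linarith
      then show ?thesis
      proof cases
        case 1
        then show ?thesis using homog_neg [OF u] by (simp add: S_def)
      next
        case 2
        then show ?thesis using f [of 0] u by (simp add: S_def)
      next
        case 3
        then have "nat i = Suc (nat (i - 1))" "int (nat (i - 1)) + 1 = i" by simp_all
        then show ?thesis using f2 [of u "nat (i - 1)"] u 3 by (simp add: S_def)
      qed
    qed
  qed
qed

section \<open>The tensor square of the resolution, with f \<otimes> 1 and 1 \<otimes> f on
  it\<close>

abbreviation W where "W \<equiv> tensor_complex P P"

definition dW where "dW = gmap W W (- 1) (cdiff W)"

lemma graded_W: "graded_bimod W" by (rule graded_tensor [OF graded_P graded_P])

sublocale t: bimod_tensor tl_act tr_act tl_act tr_act tl_act tr_act "tgen P P n" for n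
  by (rule pairing_tgen [OF graded_P graded_P])

lemma dW_tgen: "dW (tgen P P n i u v) = tgen P P (n - 1) (i - 1) (d u) v + signed i (tgen P P (n - 1) i u (d v))"
  unfolding dW_def d_def by (rule tensor_cdiff_gmap [OF graded_P graded_P cdiff_maps cdiff_maps])

lemma cdiff_W_maps: "cdiff W \<in> maps W W (- 1)"
  by (rule tensor_cdiff_gmap [OF graded_P graded_P cdiff_maps cdiff_maps])

lemma additive_dW: "additive dW" and dW_l: "dW (tl_act a w) = tl_act a (dW w)" and dW_r: "dW (tr_act w a) = tr_act (dW w) a"
  unfolding dW_def by (simp_all add: additive_gmap gmap_l gmap_r graded_W cdiff_W_maps)

lemmas dW_0 [simp] = additive.zero [OF additive_dW] and dW_add = additive.add [OF additive_dW]
  and dW_diff = additive.diff [OF additive_dW]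

lemma dW_homog: "w \<in> homog W n \<Longrightarrow> dW w \<in> homog W (n - 1)"
  unfolding dW_def using gmap_homog [OF graded_W graded_W cdiff_W_maps] by fastforce

text \<open>On x \<otimes> y a scalar passes from the left of x to its right, across the tensor
  product, and from the left of y to its right.\<close>

lemma central_W: "w \<in> homog W n \<Longrightarrow> tl_act (scale c 1) w = tr_act w (scale c 1)"
proof (induction rule: tensor_induct [OF graded_P graded_P, consumes 1, case_names zero tgen diff])
  case (tgen i u v)
  let ?u = "inc P i (prj P i u)" and ?v = "inc P (n - i) (prj P (n - i) v)"
  have "tl_act (scale c 1) ?u = tr_act ?u (scale c 1)" "tl_act (scale c 1) ?v = tr_act ?v (scale c 1)"
    by (rule central_P [OF inc_homog [OF graded_P prj_closed [OF graded_P]]])+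
  then have "tl_act (scale c 1) (tgen P P n i ?u ?v) = tr_act (tgen P P n i ?u ?v) (scale c 1)"
    using t.t_balanced [of n i ?u "scale c 1" ?v] by (simp flip: t.t_l t.t_r)
  then show ?case by (simp add: tgen_prj [OF graded_P graded_P])
qed (simp_all add: T.l_diff T.r_diff)

definition ev :: "int \<Rightarrow> (int \<Rightarrow> 'p \<Rightarrow> 'a) \<Rightarrow> ('a, 'p) total \<Rightarrow> 'a" where
  "ev n f u = f n (prj P n u)"

text \<open>\<open>KL n f\<close> and \<open>KR n f\<close> are the maps \<open>f \<otimes> 1\<close> and \<open>1 \<otimes> f\<close>, followed by the identification with \<open>P\<close>.\<close>

definition KL where
  "KL n f = (\<lambda>w. gmap (tensor_complex alg_complex P) P 0 (left_unit P)
     (gmap W (tensor_complex alg_complex P) (- n + 0) (tensor_map alg_complex P (- n) 0 f (\<lambda>_ y. y)) w))"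

definition KR where
  "KR n f = (\<lambda>w. gmap (tensor_complex P alg_complex) P 0 (right_unit P)
     (gmap W (tensor_complex P alg_complex) (0 + - n) (tensor_map P alg_complex 0 (- n) (\<lambda>_ y. y) f) w))"

lemma id_maps: "(\<lambda>_ y. y) \<in> maps P P 0"
  by (simp add: maps_def bimod_hom_def)

context
  fixes n :: int and f :: "int \<Rightarrow> 'p \<Rightarrow> 'a"
  assumes f: "f \<in> maps P alg_complex (- n)"
begin

lemma alg_val_gmap: "alg_val (gmap P alg_complex (- n) f u) = ev n f u"
  by (simp add: prj_gmap [OF graded_P graded_alg f] ev_def)

lemma additive_ev: "additive (ev n f)" and ev_l: "ev n f (tl_act a u) = a * ev n f u" and ev_r: "ev n f (tr_act u a) = ev n f u * a"
  by (simp_all add: additive_def alg_val_simps additive.add [OF additive_gmap [OF graded_P graded_alg f]]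
     gmap_l [OF graded_P graded_alg f] gmap_r [OF graded_P graded_alg f] flip: alg_val_gmap)

lemma ev_other: "u \<in> homog P i \<Longrightarrow> i \<noteq> n \<Longrightarrow> ev n f u = 0"
  using additive.zero [OF additive_ev] prj_homog_other [OF graded_P, of u i n]
  by (simp add: ev_def prj_simps [OF graded_P])

lemma maps_left: "tensor_map alg_complex P (- n) 0 f (\<lambda>_ y. y) \<in> maps W (tensor_complex alg_complex P) (- n + 0)"
  by (rule tensor_map_gmap(1) [OF graded_P graded_P graded_alg graded_P f id_maps])

lemma maps_right: "tensor_map P alg_complex 0 (- n) (\<lambda>_ y. y) f \<in> maps W (tensor_complex P alg_complex) (0 + - n)"
  by (rule tensor_map_gmap(1) [OF graded_P graded_P graded_P graded_alg id_maps f])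

lemmas graded_TL = graded_tensor [OF graded_alg graded_P] and graded_TR = graded_tensor [OF graded_P graded_alg]

lemma KL_tgen: "KL n f (tgen P P k i u v) = (if i = n then tl_act (ev n f u) (inc P (k - n) (prj P (k - n) v)) else 0)"
  unfolding KL_def tensor_map_gmap(2) [OF graded_P graded_P graded_alg graded_P f id_maps]
  by (simp add: left_unit_gmap [OF graded_P] prj_gmap [OF graded_P graded_P id_maps] alg_val_gmap)

lemma KR_tgen: "KR n f (tgen P P k i u v) =
    (if i = k - n then signed (i * n) (tr_act (inc P (k - n) (prj P (k - n) u)) (ev n f v)) else 0)"
proof -
  note R = additive_gmap [OF graded_TR graded_P right_unit_gmap(1) [OF graded_P]]
  show ?thesis
    unfolding KR_def tensor_map_gmap(2) [OF graded_P graded_P graded_P graded_alg id_maps f] additive_signed [OF R]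
    by (simp add: right_unit_gmap [OF graded_P] prj_gmap [OF graded_P graded_P id_maps] alg_val_gmap signed_def)
qed

lemma additive_KL: "additive (KL n f)" and KL_l: "KL n f (tl_act a w) = tl_act a (KL n f w)"
  and KL_r: "KL n f (tr_act w a) = tr_act (KL n f w) a"
  unfolding KL_def
  by (simp_all only: additive_def simp_thms additive.add [OF additive_gmap [OF graded_W graded_TL maps_left]]
    additive.add [OF additive_gmap [OF graded_TL graded_P left_unit_gmap(1) [OF graded_P]]]
    gmap_l [OF graded_W graded_TL maps_left] gmap_r [OF graded_W graded_TL maps_left]
    gmap_l [OF graded_TL graded_P left_unit_gmap(1) [OF graded_P]] gmap_r [OF graded_TL graded_P left_unit_gmap(1) [OF graded_P]])

lemma additive_KR: "additive (KR n f)" and KR_l: "KR n f (tl_act a w) = tl_act a (KR n f w)"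
  and KR_r: "KR n f (tr_act w a) = tr_act (KR n f w) a"
  unfolding KR_def
  by (simp_all only: additive_def simp_thms additive.add [OF additive_gmap [OF graded_W graded_TR maps_right]]
    additive.add [OF additive_gmap [OF graded_TR graded_P right_unit_gmap(1) [OF graded_P]]]
    gmap_l [OF graded_W graded_TR maps_right] gmap_r [OF graded_W graded_TR maps_right]
    gmap_l [OF graded_TR graded_P right_unit_gmap(1) [OF graded_P]] gmap_r [OF graded_TR graded_P right_unit_gmap(1) [OF graded_P]])

lemma KL_homog: "w \<in> homog W k \<Longrightarrow> KL n f w \<in> homog P (k - n)"
  and KR_homog: "w \<in> homog W k \<Longrightarrow> KR n f w \<in> homog P (k - n)"
  unfolding KL_def KR_def
  using gmap_homog [OF graded_TL graded_P left_unit_gmap(1) [OF graded_P] gmap_homog [OF graded_W graded_TL maps_left], of w k]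
    gmap_homog [OF graded_TR graded_P right_unit_gmap(1) [OF graded_P] gmap_homog [OF graded_W graded_TR maps_right], of w k]
  by simp_all

lemma KL_inc: "y \<in> carrier (cmod W k) \<Longrightarrow> KL n f (inc W k y) =
    inc P (k - n) (left_unit P (k - n) (tensor_map alg_complex P (- n) 0 f (\<lambda>_ y. y) k y))"
  and KR_inc: "y \<in> carrier (cmod W k) \<Longrightarrow> KR n f (inc W k y) =
    inc P (k - n) (right_unit P (k - n) (tensor_map P alg_complex 0 (- n) (\<lambda>_ y. y) f k y))"
proof -
  assume y: "y \<in> carrier (cmod W k)"
  show "KL n f (inc W k y) = inc P (k - n) (left_unit P (k - n) (tensor_map alg_complex P (- n) 0 f (\<lambda>_ y. y) k y))"
    unfolding KL_def gmap_inc [OF graded_W graded_TL maps_left y]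
    using gmap_inc [OF graded_TL graded_P left_unit_gmap(1) [OF graded_P] bimod_hom_closed [OF mapsD [OF maps_left] y]] by simp
  show "KR n f (inc W k y) = inc P (k - n) (right_unit P (k - n) (tensor_map P alg_complex 0 (- n) (\<lambda>_ y. y) f k y))"
    unfolding KR_def gmap_inc [OF graded_W graded_TR maps_right y]
    using gmap_inc [OF graded_TR graded_P right_unit_gmap(1) [OF graded_P] bimod_hom_closed [OF mapsD [OF maps_right] y]] by simp
qed

lemma KL_closed: "y \<in> carrier (cmod W k) \<Longrightarrow> left_unit P (k - n) (tensor_map alg_complex P (- n) 0 f (\<lambda>_ y. y) k y) \<in> carrier (cmod P (k - n))"
  and KR_closed: "y \<in> carrier (cmod W k) \<Longrightarrow> right_unit P (k - n) (tensor_map P alg_complex 0 (- n) (\<lambda>_ y. y) f k y) \<in> carrier (cmod P (k - n))"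
  using bimod_hom_closed [OF mapsD [OF left_unit_gmap(1) [OF graded_P]] bimod_hom_closed [OF mapsD [OF maps_left]], of y k]
    bimod_hom_closed [OF mapsD [OF right_unit_gmap(1) [OF graded_P]] bimod_hom_closed [OF mapsD [OF maps_right]], of y k]
  by simp_all

end

lemma aug_maps: "aug \<mu> \<in> maps P alg_complex (- 0)"
  using mu_hom by (auto simp: maps_def aug_def bimod_hom_def alg_simps graded_ring_bimod graded_alg ring_bimod_zero)

lemma ev_aug: "ev 0 (aug \<mu>) = mu"
  by (simp add: fun_eq_iff ev_def aug_def mu_def)

text \<open>
  The contraction of the left factor reduces cycles of \<open>P \<otimes> P\<close> to elements \<open>p \<otimes> v\<close> with
  \<open>p \<in> P\<^sub>0\<close>.
\<close>

lemma exact_W: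
  assumes w: "w \<in> homog W n" and dw: "dW w = 0" and n0: "n = 0 \<Longrightarrow> mu (KL 0 (aug \<mu>) w) = 0"
  shows "\<exists>w'\<in>homog W (n + 1). dW w' = w"
proof -
  let ?B = "KL 0 (aug \<mu>)"
  note B = additive_KL [OF aug_maps] KL_homog [OF aug_maps] KL_tgen [OF aug_maps, unfolded ev_aug]
  obtain p S where p: "p \<in> homog P 0" "mu p = 1" and S: "\<And>i :: int. additive (S i)" "\<And>i u a. S i (tr_act u a) = tr_act (S i u) a"
    "\<And>i u. u \<in> homog P i \<Longrightarrow> S i u \<in> homog P (i + 1)"
    "\<And>i u. u \<in> homog P i \<Longrightarrow> d (S i u) + S (i - 1) (d u) = u - (if i = 0 then tr_act p (mu u) else 0)"
    using contraction by metis
  \<comment> \<open>This is S \<otimes> 1, obtained from the universal property because S is right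
    linear only.\<close>
  have "\<exists>E. additive E \<and> (\<forall>i u v. E (tgen P P k i u v) = tgen P P (k + 1) (i + 1) (S i (inc P i (prj P i u))) v)" for k
  proof -
    obtain E where "additive E"
      "\<And>i u v. E (tgen P P k i u v) = tgen P P (k + 1) (i + 1) (S i (inc P i (prj P i u))) (inc P (k - i) (prj P (k - i) v))"
      using tensor_universal [OF graded_P graded_P, of "\<lambda>i u v. tgen P P (k + 1) (i + 1) (S i u) v" k]
      by (auto simp: additive.add [OF S(1)] S(2) t.t_add_left t.t_add_right t.t_balanced)
    then show ?thesis using tgen_prj(2) [OF graded_P graded_P, of "k + 1" "i + 1" for i]
      by (intro exI [of _ E]) simp
  qed
  then obtain E where E: "\<And>k. additive (E k)"
    "\<And>k i u v. E k (tgen P P k i u v) = tgen P P (k + 1) (i + 1) (S i (inc P i (prj P i u))) v"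
    by metis
  have E_homog: "E n w \<in> homog W (n + 1)" using w
    by (induction rule: tensor_induct [OF graded_P graded_P, consumes 1, case_names zero tgen diff])
      (simp_all add: additive.zero [OF E(1)] additive.diff [OF E(1)] E(2) homog_0 homog_diff graded_W tgen_homog graded_P)
  \<comment> \<open>S \<otimes> 1 is a homotopy from the identity to w \<mapsto> p \<otimes> (\<mu>
    \<otimes> 1)w. The terms with the differential of the right factor cancel, since S raises the
    degree of the left factor by one and thereby changes the sign.\<close>
  have "dW (E n w) + E (n - 1) (dW w) = w - tgen P P n 0 p (?B w)"
    using w
  proof (induction rule: tensor_induct [OF graded_P graded_P, consumes 1, case_names zero tgen diff])
    case zero
    show ?case by (simp add: additive.zero [OF E(1)] additive.zero [OF B(1)])
  next
    case (tgen i u v)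
    define x where "x = inc P i (prj P i u)"
    have x: "x \<in> homog P i" by (simp add: x_def inc_homog graded_P prj_closed)
    have px: "inc P i (prj P i x) = x" by (rule inc_prj [OF graded_P x])
    have pdx: "inc P (i - 1) (prj P (i - 1) (d x)) = d x" by (rule inc_prj [OF graded_P d_homog [OF x]])
    have mu_x: "i = 0 \<Longrightarrow> mu u = mu x" by (simp add: x_def mu_def prj_inc graded_P prj_closed)
    have p_act: "tgen P P n 0 p (tl_act a (inc P n (prj P n v))) = tgen P P n 0 p (tl_act a v)" for a
      using tgen_prj(2) [OF graded_P graded_P, of n 0 p "tl_act a v"]
      by (simp add: prj_simps graded_P inc_l prj_closed)
    have "dW (E n (tgen P P n i x v)) + E (n - 1) (dW (tgen P P n i x v)) =
        tgen P P n i (d (S i x) + S (i - 1) (d x)) v"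
      by (simp add: E(2) dW_tgen additive.add [OF E(1)] additive_signed [OF E(1)] px pdx t.t_add_left)
        (simp add: signed_def)
    also have "\<dots> = tgen P P n i x v - tgen P P n 0 p (?B (tgen P P n i x v))"
      by (simp add: S(4) [OF x] t.t_diff_left t.t_balanced B(3) p_act)
    finally show ?case
      by (simp add: x_def tgen_prj(1) [OF graded_P graded_P])
  next
    case (diff w w')
    then show ?case
      by (simp add: additive.diff [OF E(1)] additive.diff [OF B(1)] dW_diff t.t_diff_right algebra_simps)
  qed
  then have w_eq: "w = dW (E n w) + tgen P P n 0 p (?B w)"
    using dw by (simp add: additive.zero [OF E(1)] algebra_simps)
  \<comment> \<open>\<mu> \<otimes> 1 is a chain map to P, so the cycle \<open>w\<close> gives a
    cycle \<open>?B w\<close>. It bounds by exactness of P in positive degrees and by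
    \<open>n0\<close> in degree 0.\<close>
  have dB: "d (?B w) = ?B (dW w)"
    using w
  proof (induction rule: tensor_induct [OF graded_P graded_P, consumes 1, case_names zero tgen diff])
    case (tgen i u v)
    have "i = 1 \<Longrightarrow> mu (d u) = 0" by (simp add: mu_d)
    moreover have "inc P (n - 1) (prj P (n - 1) (d v)) = d (inc P n (prj P n v))"
      by (simp add: prj_d d_inc graded_P prj_closed)
    ultimately show ?case
      by (simp add: B(3) dW_tgen additive.add [OF B(1)] additive_signed [OF B(1)] d_l mu_d)
  qed (simp_all add: additive.zero [OF B(1)] additive.diff [OF B(1)] d_diff dW_diff)
  have Bw: "?B w \<in> homog P n" using B(2) [OF w] by simp
  have "\<exists>y\<in>homog P (n + 1). d y = ?B w"
  proof -
    consider "n < 0" | "n = 0" | "0 < n" by linarith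
    then show ?thesis
    proof cases
      case 1
      then show ?thesis using homog_neg [OF Bw] by (intro bexI [of _ 0]) (simp_all add: homog_0 graded_P)
    next
      case 2
      then show ?thesis using exact_mu [of "?B w"] n0 Bw by simp
    next
      case 3
      then show ?thesis using exact_pos [OF 3 Bw] dB dw by (simp add: additive.zero [OF B(1)])
    qed
  qed
  then obtain y where y: "y \<in> homog P (n + 1)" "d y = ?B w" by blast
  have "d p = 0" using homog_neg [OF d_homog [OF p(1)]] by simp
  then have "dW (tgen P P (n + 1) 0 p y) = tgen P P n 0 p (?B w)"
    by (simp add: dW_tgen y)
  then have "dW (E n w + tgen P P (n + 1) 0 p y) = w" using w_eq by (simp add: dW_add)
  then show ?thesis using E_homog by (intro bexI [of _ "E n w + tgen P P (n + 1) 0 p y"] homog_add graded_W tgen_homog graded_P)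
qed

end

section \<open>The bar resolution\<close>

lemma bar_relE:
  assumes "v \<in> bar_rel scale n"
  obtains (add) xs a b ys where "v = frag_of (xs @ (a + b) # ys) - frag_of (xs @ a # ys) - frag_of (xs @ b # ys)"
      "0 \<le> n" "int (length xs + length ys) = n + 1"
    | (scale) xs c a ys b zs where "v = frag_of (xs @ scale c a # ys @ b # zs) - frag_of (xs @ a # ys @ scale c b # zs)"
      "0 \<le> n" "int (length xs + length ys + length zs) = n"
  using assms unfolding bar_rel_def by blast

lemma bar_relI:
  "0 \<le> n \<Longrightarrow> int (length xs + length ys) = n + 1 \<Longrightarrow>
    frag_of (xs @ (a + b) # ys) - frag_of (xs @ a # ys) - frag_of (xs @ b # ys) \<in> bar_rel scale n"
  "0 \<le> n \<Longrightarrow> int (length xs + length ys + length zs) = n \<Longrightarrow>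
    frag_of (xs @ scale c a # ys @ b # zs) - frag_of (xs @ a # ys @ scale c b # zs) \<in> bar_rel scale n"
  unfolding bar_rel_def by blast+

abbreviation bar_gens :: "int \<Rightarrow> 'a list set" where
  "bar_gens n \<equiv> {as. 0 \<le> n \<and> int (length as) = n + 2}"

abbreviation bar_cls :: "('k \<Rightarrow> 'a::{ring,monoid_mult} \<Rightarrow> 'a) \<Rightarrow> int \<Rightarrow> 'a list \<Rightarrow> ('a list \<Rightarrow>\<^sub>0 int) set" where
  "bar_cls scale n as \<equiv> pres_class (bar_rel scale n) (frag_of as)"

lemma bar_gens_cases:
  assumes "as \<in> bar_gens n"
  obtains a bs z where "as = a # bs @ [z]" "int (length bs) = n"
proof -
  obtain a cs where 1: "as = a # cs" using assms by (cases as) auto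
  then have "cs \<noteq> []" using assms by auto
  then obtain bs z where "cs = bs @ [z]" by (metis rev_exhaust)
  with 1 assms that show thesis by auto
qed

context k_algebra
begin

lemma bar_presentation: "presentation (bar_gens n) (bar_rel scale n)
    (\<lambda>a as. (a * hd as) # tl as) (\<lambda>as a. butlast as @ [last as * a])"
proof
  fix v assume v: "v \<in> bar_rel scale n"
  then show "Poly_Mapping.keys v \<subseteq> bar_gens n"
    by (cases rule: bar_relE; simp only:; intro keys_relator) auto
  fix c
  show "frag_extend (\<lambda>g. frag_of ((c * hd g) # tl g)) v \<in> group_closure (bar_rel scale n)"
    using v
  proof (cases rule: bar_relE)
    case (add xs a b ys)
    then show ?thesis
      using bar_relI(1) [of n "[]" ys "c * a" "c * b" scale] bar_relI(1) [of n "(c * hd xs) # tl xs" ys a b scale]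
      by (cases xs) (simp_all add: frag_extend_diff distrib_left group_closure.base)
  next
    case (scale xs k a ys b zs)
    then show ?thesis
      using bar_relI(2) [of n "[]" ys zs scale k "c * a" b] bar_relI(2) [of n "(c * hd xs) # tl xs" ys zs scale k a b]
      by (cases xs) (simp_all add: frag_extend_diff group_closure.base flip: scale_mult_right)
  qed
  show "frag_extend (\<lambda>g. frag_of (butlast g @ [last g * c])) v \<in> group_closure (bar_rel scale n)"
    using v
  proof (cases rule: bar_relE)
    case (add xs a b ys)
    then show ?thesis
      using bar_relI(1) [of n xs "[]" "a * c" "b * c" scale] bar_relI(1) [of n xs "butlast ys @ [last ys * c]" a b scale]
      by (cases ys rule: rev_cases) (simp_all add: frag_extend_diff distrib_right group_closure.base butlast_append)
  next
    case (scale xs k a ys b zs)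
    then show ?thesis
      using bar_relI(2) [of n xs ys "[]" scale k a "b * c"] bar_relI(2) [of n xs ys "butlast zs @ [last zs * c]" scale k a b]
      by (cases zs rule: rev_cases) (simp_all add: frag_extend_diff group_closure.base butlast_append flip: scale_mult_left)
  qed
next
  fix as :: "'a list" and a b assume as: "as \<in> bar_gens n"
  then obtain h bs z where e: "as = h # bs @ [z]" "int (length bs) = n" by (rule bar_gens_cases)
  show "frag_of (((a + b) * hd as) # tl as) - frag_of ((a * hd as) # tl as) - frag_of ((b * hd as) # tl as)
      \<in> group_closure (bar_rel scale n)"
    using bar_relI(1) [of n "[]" "bs @ [z]" "a * h" "b * h" scale] as e by (simp add: distrib_right group_closure.base)
  show "frag_of (butlast as @ [last as * (a + b)]) - frag_of (butlast as @ [last as * a]) - frag_of (butlast as @ [last as * b])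
      \<in> group_closure (bar_rel scale n)"
    using bar_relI(1) [of n "h # bs" "[]" "z * a" "z * b" scale] as e by (simp add: distrib_left group_closure.base)
qed (erule bar_gens_cases, simp add: mult.assoc)+

abbreviation B where "B \<equiv> bar_complex scale"

lemma cmod_B [simp]: "cmod B n = bar_mod scale n"
  by (simp add: bar_complex_def)

lemmas bar_ring_bimod = presentation.ring_bimod [OF bar_presentation, folded bar_mod_def]

lemma graded_B: "graded_bimod B"
  by (simp add: graded_bimod_def bar_ring_bimod)

lemmas bar_cls_closed = presentation.gen_closed [OF bar_presentation, folded bar_mod_def]

lemma bar_cls_l: "a \<odot>\<^bsub>bar_mod scale n\<^esub> bar_cls scale n (h # as) = bar_cls scale n ((a * h) # as)"
  and bar_cls_r: "bar_cls scale n (as @ [z]) \<bullet>\<^bsub>bar_mod scale n\<^esub> a = bar_cls scale n (as @ [z * a])"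
  using presentation.gen_l [OF bar_presentation, folded bar_mod_def, where g = "h # as"]
    presentation.gen_r [OF bar_presentation, folded bar_mod_def, where g = "as @ [z]"] by simp_all

lemma bar_induct [consumes 1, case_names zero gen diff]:
  assumes "w \<in> homog B n" "R 0" "\<And>a bs z. int (length bs) = n \<Longrightarrow> R (inc B n (bar_cls scale n (a # bs @ [z])))"
    "\<And>w w'. w \<in> homog B n \<Longrightarrow> w' \<in> homog B n \<Longrightarrow> R w \<Longrightarrow> R w' \<Longrightarrow> R (w - w')"
  shows "R w"
proof -
  obtain x where x: "w = inc B n x" "x \<in> carrier (bar_mod scale n)"
    using assms(1) by (auto simp: homog_def)
  from x(2) have "R (inc B n x)"
  proof (induction rule: presentation.carrier_induct [OF bar_presentation, folded bar_mod_def, consumes 1, case_names zero gen diff])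
    case zero
    show ?case using inc_zero [OF graded_B, of n] assms(2) by simp
  next
    case (gen g)
    then show ?case using assms(3) by (elim bar_gens_cases) simp
  next
    case (diff x y)
    then show ?case using inc_diff [OF graded_B, of x n y] assms(4) inc_homog [OF graded_B] by simp
  qed
  then show ?thesis using x by simp
qed

text \<open>Zero on lists of the wrong length, which makes it multilinear as a function on all
  lists.\<close>

definition bgen :: "nat \<Rightarrow> 'a list \<Rightarrow> ('a, ('a list \<Rightarrow>\<^sub>0 int) set) total" where
  "bgen n as = (if length as = n + 2 then inc B (int n) (bar_cls scale (int n) as) else 0)"

text \<open>The relators only move scalars between slots. Moved to the first slot, a scalar becomes
  the left action of \<open>scale c 1\<close>.\<close>

lemma multilinear_bgen: "multilinear scale (\<lambda>c. tl_act (scale c 1)) (bgen n)"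
proof -
  have "bgen n (xs @ (a + b) # ys) = bgen n (xs @ a # ys) + bgen n (xs @ b # ys)" for xs ys a b
  proof (cases "length xs + length ys = n + 1")
    case True
    then have "bar_cls scale (int n) (xs @ (a + b) # ys)
        = bar_cls scale (int n) (xs @ a # ys) \<oplus>\<^bsub>bar_mod scale (int n)\<^esub> bar_cls scale (int n) (xs @ b # ys)"
      using presentation.gen_add [OF bar_presentation, folded bar_mod_def, OF bar_relI(1)] by simp
    with True show ?thesis
      using inc_add [OF graded_B, of _ "int n"] by (simp add: bgen_def bar_cls_closed)
  qed (simp add: bgen_def)
  moreover have "bgen n (xs @ scale c a # ys) = tl_act (scale c 1) (bgen n (xs @ a # ys))" for c xs a ys
  proof (cases "length xs + length ys = n + 1")
    case True
    have *: "bar_cls scale (int n) (xs @ scale c a # ys) = scale c 1 \<odot>\<^bsub>bar_mod scale (int n)\<^esub> bar_cls scale (int n) (xs @ a # ys)"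
    proof (cases xs)
      case Nil
      then show ?thesis by (simp add: bar_cls_l scale_one_left)
    next
      case (Cons x xs')
      then have "bar_cls scale (int n) (scale c x # xs' @ a # ys) = bar_cls scale (int n) (x # xs' @ scale c a # ys)"
        using presentation.gen_eq [OF bar_presentation, folded bar_mod_def, OF bar_relI(2), of "int n" "[]" xs' ys c x a] True by simp
      then show ?thesis by (simp add: Cons bar_cls_l scale_one_left)
    qed
    show ?thesis using True inc_l [OF graded_B, of _ "int n"] by (simp add: bgen_def * bar_cls_closed)
  qed (simp add: bgen_def)
  ultimately show ?thesis by (simp add: multilinear_iff slotwise_add_def)
qed

text \<open>The universal cochain. A bimodule map on the bar resolution is determined by its values
  on these elements, and composition with \<open>bar_unit\<close> turns it into a cochain.\<close>

definition bar_unit :: "'a list \<Rightarrow> ('a, ('a list \<Rightarrow>\<^sub>0 int) set) total" where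
  "bar_unit bs = inc B (int (length bs)) (bar_cls scale (int (length bs)) (1 # bs @ [1]))"

lemma bar_unit_homog: "bar_unit bs \<in> homog B (int (length bs))"
  unfolding bar_unit_def by (rule inc_homog [OF graded_B]) (simp add: bar_cls_closed)

lemma inc_bar_cls: "int (length bs) = n \<Longrightarrow> inc B n (bar_cls scale n (a # bs @ [z])) = tl_act a (tr_act (bar_unit bs) z)"
proof -
  assume n: "int (length bs) = n"
  then have c: "bar_cls scale n (1 # bs @ [1]) \<in> carrier (cmod B n)" "bar_cls scale n (1 # bs @ [z]) \<in> carrier (cmod B n)"
    by (auto simp: bar_cls_closed)
  have "tr_act (bar_unit bs) z = inc B n (bar_cls scale n (1 # bs @ [z]))"
    using inc_r [OF graded_B c(1), of z] bar_cls_r [of n "1 # bs" 1 z] n by (simp add: bar_unit_def)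
  then show ?thesis using inc_l [OF graded_B c(2), of a] by (simp add: bar_cls_l)
qed

lemma bgen_eq: "length bs = n \<Longrightarrow> bgen n (a # bs @ [z]) = tl_act a (tr_act (bar_unit bs) z)"
  by (simp add: bgen_def inc_bar_cls)

lemma multilinear_bar_unit: "multilinear scale (\<lambda>c. tl_act (scale c 1)) bar_unit"
proof -
  have 1: "bar_unit bs = bgen (length bs) (1 # bs @ [1])" for bs
    by (simp add: bgen_def bar_unit_def)
  have *: "multilinear scale (\<lambda>c. tl_act (scale c 1)) (\<lambda>bs. bgen n (1 # bs @ [1]))" for n
    using multilinear_bgen [of n] by (auto simp: multilinear_iff slotwise_add_def) (metis append_Cons append_assoc)+
  have "(\<lambda>bs. bgen (length bs) (1 # bs @ [1])) = bar_unit" by (simp add: fun_eq_iff 1)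
  then show ?thesis
    using multilinear_by_length [where Y = "\<lambda>n bs. bgen n (1 # bs @ [1])", OF *] by simp
qed

lemma central_bar: "w \<in> homog B n \<Longrightarrow> tl_act (scale c 1) w = tr_act w (scale c 1)"
proof (induction rule: bar_induct)
  case (gen a bs z)
  then have n: "n = int (length bs)" by simp
  have "bgen (length bs) (scale c a # bs @ [z]) = bgen (length bs) (a # bs @ [scale c z])"
    using multilinear_bgen [of "length bs"] by (simp add: multilinear_iff) (metis append_Cons append_Nil)
  then have "tl_act (scale c a) (tr_act (bar_unit bs) z) = tl_act a (tr_act (bar_unit bs) (scale c z))"
    by (simp add: bgen_eq)
  then show ?case
    by (simp add: inc_bar_cls gen T.l_r flip: T.l_assoc T.r_assoc) (simp add: scale_one_left scale_one_right)
qed (simp_all add: T.l_diff T.r_diff)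

text \<open>A cochain \<open>F\<close> extends to a \<otimes> bs \<otimes> z by a F(bs) z. Relators
  moving a scalar between inner slots are respected by multilinearity, those that involve the last
  slot because the values of \<open>F\<close> are central over k.\<close>

lemma bar_lift:
  fixes N :: "('a, 'm) bimodule"
  assumes N: "ring_bimod N"
    and F: "multilinear scale (\<lambda>c. tl_act (scale c 1)) F" "\<And>bs c. int (length bs) = n \<Longrightarrow> tl_act (scale c 1) (F bs) = tr_act (F bs) (scale c 1)"
    and h: "\<And>a bs z. int (length bs) = n \<Longrightarrow> h (a # bs @ [z]) \<in> carrier N \<and> embed (k, N) (h (a # bs @ [z])) = tl_act a (tr_act (F bs) z)"
  shows "pres_lift N h \<in> bimod_hom (bar_mod scale n) N"
    and "int (length bs) = n \<Longrightarrow> pres_lift N h (bar_cls scale n (a # bs @ [z])) = h (a # bs @ [z])"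
proof -
  have eqI: "x = y" if "x \<in> carrier N" "y \<in> carrier N" "embed (k, N) x = embed (k, N) y" for x y
    using that embed_inject [OF N] by blast
  have hc: "h as \<in> carrier N" if "as \<in> bar_gens n" for as
    by (rule bar_gens_cases [OF that]) (simp add: h)
  let ?e = "\<lambda>as. embed (k, N) (h as)"
  have e_add: "?e (xs @ (a + b) # ys) = ?e (xs @ a # ys) + ?e (xs @ b # ys)"
    if n: "0 \<le> n" "int (length xs + length ys) = n + 1" for xs a b ys
  proof (cases xs)
    case Nil
    then have "ys \<noteq> []" using n by auto
    then obtain bs z where ys: "ys = bs @ [z]" by (metis rev_exhaust)
    show ?thesis using n by (simp add: Nil ys h T.l_add_left)
  next
    case (Cons x xs')
    show ?thesis
    proof (cases ys rule: rev_cases)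
      case Nil
      then show ?thesis using n Cons h [of xs' x] by (simp add: T.r_add_right T.l_add)
    next
      case (snoc bs z)
      have "F (xs' @ (a + b) # bs) = F (xs' @ a # bs) + F (xs' @ b # bs)"
        using F(1) by (simp add: multilinear_iff slotwise_add_def)
      then show ?thesis
        using n Cons snoc h [of "xs' @ _ # bs" x z] by (simp add: T.l_add T.r_add)
    qed
  qed
  have e_hom: "?e (xs @ scale c a # ys) = tl_act (scale c 1) (?e (xs @ a # ys))"
    if n: "0 \<le> n" "int (length xs + length ys) = n + 1" for xs c a ys
  proof (cases xs)
    case Nil
    then have "ys \<noteq> []" using n by auto
    then obtain bs z where ys: "ys = bs @ [z]" by (metis rev_exhaust)
    show ?thesis using n by (simp add: Nil ys h scale_one_left flip: T.l_assoc)
  next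
    case (Cons x xs')
    have comm: "tl_act x (tl_act (scale c 1) y) = tl_act (scale c 1) (tl_act x y)" for y :: "('a, 'm) total"
      by (simp add: scale_one_left scale_one_right flip: T.l_assoc)
    show ?thesis
    proof (cases ys rule: rev_cases)
      case Nil
      then have "int (length xs') = n" using n Cons by simp
      moreover have "tr_act (F xs') (scale c a) = tl_act (scale c 1) (tr_act (F xs') a)"
        using F(2) [OF \<open>int (length xs') = n\<close>, of c] by (metis T.l_r T.r_assoc scale_one_left)
      ultimately show ?thesis using Nil Cons h [of xs' x] by (simp add: comm)
    next
      case (snoc bs z)
      have "F (xs' @ scale c a # bs) = tl_act (scale c 1) (F (xs' @ a # bs))"
        using F(1) by (simp add: multilinear_iff)
      then show ?thesis
        using n Cons snoc h [of "xs' @ _ # bs" x z] by (simp add: T.l_r comm)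
    qed
  qed
  have kills: "frag_eval N h v = \<zero>\<^bsub>N\<^esub>" if v: "v \<in> bar_rel scale n" for v
    using v
  proof (cases rule: bar_relE)
    case (add xs a b ys)
    have c: "h (xs @ y # ys) \<in> carrier N" for y using add by (intro hc) auto
    have "h (xs @ (a + b) # ys) = h (xs @ a # ys) \<oplus>\<^bsub>N\<^esub> h (xs @ b # ys)"
      using e_add [OF add(2,3)] by (intro eqI) (simp_all add: c N ring_bimod_add embed_add)
    then show ?thesis unfolding add(1)
      using add(2,3) by (intro frag_eval_relator(2) [where S = "bar_gens n", OF ring_bimod_group [OF N] hc]) auto
  next
    case (scale xs c a ys b zs)
    have "?e (xs @ scale c a # ys @ b # zs) = ?e (xs @ a # ys @ scale c b # zs)"
      using e_hom [of xs "ys @ b # zs" c a] e_hom [of "xs @ a # ys" zs c b] scale(2,3) by simp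
    then have "h (xs @ scale c a # ys @ b # zs) = h (xs @ a # ys @ scale c b # zs)"
      using scale(2,3) by (intro eqI hc) auto
    then show ?thesis unfolding scale(1)
      using scale(2,3) by (intro frag_eval_relator(1) [where S = "bar_gens n", OF ring_bimod_group [OF N] hc]) auto
  qed
  show "pres_lift N h \<in> bimod_hom (bar_mod scale n) N"
    unfolding bar_mod_def
  proof (rule presentation.lift_hom [OF bar_presentation N hc kills])
    fix g :: "'a list" and a assume g: "g \<in> bar_gens n"
    then obtain x bs z where e: "g = x # bs @ [z]" "int (length bs) = n" by (rule bar_gens_cases)
    show "h ((a * hd g) # tl g) = a \<odot>\<^bsub>N\<^esub> h g"
      by (rule eqI) (simp_all add: e h ring_bimod_l N embed_l T.l_assoc)
    show "h (butlast g @ [last g * a]) = h g \<bullet>\<^bsub>N\<^esub> a"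
      using h [OF e(2), of x "z * a"]
      by (intro eqI) (simp_all add: e h ring_bimod_r N embed_r T.r_assoc T.l_r butlast_append)
  qed
  show "int (length bs) = n \<Longrightarrow> pres_lift N h (bar_cls scale n (a # bs @ [z])) = h (a # bs @ [z])"
    using presentation.lift_gen [OF bar_presentation ring_bimod_group [OF N] hc kills, where g = "a # bs @ [z]"] by simp
qed

text \<open>In the bar differential neighbours are multiplied and nothing acts from outside, so it
  is \<open>merge\<close> with the right action replaced by zero.\<close>

lemma merge_zero_sum:
  fixes F :: "'a list \<Rightarrow> 'v::ab_group_add"
  shows "merge (\<lambda>_ _. 0) F as = (\<Sum>i<length as - 1. signed (int i) (F (take i as @ (as ! i * as ! Suc i) # drop (i + 2) as)))"
proof (induction as arbitrary: F rule: induct_list012)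
  case (3 x y zs)
  have e: "length (x # y # zs) - 1 = Suc (length (y # zs) - 1)" by simp
  have "signed (int (Suc i)) v = - signed (int i) v" for i and v :: 'v by (simp add: signed_def)
  then show ?case
    unfolding e sum.lessThan_Suc_shift by (simp add: 3 sum_negf del: sum.lessThan_Suc of_nat_Suc)
qed simp_all

lemma merge_zero_right:
  "merge (\<lambda>_ _. 0) (\<lambda>ys. tr_act (\<beta> (butlast ys)) (last ys)) (bs @ [z]) = tr_act (merge tr_act \<beta> bs) z"
proof (induction bs arbitrary: \<beta> rule: induct_list012)
  case (3 b c cs)
  have "merge (\<lambda>_ _. 0) (\<lambda>ys. tr_act (\<beta> (butlast (b # ys))) (last (b # ys))) ((c # cs) @ [z])
      = merge (\<lambda>_ _. 0) (\<lambda>ys. tr_act (\<beta> (b # butlast ys)) (last ys)) ((c # cs) @ [z])"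
    by (rule merge_cong) auto
  then show ?case using 3(2) [of "\<lambda>ys. \<beta> (b # ys)"] by (simp add: T.r_diff)
qed (simp_all add: T.r_assoc)

text \<open>The first face multiplies into \<open>a\<close>, the last into \<open>z\<close>. Read as
  left and right action they complete the inner faces to a coboundary, so the bar differential is
  the coboundary of the universal cochain.\<close>

lemma merge_bgen:
  assumes "bs \<noteq> []"
  shows "merge (\<lambda>_ _. 0) (bgen (length bs - 1)) (a # bs @ [z]) = tl_act a (tr_act (hb tl_act tr_act bar_unit bs) z)"
proof -
  obtain b cs where bs: "bs = b # cs" using assms by (cases bs) auto
  have "merge (\<lambda>_ _. 0) (\<lambda>ys. bgen (length bs - 1) (a # ys)) (bs @ [z])
      = merge (\<lambda>_ _. 0) (\<lambda>ys. tl_act a (tr_act (bar_unit (butlast ys)) (last ys))) (bs @ [z])"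
  proof (rule merge_cong)
    fix ys :: "'a list" assume "Suc (length ys) = length (bs @ [z])"
    then have len: "length ys = Suc (length bs - 1)" using bs by simp
    then have "ys = butlast ys @ [last ys]" by (cases ys rule: rev_cases) auto
    then show "bgen (length bs - 1) (a # ys) = tl_act a (tr_act (bar_unit (butlast ys)) (last ys))"
      using bgen_eq [of "butlast ys" "length bs - 1" a "last ys"] len by simp
  qed
  also have "\<dots> = tl_act a (merge (\<lambda>_ _. 0) (\<lambda>ys. tr_act (bar_unit (butlast ys)) (last ys)) (bs @ [z]))"
    by (rule merge_hom [OF T.additive_l, symmetric]) simp
  also have "\<dots> = tl_act a (tr_act (merge tr_act bar_unit bs) z)" by (simp only: merge_zero_right)
  finally show ?thesis
    using bgen_eq [of cs "length bs - 1" "a * b" z]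
    by (simp add: bs hb_Cons T.l_assoc T.l_diff T.r_diff T.l_r)
qed

lemma inc_bar_sum:
  assumes "finite I" "\<And>i. i \<in> I \<Longrightarrow> Poly_Mapping.keys (g i) \<subseteq> bar_gens n"
  shows "pres_class (bar_rel scale n) (sum g I) \<in> carrier (bar_mod scale n) \<and>
    inc B n (pres_class (bar_rel scale n) (sum g I)) = (\<Sum>i\<in>I. inc B n (pres_class (bar_rel scale n) (g i)))"
  using assms
proof (induction I rule: finite_induct)
  case empty
  note M = presentation.M_simps(2) [OF bar_presentation [of n], folded bar_mod_def]
  then show ?case using inc_zero [OF graded_B, of n] ring_bimod_zero [OF bar_ring_bimod, of n] by simp
next
  case (insert i I)
  note M = presentation.M_simps [OF bar_presentation [of n], folded bar_mod_def]
  have c: "pres_class (bar_rel scale n) (g i) \<in> carrier (bar_mod scale n)" using insert.prems by (auto simp: M(1))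
  have "pres_class (bar_rel scale n) (g i + sum g I) =
      pres_class (bar_rel scale n) (g i) \<oplus>\<^bsub>bar_mod scale n\<^esub> pres_class (bar_rel scale n) (sum g I)"
    by (simp add: M(3))
  then show ?case using insert c inc_add [OF graded_B, of _ n]
    by (simp add: ring_bimod_add [OF bar_ring_bimod])
qed

lemma inc_bar_signed:
  assumes "as \<in> bar_gens n"
  shows "inc B n (pres_class (bar_rel scale n) (signed k (frag_of as))) = signed k (inc B n (bar_cls scale n as))"
proof -
  note p = bar_presentation [of n]
  have "inc B n (pres_class (bar_rel scale n) (0 - frag_of as)) = 0 - inc B n (bar_cls scale n as)"
    using presentation.class_diff [OF p, of 0 "frag_of as", folded bar_mod_def] assms
      inc_diff [OF graded_B, of "\<zero>\<^bsub>bar_mod scale n\<^esub>" n "bar_cls scale n as"] bar_cls_closed [OF assms]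
      presentation.M_simps(2) [OF p, folded bar_mod_def] inc_zero [OF graded_B, of n] ring_bimod_zero [OF bar_ring_bimod, of n]
    by simp
  then show ?thesis by (simp add: signed_def)
qed

lemma cdiff_B:
  shows "cdiff B \<in> maps B B (- 1)"
    and "int (length bs) = n \<Longrightarrow> inc B (n - 1) (cdiff B n (bar_cls scale n (a # bs @ [z])))
      = tl_act a (tr_act (hb tl_act tr_act bar_unit bs) z)"
proof -
  let ?h = "\<lambda>n as. pres_class (bar_rel scale (n - 1)) (if n \<le> 0 then 0 else
          \<Sum>i\<le>nat n. signed (int i) (frag_of (take i as @ (as ! i * as ! Suc i) # drop (i + 2) as)))"
  have d: "cdiff B n = pres_lift (bar_mod scale (n - 1)) (?h n)" for n
    by (simp add: bar_complex_def)
  have h: "?h n (a # bs @ [z]) \<in> carrier (bar_mod scale (n - 1)) \<and>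
      embed (n - 1, bar_mod scale (n - 1)) (?h n (a # bs @ [z])) = tl_act a (tr_act (hb tl_act tr_act bar_unit bs) z)"
    if n: "int (length bs) = n" for n a bs z
  proof (cases "n \<le> 0")
    case True
    then have "length bs = 0" using n by linarith
    then have "bs = []" by simp
    then show ?thesis
      using True inc_zero [OF graded_B, of "n - 1"] presentation.M_simps(2) [OF bar_presentation [of "n - 1"], folded bar_mod_def]
       ring_bimod_zero [OF bar_ring_bimod, of "n - 1"] by (simp add: inc_def)
  next
    case False
    then have bs: "bs \<noteq> []" using n by auto
    let ?as = "a # bs @ [z]"
    let ?m = "\<lambda>i. take i ?as @ (?as ! i * ?as ! Suc i) # drop (i + 2) ?as"
    have len: "length ?as = nat n + 2" using n by simp
    have m: "?m i \<in> bar_gens (n - 1)" "length (?m i) = length bs - 1 + 2" if "i \<le> nat n" for i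
      using that n False bs len by (auto simp: min_def)
    have eq: "int (length bs - 1) = n - 1" using n False by simp
    have e: "inc B (n - 1) (bar_cls scale (n - 1) (?m i)) = bgen (length bs - 1) (?m i)" if "i \<le> nat n" for i
      unfolding bgen_def eq using m(2) [OF that] by (simp only: if_True refl)
    let ?g = "\<lambda>i. signed (int i) (frag_of (?m i))"
    have k: "Poly_Mapping.keys (?g i) \<subseteq> bar_gens (n - 1)" if "i \<in> {..nat n}" for i
    proof -
      have "Poly_Mapping.keys (?g i) = {?m i}" unfolding signed_def by (cases "even (int i)") (simp_all only: if_True if_False keys_minus keys_frag_of simp_thms)
      then show ?thesis using m(1) [of i] that by (simp only: atMost_iff insert_subset empty_subsetI simp_thms)
    qed
    note s = inc_bar_sum [OF finite_atMost k]
    have hs: "?h n ?as = pres_class (bar_rel scale (n - 1)) (sum ?g {..nat n})"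
      using False by (simp only: if_False)
    have "inc B (n - 1) (?h n ?as) = (\<Sum>i\<le>nat n. inc B (n - 1) (pres_class (bar_rel scale (n - 1)) (?g i)))"
      unfolding hs by (rule conjunct2 [OF s])
    also have "\<dots> = (\<Sum>i\<le>nat n. signed (int i) (bgen (length bs - 1) (?m i)))"
      by (rule sum.cong [OF refl]) (simp only: atMost_iff inc_bar_signed [OF m(1)] e)
    also have "\<dots> = merge (\<lambda>_ _. 0) (bgen (length bs - 1)) ?as"
    proof -
      have "length ?as - 1 = Suc (nat n)" using len by simp
      then show ?thesis unfolding merge_zero_sum by (simp only: lessThan_Suc_atMost)
    qed
    also have "\<dots> = tl_act a (tr_act (hb tl_act tr_act bar_unit bs) z)" by (rule merge_bgen [OF bs])
    finally show ?thesis unfolding hs using conjunct1 [OF s] by (simp only: inc_def cmod_B simp_thms)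
  qed
  have F: "multilinear scale (\<lambda>c. tl_act (scale c 1)) (hb tl_act tr_act bar_unit)"
  proof (rule multilinear_hb [OF multilinear_bar_unit])
    show "tr_act (bar_unit ys) (scale c a) = tl_act (scale c 1) (tr_act (bar_unit ys) a)" for c ys a
      using central_bar [OF bar_unit_homog, of c ys] by (metis T.l_r T.r_assoc scale_one_left)
    show "tl_act a (tl_act (scale c 1) x) = tl_act (scale c 1) (tl_act a x)"
      "tl_act (scale c a) x = tl_act (scale c 1) (tl_act a x)" for c a and x :: "('a, ('a list \<Rightarrow>\<^sub>0 int) set) total"
      by (simp_all add: scale_one_left scale_one_right flip: T.l_assoc)
  qed (simp_all add: scale_mult_left scale_mult_right T.additive_l T.additive_r T.additive_l_left T.additive_r_right T.l_r
      flip: scale_mult_left scale_mult_right)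
  have Fh: "hb tl_act tr_act bar_unit bs \<in> homog B (n - 1)" if "int (length bs) = n" for bs n
  proof (rule hb_closed)
    fix ys :: "'a list" assume "Suc (length ys) = length bs"
    then have "int (length ys) = n - 1" using that by simp
    then show "bar_unit ys \<in> homog B (n - 1)" using bar_unit_homog [of ys] by (simp only:)
  qed (simp_all add: homog_0 homog_diff homog_l homog_r graded_B)
  note lift = bar_lift [OF bar_ring_bimod F central_bar [OF Fh] h, folded d]
  show "cdiff B \<in> maps B B (- 1)" using lift(1) by (simp add: maps_def)
  show "int (length bs) = n \<Longrightarrow> inc B (n - 1) (cdiff B n (bar_cls scale n (a # bs @ [z])))
      = tl_act a (tr_act (hb tl_act tr_act bar_unit bs) z)"
    using lift(2) [where bs = bs and n = n and a = a and z = z] h [of bs n a z] by (simp add: inc_def)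
qed

definition dB where "dB = gmap B B (- 1) (cdiff B)"

lemma dB_bar_unit: "dB (bar_unit bs) = hb tl_act tr_act bar_unit bs"
  unfolding dB_def bar_unit_def [of bs]
  using gmap_inc [OF graded_B graded_B cdiff_B(1), of "bar_cls scale (int (length bs)) (1 # bs @ [1])" "int (length bs)"]
    cdiff_B(2) [of bs "int (length bs)" 1 1]
  by (simp add: bar_cls_closed T.l_one T.r_one)

end

lemma dmap_typed:
  fixes P :: "('a::{ring,monoid_mult}, 'p) bimod_complex" and Q :: "('a, 'q) bimod_complex"
  assumes P: "graded_bimod P" and Q: "graded_bimod Q" and dP: "cdiff P \<in> maps P P (- 1)" and dQ: "cdiff Q \<in> maps Q Q (- 1)"
    and f: "f \<in> maps P Q t" and x: "x \<in> carrier (cmod P i)"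
  shows "dmap P Q t f i x \<in> carrier (cmod Q (i + t - 1))"
    and "inc Q (i + t - 1) (dmap P Q t f i x) = gmap P Q t f (gmap P P (- 1) (cdiff P) (inc P i x))
      - signed t (gmap Q Q (- 1) (cdiff Q) (gmap P Q t f (inc P i x)))"
proof -
  have dx: "cdiff P i x \<in> carrier (cmod P (i - 1))" using bimod_hom_closed [OF mapsD [OF dP] x] by simp
  have fx: "f i x \<in> carrier (cmod Q (i + t))" using bimod_hom_closed [OF mapsD [OF f] x] .
  have e: "i - 1 + t = i + t - 1" by simp
  have fdx: "f (i - 1) (cdiff P i x) \<in> carrier (cmod Q (i + t - 1))" using bimod_hom_closed [OF mapsD [OF f] dx] unfolding e .
  have dfx: "cdiff Q (i + t) (f i x) \<in> carrier (cmod Q (i + t - 1))" using bimod_hom_closed [OF mapsD [OF dQ] fx] by simp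
  note rb = graded_ring_bimod [OF Q]
  have m: "msigned (cmod Q (i + t - 1)) t (cdiff Q (i + t) (f i x)) \<in> carrier (cmod Q (i + t - 1))"
    by (rule msigned_closed [OF rb dfx])
  show "dmap P Q t f i x \<in> carrier (cmod Q (i + t - 1))"
    using fdx m ring_bimod_minus [OF rb] by (simp add: dmap_def a_minus_def ring_bimod_add rb)
  have "gmap P Q t f (gmap P P (- 1) (cdiff P) (inc P i x)) = inc Q (i + t - 1) (f (i - 1) (cdiff P i x))"
    using gmap_inc [OF P P dP x] gmap_inc [OF P Q f dx] by (simp add: e)
  moreover have "gmap Q Q (- 1) (cdiff Q) (gmap P Q t f (inc P i x)) = inc Q (i + t - 1) (cdiff Q (i + t) (f i x))"
    using gmap_inc [OF P Q f x] gmap_inc [OF Q Q dQ fx] by simp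
  ultimately show "inc Q (i + t - 1) (dmap P Q t f i x) = gmap P Q t f (gmap P P (- 1) (cdiff P) (inc P i x))
      - signed t (gmap Q Q (- 1) (cdiff Q) (gmap P Q t f (inc P i x)))"
    by (simp add: dmap_def inc_diff [OF Q fdx m] inc_signed [OF Q dfx])
qed

section \<open>Lifting cochains into the resolution and its tensor square; a comparison
  cochain\<close>

context resolution
begin

abbreviation ml :: "('a list \<Rightarrow> ('a, 'x) total) \<Rightarrow> bool" where
  "ml \<equiv> multilinear scale (\<lambda>c. tl_act (scale c 1))"

abbreviation hbT :: "('a list \<Rightarrow> ('a, 'x) total) \<Rightarrow> 'a list \<Rightarrow> ('a, 'x) total" where
  "hbT \<equiv> hb tl_act tr_act"

lemma homog_W_neg:
  assumes "w \<in> homog W n" "n < 0"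
  shows "w = 0"
  using assms(1)
proof (induction rule: tensor_induct [OF graded_P graded_P, consumes 1, case_names zero tgen diff])
  case (tgen i u v)
  have "inc P i (prj P i u) = 0 \<or> inc P (n - i) (prj P (n - i) v) = 0"
    using homog_neg [OF inc_homog [OF graded_P prj_closed [OF graded_P]], of i] homog_neg [OF inc_homog [OF graded_P prj_closed [OF graded_P]], of "n - i"] assms(2)
    by (cases "i < 0") auto
  then show ?case
    using tgen_prj [OF graded_P graded_P, of n i u v] by (metis t.t_0_left t.t_0_right)
qed simp_all

text \<open>Lifting in degree 0 is possible on the kernel of the augmentation only; the sets
  \<open>V\<close> of \<open>cochain_lift\<close> are cut down accordingly.\<close>

lemma lift_P:
  assumes Z: "ml Z" "\<And>xs. Z xs \<in> homog P (int (length xs) + t)" "\<And>xs. int (length xs) + t = 0 \<Longrightarrow> mu (Z xs) = 0"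
    "\<And>xs. d (Z xs) = signed s (hbT Z xs)"
  obtains Y where "ml Y" "\<And>xs. Y xs \<in> homog P (int (length xs) + t + 1)"
    "\<And>xs. int (length xs) + t + 1 = 0 \<Longrightarrow> mu (Y xs) = 0"
    "\<And>xs. Z xs = d (Y xs) + signed s (hbT Y xs)"
proof -
  let ?V = "\<lambda>i. {u \<in> homog P i. i = 0 \<longrightarrow> mu u = 0}"
  obtain Y where "ml Y" "\<And>xs. Y xs \<in> ?V (int (length xs) + t + 1)" "\<And>xs. Z xs = d (Y xs) + signed s (hbT Y xs)"
  proof (rule K.cochain_lift [where V = ?V and e = d and Z = Z and t = t and s = s])
    fix i x assume x: "x \<in> ?V i" "d x = 0"
    consider "i < 0" | "i = 0" | "0 < i" by linarith
    then show "\<exists>y\<in>?V (i + 1). d y = x"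
    proof cases
      case 1
      then show ?thesis using homog_neg [of x i] x by (intro bexI [of _ 0]) (simp_all add: homog_0 graded_P)
    next
      case 2
      then show ?thesis using exact_mu [of x] x by auto
    next
      case 3
      then show ?thesis using exact_pos [OF 3, of x] x by auto
    qed
  qed (use Z central_P in \<open>auto simp: homog_0 homog_diff homog_l homog_r graded_P mu_diff mu_l mu_r additive_d d_l d_r\<close>)
  then show thesis using that by blast
qed

text \<open>As for P, with \<mu> after \<mu> \<otimes> 1 as augmentation. Since \<open>Z xs\<close>
  has degree \<open>length xs\<close>, the condition in degree 0 concerns \<open>Z []\<close>
  alone.\<close>

lemma lift_W:
  assumes Z: "ml Z" "\<And>xs. Z xs \<in> homog W (int (length xs))" "mu (KL 0 (aug \<mu>) (Z [])) = 0"
    "\<And>xs. dW (Z xs) = hbT Z xs"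
  obtains Y where "ml Y" "\<And>xs. Y xs \<in> homog W (int (length xs) + 1)" "\<And>xs. Z xs = dW (Y xs) + hbT Y xs"
proof -
  note B = additive_KL [OF aug_maps] KL_l [OF aug_maps] KL_r [OF aug_maps]
  let ?V = "\<lambda>i. {w \<in> homog W i. i = 0 \<longrightarrow> mu (KL 0 (aug \<mu>) w) = 0}"
  interpret KW: k_bimod_act scale tl_act "tr_act :: ('a, (int \<times> 'p \<times> 'p \<Rightarrow>\<^sub>0 int) set) total \<Rightarrow> _" ..
  obtain Y where "ml Y" "\<And>xs. Y xs \<in> ?V (int (length xs) + 0 + 1)" "\<And>xs. Z xs = dW (Y xs) + signed 0 (hbT Y xs)"
  proof (rule KW.cochain_lift [where V = ?V and e = dW and Z = Z and t = 0 and s = 0])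
    fix i x assume x: "x \<in> ?V i" "dW x = 0"
    show "\<exists>y\<in>?V (i + 1). dW y = x"
    proof (cases "i < 0")
      case True
      then show ?thesis using homog_W_neg [of x i] x
        by (intro bexI [of _ 0]) (simp_all add: homog_0 graded_W additive.zero [OF B(1)])
    next
      case False
      then show ?thesis using exact_W [of x i] x by auto
    qed
  qed (use Z central_W in \<open>auto simp: homog_0 homog_diff homog_l homog_r graded_W mu_diff mu_l mu_r
      additive_dW dW_l dW_r additive.diff [OF B(1)] additive.zero [OF B(1)] B\<close>)
  then show thesis using that [of Y] by simp
qed

text \<open>The cochain \<open>I0\<close>, equal to p on the empty list and zero elsewhere, fails to
  satisfy d I = hb I only by the values a p - p a on lists \<open>[a]\<close>. These lie in the
  kernel of \<mu>, so \<open>lift_P\<close> with shift -1 and odd sign yields Y with hb I0 = d Y -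
  hb Y, and I0 + Y satisfies the equation. As Y has augmentation 0 on the empty list, the
  normalisation is kept.\<close>

lemma obtain_iota:
  obtains I where "ml I" "\<And>xs. I xs \<in> homog P (int (length xs))" "\<And>xs. d (I xs) = hbT I xs" "mu (I []) = 1"
proof -
  obtain p where p: "p \<in> homog P 0" "mu p = 1" by (rule obtain_unit)
  define I0 where "I0 xs = (if xs = [] then p else 0)" for xs :: "'a list"
  have I0: "ml I0" by (simp add: I0_def multilinear_iff slotwise_add_def)
  have dI0: "d (I0 xs) = 0" for xs
    using homog_neg [OF d_homog [OF p(1)]] by (simp add: I0_def)
  have hbI0: "hbT I0 xs = (if length xs = 1 then tl_act (hd xs) p - tr_act p (hd xs) else 0)" for xs
  proof (cases "length xs = 1")
    case True
    then obtain a where "xs = [a]" by (metis One_nat_def length_0_conv length_Suc_conv)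
    then show ?thesis by (simp add: hb_Cons I0_def)
  next
    case False
    then have "hbT I0 xs = hbT (\<lambda>_. 0) xs" by (intro hb_cong) (auto simp: I0_def)
    then show ?thesis using False by simp
  qed
  have hb_ml: "ml (hbT I0)"
  proof (rule multilinear_hb [OF I0])
    show "tr_act (I0 ys) (scale c a) = tl_act (scale c 1) (tr_act (I0 ys) a)" for c ys a
      using central_P [OF p(1), of c] by (simp add: I0_def) (metis T.l_r T.r_assoc scale_one_left)
    show "tl_act a (tl_act (scale c 1) x) = tl_act (scale c 1) (tl_act a x)"
      "tl_act (scale c a) x = tl_act (scale c 1) (tl_act a x)" for c a and x :: "('a, 'p) total"
      by (simp_all add: scale_one_left scale_one_right flip: T.l_assoc)
  qed (simp_all add: scale_mult_left scale_mult_right T.additive_l T.additive_r T.additive_l_left T.additive_r_right T.l_r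
      flip: scale_mult_left scale_mult_right)
  obtain Y where Y: "ml Y" "\<And>xs. Y xs \<in> homog P (int (length xs) + - 1 + 1)"
    "\<And>xs. int (length xs) + - 1 + 1 = 0 \<Longrightarrow> mu (Y xs) = 0"
    "\<And>xs. hbT I0 xs = d (Y xs) + signed 1 (hbT Y xs)"
  proof -
    note Y_that = that
    show thesis
  proof (rule lift_P [OF hb_ml, of "- 1" 1])
    show "hbT I0 xs \<in> homog P (int (length xs) + - 1)" for xs
      using p by (auto simp: hbI0 homog_0 homog_diff homog_l homog_r graded_P)
    show "mu (hbT I0 xs) = 0" for xs by (simp add: hbI0 mu_diff mu_l mu_r p)
    show "d (hbT I0 xs) = signed 1 (hbT (hbT I0) xs)" for xs
    proof -
      have "d p = 0" using dI0 [of "[]"] by (simp add: I0_def)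
      then show ?thesis by (simp add: hbI0 T.hb_hb d_diff d_l d_r)
    qed
    show thesis if "ml Y" "\<And>xs. Y xs \<in> homog P (int (length xs) + - 1 + 1)"
      "\<And>xs. int (length xs) + - 1 + 1 = 0 \<Longrightarrow> mu (Y xs) = 0" "\<And>xs. hbT I0 xs = d (Y xs) + signed 1 (hbT Y xs)" for Y
      by (rule Y_that [OF that])
  qed
  qed
  have "ml (\<lambda>xs. I0 xs + Y xs)" by (rule multilinear_add [OF I0 Y(1) T.additive_l])
  moreover have "I0 xs + Y xs \<in> homog P (int (length xs))" for xs
    using Y(2) [of xs] p by (intro homog_add graded_P) (auto simp: I0_def homog_0 graded_P)
  moreover have "d (I0 xs + Y xs) = hbT (\<lambda>xs. I0 xs + Y xs) xs" for xs
    using Y(4) [of xs] by (simp add: d_add dI0 T.hb_add signed_def)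
  moreover have "mu (I0 [] + Y []) = 1" using Y(3) [of "[]"] p by (simp add: I0_def mu_add)
  ultimately show thesis by (rule that)
qed

end

section \<open>The diagonal and the cup square of the comparison cochain\<close>

locale comparison = resolution scale P \<mu>
  for scale :: "'k::field \<Rightarrow> 'a::{ring,monoid_mult} \<Rightarrow> 'a"
    and P :: "('a, 'p) bimod_complex" and \<mu> :: "'p \<Rightarrow> 'a" +
  fixes I :: "'a list \<Rightarrow> ('a, 'p) total" and \<Delta> :: "int \<Rightarrow> 'p \<Rightarrow> (int \<times> 'p \<times> 'p \<Rightarrow>\<^sub>0 int) set"
  assumes I_ml: "ml I" and I_homog: "I xs \<in> homog P (int (length xs))"
    and I_d: "d (I xs) = hbT I xs" and I_mu: "mu (I []) = 1"
    and diag: "diagonal_approximation P \<mu> \<Delta>"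
begin

definition D where "D = gmap P W 0 \<Delta>"

lemma \<Delta>_maps: "\<Delta> \<in> maps P W 0"
  using diag by (simp add: diagonal_approximation_def chain_map_def)

lemma additive_D: "additive D" and D_l: "D (tl_act a u) = tl_act a (D u)" and D_r: "D (tr_act u a) = tr_act (D u) a"
  unfolding D_def by (simp_all add: additive_gmap gmap_l gmap_r graded_P graded_W \<Delta>_maps)

lemma D_inc: "x \<in> carrier (cmod P i) \<Longrightarrow> D (inc P i x) = inc W i (\<Delta> i x)"
  and D_closed: "x \<in> carrier (cmod P i) \<Longrightarrow> \<Delta> i x \<in> carrier (cmod W i)"
  using gmap_inc [OF graded_P graded_W \<Delta>_maps, of x i] bimod_hom_closed [OF mapsD [OF \<Delta>_maps], of x i]
  by (simp_all add: D_def)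

lemma D_homog: "u \<in> homog P i \<Longrightarrow> D u \<in> homog W i"
  unfolding D_def using gmap_homog [OF graded_P graded_W \<Delta>_maps] by fastforce

lemma D_d: "u \<in> homog P i \<Longrightarrow> D (d u) = dW (D u)"
proof -
  assume "u \<in> homog P i"
  then obtain x where x: "u = inc P i x" "x \<in> carrier (cmod P i)" by (auto simp: homog_def)
  have "dmap P W 0 \<Delta> i x = \<zero>\<^bsub>cmod W (i - 1)\<^esub>"
    using diag x by (simp add: diagonal_approximation_def chain_map_def)
  then show ?thesis
    using dmap_typed(2) [OF graded_P graded_W cdiff_maps cdiff_W_maps \<Delta>_maps x(2)] inc_zero [OF graded_W, of "i - 1"]
    by (simp add: x(1) D_def d_def dW_def)
qed

text \<open>The diagonal is normalised by \<mu> \<otimes> \<mu>, whereas exactness of the tensor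
  square is stated with \<mu> after \<mu> \<otimes> 1. Left linearity of \<mu> identifies the two on
  generators.\<close>

lemma D_mu: "u \<in> homog P 0 \<Longrightarrow> mu (KL 0 (aug \<mu>) (D u)) = mu u"
proof -
  assume "u \<in> homog P 0"
  then obtain x where x: "u = inc P 0 x" "x \<in> carrier (cmod P 0)" by (auto simp: homog_def)
  have A: "aug \<mu> \<in> maps P alg_complex 0" using aug_maps by simp
  let ?T = "tensor_complex (alg_complex :: ('a, 'a) bimod_complex) alg_complex"
  note gT = graded_tensor [OF graded_alg graded_alg]
  note TM = tensor_map_gmap [OF graded_P graded_P graded_alg graded_alg A A]
  note LU = left_unit_gmap [OF graded_alg]
  let ?L = "gmap ?T alg_complex 0 (left_unit alg_complex)" and ?M = "gmap W ?T (0 + 0) (tensor_map alg_complex alg_complex 0 0 (aug \<mu>) (aug \<mu>))"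
  note add = additive_gmap [OF gT graded_alg LU(1)] additive_gmap [OF graded_W gT TM(1)]
  have val: "alg_val (gmap P alg_complex 0 (aug \<mu>) u) = mu u" for u
    using alg_val_gmap [OF aug_maps, of u] by (simp add: ev_aug)
  have "alg_val (?L (?M w)) = mu (KL 0 (aug \<mu>) w)" if "w \<in> homog W 0" for w
    using that
  proof (induction rule: tensor_induct [OF graded_P graded_P, consumes 1, case_names zero tgen diff])
    case zero
    show ?case by (simp only: additive.zero [OF add(1)] additive.zero [OF add(2)] additive.zero [OF additive_KL [OF aug_maps]]
        mu_0 prj_simps [OF graded_alg] alg_simps)
  next
    case (tgen i u v)
    have 1: "mu (inc P 0 (prj P 0 v)) = mu v" by (simp add: mu_def prj_inc graded_P prj_closed)
    have 2: "prj alg_complex 0 (inc alg_complex 0 a) = a" for a :: 'a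
      by (simp add: prj_inc graded_alg alg_simps)
    show ?case
      unfolding TM(2)
      by (simp add: LU KL_tgen [OF aug_maps] ev_aug mu_l 1 val 2 alg_val_simps prj_simps [OF graded_alg] alg_simps)
  next
    case (diff w w')
    have m: "alg_val (u - v) = alg_val u - alg_val v" for u v :: "('a, 'a) total"
      using alg_val_simps(1) [of "u - v" v] by (simp add: algebra_simps)
    from diff show ?case
      by (simp only: additive.diff [OF add(1)] additive.diff [OF add(2)] additive.diff [OF additive_KL [OF aug_maps]] mu_diff m)
  qed
  note this [OF D_homog [OF \<open>u \<in> homog P 0\<close>]]
  moreover have "alg_val (?L (?M (D u))) = left_unit alg_complex 0 (tensor_map alg_complex alg_complex 0 0 (aug \<mu>) (aug \<mu>) 0 (\<Delta> 0 x))"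
  proof -
    note c1 = D_closed [OF x(2)]
    note c2 = bimod_hom_closed [OF mapsD [OF TM(1)] c1]
    have "?M (D u) = inc ?T 0 (tensor_map alg_complex alg_complex 0 0 (aug \<mu>) (aug \<mu>) 0 (\<Delta> 0 x))"
      using gmap_inc [OF graded_W gT TM(1) c1] by (simp add: x D_inc)
    then show ?thesis using gmap_inc [OF gT graded_alg LU(1) c2] bimod_hom_closed [OF mapsD [OF LU(1)] c2]
      by (simp add: prj_inc graded_alg)
  qed
  moreover have "left_unit alg_complex 0 (tensor_map alg_complex alg_complex 0 0 (aug \<mu>) (aug \<mu>) 0 (\<Delta> 0 x)) = aug \<mu> 0 x"
    using diag x(2) by (simp add: diagonal_approximation_def)
  ultimately show ?thesis by (simp add: aug_def mu_def x prj_inc graded_P)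
qed

text \<open>The value of \<iota> \<otimes> \<iota> on the deconcatenation diagonal of the bar
  resolution.\<close>

definition T2 where "T2 xs = cup (tgen P P (int (length xs))) 0 I I xs"

lemma I_central: "tl_act (scale c 1) (I xs) = tr_act (I xs) (scale c 1)"
  by (rule central_P [OF I_homog])

lemma T2_ml: "ml T2"
proof -
  have *: "ml (cup (tgen P P n) 0 I I)" for n
  proof (rule multilinear_cup [OF I_ml I_ml])
    show "tgen P P n i (I xs) (tl_act (scale c 1) y) = tl_act (scale c 1) (tgen P P n i (I xs) y)" for c i xs y
      by (simp add: t.t_l flip: t.t_balanced I_central)
  qed (simp_all add: t.additive_t_left t.additive_t_right T.additive_l t.t_l)
  show ?thesis
    using multilinear_by_length [where Y = "\<lambda>n. cup (tgen P P (int n)) 0 I I", OF *] by (simp add: T2_def [abs_def])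
qed

lemma T2_homog: "T2 xs \<in> homog W (int (length xs))"
proof -
  have "cup (tgen P P n) i F G as \<in> homog W n" for n i F G and as :: "'a list"
    by (induction as arbitrary: i F) (simp_all add: tgen_homog homog_add graded_P graded_W)
  then show ?thesis by (simp add: T2_def)
qed

text \<open>\<open>cup_hom\<close> and \<open>hb_cup\<close> give the same expression once d I = hb
  I is inserted. On the empty list both sides vanish, the left one because it has degree -1.\<close>

lemma dW_T2: "dW (T2 xs) = hbT T2 xs"
proof (cases xs)
  case Nil
  then show ?thesis using homog_W_neg [OF dW_homog [OF T2_homog [of xs]]] by simp
next
  case (Cons a as)
  let ?N = "int (length as)"
  have Id: "(\<lambda>ys. d (I ys)) = hbT I" by (simp add: fun_eq_iff I_d)
  have "dW (T2 xs) = cup (tgen P P ?N) (0 - 1) (\<lambda>ys. d (I ys)) I xs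
      + signed 0 (cup (tgen P P ?N) 0 (\<lambda>ys. signed (int (length ys)) (I ys)) (\<lambda>ys. d (I ys)) xs)"
    unfolding T2_def using Cons
    by (intro cup_hom [OF additive_dW]) (simp_all add: dW_tgen additive_signed [OF t.additive_t_left])
  also have "\<dots> = hbT (cup (tgen P P ?N) 0 I I) xs" by (simp only: t.hb_cup Id signed_zero)
  also have "\<dots> = hbT T2 xs" by (rule hb_cong) (simp add: T2_def Cons)
  finally show ?thesis .
qed

lemma obtain_H:
  obtains H where "ml H" "\<And>xs. H xs \<in> homog W (int (length xs) + 1)" "\<And>xs. D (I xs) - T2 xs = dW (H xs) + hbT H xs"
proof -
  have 1: "ml (\<lambda>xs. D (I xs) - T2 xs)"
    by (intro multilinear_diff [OF _ T2_ml T.additive_l] multilinear_hom [OF I_ml additive_D] D_l)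
  have 2: "D (I xs) - T2 xs \<in> homog W (int (length xs))" for xs
    by (intro homog_diff graded_W D_homog I_homog T2_homog)
  \<comment> \<open>Both \<open>D (I [])\<close> and \<open>T2 []\<close> have augmentation
    1.\<close>
  have 3: "mu (KL 0 (aug \<mu>) (D (I []) - T2 [])) = 0"
  proof -
    have "inc P 0 (prj P 0 (I [])) = I []" using I_homog [of "[]"] by (simp add: inc_prj graded_P)
    then show ?thesis using I_homog [of "[]"]
      by (simp add: additive.diff [OF additive_KL [OF aug_maps]] mu_diff D_mu I_mu T2_def KL_tgen [OF aug_maps] ev_aug mu_l)
  qed
  have 4: "dW (D (I xs) - T2 xs) = hbT (\<lambda>xs. D (I xs) - T2 xs) xs" for xs
  proof -
    have "dW (D (I xs)) = D (hbT I xs)" using D_d [OF I_homog, of xs] by (simp add: I_d)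
    also have "\<dots> = hbT (\<lambda>xs. D (I xs)) xs" by (rule hb_hom [OF additive_D]) (rule D_r, rule D_l)
    finally show ?thesis by (simp add: dW_diff dW_T2 T.hb_diff)
  qed
  show thesis by (rule lift_W [OF 1 2 3 4]) (rule that)
qed

end

section \<open>The commutator f \<otimes> 1 - 1 \<otimes> f, and homotopy liftings on
  cochains\<close>

context comparison
begin

lemma additive_diff_fun: "additive f \<Longrightarrow> additive g \<Longrightarrow> additive (\<lambda>x. f x - g x :: 'z::ab_group_add)"
  by (simp add: additive_def)

definition K where "K n f w = KL n f w - KR n f w"

definition coch :: "int \<Rightarrow> (int \<Rightarrow> 'p \<Rightarrow> 'a) \<Rightarrow> 'a list \<Rightarrow> 'a" where
  "coch n f xs = ev n f (I xs)"

context
  fixes n :: int and f :: "int \<Rightarrow> 'p \<Rightarrow> 'a"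
  assumes f: "cocycle P n f"
begin

lemma f_maps: "f \<in> maps P alg_complex (- n)"
  using f by (simp add: cocycle_def)

lemma ev_d: "ev n f (d u) = 0"
proof -
  have "f (n + 1 - 1) (cdiff P (n + 1) (prj P (n + 1) u)) = 0"
    using f prj_closed [OF graded_P] unfolding cocycle_def by blast
  then show ?thesis by (simp add: ev_def prj_d)
qed

lemmas additive_evf = additive_ev [OF f_maps]
lemmas evf_0 [simp] = additive.zero [OF additive_evf] and evf_add = additive.add [OF additive_evf]
  and evf_diff = additive.diff [OF additive_evf] and evf_signed = additive_signed [OF additive_evf]

lemma coch_ml: "multilinear scale scale (coch n f)"
proof -
  have "multilinear scale scale (\<lambda>xs. ev n f (I xs))"
    by (rule multilinear_hom [OF I_ml additive_evf]) (simp add: ev_l [OF f_maps] scale_one_left)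
  then show ?thesis by (simp add: coch_def [abs_def])
qed

lemma coch_other: "int (length xs) \<noteq> n \<Longrightarrow> coch n f xs = 0"
  unfolding coch_def using ev_other [OF f_maps I_homog] by blast

lemma hb_coch: "hb (*) (*) (coch n f) xs = 0"
proof -
  have "ev n f (hbT I xs) = hb (*) (*) (\<lambda>xs. ev n f (I xs)) xs"
    by (rule hb_hom [OF additive_evf]) (simp_all add: ev_l ev_r f_maps)
  then show ?thesis using ev_d [of "I xs"] by (simp add: coch_def [abs_def] I_d)
qed

lemma additive_K: "additive (K n f)" and K_l: "K n f (tl_act a w) = tl_act a (K n f w)"
  and K_r: "K n f (tr_act w a) = tr_act (K n f w) a"
  unfolding K_def [abs_def]
  by (simp_all add: additive_diff_fun additive_KL additive_KR KL_l KL_r KR_l KR_r f_maps T.l_diff T.r_diff)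

lemma K_homog: "w \<in> homog W k \<Longrightarrow> K n f w \<in> homog P (k - n)"
  unfolding K_def by (intro homog_diff graded_P KL_homog KR_homog f_maps)

text \<open>As f vanishes on boundaries, f \<otimes> 1 and 1 \<otimes> f both commute with the
  differentials up to (-1)^n. For f \<otimes> 1 this is the sign of the differential behind a factor
  of degree n, for 1 \<otimes> f it comes from (-1)^(in) as the degree i of the left factor drops by
  one.\<close>

lemma K_dW:
  assumes "w \<in> homog W k"
  shows "K n f (dW w) = signed n (d (K n f w))"
  using assms
proof (induction rule: tensor_induct [OF graded_P graded_P, consumes 1, case_names zero tgen diff])
  case zero
  show ?case by (simp add: additive.zero [OF additive_K])
next
  case (tgen i u v)
  note add = additive.add [OF additive_K] additive_signed [OF additive_K]
  have pd: "inc P (j - 1) (prj P (j - 1) (d w)) = d (inc P j (prj P j w))" for j w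
    by (simp add: prj_d d_inc graded_P prj_closed)
  have pdL: "inc P (k - 1 - n) (prj P (k - 1 - n) (d w)) = d (inc P (k - n) (prj P (k - n) w))" for w
    using pd [of "k - n" w] by (simp add: algebra_simps)
  have L: "KL n f (dW (tgen P P k i u v)) = signed n (d (KL n f (tgen P P k i u v)))"
    using pdL [of v]
    by (simp add: dW_tgen additive.add [OF additive_KL [OF f_maps]] additive_signed [OF additive_KL [OF f_maps]]
        KL_tgen [OF f_maps] ev_d d_l)
  have e: "(i - 1 = k - 1 - n) = (i = k - n)" by linarith
  have sg: "signed ((j - 1) * n) x = signed n (signed (j * n) x)" for j and x :: "('a, 'p) total"
    by (cases "even j"; cases "even n") (simp_all add: signed_def)
  have R: "KR n f (dW (tgen P P k i u v)) = signed n (d (KR n f (tgen P P k i u v)))"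
    using pdL [of u]
    by (simp add: dW_tgen additive.add [OF additive_KR [OF f_maps]] additive_signed [OF additive_KR [OF f_maps]]
        KR_tgen [OF f_maps] ev_d d_r d_signed e sg)
  show ?case by (simp add: K_def L R d_diff signed_diff)
next
  case (diff w w')
  then show ?case by (simp add: dW_diff additive.diff [OF additive_K] d_diff signed_diff)
qed

text \<open>f \<otimes> 1 selects the splitting with a prefix of length n, 1 \<otimes> f the one
  with a suffix of length n.\<close>

lemma K_T2:
  assumes n: "0 \<le> n"
  shows "K n f (T2 xs) = (if n \<le> int (length xs) then
      tl_act (coch n f (take (nat n) xs)) (I (drop (nat n) xs))
      - signed (int (length xs - nat n) * n) (tr_act (I (take (length xs - nat n) xs)) (coch n f (drop (length xs - nat n) xs)))
    else 0)"
proof -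
  let ?N = "int (length xs)"
  have L: "KL n f (T2 xs) = (if 0 \<le> n \<and> n \<le> 0 + int (length xs) then
      tl_act (ev n f (I (take (nat (n - 0)) xs))) (inc P (?N - n) (prj P (?N - n) (I (drop (nat (n - 0)) xs)))) else 0)"
    unfolding T2_def by (rule cup_eval [OF additive_KL [OF f_maps]]) (simp add: KL_tgen f_maps)
  have R: "KR n f (T2 xs) = (if 0 \<le> ?N - n \<and> ?N - n \<le> 0 + int (length xs) then
      signed ((?N - n) * n) (tr_act (inc P (?N - n) (prj P (?N - n) (I (take (nat (?N - n - 0)) xs)))) (ev n f (I (drop (nat (?N - n - 0)) xs)))) else 0)"
    unfolding T2_def by (rule cup_eval [OF additive_KR [OF f_maps]]) (simp add: KR_tgen f_maps)
  have h: "I ys \<in> homog P (?N - n)" if "int (length ys) = ?N - n" for ys using I_homog [of ys] that by simp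
  show ?thesis
  proof (cases "n \<le> ?N")
    case True
    have e: "nat (?N - n) = length xs - nat n" "int (length xs - nat n) = ?N - n" using True n by simp_all
    have i: "inc P (?N - n) (prj P (?N - n) (I ys)) = I ys" if "int (length ys) = ?N - n" for ys
      by (rule inc_prj [OF graded_P h [OF that]])
    show ?thesis
      using True n e by (simp add: K_def L R coch_def i min_def)
  qed (use n in \<open>simp add: K_def L R\<close>)
qed

text \<open>In \<open>insertion_hb\<close> the term with the coboundary of the inserted cocycle
  drops out, and the two cup terms are the two halves of \<open>K n f (T2 xs)\<close>. On lists that
  are too short everything vanishes.\<close>

lemma insertion_K:
  assumes n: "n = int k"
  shows "signed n (hbT (insertion k (coch n f) I) xs) + insertion k (coch n f) (hbT I) xs = K n f (T2 xs)"
proof (cases "k \<le> length xs")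
  case True
  have "insertion (Suc k) (hb (*) (*) (coch n f)) I xs = 0"
    by (rule insertion_zero_inner [OF multilinear_slotwise [OF I_ml] hb_coch])
  then show ?thesis
    using T.insertion_hb [OF multilinear_slotwise [OF I_ml] True, of "coch n f"] True K_T2 [of xs] n
    by (simp add: of_nat_diff)
next
  case False
  have "hbT (insertion k (coch n f) I) xs = hbT (\<lambda>_. 0) xs"
    by (rule hb_cong) (use False in \<open>auto intro: insertion_short\<close>)
  then show ?thesis using False K_T2 [of xs] n by (simp add: insertion_short)
qed

end

lemma aug_cocycle: "cocycle P 0 (aug \<mu>)"
proof -
  have "aug \<mu> (i - 1) (cdiff P i x) = 0" if "x \<in> carrier (cmod P i)" for i x
  proof (cases "i = 1")
    case True
    then show ?thesis using that mu_ker by (auto simp: aug_def)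
  qed (simp add: aug_def)
  then show ?thesis using aug_maps by (simp add: cocycle_def)
qed

text \<open>In total degree n, augmenting one factor and evaluating f on the other may be done in
  either order: \<mu>(f \<otimes> 1) = f(1 \<otimes> \<mu>) and \<mu>(1 \<otimes> f) = f(\<mu>
  \<otimes> 1). The commutator exchanges the two terms, hence the minus sign.\<close>

lemma K_aug:
  assumes "cocycle P n f" "w \<in> homog W n"
  shows "mu (K n f w) = - ev n f (K 0 (aug \<mu>) w)"
  using assms(2)
proof (induction rule: tensor_induct [OF graded_P graded_P, consumes 1, case_names zero tgen diff])
  case zero
  show ?case by (simp add: additive.zero [OF additive_K] assms(1) aug_cocycle additive.zero [OF additive_evf [OF assms(1)]])
next
  case (tgen i u v)
  note f = f_maps [OF assms(1)]
  have mu: "mu (inc P 0 (prj P 0 w)) = mu w" for w by (simp add: mu_def prj_inc graded_P prj_closed)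
  have evf: "ev n f (inc P n (prj P n w)) = ev n f w" for w by (simp add: ev_def prj_inc graded_P prj_closed)
  have r0: "n = 0 \<Longrightarrow> ev 0 f (tr_act w a) = ev 0 f w * a" "n = 0 \<Longrightarrow> ev 0 f (inc P 0 (prj P 0 w)) = ev 0 f w" for w a
    using ev_r [OF f, of w a] evf [of w] by simp_all
  show ?case
    by (simp add: evf_0 [OF assms(1)] r0 K_def KL_tgen [OF f] KR_tgen [OF f] KL_tgen [OF aug_maps] KR_tgen [OF aug_maps] f ev_aug mu_diff evf_diff [OF assms(1)] mu_l mu_r ev_l ev_r mu evf)
next
  case (diff w w')
  then show ?case
    by (simp add: additive.diff [OF additive_K] assms(1) aug_cocycle mu_diff evf_diff [OF assms(1)])
qed

text \<open>On x \<otimes> y both sides are f(x) g(y); the sign is that of g passing x, which has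
  degree n.\<close>

lemma ev_KL_KR:
  assumes f: "cocycle P n f" and g: "cocycle P m g" and w: "w \<in> homog W (n + m)"
  shows "ev m g (KL n f w) = signed (n * m) (ev n f (KR m g w))"
  using w
proof (induction rule: tensor_induct [OF graded_P graded_P, consumes 1, case_names zero tgen diff])
  case zero
  show ?case by (simp add: additive.zero [OF additive_KL [OF f_maps [OF f]]] additive.zero [OF additive_KR [OF f_maps [OF g]]] evf_0 f g)
next
  case (tgen i u v)
  have ev: "ev n f (inc P n (prj P n w)) = ev n f w" for n f w by (simp add: ev_def prj_inc graded_P prj_closed)
  show ?case
    by (simp add: KL_tgen KR_tgen f_maps [OF f] f_maps [OF g] ev_l ev_r ev evf_signed [OF f] evf_0 f g signed_signed)
      (simp add: signed_def)
next
  case (diff w w')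
  then show ?case
    by (simp add: additive.diff [OF additive_KL [OF f_maps [OF f]]] additive.diff [OF additive_KR [OF f_maps [OF g]]]
        evf_diff f g signed_diff)
qed

lemma diag_commutator_typed:
  assumes f: "cocycle P n f" and x: "x \<in> carrier (cmod P i)"
  shows "diag_commutator P \<Delta> n f i x \<in> carrier (cmod P (i - n))"
    and "inc P (i - n) (diag_commutator P \<Delta> n f i x) = K n f (D (inc P i x))"
proof -
  note c = KL_closed [OF f_maps [OF f] D_closed [OF x]] KR_closed [OF f_maps [OF f] D_closed [OF x]]
  show "diag_commutator P \<Delta> n f i x \<in> carrier (cmod P (i - n))"
    using c by (simp add: diag_commutator_def a_minus_def graded_ring_bimod graded_P ring_bimod_add ring_bimod_minus)
  show "inc P (i - n) (diag_commutator P \<Delta> n f i x) = K n f (D (inc P i x))"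
    by (simp add: diag_commutator_def inc_diff graded_P c K_def D_inc x KL_inc [OF f_maps [OF f] D_closed [OF x]]
        KR_inc [OF f_maps [OF f] D_closed [OF x]])
qed

lemma lifting_eq:
  assumes f: "cocycle P n f" and \<phi>: "\<phi> \<in> maps P P (1 - n)"
    "\<And>i x. x \<in> carrier (cmod P i) \<Longrightarrow> dmap P P (1 - n) \<phi> i x = diag_commutator P \<Delta> n f i x" and u: "u \<in> homog P i"
  shows "gmap P P (1 - n) \<phi> (d u) = signed (1 - n) (d (gmap P P (1 - n) \<phi> u)) + K n f (D u)"
proof -
  obtain x where x: "u = inc P i x" "x \<in> carrier (cmod P i)" using u by (auto simp: homog_def)
  have "i + (1 - n) - 1 = i - n" by simp
  then show ?thesis
    using dmap_typed(2) [OF graded_P graded_P cdiff_maps cdiff_maps \<phi>(1) x(2)] diag_commutator_typed(2) [OF f x(2)] \<phi>(2) [OF x(2)]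
    by (simp add: x(1) d_def algebra_simps)
qed

text \<open>The differential of A is zero, so a homotopy to zero amounts to a factorisation through
  d. As A sits in degree 0, the relation is read on elements of degree n - 1, and s is evaluated in
  degree n - 2.\<close>

lemma lifting_aug:
  assumes f: "cocycle P n f" and \<phi>: "\<phi> \<in> maps P P (1 - n)" and \<psi>: "\<psi> \<in> maps P P 1"
    and h: "homotopic P alg_complex (1 - n) (\<lambda>i x. aug \<mu> (i + (1 - n)) (\<phi> i x) + f (i + 1) (\<psi> i x)) (\<lambda>_ _. 0)"
  obtains s where "s \<in> maps P alg_complex (- (n - 2))"
    "\<And>u. u \<in> homog P (n - 1) \<Longrightarrow> mu (gmap P P (1 - n) \<phi> u) + ev n f (gmap P P 1 \<psi> u) = ev (n - 2) s (d u)"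
proof -
  obtain s where s: "s \<in> maps P alg_complex (1 - n + 1)"
    "\<And>i x. x \<in> carrier (cmod P i) \<Longrightarrow> (aug \<mu> (i + (1 - n)) (\<phi> i x) + f (i + 1) (\<psi> i x)) \<ominus>\<^bsub>cmod alg_complex (i + (1 - n))\<^esub> 0
      = dmap P alg_complex (1 - n + 1) s i x"
    using h unfolding homotopic_def by blast
  have s': "s \<in> maps P alg_complex (- (n - 2))"
    using s(1) by (simp add: algebra_simps)
  have neg0: "\<ominus>\<^bsub>cmod alg_complex i\<^esub> (0 :: 'a) = 0" for i
    using ring_bimod_minus_zero [OF graded_ring_bimod [OF graded_alg], of i] unfolding alg_simps by blast
  have minus0: "a \<ominus>\<^bsub>cmod alg_complex i\<^esub> 0 = a" for a :: 'a and i
    by (simp add: a_minus_def alg_simps neg0)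
  show thesis
  proof (rule that [OF s'])
    fix u assume "u \<in> homog P (n - 1)"
    then obtain x where x: "u = inc P (n - 1) x" "x \<in> carrier (cmod P (n - 1))" by (auto simp: homog_def)
    have cd: "cdiff alg_complex i a = 0" for i and a :: 'a by (simp add: alg_complex_def)
    have ms: "msigned (cmod alg_complex i) k (0 :: 'a) = 0" for i k
      by (simp add: msigned_def neg0)
    have "\<mu> (\<phi> (n - 1) x) + f n (\<psi> (n - 1) x) = s (n - 2) (cdiff P (n - 1) x)"
      using s(2) [OF x(2)] by (simp add: minus0 dmap_def cd ms aug_def)
    moreover have "\<phi> (n - 1) x \<in> carrier (cmod P 0)" "\<psi> (n - 1) x \<in> carrier (cmod P n)" "cdiff P (n - 1) x \<in> carrier (cmod P (n - 2))"
      using bimod_hom_closed [OF mapsD [OF \<phi>] x(2)] bimod_hom_closed [OF mapsD [OF \<psi>] x(2)] cdiff_closed [OF x(2)] by simp_all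
    ultimately show "mu (gmap P P (1 - n) \<phi> u) + ev n f (gmap P P 1 \<psi> u) = ev (n - 2) s (d u)"
      using gmap_inc [OF graded_P graded_P \<phi> x(2)] gmap_inc [OF graded_P graded_P \<psi> x(2)] d_inc [OF x(2)]
      by (simp add: x(1) mu_def ev_def prj_inc graded_P)
  qed
qed

lemma ml_hb_P: "ml F \<Longrightarrow> (\<And>xs. \<exists>i. F xs \<in> homog P i) \<Longrightarrow> ml (hbT F)"
proof (rule multilinear_hb)
  assume F: "\<And>xs. \<exists>i. F xs \<in> homog P i"
  show "tr_act (F ys) (scale c a) = tl_act (scale c 1) (tr_act (F ys) a)" for c ys a
    using F [of ys] central_P [of "F ys" _ c] by (metis T.l_r T.r_assoc scale_one_left)
  show "tl_act a (tl_act (scale c 1) x) = tl_act (scale c 1) (tl_act a x)"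
    "tl_act (scale c a) x = tl_act (scale c 1) (tl_act a x)" for c a and x :: "('a, 'p) total"
    by (simp_all add: scale_one_left scale_one_right flip: T.l_assoc)
qed (simp_all add: scale_mult_left scale_mult_right T.additive_l T.additive_r T.additive_l_left T.additive_r_right T.l_r
    flip: scale_mult_left scale_mult_right)

text \<open>The shift j is carried along because freezing the head in
  \<open>\<lambda>ys. F (a # ys)\<close> raises the degree relative to the length.\<close>

lemma insertion_homog:
  assumes "\<And>xs. F xs \<in> homog P (int (length xs) + j)"
  shows "insertion k \<alpha> F xs \<in> homog P (int (length xs) + 1 - int k + j)"
  using assms
proof (induction xs arbitrary: F j)
  case Nil
  then show ?case using Nil [of "[\<alpha> []]"] by (auto simp: insert1_def homog_0 graded_P add.commute)
next
  case (Cons a as)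
  have "insertion k \<alpha> (\<lambda>ys. F (a # ys)) as \<in> homog P (int (length as) + 1 - int k + (j + 1))"
    using Cons.IH [of "\<lambda>ys. F (a # ys)" "j + 1"] Cons.prems [of "a # _"] by (simp add: algebra_simps)
  moreover have "int (length as) + 1 - int k + (j + 1) = int (length (a # as)) + 1 - int k + j" by simp
  moreover have "insert1 k \<alpha> F (a # as) \<in> homog P (int (length (a # as)) + 1 - int k + j)"
  proof (cases "k \<le> length (a # as)")
    case True
    then have "int (length (\<alpha> (take k (a # as)) # drop k (a # as))) + j = int (length (a # as)) + 1 - int k + j"
      by simp
    then show ?thesis using Cons.prems [of "\<alpha> (take k (a # as)) # drop k (a # as)"] True
      by (simp only: insert1_def if_True)
  qed (simp add: insert1_def homog_0 graded_P)
  ultimately show ?case by (simp only: insertion.simps homog_add homog_signed graded_P)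
qed

text \<open>
  The difference of \<open>\<phi>\<^sub>f\<iota>\<close> and the standard lifting of \<open>f\<iota>\<close> on the bar resolution, corrected by
  the homotopy \<open>H\<close>, is a null-homotopic chain map; composing with \<open>g\<close> compares both brackets.
\<close>

lemma lifting_insertion:
  assumes H: "ml H" "\<And>xs. H xs \<in> homog W (int (length xs) + 1)" "\<And>xs. D (I xs) - T2 xs = dW (H xs) + hbT H xs"
    and f: "cocycle P (int n) f" and hl: "homotopy_lifting P \<mu> \<Delta> (int n) f \<phi>" and g: "cocycle P m g"
  obtains \<eta> where "multilinear scale scale \<eta>"
    "\<And>xs. ev m g (gmap P P (1 - int n) \<phi> (I xs)) = signed (int n) (insertion n (coch (int n) f) (coch m g) xs)
       + ev m g (K (int n) f (H xs)) + hb (*) (*) \<eta> xs"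
proof -
  let ?n = "int n" and ?\<phi> = "gmap P P (1 - int n) \<phi>" and ?\<alpha> = "coch (int n) f"
  have \<phi>: "\<phi> \<in> maps P P (1 - ?n)" "\<And>i x. x \<in> carrier (cmod P i) \<Longrightarrow> dmap P P (1 - ?n) \<phi> i x = diag_commutator P \<Delta> ?n f i x"
    using hl by (simp_all add: homotopy_lifting_def)
  obtain \<psi> where \<psi>: "\<psi> \<in> maps P P 1"
    "\<And>i x. x \<in> carrier (cmod P i) \<Longrightarrow> dmap P P 1 \<psi> i x = diag_commutator P \<Delta> 0 (aug \<mu>) i x"
    "homotopic P alg_complex (1 - ?n) (\<lambda>i x. aug \<mu> (i + (1 - ?n)) (\<phi> i x) + f (i + 1) (\<psi> i x)) (\<lambda>_ _. 0)"
    using hl unfolding homotopy_lifting_def by blast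
  let ?\<psi> = "gmap P P 1 \<psi>"
  obtain s where s: "s \<in> maps P alg_complex (- (?n - 2))"
    "\<And>u. u \<in> homog P (?n - 1) \<Longrightarrow> mu (?\<phi> u) + ev ?n f (?\<psi> u) = ev (?n - 2) s (d u)"
    using lifting_aug [OF f \<phi>(1) \<psi>(1,3)] by blast
  note K = additive_K [OF f] K_l [OF f] K_r [OF f]
    and K0 = additive_K [OF aug_cocycle] K_l [OF aug_cocycle] K_r [OF aug_cocycle]
    and P\<phi> = additive_gmap [OF graded_P graded_P \<phi>(1)] gmap_l [OF graded_P graded_P \<phi>(1)] gmap_r [OF graded_P graded_P \<phi>(1)]
    and P\<psi> = additive_gmap [OF graded_P graded_P \<psi>(1)] gmap_l [OF graded_P graded_P \<psi>(1)] gmap_r [OF graded_P graded_P \<psi>(1)]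
  have HW: "hbT H xs = D (I xs) - T2 xs - dW (H xs)" for xs using H(3) [of xs] by (simp add: algebra_simps)

  \<comment> \<open>\<psi> is a homotopy for (\<mu> \<otimes> 1 - 1 \<otimes> \<mu>) on the
    diagonal. Subtracting the same commutator on \<open>H\<close> replaces the diagonal by
    \<open>T2\<close>, on which the commutator vanishes, and leaves a chain map of degree 1.\<close>
  define \<Psi> where "\<Psi> xs = ?\<psi> (I xs) - K 0 (aug \<mu>) (H xs)" for xs
  have \<Psi>_ml: "ml \<Psi>"
    unfolding \<Psi>_def by (intro multilinear_diff T.additive_l multilinear_hom [OF I_ml P\<psi>(1)] multilinear_hom [OF H(1) K0(1)] P\<psi>(2) K0(2))
  have \<Psi>_homog: "\<Psi> xs \<in> homog P (int (length xs) + 1)" for xs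
    unfolding \<Psi>_def using gmap_homog [OF graded_P graded_P \<psi>(1) I_homog] K_homog [OF aug_cocycle H(2), of xs]
    by (intro homog_diff graded_P) simp_all
  \<comment> \<open>Only the outermost splittings contribute, and with \<mu>(I []) = 1 both give
    \<open>I xs\<close>.\<close>
  have T0: "K 0 (aug \<mu>) (T2 xs) = 0" for xs
    using K_T2 [OF aug_cocycle, of xs] coch_other [OF aug_cocycle]
    by (simp add: coch_def ev_aug I_mu T.l_one T.r_one)
  have \<Psi>_d: "d (\<Psi> xs) = signed 1 (hbT \<Psi> xs)" for xs
  proof -
    have "hbT \<Psi> xs = ?\<psi> (hbT I xs) - K 0 (aug \<mu>) (hbT H xs)"
      unfolding \<Psi>_def T.hb_diff
      using hb_hom [OF P\<psi>(1), of tr_act I tr_act tl_act tl_act xs] hb_hom [OF K0(1), of tr_act H tr_act tl_act tl_act xs]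
      by (simp add: P\<psi> K0)
    also have "?\<psi> (hbT I xs) = - d (?\<psi> (I xs)) + K 0 (aug \<mu>) (D (I xs))"
      using lifting_eq [OF aug_cocycle, of \<psi>, OF _ _ I_homog] \<psi> by (simp add: I_d signed_def)
    finally have "hbT \<Psi> xs = - d (\<Psi> xs)"
      using K_dW [OF aug_cocycle H(2), of xs]
      by (simp add: HW additive.diff [OF K0(1)] T0 \<Psi>_def [of xs] d_diff)
    then show ?thesis by (simp add: signed_def)
  qed
  \<comment> \<open>The values of \<Psi> have positive degree, so the condition on \<mu> is
    vacuous.\<close>
  obtain Y1 where Y1: "ml Y1" "\<And>xs. Y1 xs \<in> homog P (int (length xs) + 1 + 1)" "\<And>xs. \<Psi> xs = d (Y1 xs) + signed 1 (hbT Y1 xs)"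
    using lift_P [OF \<Psi>_ml \<Psi>_homog _ \<Psi>_d] by (metis (no_types, lifting) of_nat_Suc of_nat_eq_0_iff add.commute nat.distinct(2))

  define X where "X xs = ?\<phi> (I xs) - signed ?n (insertion n ?\<alpha> I xs) - K ?n f (H xs)" for xs
  have ins_ml: "ml (insertion n ?\<alpha> I)"
    by (rule multilinear_insertion [OF I_ml coch_ml [OF f] T.additive_l])
  have X_ml: "ml X"
    unfolding X_def
    by (intro multilinear_diff T.additive_l multilinear_hom [OF I_ml P\<phi>(1)] multilinear_hom [OF H(1) K(1)] P\<phi>(2) K(2)
      multilinear_hom [OF ins_ml additive_sgn] T.l_signed [symmetric])
  have X_homog: "X xs \<in> homog P (int (length xs) + (1 - ?n))" for xs
    unfolding X_def
    using gmap_homog [OF graded_P graded_P \<phi>(1) I_homog] K_homog [OF f H(2), of xs] insertion_homog [of I 0 n ?\<alpha> xs] I_homog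
    by (intro homog_diff homog_signed graded_P) (simp_all add: algebra_simps)
  \<comment> \<open>The terms \<open>K (D (I xs))\<close> and \<open>K (T2 xs)\<close> cancel
    through the equation for \<open>hbT H\<close>; only differentials remain.\<close>
  have hb_X: "hbT X xs = signed (1 - ?n) (d (X xs))" for xs
  proof -
    have "hbT X xs = ?\<phi> (hbT I xs) - signed ?n (hbT (insertion n ?\<alpha> I) xs) - K ?n f (hbT H xs)"
      unfolding X_def T.hb_diff T.hb_signed
      using hb_hom [OF P\<phi>(1), of tr_act I tr_act tl_act tl_act xs] hb_hom [OF K(1), of tr_act H tr_act tl_act tl_act xs]
      by (simp add: P\<phi> K)
    also have "?\<phi> (hbT I xs) = signed (1 - ?n) (d (?\<phi> (I xs))) + K ?n f (D (I xs))"
      using lifting_eq [OF f \<phi>(1) \<phi>(2) I_homog, of xs] by (simp add: I_d)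
    also have "signed ?n (hbT (insertion n ?\<alpha> I) xs) = K ?n f (T2 xs) - d (insertion n ?\<alpha> I xs)"
    proof -
      have "hbT I = (\<lambda>xs. d (I xs))" by (simp add: fun_eq_iff I_d)
      then show ?thesis
        using insertion_K [OF f refl, of xs] insertion_hom [OF additive_d, of n ?\<alpha> I xs] by (simp add: algebra_simps)
    qed
    finally show ?thesis
      using K_dW [OF f H(2), of xs]
      by (cases "even n") (simp_all add: HW additive.diff [OF K(1)] additive.add [OF K(1)] X_def [of xs] d_diff d_minus d_add signed_def algebra_simps)
  qed

  obtain p where p: "p \<in> homog P 0" "mu p = 1" by (rule obtain_unit)
  \<comment> \<open>A cochain of degree n - 2 whose coboundary is \<mu>X: the first summand accounts
    for s d in \<mu>\<phi> + f\<psi> = s d, the second for f\<Psi>, into which f\<psi> and, by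
    \<open>K_aug\<close>, the term with \<open>H\<close> combine.\<close>
  define h where "h xs = ev (?n - 2) s (I xs) + ev ?n f (Y1 xs)" for xs
  have h_ml: "multilinear scale scale h"
    unfolding h_def
    by (intro multilinear_add additive_scale multilinear_hom [OF I_ml additive_ev [OF s(1)]] multilinear_hom [OF Y1(1) additive_evf [OF f]])
      (simp_all add: ev_l [OF s(1)] ev_l [OF f_maps [OF f]] scale_one_left)
  have h_other: "h xs = 0" if "int (length xs) \<noteq> ?n - 2" for xs
    using ev_other [OF s(1) I_homog, of xs] ev_other [OF f_maps [OF f] Y1(2), of xs] that by (simp add: h_def)
  have mu_X: "mu (X xs) = hb (*) (*) h xs" if len: "int (length xs) + (1 - ?n) = 0" for xs
  proof -
    have Ih: "I xs \<in> homog P (?n - 1)" and Hh: "H xs \<in> homog W ?n"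
    proof -
      have "int (length xs) = ?n - 1" "int (length xs) + 1 = ?n" using len by simp_all
      then show "I xs \<in> homog P (?n - 1)" "H xs \<in> homog W ?n"
        using I_homog [of xs] H(2) [of xs] by (simp_all only:)
    qed
    have "mu (X xs) = mu (?\<phi> (I xs)) - mu (K ?n f (H xs))"
      using len by (simp add: X_def mu_diff insertion_short)
    also have "mu (?\<phi> (I xs)) = ev (?n - 2) s (d (I xs)) - ev ?n f (?\<psi> (I xs))"
      using s(2) [OF Ih] by (simp add: algebra_simps)
    also have "mu (K ?n f (H xs)) = - ev ?n f (K 0 (aug \<mu>) (H xs))" by (rule K_aug [OF f Hh])
    also have "ev (?n - 2) s (d (I xs)) = hb (*) (*) (\<lambda>xs. ev (?n - 2) s (I xs)) xs"
      unfolding I_d by (rule hb_hom [OF additive_ev [OF s(1)]]) (simp_all add: ev_l [OF s(1)] ev_r [OF s(1)])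
    finally have "mu (X xs) = hb (*) (*) (\<lambda>xs. ev (?n - 2) s (I xs)) xs - ev ?n f (\<Psi> xs)"
      by (simp add: \<Psi>_def evf_diff f)
    also have "ev ?n f (\<Psi> xs) = - hb (*) (*) (\<lambda>xs. ev ?n f (Y1 xs)) xs"
    proof -
      have "ev ?n f (hbT Y1 xs) = hb (*) (*) (\<lambda>xs. ev ?n f (Y1 xs)) xs"
        by (rule hb_hom [OF additive_evf [OF f]]) (simp_all add: ev_l ev_r f_maps f)
      then show ?thesis by (simp add: Y1(3) evf_add evf_diff f ev_d signed_def)
    qed
    finally show ?thesis
      by (simp add: h_def [abs_def] bimod_act.hb_add [OF bimod_act_mult])
  qed
  \<comment> \<open>A lift of \<open>h\<close> along \<mu> with values in degree 0, so that d h' =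
    0. Subtracting its coboundary from X keeps the chain map equation and makes the augmentation
    vanish.\<close>
  define h' where "h' xs = tr_act p (h xs)" for xs
  have h'_homog: "h' xs \<in> homog P (int (length xs) + (1 - ?n) + 1)" for xs
  proof (cases "int (length xs) = ?n - 2")
    case True
    then have "int (length xs) + (1 - ?n) + 1 = 0" by simp
    then show ?thesis using p by (simp only: h'_def homog_r graded_P)
  qed (simp add: h'_def h_other homog_0 graded_P)
  have h'_ml: "ml h'"
    unfolding h'_def
  proof (rule multilinear_hom [OF h_ml T.additive_r_right])
    fix c xs
    show "tr_act p (scale c (h xs)) = tl_act (scale c 1) (tr_act p (h xs))"
      using central_P [OF p(1), of c] by (metis T.l_r T.r_assoc scale_one_left)
  qed
  have dh': "d (h' xs) = 0" for xs
    using homog_neg [OF d_homog [OF p(1)]] by (simp add: h'_def d_r)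
  have hb_h'_ml: "ml (hbT h')" by (rule ml_hb_P [OF h'_ml]) (use h'_homog in blast)
  have hb_h'_homog: "hbT h' xs \<in> homog P (int (length xs) + (1 - ?n))" for xs
  proof (rule hb_closed)
    fix ys :: "'a list" assume "Suc (length ys) = length xs"
    then have "int (length ys) + (1 - ?n) + 1 = int (length xs) + (1 - ?n)" by simp
    then show "h' ys \<in> homog P (int (length xs) + (1 - ?n))" using h'_homog [of ys] by (simp only:)
  qed (simp_all add: homog_0 homog_diff homog_l homog_r graded_P)
  have mu_h': "mu (hbT h' xs) = hb (*) (*) h xs" for xs
  proof -
    have "mu (hbT h' xs) = hb (*) (*) (\<lambda>xs. mu (h' xs)) xs"
      by (rule hb_hom [OF additive_mu]) (simp_all add: mu_l mu_r)
    then show ?thesis by (simp add: h'_def mu_r p)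
  qed
  have d_hb_h': "d (hbT h' xs) = 0" for xs
  proof -
    have "d (hbT h' xs) = hbT (\<lambda>xs. d (h' xs)) xs"
      by (rule hb_hom [OF additive_d]) (simp_all add: d_l d_r)
    then show ?thesis by (simp add: dh')
  qed
  obtain Y where Y: "ml Y" "\<And>xs. X xs - hbT h' xs = d (Y xs) + signed (1 - ?n) (hbT Y xs)"
  proof (rule lift_P [of "\<lambda>xs. X xs - hbT h' xs" "1 - ?n" "1 - ?n"])
    show "ml (\<lambda>xs. X xs - hbT h' xs)" by (rule multilinear_diff [OF X_ml hb_h'_ml T.additive_l])
    show "X xs - hbT h' xs \<in> homog P (int (length xs) + (1 - ?n))" for xs
      by (rule homog_diff [OF graded_P X_homog hb_h'_homog])
    show "mu (X xs - hbT h' xs) = 0" if "int (length xs) + (1 - ?n) = 0" for xs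
      using mu_X [OF that] by (simp add: mu_diff mu_h')
    show "d (X xs - hbT h' xs) = signed (1 - ?n) (hbT (\<lambda>xs. X xs - hbT h' xs) xs)" for xs
      by (simp add: d_diff d_hb_h' T.hb_diff T.hb_hb hb_X signed_signed) (simp add: signed_def)
  qed (rule that)

  \<comment> \<open>The images under g of \<open>h'\<close> and of the null-homotopy
    \<open>Y\<close>; g (d Y) = 0 because g is a cocycle.\<close>
  let ?\<eta> = "\<lambda>xs. ev m g (h' xs) + signed (1 - ?n) (ev m g (Y xs))"
  have g_l: "ev m g (tl_act a u) = a * ev m g u" for a u by (rule ev_l [OF f_maps [OF g]])
  have gml: "multilinear scale scale (\<lambda>xs. ev m g (F xs))" if "ml F" for F
    by (rule multilinear_hom [OF that additive_evf [OF g]]) (simp add: g_l scale_one_left)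
  have ghb: "ev m g (hbT F xs) = hb (*) (*) (\<lambda>xs. ev m g (F xs)) xs" for F xs
    by (rule hb_hom [OF additive_evf [OF g]]) (simp_all add: ev_l ev_r f_maps g)
  show thesis
  proof (rule that)
    show "multilinear scale scale ?\<eta>"
      by (intro multilinear_add multilinear_signed gml h'_ml Y(1) additive_scale)
    fix xs
    have "ev m g (X xs) = ev m g (hbT h' xs) + ev m g (X xs - hbT h' xs)"
      by (simp add: evf_diff g)
    also have "\<dots> = hb (*) (*) ?\<eta> xs"
      by (simp add: Y(2) evf_add evf_signed g ev_d ghb bimod_act.hb_add [OF bimod_act_mult] bimod_act.hb_signed [OF bimod_act_mult])
    finally show "ev m g (?\<phi> (I xs)) = signed ?n (insertion n ?\<alpha> (coch m g) xs)
       + ev m g (K ?n f (H xs)) + hb (*) (*) ?\<eta> xs"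
      using insertion_hom [OF additive_evf [OF g], of n ?\<alpha> I xs]
      by (simp add: X_def evf_diff evf_add evf_signed g coch_def [abs_def] algebra_simps)
  qed
qed

end

section \<open>Cohomology classes\<close>

text \<open>Separates the coboundary relation, which is an equivalence, from the cocycle condition
  in \<open>hh_class\<close>.\<close>

definition cohomologous :: "('a::{ring,monoid_mult}, 'p) bimod_complex \<Rightarrow> int \<Rightarrow> (int \<Rightarrow> 'p \<Rightarrow> 'a) \<Rightarrow> (int \<Rightarrow> 'p \<Rightarrow> 'a) \<Rightarrow> bool" where
  "cohomologous P n f f' \<longleftrightarrow> (\<exists>h \<in> maps P alg_complex (1 - n).
     \<forall>i. \<forall>x\<in>carrier (cmod P i). f' i x - f i x = h (i - 1) (cdiff P i x))"

lemma hh_class_alt: "hh_class P n f = {f'. cocycle P n f' \<and> cohomologous P n f f'}"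
  by (simp add: hh_class_def cohomologous_def)

lemma alg_carrier: "carrier (cmod alg_complex i) = {a. i = 0 \<or> a = 0}"
  by (simp add: alg_complex_def)

lemma bimod_hom_alg_combine:
  assumes "f \<in> bimod_hom M (cmod alg_complex i)" "g \<in> bimod_hom M (cmod alg_complex i)"
  shows "(\<lambda>x. signed j (f x) + signed k (g x)) \<in> bimod_hom M (cmod alg_complex i)"
  using assms by (auto simp: bimod_hom_def alg_simps alg_carrier Pi_iff signed_def algebra_simps)

lemma bimod_hom_alg_zero: "(\<lambda>x. 0) \<in> bimod_hom M (cmod alg_complex i)"
  by (simp add: bimod_hom_def alg_simps alg_carrier)

lemma maps_alg_combine:
  assumes "h \<in> maps P alg_complex t" "h' \<in> maps P alg_complex t"
  shows "(\<lambda>i x. signed j (h i x) + signed k (h' i x)) \<in> maps P alg_complex t"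
  using assms by (simp add: maps_def bimod_hom_alg_combine)

lemma cohomologous_refl: "cohomologous P n f f"
  unfolding cohomologous_def
  by (rule bexI [of _ "\<lambda>i x. 0"]) (simp_all add: maps_def bimod_hom_alg_zero)

lemma cohomologous_sym: "cohomologous P n f f' \<Longrightarrow> cohomologous P n f' f"
proof -
  assume "cohomologous P n f f'"
  then obtain h where h: "h \<in> maps P alg_complex (1 - n)"
    "\<And>i x. x \<in> carrier (cmod P i) \<Longrightarrow> f' i x - f i x = h (i - 1) (cdiff P i x)"
    unfolding cohomologous_def by blast
  have "(\<lambda>i x. signed 1 (h i x) + signed 0 ((\<lambda>i x. 0) i x)) \<in> maps P alg_complex (1 - n)"
    by (rule maps_alg_combine [OF h(1)]) (simp add: maps_def bimod_hom_alg_zero)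
  then show ?thesis unfolding cohomologous_def
    by (rule rev_bexI) (auto simp: signed_def simp flip: h(2))
qed

lemma cohomologous_trans: "cohomologous P n f f' \<Longrightarrow> cohomologous P n f' f'' \<Longrightarrow> cohomologous P n f f''"
proof -
  assume "cohomologous P n f f'" "cohomologous P n f' f''"
  then obtain h h' where h: "h \<in> maps P alg_complex (1 - n)"
      "\<And>i x. x \<in> carrier (cmod P i) \<Longrightarrow> f' i x - f i x = h (i - 1) (cdiff P i x)"
    and h': "h' \<in> maps P alg_complex (1 - n)"
      "\<And>i x. x \<in> carrier (cmod P i) \<Longrightarrow> f'' i x - f' i x = h' (i - 1) (cdiff P i x)"
    unfolding cohomologous_def by blast
  show ?thesis unfolding cohomologous_def
    by (rule rev_bexI [OF maps_alg_combine [OF h(1) h'(1), of 0 0]]) (auto simp flip: h(2) h'(2))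
qed

lemma hh_class_cong: "cohomologous P n f f' \<Longrightarrow> hh_class P n f = hh_class P n f'"
  unfolding hh_class_alt by (blast intro: cohomologous_sym cohomologous_trans)

lemma bimod_hom_comp: "f \<in> bimod_hom M N \<Longrightarrow> g \<in> bimod_hom N L \<Longrightarrow> (\<lambda>x. g (f x)) \<in> bimod_hom M L"
  by (simp add: bimod_hom_def Pi_iff)

lemma maps_comp: "f \<in> maps P Q s \<Longrightarrow> g \<in> maps Q R t \<Longrightarrow> (\<lambda>i x. g (i + s) (f i x)) \<in> maps P R (s + t)"
  unfolding maps_def by (auto simp flip: add.assoc intro: bimod_hom_comp)

section \<open>Cochains on the bar resolution\<close>

context k_algebra
begin

lemma bar_hom_eqI:
  assumes f: "f \<in> bimod_hom (bar_mod scale n) N" and g: "g \<in> bimod_hom (bar_mod scale n) N" and N: "ring_bimod N"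
    and eq: "\<And>bs. int (length bs) = n \<Longrightarrow> f (bar_cls scale n (1 # bs @ [1])) = g (bar_cls scale n (1 # bs @ [1]))"
    and x: "x \<in> carrier (bar_mod scale n)"
  shows "f x = g x"
  using x
proof (induction rule: presentation.carrier_induct [OF bar_presentation, folded bar_mod_def, consumes 1, case_names zero gen diff])
  case zero
  show ?case by (simp add: bimod_hom_zero [OF f bar_ring_bimod N] bimod_hom_zero [OF g bar_ring_bimod N])
next
  case (gen as)
  then obtain a bs z where as: "as = a # bs @ [z]" "int (length bs) = n" by (rule bar_gens_cases)
  let ?c = "bar_cls scale n (1 # bs @ [1])" and ?M = "bar_mod scale n"
  have c: "?c \<in> carrier ?M" "?c \<bullet>\<^bsub>?M\<^esub> z \<in> carrier ?M"
    using as by (auto simp: bar_cls_closed ring_bimod_r bar_ring_bimod)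
  have "bar_cls scale n as = a \<odot>\<^bsub>?M\<^esub> (?c \<bullet>\<^bsub>?M\<^esub> z)"
    using bar_cls_r [where as = "1 # bs" and z = 1 and a = z] bar_cls_l [where a = a and h = 1 and as = "bs @ [z]"] by (simp add: as)
  then show ?case
    using c eq [OF as(2)] by (simp add: bimod_hom_l [OF f] bimod_hom_r [OF f] bimod_hom_l [OF g] bimod_hom_r [OF g])
next
  case (diff x y)
  then show ?case
    by (simp add: bimod_hom_diff [OF f bar_ring_bimod N] bimod_hom_diff [OF g bar_ring_bimod N])
qed

text \<open>Agrees with \<open>cochain_of\<close> on lists of length n. The projection gives zero on
  all other lists, so \<open>cc n \<alpha>\<close> is multilinear on lists of every length.\<close>

definition cc :: "int \<Rightarrow> (int \<Rightarrow> ('a list \<Rightarrow>\<^sub>0 int) set \<Rightarrow> 'a) \<Rightarrow> 'a list \<Rightarrow> 'a" where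
  "cc n \<alpha> bs = \<alpha> n (prj B n (bar_unit bs))"

lemma cc_eq: "int (length bs) = n \<Longrightarrow> cc n \<alpha> bs = \<alpha> n (bar_cls scale n (1 # bs @ [1]))"
  by (auto simp: cc_def bar_unit_def prj_inc graded_B bar_cls_closed)

lemma cochain_of_eq: "length bs = n \<Longrightarrow> cochain_of scale n \<alpha> bs = cc (int n) \<alpha> bs"
  by (simp add: cochain_of_def cc_eq)

context
  fixes n :: int and \<alpha>
  assumes \<alpha>: "\<alpha> \<in> maps B alg_complex (- n)"
begin

lemma cc_gmap: "\<alpha> n (prj B n u) = alg_val (gmap B alg_complex (- n) \<alpha> u)"
  by (simp add: prj_gmap [OF graded_B graded_alg \<alpha>])

lemma additive_cc: "additive (\<lambda>u. \<alpha> n (prj B n u))"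
  and cc_l: "\<alpha> n (prj B n (tl_act a u)) = a * \<alpha> n (prj B n u)"
  and cc_r: "\<alpha> n (prj B n (tr_act u a)) = \<alpha> n (prj B n u) * a"
  unfolding cc_gmap
  by (simp_all add: additive_def alg_val_simps additive.add [OF additive_gmap [OF graded_B graded_alg \<alpha>]]
     gmap_l [OF graded_B graded_alg \<alpha>] gmap_r [OF graded_B graded_alg \<alpha>])

lemma cc_ml: "multilinear scale scale (cc n \<alpha>)"
proof -
  have "multilinear scale scale (\<lambda>bs. \<alpha> n (prj B n (bar_unit bs)))"
    by (rule multilinear_hom [OF multilinear_bar_unit additive_cc]) (simp add: cc_l scale_one_left)
  then show ?thesis by (simp add: cc_def [abs_def])
qed

lemma cc_hb: "hb (*) (*) (cc n \<alpha>) bs = \<alpha> n (cdiff B (n + 1) (prj B (n + 1) (bar_unit bs)))"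
proof -
  have "\<alpha> n (prj B n (hb tl_act tr_act bar_unit bs)) = hb (*) (*) (\<lambda>bs. \<alpha> n (prj B n (bar_unit bs))) bs"
    by (rule hb_hom [OF additive_cc]) (simp_all add: cc_l cc_r)
  moreover have "prj B n (dB (bar_unit bs)) = cdiff B (n + 1) (prj B (n + 1) (bar_unit bs))"
    unfolding dB_def by (simp add: prj_gmap [OF graded_B graded_B cdiff_B(1)])
  ultimately show ?thesis by (simp add: cc_def [abs_def] dB_bar_unit)
qed

end

lemma cc_cocycle: "cocycle B n \<alpha> \<Longrightarrow> hb (*) (*) (cc n \<alpha>) bs = 0"
proof -
  assume \<alpha>: "cocycle B n \<alpha>"
  then have "\<alpha> (n + 1 - 1) (cdiff B (n + 1) (prj B (n + 1) (bar_unit bs))) = 0"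
    using prj_closed [OF graded_B] unfolding cocycle_def by blast
  then show ?thesis using cc_hb [of \<alpha> n bs] \<alpha> by (simp add: cocycle_def)
qed

text \<open>The bracket is computed by insertions only on lists of the right length; therefore
  multilinearity is asked of a function \<gamma> that agrees with \<gamma>' on these lists.\<close>

lemma bar_map_of_maps:
  assumes \<gamma>: "multilinear scale scale \<gamma>" and eq: "\<And>bs. int (length bs) = k \<Longrightarrow> \<gamma>' bs = \<gamma> bs"
  shows "bar_map_of k \<gamma>' \<in> maps B alg_complex (- k)"
    and "int (length bs) = k \<Longrightarrow> cc k (bar_map_of k \<gamma>') bs = \<gamma> bs"
proof -
  let ?F = "\<lambda>bs. inc alg_complex 0 (\<gamma> bs)"
  let ?h = "\<lambda>as. hd as * \<gamma>' (butlast (tl as)) * last as"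
  have i: "inc alg_complex 0 (a + b :: 'a) = inc alg_complex 0 a + inc alg_complex 0 b"
    "tl_act c (inc alg_complex 0 a) = inc alg_complex 0 (c * a)" "tr_act (inc alg_complex 0 a) c = inc alg_complex 0 (a * c)" for a b c :: 'a
    using inc_add [OF graded_alg, of a 0 b] inc_l [OF graded_alg, of a 0 c] inc_r [OF graded_alg, of a 0 c]
    by (simp_all add: alg_simps)
  have F: "multilinear scale (\<lambda>c. tl_act (scale c 1)) ?F"
    by (rule multilinear_hom [OF \<gamma>]) (simp_all add: additive_def i scale_one_left)
  have c: "tl_act (scale c 1) (?F bs) = tr_act (?F bs) (scale c 1)" for c bs
    by (simp add: i scale_one_left scale_one_right)
  have h: "?h (a # bs @ [z]) \<in> carrier (cmod alg_complex 0) \<and>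
      embed (0, cmod alg_complex 0) (?h (a # bs @ [z])) = tl_act a (tr_act (?F bs) z)" if "int (length bs) = k" for a bs z
    using that by (simp add: alg_simps i eq mult.assoc flip: inc_def)
  note lift = bar_lift [where n = k, OF graded_ring_bimod [OF graded_alg] F c h]
  show m: "bar_map_of k \<gamma>' \<in> maps B alg_complex (- k)"
  proof -
    have "bar_map_of k \<gamma>' i \<in> bimod_hom (bar_mod scale i) (cmod alg_complex (i - k))" for i
      using lift(1) by (cases "i = k") (simp_all add: bar_map_of_def bimod_hom_alg_zero)
    then show ?thesis by (simp add: maps_def)
  qed
  show "int (length bs) = k \<Longrightarrow> cc k (bar_map_of k \<gamma>') bs = \<gamma> bs"
    using lift(2) [where bs = bs and a = 1 and z = 1] by (simp add: cc_eq bar_map_of_def eq)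
qed

lemma cohomologous_cc:
  assumes "cohomologous B n \<alpha> \<alpha>'"
  obtains h where "multilinear scale scale h" "\<And>bs. cc n \<alpha>' bs - cc n \<alpha> bs = hb (*) (*) h bs"
proof -
  obtain h where h: "h \<in> maps B alg_complex (1 - n)"
    "\<And>i x. x \<in> carrier (cmod B i) \<Longrightarrow> \<alpha>' i x - \<alpha> i x = h (i - 1) (cdiff B i x)"
    using assms unfolding cohomologous_def by blast
  have h': "h \<in> maps B alg_complex (- (n - 1))" using h(1) by simp
  show thesis
  proof (rule that [OF cc_ml [OF h']])
    show "cc n \<alpha>' bs - cc n \<alpha> bs = hb (*) (*) (cc (n - 1) h) bs" for bs
      using h(2) [OF prj_closed [OF graded_B], of n "bar_unit bs"] cc_hb [OF h', of bs] by (simp add: cc_def)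
  qed
qed

text \<open>Both sides of the required equation are bimodule maps, so comparing them on the units
  suffices. Outside degree n they vanish because A is concentrated in degree 0.\<close>

lemma cc_cohomologous:
  assumes \<alpha>: "\<alpha> \<in> maps B alg_complex (- n)" and \<alpha>': "\<alpha>' \<in> maps B alg_complex (- n)"
    and \<eta>: "multilinear scale scale \<eta>"
    and eq: "\<And>bs. int (length bs) = n \<Longrightarrow> cc n \<alpha>' bs - cc n \<alpha> bs = hb (*) (*) \<eta> bs"
  shows "cohomologous B n \<alpha> \<alpha>'"
  unfolding cohomologous_def
proof (rule bexI)
  let ?h = "bar_map_of (n - 1) \<eta>"
  have h: "?h \<in> maps B alg_complex (- (n - 1))" by (rule bar_map_of_maps [OF \<eta> refl])
  then show "?h \<in> maps B alg_complex (1 - n)" by simp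
  show "\<forall>i. \<forall>x\<in>carrier (cmod B i). \<alpha>' i x - \<alpha> i x = ?h (i - 1) (cdiff B i x)"
  proof (intro allI ballI)
    fix i x assume x: "x \<in> carrier (cmod B i)"
    show "\<alpha>' i x - \<alpha> i x = ?h (i - 1) (cdiff B i x)"
    proof (cases "i = n")
      case False
      then have "\<alpha> i x = 0" "\<alpha>' i x = 0"
        using bimod_hom_closed [OF mapsD [OF \<alpha>] x] bimod_hom_closed [OF mapsD [OF \<alpha>'] x] by (simp_all add: alg_carrier)
      then show ?thesis using False by (simp add: bar_map_of_def)
    next
      case True
      have 1: "\<alpha> n \<in> bimod_hom (bar_mod scale n) (cmod alg_complex 0)" "\<alpha>' n \<in> bimod_hom (bar_mod scale n) (cmod alg_complex 0)"
        using mapsD [OF \<alpha>, of n] mapsD [OF \<alpha>', of n] by simp_all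
      have 2: "(\<lambda>x. ?h (n - 1) (cdiff B n x)) \<in> bimod_hom (bar_mod scale n) (cmod alg_complex 0)"
        using bimod_hom_comp [OF mapsD [OF cdiff_B(1), of n] mapsD [OF h, of "n + - 1"]] by simp
      have "signed 0 (\<alpha>' n x) + signed 1 (\<alpha> n x) = ?h (n - 1) (cdiff B n x)"
      proof (rule bar_hom_eqI [OF bimod_hom_alg_combine [OF 1(2) 1(1)] 2 graded_ring_bimod [OF graded_alg]])
        show "x \<in> carrier (bar_mod scale n)" using x True by simp
        fix bs :: "'a list" assume len: "int (length bs) = n"
        have "?h (n - 1) (cdiff B n (bar_cls scale n (1 # bs @ [1]))) = hb (*) (*) (cc (n - 1) ?h) bs"
          using cc_hb [OF h, of bs] len by (auto simp: bar_unit_def prj_inc graded_B bar_cls_closed)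
        also have "\<dots> = hb (*) (*) \<eta> bs"
          by (rule hb_cong) (use len in \<open>auto intro!: bar_map_of_maps(2) [OF \<eta> refl]\<close>)
        finally show "signed 0 (\<alpha>' n (bar_cls scale n (1 # bs @ [1]))) + signed 1 (\<alpha> n (bar_cls scale n (1 # bs @ [1])))
            = ?h (n - 1) (cdiff B n (bar_cls scale n (1 # bs @ [1])))"
          using eq [OF len] len by (simp add: cc_eq signed_def)
      qed
      then show ?thesis by (simp add: True signed_def)
    qed
  qed
qed

lemma bar_aug_hom: "bar_aug \<in> bimod_hom (bar_mod scale 0) (cmod alg_complex 0)"
  and bar_aug_unit: "bar_aug (bar_cls scale 0 [1, 1]) = 1"
proof -
  let ?F = "\<lambda>bs :: 'a list. if bs = [] then inc alg_complex 0 1 else 0"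
  have i: "tl_act c (inc alg_complex 0 a) = inc alg_complex 0 (c * a)" "tr_act (inc alg_complex 0 a) c = inc alg_complex 0 (a * c)" for a c :: 'a
    using inc_l [OF graded_alg, of a 0 c] inc_r [OF graded_alg, of a 0 c] by (simp_all add: alg_simps)
  have F: "multilinear scale (\<lambda>c. tl_act (scale c 1)) ?F" by (simp add: multilinear_iff slotwise_add_def)
  have c: "tl_act (scale c 1) (?F bs) = tr_act (?F bs) (scale c 1)" for c bs by (simp add: i)
  have h: "(\<lambda>as. as ! 0 * as ! 1) (a # bs @ [z]) \<in> carrier (cmod alg_complex 0) \<and>
      embed (0, cmod alg_complex 0) ((\<lambda>as. as ! 0 * as ! 1) (a # bs @ [z])) = tl_act a (tr_act (?F bs) z)" if "int (length bs) = 0" for a bs and z :: 'a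
    using that by (simp add: alg_simps i flip: inc_def)
  note lift = bar_lift [where n = 0, OF graded_ring_bimod [OF graded_alg] F c h, folded bar_aug_def]
  show "bar_aug \<in> bimod_hom (bar_mod scale 0) (cmod alg_complex 0)" by (rule lift(1))
  show "bar_aug (bar_cls scale 0 [1, 1]) = 1" using lift(2) [where bs = "[]" and a = 1 and z = 1] by simp
qed

end

section \<open>The bracket of homotopy liftings as a Gerstenhaber bracket\<close>

context comparison
begin

text \<open>Expanding both commutators and applying \<open>ev_KL_KR\<close> in both orders gives
  four terms that cancel in pairs. Used with the diagonal for the cocycle property, and with
  \<open>H\<close> to remove the terms depending on it.\<close>

lemma ev_K_swap:
  assumes f: "cocycle P n f" and g: "cocycle P m g" and w: "w \<in> homog W (n + m)"
  shows "signed m (ev n f (K m g w)) + signed (m * (n - 1)) (ev m g (K n f w)) = 0"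
  using ev_KL_KR [OF f g w] ev_KL_KR [OF g f, of w] w
  by (simp add: K_def evf_diff f g add.commute signed_def)

context
  fixes n m :: nat and f g :: "int \<Rightarrow> 'p \<Rightarrow> 'a" and \<phi>\<^sub>f \<phi>\<^sub>g :: "int \<Rightarrow> 'p \<Rightarrow> 'p"
  assumes f: "cocycle P (int n) f" and g: "cocycle P (int m) g"
    and \<phi>\<^sub>f: "homotopy_lifting P \<mu> \<Delta> (int n) f \<phi>\<^sub>f" and \<phi>\<^sub>g: "homotopy_lifting P \<mu> \<Delta> (int m) g \<phi>\<^sub>g"
begin

lemma lifting_maps: "\<phi>\<^sub>f \<in> maps P P (1 - int n)" "\<phi>\<^sub>g \<in> maps P P (1 - int m)"
  using \<phi>\<^sub>f \<phi>\<^sub>g by (simp_all add: homotopy_lifting_def)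

lemma lifting_bracket_prj:
  "lifting_bracket n m f g \<phi>\<^sub>f \<phi>\<^sub>g (int n + int m - 1) (prj P (int n + int m - 1) u)
    = signed (int m) (ev (int n) f (gmap P P (1 - int m) \<phi>\<^sub>g u))
      + signed (int m * (int n - 1)) (ev (int m) g (gmap P P (1 - int n) \<phi>\<^sub>f u))"
proof -
  have 1: "int n - (1 - int m) = int n + int m - 1" "int m - (1 - int n) = int n + int m - 1"
    "int n + int m - 1 + (1 - int m) = int n" "int n + int m - 1 + (1 - int n) = int m" by simp_all
  show ?thesis
    unfolding lifting_bracket_def ev_def prj_gmap [OF graded_P graded_P lifting_maps(1)] prj_gmap [OF graded_P graded_P lifting_maps(2)] 1 ..
qed

lemma lifting_bracket_maps: "lifting_bracket n m f g \<phi>\<^sub>f \<phi>\<^sub>g \<in> maps P alg_complex (- (int n + int m - 1))"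
proof -
  have 1: "(\<lambda>i x. f (i + (1 - int m)) (\<phi>\<^sub>g i x)) \<in> maps P alg_complex (- (int n + int m - 1))"
    using maps_comp [OF lifting_maps(2) f_maps [OF f]] by (simp add: algebra_simps)
  have 2: "(\<lambda>i x. g (i + (1 - int n)) (\<phi>\<^sub>f i x)) \<in> maps P alg_complex (- (int n + int m - 1))"
    using maps_comp [OF lifting_maps(1) f_maps [OF g]] by (simp add: algebra_simps)
  show ?thesis using maps_alg_combine [OF 1 2] by (simp add: lifting_bracket_def)
qed

text \<open>\<open>\<phi>\<^sub>f d\<close> is a boundary plus the commutator of f on the diagonal,
  and likewise for g. Cocycles kill boundaries, and the two commutators cancel by
  \<open>ev_K_swap\<close>. Away from degree n + m the target is zero.\<close>

lemma lifting_bracket_cocycle: "cocycle P (int n + int m - 1) (lifting_bracket n m f g \<phi>\<^sub>f \<phi>\<^sub>g)"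
  unfolding cocycle_def
proof (intro conjI allI ballI lifting_bracket_maps)
  let ?k = "int n + int m - 1"
  fix i x assume x: "x \<in> carrier (cmod P i)"
  show "lifting_bracket n m f g \<phi>\<^sub>f \<phi>\<^sub>g (i - 1) (cdiff P i x) = 0"
  proof (cases "i = int n + int m")
    case False
    then show ?thesis
      using bimod_hom_closed [OF mapsD [OF lifting_bracket_maps], of "cdiff P i x" "i - 1"] bimod_hom_closed [OF mapsD [OF cdiff_maps] x]
      by (simp add: alg_carrier)
  next
    case True
    define u where "u = inc P i x"
    have u: "u \<in> homog P (int n + int m)" using x True by (simp add: u_def inc_homog graded_P)
    have dx: "cdiff P i x = prj P ?k (d u)"
      using d_inc [OF x] bimod_hom_closed [OF mapsD [OF cdiff_maps] x] True by (simp add: u_def prj_inc graded_P)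
    have "lifting_bracket n m f g \<phi>\<^sub>f \<phi>\<^sub>g (i - 1) (cdiff P i x) = lifting_bracket n m f g \<phi>\<^sub>f \<phi>\<^sub>g ?k (prj P ?k (d u))"
      using dx True by simp
    also have "\<dots> = signed (int m) (ev (int n) f (K (int m) g (D u))) + signed (int m * (int n - 1)) (ev (int m) g (K (int n) f (D u)))"
    proof -
      have "gmap P P (1 - int n) \<phi>\<^sub>f (d u) = signed (1 - int n) (d (gmap P P (1 - int n) \<phi>\<^sub>f u)) + K (int n) f (D u)"
        using \<phi>\<^sub>f by (intro lifting_eq [OF f lifting_maps(1) _ u]) (simp add: homotopy_lifting_def)
      moreover have "gmap P P (1 - int m) \<phi>\<^sub>g (d u) = signed (1 - int m) (d (gmap P P (1 - int m) \<phi>\<^sub>g u)) + K (int m) g (D u)"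
        using \<phi>\<^sub>g by (intro lifting_eq [OF g lifting_maps(2) _ u]) (simp add: homotopy_lifting_def)
      ultimately show ?thesis
        unfolding lifting_bracket_prj by (simp add: evf_add evf_signed ev_d f g)
    qed
    also have "\<dots> = 0" by (rule ev_K_swap [OF f g D_homog [OF u]])
    finally show ?thesis .
  qed
qed

text \<open>\<open>lifting_insertion\<close> for both liftings with a common \<open>H\<close>. The
  sign (-1)^m of the bracket meets the sign (-1)^m of the insertion of g and disappears; for the
  insertion of f the product of (-1)^(m(n-1)) and (-1)^n is the Gerstenhaber sign
  -(-1)^((n-1)(m-1)).\<close>

lemma lifting_bracket_gerstenhaber:
  obtains \<eta> where "multilinear scale scale \<eta>"
    "\<And>xs. int (length xs) = int n + int m - 1 \<Longrightarrow>
      lifting_bracket n m f g \<phi>\<^sub>f \<phi>\<^sub>g (int n + int m - 1) (prj P (int n + int m - 1) (I xs))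
      = gerstenhaber n m (coch (int n) f) (coch (int m) g) xs + hb (*) (*) \<eta> xs"
proof -
  interpret A: bimod_act "(*)" "(*) :: 'a \<Rightarrow> 'a \<Rightarrow> 'a" by (rule bimod_act_mult)
  obtain H where H: "ml H" "\<And>xs. H xs \<in> homog W (int (length xs) + 1)" "\<And>xs. D (I xs) - T2 xs = dW (H xs) + hbT H xs"
    by (rule obtain_H) (rule that)
  obtain \<eta>\<^sub>1 where \<eta>\<^sub>1: "multilinear scale scale \<eta>\<^sub>1"
    "\<And>xs. ev (int m) g (gmap P P (1 - int n) \<phi>\<^sub>f (I xs)) = signed (int n) (insertion n (coch (int n) f) (coch (int m) g) xs)
       + ev (int m) g (K (int n) f (H xs)) + hb (*) (*) \<eta>\<^sub>1 xs"
    using lifting_insertion [OF H f \<phi>\<^sub>f g] by blast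
  obtain \<eta>\<^sub>2 where \<eta>\<^sub>2: "multilinear scale scale \<eta>\<^sub>2"
    "\<And>xs. ev (int n) f (gmap P P (1 - int m) \<phi>\<^sub>g (I xs)) = signed (int m) (insertion m (coch (int m) g) (coch (int n) f) xs)
       + ev (int n) f (K (int m) g (H xs)) + hb (*) (*) \<eta>\<^sub>2 xs"
    using lifting_insertion [OF H g \<phi>\<^sub>g f] by blast
  let ?\<eta> = "\<lambda>xs. signed (int m) (\<eta>\<^sub>2 xs) + signed (int m * (int n - 1)) (\<eta>\<^sub>1 xs)"
  show thesis
  proof (rule that)
    show "multilinear scale scale ?\<eta>"
      by (intro multilinear_add multilinear_signed \<eta>\<^sub>1 \<eta>\<^sub>2 additive_scale)
    fix xs :: "'a list" assume xs: "int (length xs) = int n + int m - 1"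
    then have w: "H xs \<in> homog W (int n + int m)" using H(2) [of xs] by simp
    have hb: "hb (*) (*) ?\<eta> xs = signed (int m) (hb (*) (*) \<eta>\<^sub>2 xs) + signed (int m * (int n - 1)) (hb (*) (*) \<eta>\<^sub>1 xs)"
      by (simp add: A.hb_add A.hb_signed)
    have "length xs + 1 = n + m" using xs by linarith
    from gerstenhaber_eq_insertion [OF this] ev_K_swap [OF f g w]
    show "lifting_bracket n m f g \<phi>\<^sub>f \<phi>\<^sub>g (int n + int m - 1) (prj P (int n + int m - 1) (I xs))
      = gerstenhaber n m (coch (int n) f) (coch (int m) g) xs + hb (*) (*) ?\<eta> xs"
      unfolding lifting_bracket_prj hb \<eta>\<^sub>1(2) \<eta>\<^sub>2(2)
      by (cases "even m"; cases "even n") (simp_all add: signed_def algebra_simps)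
  qed
qed

end

end

section \<open>Existence of a comparison map\<close>

context resolution
begin

text \<open>The bimodule extension of the cochain from \<open>obtain_iota\<close>. Being a chain map
  is checked on units, where the bar differential is the coboundary of \<open>bar_unit\<close> and d
  I = hb I.\<close>

lemma obtain_comparison:
  obtains \<iota> where "comparison_map B bar_aug P \<mu> \<iota>"
proof -
  obtain I where I: "ml I" "\<And>xs. I xs \<in> homog P (int (length xs))" "\<And>xs. d (I xs) = hbT I xs" "mu (I []) = 1"
    by (rule obtain_iota) (rule that)
  let ?h = "\<lambda>i as. prj P i (tl_act (hd as) (tr_act (I (butlast (tl as))) (last as)))"
  define \<iota> where "\<iota> i = pres_lift (cmod P i) (?h i)" for i
  have h: "?h i (a # bs @ [z]) \<in> carrier (cmod P i) \<and> embed (i, cmod P i) (?h i (a # bs @ [z])) = tl_act a (tr_act (I bs) z)"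
    if "int (length bs) = i" for i a bs z
  proof -
    have "tl_act a (tr_act (I bs) z) \<in> homog P i" using I(2) [of bs] that by (simp add: homog_l homog_r graded_P)
    from inc_prj [OF graded_P this] show ?thesis by (simp add: prj_closed graded_P flip: inc_def)
  qed
  note lift = bar_lift [OF graded_ring_bimod [OF graded_P] I(1) central_P [OF I(2)] h, folded \<iota>_def]
  have m: "\<iota> \<in> maps B P 0"
    using lift(1) by (simp add: maps_def)
  have unit: "gmap B P 0 \<iota> (bar_unit bs) = I bs" for bs
  proof -
    let ?n = "int (length bs)"
    have "gmap B P 0 \<iota> (bar_unit bs) = inc P ?n (\<iota> ?n (bar_cls scale ?n (1 # bs @ [1])))"
      using gmap_inc [OF graded_B graded_P m, of "bar_cls scale ?n (1 # bs @ [1])" ?n] by (simp add: bar_unit_def bar_cls_closed)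
    then show ?thesis using I(2) [of bs] by (simp add: lift(2) T.l_one T.r_one inc_prj graded_P)
  qed
  note gm = additive_gmap [OF graded_B graded_P m] gmap_l [OF graded_B graded_P m] gmap_r [OF graded_B graded_P m]
  note gB = additive_gmap [OF graded_B graded_B cdiff_B(1), folded dB_def] gmap_l [OF graded_B graded_B cdiff_B(1), folded dB_def]
    gmap_r [OF graded_B graded_B cdiff_B(1), folded dB_def]
  have chain: "gmap B P 0 \<iota> (dB w) = d (gmap B P 0 \<iota> w)" if "w \<in> homog B n" for w n
    using that
  proof (induction rule: bar_induct)
    case zero
    show ?case by (simp add: additive.zero [OF gm(1)] additive.zero [OF gB(1)])
  next
    case (gen a bs z)
    have "gmap B P 0 \<iota> (hbT bar_unit bs) = hbT (\<lambda>bs. gmap B P 0 \<iota> (bar_unit bs)) bs"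
      by (rule hb_hom [OF gm(1)]) (simp_all add: gm)
    then show ?case by (simp add: inc_bar_cls gen gm gB d_l d_r unit dB_bar_unit I(3))
  next
    case (diff w w')
    then show ?case by (simp add: additive.diff [OF gm(1)] additive.diff [OF gB(1)] d_diff)
  qed
  have "dmap B P 0 \<iota> i x = \<zero>\<^bsub>cmod P (i - 1)\<^esub>" if "x \<in> carrier (cmod B i)" for i x
  proof -
    note t = dmap_typed [OF graded_B graded_P cdiff_B(1) cdiff_maps m that]
    have "inc P (i - 1) (dmap B P 0 \<iota> i x) = inc P (i - 1) \<zero>\<^bsub>cmod P (i - 1)\<^esub>"
      using t(2) chain [OF inc_homog [OF graded_B that]] by (simp add: d_def dB_def inc_zero graded_P)
    then show ?thesis
      using inc_inject [OF graded_P] t(1) ring_bimod_zero [OF graded_ring_bimod [OF graded_P]] by simp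
  qed
  then have "chain_map B P \<iota>" using m by (simp add: chain_map_def)
  moreover have "\<mu> (\<iota> 0 x) = bar_aug x" if "x \<in> carrier (cmod B 0)" for x
  proof -
    have "\<mu> \<in> bimod_hom (cmod P (0 + 0)) (cmod alg_complex 0)"
      using res by (simp add: projective_resolution_def)
    then have 1: "(\<lambda>x. \<mu> (\<iota> 0 x)) \<in> bimod_hom (bar_mod scale 0) (cmod alg_complex 0)"
      using bimod_hom_comp [OF mapsD [OF m, of 0]] by simp
    have 2: "\<iota> 0 (bar_cls scale 0 [1, 1]) = prj P 0 (I [])"
      using lift(2) [where bs = "[]" and a = 1 and z = 1] by (simp add: T.l_one T.r_one)
    show ?thesis
    proof (rule bar_hom_eqI [OF 1 bar_aug_hom graded_ring_bimod [OF graded_alg]])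
      show "x \<in> carrier (bar_mod scale 0)" using that by simp
    qed (use I(4) in \<open>simp add: 2 mu_def bar_aug_unit\<close>)
  qed
  ultimately show thesis by (intro that [of \<iota>]) (simp add: comparison_map_def)
qed

end

section \<open>Independence of the bracket from the representatives\<close>

lemma gerstenhaber_cong:
  assumes "length xs + 1 = n + m" "\<And>ys. length ys = n \<Longrightarrow> \<alpha> ys = \<alpha>' ys" "\<And>ys. length ys = m \<Longrightarrow> \<beta> ys = \<beta>' ys"
  shows "gerstenhaber n m \<alpha> \<beta> xs = gerstenhaber n m \<alpha>' \<beta>' xs"
proof -
  have "insertion m \<beta> \<alpha> xs = insertion m \<beta>' \<alpha>' xs" "insertion n \<alpha> \<beta> xs = insertion n \<alpha>' \<beta>' xs"
    using assms by (auto intro!: insertion_cong)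
  then show ?thesis by (simp only: gerstenhaber_eq_insertion [OF assms(1)])
qed

context k_algebra
begin

lemma multilinear_zero: "multilinear scale scale (\<lambda>_. 0)"
  by (simp add: multilinear_iff slotwise_add_def)

text \<open>The bracket is additive in each argument, and the bracket of a coboundary with a cocycle
  is a coboundary.\<close>

lemma gerstenhaber_coboundary_left:
  assumes \<alpha>: "multilinear scale scale \<alpha>" and \<beta>: "multilinear scale scale \<beta>" and h: "multilinear scale scale h"
    and cocycle: "\<And>xs. hb (*) (*) \<beta> xs = 0" and eq: "\<And>xs. \<alpha>' xs = \<alpha> xs + hb (*) (*) h xs"
  obtains \<eta> where "multilinear scale scale \<eta>"
    "\<And>xs. length xs + 1 = n + m \<Longrightarrow> gerstenhaber n m \<alpha>' \<beta> xs = gerstenhaber n m \<alpha> \<beta> xs + hb (*) (*) \<eta> xs"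
proof (cases n)
  \<comment> \<open>There are no coboundaries in degree 0: \<open>hb\<close> vanishes on the empty
    list, so \<alpha> and \<alpha>' agree there.\<close>
  case 0
  interpret A: bimod_act "(*)" "(*) :: 'a \<Rightarrow> 'a \<Rightarrow> 'a" by (rule bimod_act_mult)
  show thesis
  proof (rule that [OF multilinear_zero])
    fix xs :: "'a list" assume "length xs + 1 = n + m"
    then have "gerstenhaber n m \<alpha>' \<beta> xs = gerstenhaber n m \<alpha> \<beta> xs"
      by (rule gerstenhaber_cong) (simp_all add: 0 eq)
    then show "gerstenhaber n m \<alpha>' \<beta> xs = gerstenhaber n m \<alpha> \<beta> xs + hb (*) (*) (\<lambda>_. 0) xs" by simp
  qed
next
  case (Suc k)
  obtain \<eta> where \<eta>: "multilinear scale scale \<eta>"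
    "\<And>xs. length xs = k + m \<Longrightarrow> gerstenhaber (Suc k) m (hb (*) (*) h) \<beta> xs = hb (*) (*) \<eta> xs"
    using bracket_coboundary_left [OF h \<beta> cocycle] by blast
  show thesis
  proof (rule that [OF \<eta>(1)])
    fix xs :: "'a list" assume len: "length xs + 1 = n + m"
    have "slotwise_add \<beta>" using \<beta> by (simp add: multilinear_iff)
    note insertion_add_inner [OF this, of n \<alpha> "hb (*) (*) h" xs] insertion_add [of m \<beta> \<alpha> "hb (*) (*) h" xs]
    moreover have "\<alpha>' = (\<lambda>xs. \<alpha> xs + hb (*) (*) h xs)" by (simp add: fun_eq_iff eq)
    ultimately have "gerstenhaber n m \<alpha>' \<beta> xs = gerstenhaber n m \<alpha> \<beta> xs + gerstenhaber n m (hb (*) (*) h) \<beta> xs"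
      by (simp add: gerstenhaber_eq_insertion [OF len] signed_add)
    then show "gerstenhaber n m \<alpha>' \<beta> xs = gerstenhaber n m \<alpha> \<beta> xs + hb (*) (*) \<eta> xs"
      using \<eta>(2) [of xs] len by (simp add: Suc)
  qed
qed

lemma gerstenhaber_coboundary_right:
  assumes \<alpha>: "multilinear scale scale \<alpha>" and \<beta>: "multilinear scale scale \<beta>" and h: "multilinear scale scale h"
    and cocycle: "\<And>xs. hb (*) (*) \<alpha> xs = 0" and eq: "\<And>xs. \<beta>' xs = \<beta> xs + hb (*) (*) h xs"
  obtains \<eta> where "multilinear scale scale \<eta>"
    "\<And>xs. length xs + 1 = n + m \<Longrightarrow> gerstenhaber n m \<alpha> \<beta>' xs = gerstenhaber n m \<alpha> \<beta> xs + hb (*) (*) \<eta> xs"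
proof (cases m)
  case 0
  interpret A: bimod_act "(*)" "(*) :: 'a \<Rightarrow> 'a \<Rightarrow> 'a" by (rule bimod_act_mult)
  show thesis
  proof (rule that [OF multilinear_zero])
    fix xs :: "'a list" assume "length xs + 1 = n + m"
    then have "gerstenhaber n m \<alpha> \<beta>' xs = gerstenhaber n m \<alpha> \<beta> xs"
      by (rule gerstenhaber_cong) (simp_all add: 0 eq)
    then show "gerstenhaber n m \<alpha> \<beta>' xs = gerstenhaber n m \<alpha> \<beta> xs + hb (*) (*) (\<lambda>_. 0) xs" by simp
  qed
next
  case (Suc k)
  obtain \<eta> where \<eta>: "multilinear scale scale \<eta>"
    "\<And>xs. length xs = n + k \<Longrightarrow> gerstenhaber n (Suc k) \<alpha> (hb (*) (*) h) xs = hb (*) (*) \<eta> xs"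
    using bracket_coboundary_right [OF h \<alpha> cocycle] by blast
  show thesis
  proof (rule that [OF \<eta>(1)])
    fix xs :: "'a list" assume len: "length xs + 1 = n + m"
    have "slotwise_add \<alpha>" using \<alpha> by (simp add: multilinear_iff)
    note insertion_add_inner [OF this, of m \<beta> "hb (*) (*) h" xs] insertion_add [of n \<alpha> \<beta> "hb (*) (*) h" xs]
    moreover have "\<beta>' = (\<lambda>xs. \<beta> xs + hb (*) (*) h xs)" by (simp add: fun_eq_iff eq)
    ultimately have "gerstenhaber n m \<alpha> \<beta>' xs = gerstenhaber n m \<alpha> \<beta> xs + gerstenhaber n m \<alpha> (hb (*) (*) h) xs"
      by (simp add: gerstenhaber_eq_insertion [OF len] signed_add)
    then show "gerstenhaber n m \<alpha> \<beta>' xs = gerstenhaber n m \<alpha> \<beta> xs + hb (*) (*) \<eta> xs"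
      using \<eta>(2) [of xs] len by (simp add: Suc)
  qed
qed

lemma gerstenhaber_cohomologous:
  assumes \<alpha>: "cocycle B (int n) \<alpha>" "cocycle B (int n) \<alpha>'" "cohomologous B (int n) \<alpha> \<alpha>'"
    and \<beta>: "cocycle B (int m) \<beta>" "cocycle B (int m) \<beta>'" "cohomologous B (int m) \<beta> \<beta>'"
  obtains \<eta> where "multilinear scale scale \<eta>"
    "\<And>xs. length xs + 1 = n + m \<Longrightarrow> gerstenhaber n m (cc (int n) \<alpha>') (cc (int m) \<beta>') xs
      = gerstenhaber n m (cc (int n) \<alpha>) (cc (int m) \<beta>) xs + hb (*) (*) \<eta> xs"
proof -
  interpret A: bimod_act "(*)" "(*) :: 'a \<Rightarrow> 'a \<Rightarrow> 'a" by (rule bimod_act_mult)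
  have ml: "multilinear scale scale (cc n \<alpha>)" if "cocycle B n \<alpha>" for n \<alpha>
    using that by (simp add: cc_ml cocycle_def)
  obtain h where h: "multilinear scale scale h" "\<And>xs. cc (int n) \<alpha>' xs - cc (int n) \<alpha> xs = hb (*) (*) h xs"
    using cohomologous_cc [OF \<alpha>(3)] by blast
  obtain h' where h': "multilinear scale scale h'" "\<And>xs. cc (int m) \<beta>' xs - cc (int m) \<beta> xs = hb (*) (*) h' xs"
    using cohomologous_cc [OF \<beta>(3)] by blast
  obtain \<eta> where \<eta>: "multilinear scale scale \<eta>"
    "\<And>xs. length xs + 1 = n + m \<Longrightarrow> gerstenhaber n m (cc (int n) \<alpha>') (cc (int m) \<beta>') xs
      = gerstenhaber n m (cc (int n) \<alpha>) (cc (int m) \<beta>') xs + hb (*) (*) \<eta> xs"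
  proof (rule gerstenhaber_coboundary_left [OF ml [OF \<alpha>(1)] ml [OF \<beta>(2)] h(1) cc_cocycle [OF \<beta>(2)]])
    show "cc (int n) \<alpha>' xs = cc (int n) \<alpha> xs + hb (*) (*) h xs" for xs by (simp flip: h(2))
  qed (rule that)
  obtain \<eta>' where \<eta>': "multilinear scale scale \<eta>'"
    "\<And>xs. length xs + 1 = n + m \<Longrightarrow> gerstenhaber n m (cc (int n) \<alpha>) (cc (int m) \<beta>') xs
      = gerstenhaber n m (cc (int n) \<alpha>) (cc (int m) \<beta>) xs + hb (*) (*) \<eta>' xs"
  proof (rule gerstenhaber_coboundary_right [OF ml [OF \<alpha>(1)] ml [OF \<beta>(1)] h'(1) cc_cocycle [OF \<alpha>(1)]])
    show "cc (int m) \<beta>' xs = cc (int m) \<beta> xs + hb (*) (*) h' xs" for xs by (simp flip: h'(2))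
  qed (rule that)
  show thesis
    by (rule that [of "\<lambda>xs. \<eta> xs + \<eta>' xs"])
      (simp_all add: A.hb_add \<eta>(2) \<eta>'(2) multilinear_add \<eta>(1) \<eta>'(1) additive_scale)
qed

text \<open>The insertions serve as the multilinear function that agrees with the bracket on lists
  of the right length.\<close>

lemma bar_map_of_gerstenhaber:
  assumes \<alpha>: "cocycle B (int n) \<alpha>" and \<beta>: "cocycle B (int m) \<beta>"
  defines "\<gamma> \<equiv> bar_map_of (int n + int m - 1) (gerstenhaber n m (cochain_of scale n \<alpha>) (cochain_of scale m \<beta>))"
  shows "\<gamma> \<in> maps B alg_complex (- (int n + int m - 1))"
    and "length xs + 1 = n + m \<Longrightarrow> cc (int n + int m - 1) \<gamma> xs = gerstenhaber n m (cc (int n) \<alpha>) (cc (int m) \<beta>) xs"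
proof -
  let ?\<alpha> = "cc (int n) \<alpha>" and ?\<beta> = "cc (int m) \<beta>"
  let ?\<gamma> = "\<lambda>xs. insertion m ?\<beta> ?\<alpha> xs - signed ((int n - 1) * (int m - 1)) (insertion n ?\<alpha> ?\<beta> xs)"
  have ml: "multilinear scale scale ?\<gamma>"
    using \<alpha> \<beta> by (intro multilinear_gerstenhaber cc_ml) (simp_all add: cocycle_def)
  have eq: "gerstenhaber n m (cochain_of scale n \<alpha>) (cochain_of scale m \<beta>) xs = ?\<gamma> xs" if "int (length xs) = int n + int m - 1" for xs
  proof -
    have len: "length xs + 1 = n + m" using that by linarith
    have "gerstenhaber n m (cochain_of scale n \<alpha>) (cochain_of scale m \<beta>) xs = gerstenhaber n m ?\<alpha> ?\<beta> xs"
      by (rule gerstenhaber_cong [OF len]) (simp_all add: cochain_of_eq)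
    then show ?thesis by (simp only: gerstenhaber_eq_insertion [OF len])
  qed
  show "\<gamma> \<in> maps B alg_complex (- (int n + int m - 1))"
    unfolding \<gamma>_def by (rule bar_map_of_maps(1) [OF ml eq])
  assume len: "length xs + 1 = n + m"
  then have "int (length xs) = int n + int m - 1" by linarith
  from bar_map_of_maps(2) [OF ml eq this]
  show "cc (int n + int m - 1) \<gamma> xs = gerstenhaber n m ?\<alpha> ?\<beta> xs"
    by (simp only: \<gamma>_def gerstenhaber_eq_insertion [OF len])
qed

end

section \<open>Pullback of classes to the bar resolution\<close>

context resolution
begin

context
  fixes \<iota> assumes \<iota>: "comparison_map B bar_aug P \<mu> \<iota>"
begin

lemma iota_maps: "\<iota> \<in> maps B P 0"
  using \<iota> by (simp add: comparison_map_def chain_map_def)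

lemma iota_dB: "w \<in> homog B i \<Longrightarrow> gmap B P 0 \<iota> (dB w) = d (gmap B P 0 \<iota> w)"
proof -
  assume "w \<in> homog B i"
  then obtain x where x: "w = inc B i x" "x \<in> carrier (cmod B i)" by (auto simp: homog_def)
  have "dmap B P 0 \<iota> i x = \<zero>\<^bsub>cmod P (i - 1)\<^esub>"
    using \<iota> x by (simp add: comparison_map_def chain_map_def)
  then show ?thesis
    using dmap_typed(2) [OF graded_B graded_P cdiff_B(1) cdiff_maps iota_maps x(2)] inc_zero [OF graded_P, of "i - 1"]
    by (simp add: x(1) d_def dB_def)
qed

lemma iota_cdiff:
  assumes x: "x \<in> carrier (cmod B i)"
  shows "\<iota> (i - 1) (cdiff B i x) = cdiff P i (\<iota> i x)" and "\<iota> i x \<in> carrier (cmod P i)"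
proof -
  show y: "\<iota> i x \<in> carrier (cmod P i)"
    using bimod_hom_closed [OF mapsD [OF iota_maps] x] by simp
  have dx: "cdiff B i x \<in> carrier (cmod B (i - 1))"
    using bimod_hom_closed [OF mapsD [OF cdiff_B(1)] x] by simp
  have "\<iota> (i - 1) (prj B (i - 1) (dB (inc B i x))) = prj P (i - 1) (gmap B P 0 \<iota> (dB (inc B i x)))"
    by (simp add: prj_gmap [OF graded_B graded_P iota_maps])
  also have "\<dots> = cdiff P i (\<iota> i x)"
    using iota_dB [OF inc_homog [OF graded_B x]] x
    by (simp add: prj_d prj_gmap [OF graded_B graded_P iota_maps] prj_inc [OF graded_B])
  finally show "\<iota> (i - 1) (cdiff B i x) = cdiff P i (\<iota> i x)"
    using gmap_inc [OF graded_B graded_B cdiff_B(1) x] dx by (simp add: dB_def prj_inc [OF graded_B])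
qed

lemma pullback_maps: "f \<in> maps P alg_complex t \<Longrightarrow> (\<lambda>i x. f i (\<iota> i x)) \<in> maps B alg_complex t"
  using maps_comp [OF iota_maps, of f alg_complex t] by simp

lemma pullback_cocycle: "cocycle P n f \<Longrightarrow> cocycle B n (\<lambda>i x. f i (\<iota> i x))"
  by (simp add: cocycle_def pullback_maps iota_cdiff)

lemma pullback_cohomologous:
  assumes "cohomologous P n f f'"
  shows "cohomologous B n (\<lambda>i x. f i (\<iota> i x)) (\<lambda>i x. f' i (\<iota> i x))"
proof -
  obtain h where h: "h \<in> maps P alg_complex (1 - n)"
    "\<And>i x. x \<in> carrier (cmod P i) \<Longrightarrow> f' i x - f i x = h (i - 1) (cdiff P i x)"
    using assms unfolding cohomologous_def by blast
  show ?thesis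
    unfolding cohomologous_def by (rule rev_bexI [OF pullback_maps [OF h(1)]]) (simp add: iota_cdiff h(2))
qed

text \<open>Cohomologous cocycles have cohomologous pullbacks, so all members of the union in
  \<open>hh_pullback\<close> coincide.\<close>

lemma pullback_class:
  assumes "cocycle P n f"
  shows "hh_pullback B n \<iota> (hh_class P n f) = hh_class B n (\<lambda>i x. f i (\<iota> i x))"
proof -
  have "f \<in> hh_class P n f" using assms by (simp add: hh_class_alt cohomologous_refl)
  moreover have "hh_class B n (\<lambda>i x. f' i (\<iota> i x)) = hh_class B n (\<lambda>i x. f i (\<iota> i x))" if "f' \<in> hh_class P n f" for f'
  proof -
    have "cohomologous P n f f'" using that by (simp add: hh_class_alt)
    from hh_class_cong [OF pullback_cohomologous [OF this]] show ?thesis ..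
  qed
  ultimately show ?thesis unfolding hh_pullback_def by blast
qed

text \<open>Makes the calculations with the cochain \<open>I\<close> available for an arbitrary
  given comparison map, not just for the one constructed.\<close>

lemma comparison_of_map:
  assumes "diagonal_approximation P \<mu> \<Delta>"
  shows "comparison scale P \<mu> (\<lambda>bs. gmap B P 0 \<iota> (bar_unit bs)) \<Delta>"
proof -
  note gm = additive_gmap [OF graded_B graded_P iota_maps] gmap_l [OF graded_B graded_P iota_maps] gmap_r [OF graded_B graded_P iota_maps]
  show ?thesis
  proof (intro comparison.intro comparison_axioms.intro resolution_axioms assms)
    show "ml (\<lambda>bs. gmap B P 0 \<iota> (bar_unit bs))"
      by (rule multilinear_hom [OF multilinear_bar_unit gm(1)]) (simp add: gm)
    show "gmap B P 0 \<iota> (bar_unit bs) \<in> homog P (int (length bs))" for bs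
      using gmap_homog [OF graded_B graded_P iota_maps bar_unit_homog, of bs] by simp
    show "d (gmap B P 0 \<iota> (bar_unit bs)) = hbT (\<lambda>bs. gmap B P 0 \<iota> (bar_unit bs)) bs" for bs
    proof -
      have "gmap B P 0 \<iota> (hbT bar_unit bs) = hbT (\<lambda>bs. gmap B P 0 \<iota> (bar_unit bs)) bs"
        by (rule hb_hom [OF gm(1)]) (simp_all add: gm)
      then show ?thesis by (simp add: dB_bar_unit flip: iota_dB [OF bar_unit_homog])
    qed
    have c: "bar_cls scale 0 [1, 1] \<in> carrier (cmod B 0)" by (simp add: bar_cls_closed)
    have "\<mu> (\<iota> 0 (bar_cls scale 0 [1, 1])) = 1"
      using \<iota> c by (simp add: comparison_map_def bar_aug_unit)
    then show "mu (gmap B P 0 \<iota> (bar_unit [])) = 1"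
      using c by (simp add: mu_def bar_unit_def prj_gmap [OF graded_B graded_P iota_maps] prj_inc [OF graded_B])
  qed
qed

end

end

context resolution
begin

text \<open>The union in \<open>hh_bracket\<close> runs over all representatives. Each contributes
  the class of the pulled back lifting bracket: by \<open>gerstenhaber_cohomologous\<close> it may
  be replaced by the pullbacks of f and g, for which \<open>lifting_bracket_gerstenhaber\<close>
  applies.\<close>

lemma bracket_pullback:
  assumes diag: "diagonal_approximation P \<mu> \<Delta>" and f: "cocycle P (int n) f" and g: "cocycle P (int m) g"
    and \<phi>\<^sub>f: "homotopy_lifting P \<mu> \<Delta> (int n) f \<phi>\<^sub>f" and \<phi>\<^sub>g: "homotopy_lifting P \<mu> \<Delta> (int m) g \<phi>\<^sub>g"
    and \<iota>: "comparison_map B bar_aug P \<mu> \<iota>"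
  defines "k \<equiv> int n + int m - 1"
  shows "hh_bracket scale n m (hh_pullback B (int n) \<iota> (hh_class P (int n) f)) (hh_pullback B (int m) \<iota> (hh_class P (int m) g))
    = hh_pullback B k \<iota> (hh_class P k (lifting_bracket n m f g \<phi>\<^sub>f \<phi>\<^sub>g))"
proof -
  interpret A: bimod_act "(*)" "(*) :: 'a \<Rightarrow> 'a \<Rightarrow> 'a" by (rule bimod_act_mult)
  define I where "I bs = gmap B P 0 \<iota> (bar_unit bs)" for bs
  interpret C: comparison scale P \<mu> I \<Delta>
    using comparison_of_map [OF \<iota> diag] by (simp add: I_def [abs_def])
  let ?F = "\<lambda>i x. f i (\<iota> i x)" and ?G = "\<lambda>i x. g i (\<iota> i x)"
  let ?R = "\<lambda>i x. lifting_bracket n m f g \<phi>\<^sub>f \<phi>\<^sub>g i (\<iota> i x)"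
  have F: "cocycle B (int n) ?F" and G: "cocycle B (int m) ?G"
    using pullback_cocycle [OF \<iota>] f g by blast+
  have bracket: "cocycle P k (lifting_bracket n m f g \<phi>\<^sub>f \<phi>\<^sub>g)"
    unfolding k_def by (rule C.lifting_bracket_cocycle [OF f g \<phi>\<^sub>f \<phi>\<^sub>g])
  note R = pullback_cocycle [OF \<iota> bracket]
  have cc: "cc j (\<lambda>i x. q i (\<iota> i x)) xs = q j (prj P j (I xs))" for j q xs
    by (simp add: cc_def I_def prj_gmap [OF graded_B graded_P iota_maps [OF \<iota>]])
  obtain \<eta> where \<eta>: "multilinear scale scale \<eta>"
    "\<And>xs. int (length xs) = k \<Longrightarrow> lifting_bracket n m f g \<phi>\<^sub>f \<phi>\<^sub>g k (prj P k (I xs))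
      = gerstenhaber n m (C.coch (int n) f) (C.coch (int m) g) xs + hb (*) (*) \<eta> xs"
    unfolding k_def using C.lifting_bracket_gerstenhaber [OF f g \<phi>\<^sub>f \<phi>\<^sub>g] by blast
  have coch: "C.coch (int n) f = cc (int n) ?F" "C.coch (int m) g = cc (int m) ?G"
    by (simp_all add: fun_eq_iff cc C.coch_def ev_def)
  have main: "hh_class B k (bar_map_of k (gerstenhaber n m (cochain_of scale n \<alpha>) (cochain_of scale m \<beta>))) = hh_class B k ?R"
    if \<alpha>: "cocycle B (int n) \<alpha>" "cohomologous B (int n) ?F \<alpha>" and \<beta>: "cocycle B (int m) \<beta>" "cohomologous B (int m) ?G \<beta>" for \<alpha> \<beta>
  proof -
    let ?\<gamma> = "bar_map_of k (gerstenhaber n m (cochain_of scale n \<alpha>) (cochain_of scale m \<beta>))"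
    note \<gamma> = bar_map_of_gerstenhaber [OF \<alpha>(1) \<beta>(1), folded k_def]
    obtain \<eta>' where \<eta>': "multilinear scale scale \<eta>'"
      "\<And>xs. length xs + 1 = n + m \<Longrightarrow> gerstenhaber n m (cc (int n) \<alpha>) (cc (int m) \<beta>) xs
        = gerstenhaber n m (cc (int n) ?F) (cc (int m) ?G) xs + hb (*) (*) \<eta>' xs"
      using gerstenhaber_cohomologous [OF F \<alpha> G \<beta>] by blast
    have "cohomologous B k ?R ?\<gamma>"
    proof (rule cc_cohomologous)
      show "?R \<in> maps B alg_complex (- k)" using R by (simp add: cocycle_def)
      show "?\<gamma> \<in> maps B alg_complex (- k)" by (rule \<gamma>(1))
      \<comment> \<open>\<eta>' stems from the change of representatives, \<eta> from the comparison
        with the lifting bracket.\<close>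
      show "multilinear scale scale (\<lambda>xs. \<eta>' xs - \<eta> xs)"
        by (intro multilinear_diff \<eta> \<eta>' additive_scale)
      fix xs :: "'a list" assume k: "int (length xs) = k"
      then have len: "length xs + 1 = n + m" by (simp add: k_def)
      show "cc k ?\<gamma> xs - cc k ?R xs = hb (*) (*) (\<lambda>xs. \<eta>' xs - \<eta> xs) xs"
        unfolding \<gamma>(2) [OF len] \<eta>'(2) [OF len] cc \<eta>(2) [OF k] A.hb_diff
        by (simp add: coch [unfolded cc, symmetric] cc flip: coch)
    qed
    from hh_class_cong [OF this] show ?thesis ..
  qed
  have "?F \<in> hh_class B (int n) ?F" "?G \<in> hh_class B (int m) ?G"
    using F G by (simp_all add: hh_class_alt cohomologous_refl)
  moreover have "hh_class B k (bar_map_of k (gerstenhaber n m (cochain_of scale n \<alpha>) (cochain_of scale m \<beta>))) = hh_class B k ?R"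
    if "\<alpha> \<in> hh_class B (int n) ?F" "\<beta> \<in> hh_class B (int m) ?G" for \<alpha> \<beta>
    using that by (intro main) (simp_all add: hh_class_alt)
  ultimately have "hh_bracket scale n m (hh_class B (int n) ?F) (hh_class B (int m) ?G) = hh_class B k ?R"
    unfolding hh_bracket_def k_def [symmetric] by blast
  then show ?thesis
    by (simp only: pullback_class [OF \<iota> f] pullback_class [OF \<iota> g] pullback_class [OF \<iota> bracket])
qed

end

text \<open>The bracket on the cohomology of P is the one transported from the bar resolution. The
  identity is stated for every comparison map, so the choice is immaterial, and existence of such a
  map is asserted as well, so the identity is not vacuous.\<close>

theorem theorem4:
  fixes scale :: "'k::field \<Rightarrow> 'a::{ring,monoid_mult} \<Rightarrow> 'a"
    and P :: "('a, 'p) bimod_complex"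
    and \<mu> :: "'p \<Rightarrow> 'a"
    and \<Delta> :: "int \<Rightarrow> 'p \<Rightarrow> (int \<times> 'p \<times> 'p \<Rightarrow>\<^sub>0 int) set"
    and n m :: nat
    and f g :: "int \<Rightarrow> 'p \<Rightarrow> 'a"
    and \<phi>\<^sub>f \<phi>\<^sub>g :: "int \<Rightarrow> 'p \<Rightarrow> 'p"
  assumes "k_algebra scale"
    and "projective_resolution scale P \<mu>"
    and "diagonal_approximation P \<mu> \<Delta>"
    and "cocycle P (int n) f"
    and "cocycle P (int m) g"
    and "homotopy_lifting P \<mu> \<Delta> (int n) f \<phi>\<^sub>f"
    and "homotopy_lifting P \<mu> \<Delta> (int m) g \<phi>\<^sub>g"
  shows "cocycle P (int n + int m - 1) (lifting_bracket n m f g \<phi>\<^sub>f \<phi>\<^sub>g) \<and>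
    (\<exists>\<iota>. comparison_map (bar_complex scale) bar_aug P \<mu> \<iota>) \<and>
    (\<forall>\<iota>. comparison_map (bar_complex scale) bar_aug P \<mu> \<iota> \<longrightarrow>
      hh_bracket scale n m
        (hh_pullback (bar_complex scale) (int n) \<iota> (hh_class P (int n) f))
        (hh_pullback (bar_complex scale) (int m) \<iota> (hh_class P (int m) g))
      = hh_pullback (bar_complex scale) (int n + int m - 1) \<iota>
          (hh_class P (int n + int m - 1) (lifting_bracket n m f g \<phi>\<^sub>f \<phi>\<^sub>g)))"
proof -
  interpret resolution scale P \<mu>
    by (intro resolution.intro resolution_axioms.intro assms)
  obtain \<iota> where \<iota>: "comparison_map (bar_complex scale) bar_aug P \<mu> \<iota>"
    by (rule obtain_comparison)
  interpret comparison scale P \<mu> "\<lambda>bs. gmap (bar_complex scale) P 0 \<iota> (bar_unit bs)" \<Delta>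
    by (rule comparison_of_map [OF \<iota> assms(3)])
  from lifting_bracket_cocycle [OF assms(4-)] \<iota> bracket_pullback [OF assms(3-)]
  show ?thesis by blast
qed

end
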